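(* Let $n\geqslant 2$ and set $\tilde P_n=\sum_{\mu\in\Lambda_{n,N}}P^{(\mu)}_n\,z^{(\mu)}\in B_n(\varepsilon N)$. Then the universal traceless projector $\mathfrak P_n$ on $V^{\otimes n}$ satisfies $$\mathfrak P_n=\mathfrak r(\tilde P_n).$$
   Context: $V$ is a complex vector space of dimension $N\geqslant 1$ with a non-degenerate bilinear form $\langle\cdot,\cdot\rangle$, either symmetric ($\varepsilon=1$) or skew-symmetric ($\varepsilon=-1$, $N$ even). For a basis $e_a$, $g_{ab}=\langle e_a,e_b\rangle$, $g^{ac}g_{cb}=\delta^a_b$, $E=\sum g^{ab}e_a\otimes e_b$. The Brauer algebra $B_n(\delta)$ has as basis the perfect matchings (diagrams) of $n$ upper and $n$ lower nodes; $b_1b_2$ is computed by placing $b_1$ below $b_2$, identifying the upper nodes of $b_1$ with the lower nodes of $b_2$, and replacing each closed loop by a factor $\delta$. Diagrams without arcs (lines joining nodes of the same row) span $\mathbb C\mathfrak S_n$. $d_{ij}$ is the diagram with an arc joining upper nodes $i,j$, an arc joining lower nodes $i,j$, and vertical lines elsewhere; $A_n=\sum_{i<j}d_{ij}$. The homomorphism $\mathfrak r:B_n(\varepsilon N)\to\mathrm{End}(V^{\otimes n})$ is determined by: $s_i=(i\;i{+}1)$ acts as $\varepsilon$ times the flip of factors $i,i+1$; $d_{i\,i+1}$ acts by $v_1\otimes\dots\otimes v_n\mapsto\langle v_i,v_{i+1}\rangle v_1\otimes\dots\otimes E\otimes\dots\otimes v_n$. Partitions are identified with Young diagrams; $\lambda'$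 is the transpose; a partition is even if all parts are even ($\varnothing$ is even). $c(\lambda)=\sum_{(i,j)\in\lambda}(j-i)$, $c(\mu\backslash\lambda)=c(\mu)-c(\lambda)$. $c^\mu_{\nu\lambda}$ are Littlewood–Richardson coefficients. $\Lambda_{l,N}=\{\lambda\vdash l:\lambda_1'+\lambda_2'\leqslant N\}$ if $\varepsilon=1$, $\{\lambda\vdash l:\lambda_1\leqslant N/2\}$ if $\varepsilon=-1$. $\Sigma_{n,N}=\{\mu\vdash n:\mu_1'\leqslant N\}$ if $\varepsilon=1$, $\{\mu\vdash n:\mu_1\leqslant N\}$ if $\varepsilon=-1$. $\mathrm{cl}^{(f)}_N(\lambda)=\{\mu\in\Sigma_{n,N}:\mu\supset\lambda,\ c^\mu_{\nu\lambda}\ne0$ for some even $\nu$ with $|\nu|=2f\}$ for $\lambda\vdash n-2f$. $\varepsilon\mathbb N=\{\varepsilon k:k=1,2,\dots\}$. $\mathrm{spec}^\times(A_n)=\{(\varepsilon N-1)f+c(\mu\backslash\lambda):f=1,\dots,\lfloor n/2\rfloor,\lambda\in\Lambda_{n-2f,N},\mu\in\mathrm{cl}^{(f)}_N(\lambda)\}\cap\varepsilon\mathbb N$. The universal traceless projector is $\mathfrak P_n=\mathfrak r(P_n)$ with $P_n=\prod_{\alpha\in\mathrm{spec}^\times(A_n)}(1-\alpha^{-1}A_n)$; it is an idempotent whose image is the space of traceless tensors. For $\rho\vdash n$: $\Lambda^{(\rho)}_N$ is the set of $\sigma$ such that, for some $f\geqslant0$, $\sigma\in\Lambda_{n-2f,N}$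 and $c^\rho_{\sigma\nu}\neq0$ for some even $\nu\subset\rho$ with $|\nu|=2f$; $\mathrm{spec}^\times_\rho(A_n)=\{(\varepsilon N-1)f+c(\rho\backslash\sigma):f=1,\dots,\lfloor n/2\rfloor,\ \sigma\in\Lambda^{(\rho)}_N,\ |\rho|-|\sigma|=2f\}\cap\varepsilon\mathbb N$; $P^{(\rho)}_n=\prod_{\alpha\in\mathrm{spec}^\times_\rho(A_n)}(1-\alpha^{-1}A_n)$ (with $P_n^{(\rho)}=1$ for $\rho=(1^n)$, where the index set is empty). $z^{(\mu)}\in\mathbb C\mathfrak S_n$ is the central Young symmetriser, i.e. the primitive central idempotent of $\mathbb C\mathfrak S_n$ corresponding to the simple (Specht) module $L^{(\mu)}$ ($L^{(n)}$ being trivial). *)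

theory Defs
  imports
    Complex_Main
    "HOL-Library.Function_Algebras"
    "HOL-Library.Disjoint_Sets"
    "HOL-Combinatorics.Permutations"
    "HOL-Algebra.Ring"
begin

section \<open>The Brauer algebra\<close>

text \<open>
  A node is a pair (row, position), with row 0 the lower and row 1 the upper row; positions
  are numbered from 0. A diagram is the set of its lines, each line being the set of its two ends.
\<close>

type_synonym node = "nat \<times> nat"
type_synonym diagram = "node set set"

definition diagrams :: "nat \<Rightarrow> diagram set" where
  "diagrams n = {b. partition_on ({0, 1} \<times> {..<n}) b \<and> (\<forall>l\<in>b. card l = 2)}"

text \<open>
  Placing \<open>b1\<close> below \<open>b2\<close> gives three rows: row 1 holds the identified nodes, row 2 the upper
  nodes of \<open>b2\<close>.
\<close>

definition stack :: "diagram \<Rightarrow> diagram \<Rightarrow> diagram" where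
  "stack b1 b2 = b1 \<union> (\<lambda>l. (\<lambda>(r, i). (Suc r, i)) ` l) ` b2"

definition connected_nodes :: "diagram \<Rightarrow> diagram \<Rightarrow> (node \<times> node) set" where
  "connected_nodes b1 b2 = {(x, y). \<exists>l\<in>stack b1 b2. x \<in> l \<and> y \<in> l}\<^sup>*"

text \<open>The outer rows 0 and 2 of the stack are the rows 0 and 1 of the composite.\<close>

definition compose_diagrams :: "nat \<Rightarrow> diagram \<Rightarrow> diagram \<Rightarrow> diagram" where
  "compose_diagrams n b1 b2 =
    {{(r, i), (r', j)} | r i r' j.
       (r, i) \<in> {0, 1} \<times> {..<n} \<and> (r', j) \<in> {0, 1} \<times> {..<n} \<and> (r, i) \<noteq> (r', j) \<and>
       ((2 * r, i), (2 * r', j)) \<in> connected_nodes b1 b2}"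

definition closed_loops :: "nat \<Rightarrow> diagram \<Rightarrow> diagram \<Rightarrow> nat" where
  "closed_loops n b1 b2 =
    card {C \<in> ({1} \<times> {..<n}) // connected_nodes b1 b2. C \<subseteq> {1} \<times> {..<n}}"

text \<open>
  An element of the algebra is the function giving its coefficient on each diagram. The additive
  structure is the pointwise one.
\<close>

type_synonym brauer = "diagram \<Rightarrow> complex"

definition basis_elt :: "diagram \<Rightarrow> brauer" where
  "basis_elt b = (\<lambda>d. if d = b then 1 else 0)"

definition scale_elt :: "complex \<Rightarrow> brauer \<Rightarrow> brauer" where
  "scale_elt c x = (\<lambda>d. c * x d)"

definition perm_diagram :: "nat \<Rightarrow> (nat \<Rightarrow> nat) \<Rightarrow> diagram" where
  "perm_diagram n p = {{(1, k), (0, p k)} | k. k < n}"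

definition brauer_algebra :: "nat \<Rightarrow> complex \<Rightarrow> brauer ring" where
  "brauer_algebra n \<delta> =
    \<lparr>carrier = {x. \<forall>d. d \<notin> diagrams n \<longrightarrow> x d = 0},
     mult = (\<lambda>x y. \<Sum>b1\<in>diagrams n. \<Sum>b2\<in>diagrams n.
               scale_elt (x b1 * y b2 * \<delta> ^ closed_loops n b1 b2)
                 (basis_elt (compose_diagrams n b1 b2))),
     one = basis_elt (perm_diagram n id),
     zero = 0,
     add = (+)\<rparr>"

definition arc_diagram :: "nat \<Rightarrow> nat \<Rightarrow> nat \<Rightarrow> diagram" where
  "arc_diagram n i j =
    {{(1, i), (1, j)}, {(0, i), (0, j)}} \<union> {{(0, k), (1, k)} | k. k < n \<and> k \<noteq> i \<and> k \<noteq> j}"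

definition A_elt :: "nat \<Rightarrow> brauer" where
  "A_elt n = (\<Sum>(i, j)\<in>{(i, j). i < j \<and> j < n}. basis_elt (arc_diagram n i j))"

text \<open>
  The product of \<open>1 - A\<^sub>n / \<alpha>\<close> over \<open>\<alpha>\<close> in a finite set \<open>S\<close> of nonzero integers. The factors commute;
  they are multiplied in increasing order of \<open>\<alpha>\<close> only because the algebra is not commutative.
\<close>

definition A_product :: "nat \<Rightarrow> complex \<Rightarrow> int set \<Rightarrow> brauer" where
  "A_product n \<delta> S =
    foldr (\<lambda>\<alpha> x. (\<one>\<^bsub>brauer_algebra n \<delta>\<^esub> - scale_elt (1 / of_int \<alpha>) (A_elt n))
                    \<otimes>\<^bsub>brauer_algebra n \<delta>\<^esub> x)
      (sorted_list_of_set S) \<one>\<^bsub>brauer_algebra n \<delta>\<^esub>"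


section \<open>Partitions\<close>

definition partitions :: "nat \<Rightarrow> nat list set" where
  "partitions n = {\<mu>. sorted_wrt (\<ge>) \<mu> \<and> 0 \<notin> set \<mu> \<and> sum_list \<mu> = n}"

text \<open>Rows and columns are numbered from 0, which does not affect contents.\<close>

definition young :: "nat list \<Rightarrow> (nat \<times> nat) set" where
  "young \<mu> = {(i, j). i < length \<mu> \<and> j < \<mu> ! i}"

definition part :: "nat list \<Rightarrow> nat \<Rightarrow> nat" where
  "part \<mu> i = (if 1 \<le> i \<and> i \<le> length \<mu> then \<mu> ! (i - 1) else 0)"

definition conjugate :: "nat list \<Rightarrow> nat list" where
  "conjugate \<mu> = map (\<lambda>j. card {i. (i, j) \<in> young \<mu>}) [0..<part \<mu> 1]"

definition even_partition :: "nat list \<Rightarrow> bool" where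
  "even_partition \<mu> \<longleftrightarrow> (\<forall>k\<in>set \<mu>. even k)"

definition content :: "nat list \<Rightarrow> int" where
  "content \<mu> = (\<Sum>(i, j)\<in>young \<mu>. int j - int i)"


section \<open>The group algebra of the symmetric group\<close>

text \<open>
  No loops arise among diagrams without arcs, so the loop parameter 1 chosen here is immaterial.
  With the product of \<^const>\<open>brauer_algebra\<close>, the diagram of a permutation \<open>p\<close> (upper \<open>k\<close> joined
  to lower \<open>p k\<close>) multiplies like composition of functions.
\<close>

definition sym_algebra :: "nat \<Rightarrow> brauer ring" where
  "sym_algebra n = (brauer_algebra n 1)
     \<lparr>carrier := {x \<in> carrier (brauer_algebra n 1). \<forall>d. x d \<noteq> 0 \<longrightarrow> (\<forall>l\<in>d. fst ` l = {0, 1})}\<rparr>"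

abbreviation perm_elt :: "nat \<Rightarrow> (nat \<Rightarrow> nat) \<Rightarrow> brauer" where
  "perm_elt n p \<equiv> basis_elt (perm_diagram n p)"

text \<open>Row and column of the entry \<open>k\<close> in the tableau filled with 0, 1, 2, ... in reading order.\<close>

definition tab_row :: "nat list \<Rightarrow> nat \<Rightarrow> nat" where
  "tab_row \<mu> k = (LEAST i. k < sum_list (take (Suc i) \<mu>))"

definition tab_col :: "nat list \<Rightarrow> nat \<Rightarrow> nat" where
  "tab_col \<mu> k = k - sum_list (take (tab_row \<mu> k) \<mu>)"

definition row_group :: "nat list \<Rightarrow> (nat \<Rightarrow> nat) set" where
  "row_group \<mu> = {p. p permutes {..<sum_list \<mu>} \<and> (\<forall>k<sum_list \<mu>. tab_row \<mu> (p k) = tab_row \<mu> k)}"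

definition col_group :: "nat list \<Rightarrow> (nat \<Rightarrow> nat) set" where
  "col_group \<mu> = {q. q permutes {..<sum_list \<mu>} \<and> (\<forall>k<sum_list \<mu>. tab_col \<mu> (q k) = tab_col \<mu> k)}"

definition young_symmetriser :: "nat list \<Rightarrow> brauer" where
  "young_symmetriser \<mu> =
    (\<Sum>p\<in>row_group \<mu>. perm_elt (sum_list \<mu>) p) \<otimes>\<^bsub>sym_algebra (sum_list \<mu>)\<^esub>
    (\<Sum>q\<in>col_group \<mu>. scale_elt (of_int (sign q)) (perm_elt (sum_list \<mu>) q))"

text \<open>
  The simple module is realised as the left ideal generated by the Young symmetriser, so that the
  module of a one-row partition is trivial.
\<close>

definition specht :: "nat list \<Rightarrow> brauer set" where
  "specht \<mu> = {x \<otimes>\<^bsub>sym_algebra (sum_list \<mu>)\<^esub> young_symmetriser \<mu> | x. x \<in> carrier (sym_algebra (sum_list \<mu>))}"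

definition central_idempotent :: "('a, 'b) ring_scheme \<Rightarrow> 'a \<Rightarrow> bool" where
  "central_idempotent R z \<longleftrightarrow> z \<in> carrier R \<and> z \<otimes>\<^bsub>R\<^esub> z = z \<and>
     (\<forall>x\<in>carrier R. z \<otimes>\<^bsub>R\<^esub> x = x \<otimes>\<^bsub>R\<^esub> z)"

definition primitive_central_idempotent :: "('a, 'b) ring_scheme \<Rightarrow> 'a \<Rightarrow> bool" where
  "primitive_central_idempotent R z \<longleftrightarrow> central_idempotent R z \<and> z \<noteq> \<zero>\<^bsub>R\<^esub> \<and>
     (\<forall>u v. central_idempotent R u \<and> central_idempotent R v \<and> u \<otimes>\<^bsub>R\<^esub> v = \<zero>\<^bsub>R\<^esub> \<and> z = u \<oplus>\<^bsub>R\<^esub> v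
        \<longrightarrow> u = \<zero>\<^bsub>R\<^esub> \<or> v = \<zero>\<^bsub>R\<^esub>)"

definition central_young_symmetriser :: "nat list \<Rightarrow> brauer" where
  "central_young_symmetriser \<mu> =
    (THE z. primitive_central_idempotent (sym_algebra (sum_list \<mu>)) z \<and>
            (\<forall>x\<in>specht \<mu>. z \<otimes>\<^bsub>sym_algebra (sum_list \<mu>)\<^esub> x = x))"


section \<open>Littlewood--Richardson coefficients\<close>

text \<open>The element of the Young subgroup of type \<open>(k, l)\<close> given by a pair of permutations.\<close>

definition juxtapose :: "nat \<Rightarrow> nat \<Rightarrow> (nat \<Rightarrow> nat) \<Rightarrow> (nat \<Rightarrow> nat) \<Rightarrow> nat \<Rightarrow> nat" where
  "juxtapose k l p q i = (if i < k then p i else if i < k + l then k + q (i - k) else i)"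

text \<open>
  The homomorphisms from \<open>L(\<nu>) \<otimes> L(\<kappa>)\<close> to the restriction of \<open>L(\<mu>)\<close> to the Young subgroup, given
  as equivariant bilinear maps, extended by 0.
\<close>

definition lr_homs :: "nat list \<Rightarrow> nat list \<Rightarrow> nat list \<Rightarrow> (brauer \<Rightarrow> brauer \<Rightarrow> brauer) set" where
  "lr_homs \<mu> \<nu> \<kappa> = {\<beta>.
     (\<forall>x y. x \<notin> specht \<nu> \<or> y \<notin> specht \<kappa> \<longrightarrow> \<beta> x y = 0) \<and>
     (\<forall>x\<in>specht \<nu>. \<forall>y\<in>specht \<kappa>. \<beta> x y \<in> specht \<mu>) \<and>
     (\<forall>x\<in>specht \<nu>. \<forall>x'\<in>specht \<nu>. \<forall>y\<in>specht \<kappa>. \<beta> (x + x') y = \<beta> x y + \<beta> x' y) \<and>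
     (\<forall>x\<in>specht \<nu>. \<forall>y\<in>specht \<kappa>. \<forall>y'\<in>specht \<kappa>. \<beta> x (y + y') = \<beta> x y + \<beta> x y') \<and>
     (\<forall>c. \<forall>x\<in>specht \<nu>. \<forall>y\<in>specht \<kappa>.
        \<beta> (scale_elt c x) y = scale_elt c (\<beta> x y) \<and> \<beta> x (scale_elt c y) = scale_elt c (\<beta> x y)) \<and>
     (\<forall>p q. p permutes {..<sum_list \<nu>} \<and> q permutes {..<sum_list \<kappa>} \<longrightarrow>
        (\<forall>x\<in>specht \<nu>. \<forall>y\<in>specht \<kappa>.
           \<beta> (perm_elt (sum_list \<nu>) p \<otimes>\<^bsub>sym_algebra (sum_list \<nu>)\<^esub> x)
             (perm_elt (sum_list \<kappa>) q \<otimes>\<^bsub>sym_algebra (sum_list \<kappa>)\<^esub> y) =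
           perm_elt (sum_list \<mu>) (juxtapose (sum_list \<nu>) (sum_list \<kappa>) p q)
             \<otimes>\<^bsub>sym_algebra (sum_list \<mu>)\<^esub> \<beta> x y))}"

text \<open>
  The multiplicity of \<open>L(\<nu>) \<otimes> L(\<kappa>)\<close> in the restriction of \<open>L(\<mu>)\<close>, equivalently of \<open>L(\<mu>)\<close> in the
  induction product of \<open>L(\<nu>)\<close> and \<open>L(\<kappa>)\<close>.
\<close>

definition lr_coeff :: "nat list \<Rightarrow> nat list \<Rightarrow> nat list \<Rightarrow> nat" where
  "lr_coeff \<mu> \<nu> \<kappa> =
    (if sum_list \<mu> = sum_list \<nu> + sum_list \<kappa>
     then vector_space.dim (\<lambda>c \<beta> x y. scale_elt c (\<beta> x y)) (lr_homs \<mu> \<nu> \<kappa>) else 0)"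


section \<open>The sets of eigenvalues and the two elements\<close>

definition Lambda_set :: "int \<Rightarrow> nat \<Rightarrow> nat \<Rightarrow> nat list set" where
  "Lambda_set \<epsilon> N l = {\<kappa> \<in> partitions l.
     if \<epsilon> = 1 then part (conjugate \<kappa>) 1 + part (conjugate \<kappa>) 2 \<le> N else 2 * part \<kappa> 1 \<le> N}"

definition Sigma_set :: "int \<Rightarrow> nat \<Rightarrow> nat \<Rightarrow> nat list set" where
  "Sigma_set \<epsilon> N n = {\<mu> \<in> partitions n.
     if \<epsilon> = 1 then part (conjugate \<mu>) 1 \<le> N else part \<mu> 1 \<le> N}"

definition cl_set :: "int \<Rightarrow> nat \<Rightarrow> nat \<Rightarrow> nat list \<Rightarrow> nat list set" where
  "cl_set \<epsilon> N f \<kappa> = {\<mu> \<in> Sigma_set \<epsilon> N (sum_list \<kappa> + 2 * f). young \<kappa> \<subseteq> young \<mu> \<and>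
     (\<exists>\<nu>\<in>partitions (2 * f). even_partition \<nu> \<and> lr_coeff \<mu> \<nu> \<kappa> \<noteq> 0)}"

definition signed_naturals :: "int \<Rightarrow> int set" where
  "signed_naturals \<epsilon> = {\<epsilon> * int k | k. 1 \<le> k}"

definition spec_nz :: "int \<Rightarrow> nat \<Rightarrow> nat \<Rightarrow> int set" where
  "spec_nz \<epsilon> N n =
    {(\<epsilon> * int N - 1) * int f + (content \<mu> - content \<kappa>) | f \<kappa> \<mu>.
       1 \<le> f \<and> f \<le> n div 2 \<and> \<kappa> \<in> Lambda_set \<epsilon> N (n - 2 * f) \<and> \<mu> \<in> cl_set \<epsilon> N f \<kappa>}
    \<inter> signed_naturals \<epsilon>"

definition Lambda_rho :: "int \<Rightarrow> nat \<Rightarrow> nat list \<Rightarrow> nat list set" where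
  "Lambda_rho \<epsilon> N \<rho> = {\<sigma>. \<exists>f. 2 * f \<le> sum_list \<rho> \<and> \<sigma> \<in> Lambda_set \<epsilon> N (sum_list \<rho> - 2 * f) \<and>
     (\<exists>\<nu>\<in>partitions (2 * f). even_partition \<nu> \<and> young \<nu> \<subseteq> young \<rho> \<and> lr_coeff \<rho> \<sigma> \<nu> \<noteq> 0)}"

definition spec_nz_rho :: "int \<Rightarrow> nat \<Rightarrow> nat list \<Rightarrow> int set" where
  "spec_nz_rho \<epsilon> N \<rho> =
    {(\<epsilon> * int N - 1) * int f + (content \<rho> - content \<sigma>) | f \<sigma>.
       1 \<le> f \<and> f \<le> sum_list \<rho> div 2 \<and> \<sigma> \<in> Lambda_rho \<epsilon> N \<rho> \<and> sum_list \<rho> = sum_list \<sigma> + 2 * f}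
    \<inter> signed_naturals \<epsilon>"

abbreviation loop_value :: "int \<Rightarrow> nat \<Rightarrow> complex" where
  "loop_value \<epsilon> N \<equiv> of_int (\<epsilon> * int N)"

definition P_elt :: "int \<Rightarrow> nat \<Rightarrow> nat \<Rightarrow> brauer" where
  "P_elt \<epsilon> N n = A_product n (loop_value \<epsilon> N) (spec_nz \<epsilon> N n)"

definition P_rho_elt :: "int \<Rightarrow> nat \<Rightarrow> nat list \<Rightarrow> brauer" where
  "P_rho_elt \<epsilon> N \<rho> = A_product (sum_list \<rho>) (loop_value \<epsilon> N) (spec_nz_rho \<epsilon> N \<rho>)"

definition P_tilde_elt :: "int \<Rightarrow> nat \<Rightarrow> nat \<Rightarrow> brauer" where
  "P_tilde_elt \<epsilon> N n = (\<Sum>\<mu>\<in>Lambda_set \<epsilon> N n.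
     P_rho_elt \<epsilon> N \<mu> \<otimes>\<^bsub>brauer_algebra n (loop_value \<epsilon> N)\<^esub> central_young_symmetriser \<mu>)"


section \<open>Tensor powers and the action of the Brauer algebra\<close>

text \<open>
  For finite-dimensional \<open>V\<close> the tensor power is realised, without choosing a basis, inside the
  multilinear functions of \<open>n\<close> linear functionals on \<open>V\<close>.
\<close>

type_synonym 'v tensor = "('v \<Rightarrow> complex) list \<Rightarrow> complex"

definition scale_tensor :: "complex \<Rightarrow> 'v tensor \<Rightarrow> 'v tensor" where
  "scale_tensor c T = (\<lambda>\<phi>s. c * T \<phi>s)"

definition pure_tensor :: "(complex \<Rightarrow> 'v::ab_group_add \<Rightarrow> 'v) \<Rightarrow> 'v list \<Rightarrow> 'v tensor" where
  "pure_tensor scale vs = (\<lambda>\<phi>s.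
     if length \<phi>s = length vs \<and> (\<forall>\<phi>\<in>set \<phi>s. Vector_Spaces.linear scale (*) \<phi>)
     then \<Prod>i<length vs. (\<phi>s ! i) (vs ! i) else 0)"

definition tensor_power :: "(complex \<Rightarrow> 'v::ab_group_add \<Rightarrow> 'v) \<Rightarrow> nat \<Rightarrow> 'v tensor set" where
  "tensor_power scale n = module.span scale_tensor {pure_tensor scale vs | vs. length vs = n}"

definition End_ring :: "'v tensor set \<Rightarrow> ('v tensor \<Rightarrow> 'v tensor) ring" where
  "End_ring W =
    \<lparr>carrier = {F \<in> W \<rightarrow>\<^sub>E W. (\<forall>S\<in>W. \<forall>T\<in>W. F (S + T) = F S + F T) \<and>
                               (\<forall>c. \<forall>T\<in>W. F (scale_tensor c T) = scale_tensor c (F T))},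
     mult = compose W,
     one = (\<lambda>T\<in>W. T),
     zero = (\<lambda>T\<in>W. 0),
     add = (\<lambda>F G. \<lambda>T\<in>W. F T + G T)\<rparr>"

text \<open>
  \<open>ginv\<close> is the inverse Gram matrix in the basis \<open>e\<close>. That \<open>N\<close> is even when \<open>\<epsilon> = -1\<close> follows from
  nondegeneracy.
\<close>

locale form_space = vector_space scale
  for scale :: "complex \<Rightarrow> 'v::ab_group_add \<Rightarrow> 'v" +
  fixes N :: nat and \<epsilon> :: int and form :: "'v \<Rightarrow> 'v \<Rightarrow> complex"
    and e :: "nat \<Rightarrow> 'v" and ginv :: "nat \<Rightarrow> nat \<Rightarrow> complex"
  assumes N_pos: "1 \<le> N"
    and eps: "\<epsilon> = 1 \<or> \<epsilon> = -1"
    and form_linear_left: "\<And>w. Vector_Spaces.linear scale (*) (\<lambda>v. form v w)"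
    and form_linear_right: "\<And>v. Vector_Spaces.linear scale (*) (form v)"
    and form_sym: "\<And>v w. form w v = of_int \<epsilon> * form v w"
    and form_nondegenerate: "\<And>v. (\<And>w. form v w = 0) \<Longrightarrow> v = 0"
    and basis_inj: "inj_on e {..<N}"
    and basis_independent: "independent (e ` {..<N})"
    and basis_span: "span (e ` {..<N}) = UNIV"
    and ginv: "\<And>a b. a < N \<Longrightarrow> b < N \<Longrightarrow>
                 (\<Sum>c<N. ginv a c * form (e c) (e b)) = (if a = b then 1 else 0)"

definition tensor_rep ::
    "(complex \<Rightarrow> 'v::ab_group_add \<Rightarrow> 'v) \<Rightarrow> nat \<Rightarrow> int \<Rightarrow> ('v \<Rightarrow> 'v \<Rightarrow> complex) \<Rightarrow> (nat \<Rightarrow> 'v) \<Rightarrow>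
     (nat \<Rightarrow> nat \<Rightarrow> complex) \<Rightarrow> nat \<Rightarrow> (brauer \<Rightarrow> 'v tensor \<Rightarrow> 'v tensor) \<Rightarrow> bool" where
  "tensor_rep scale N \<epsilon> form e ginv n \<r> \<longleftrightarrow>
    \<r> \<in> ring_hom (brauer_algebra n (loop_value \<epsilon> N)) (End_ring (tensor_power scale n)) \<and>
    (\<forall>c. \<forall>x\<in>carrier (brauer_algebra n (loop_value \<epsilon> N)). \<forall>T\<in>tensor_power scale n.
       \<r> (scale_elt c x) T = scale_tensor c (\<r> x T)) \<and>
    (\<forall>i vs. Suc i < n \<and> length vs = n \<longrightarrow>
       \<r> (perm_elt n (Transposition.transpose i (Suc i))) (pure_tensor scale vs) =
         scale_tensor (of_int \<epsilon>) (pure_tensor scale (vs[i := vs ! Suc i, Suc i := vs ! i])) \<and>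
       \<r> (basis_elt (arc_diagram n i (Suc i))) (pure_tensor scale vs) =
         scale_tensor (form (vs ! i) (vs ! Suc i))
           (\<Sum>a<N. \<Sum>b<N. scale_tensor (ginv a b) (pure_tensor scale (vs[i := e a, Suc i := e b]))))"

definition universal_traceless_projector ::
    "(brauer \<Rightarrow> 'v tensor \<Rightarrow> 'v tensor) \<Rightarrow> int \<Rightarrow> nat \<Rightarrow> nat \<Rightarrow> 'v tensor \<Rightarrow> 'v tensor" where
  "universal_traceless_projector \<r> \<epsilon> N n = \<r> (P_elt \<epsilon> N n)"

end

theory Submission
  imports Defs "HOL-Library.Poly_Mapping" "HOL-Combinatorics.Cycles"
begin

text \<open>
  In the coordinates of a basis with real orthogonal Gram matrix, \<open>\<epsilon> A\<^sub>n\<close> is a nonnegative Hermitian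
  operator. Splitting off contracted parts by orthogonal projection shows that the tensor power is
  spanned by permutations of tensors that carry the invariant tensor on \<open>f\<close> pairs of slots and are
  traceless on the other slots. Cutting such a tensor by the central idempotents of \<open>\<lambda>\<close> on the
  traceless slots, of \<open>\<nu>\<close> on the paired slots and of \<open>\<mu>\<close> on all slots gives an eigenvector of
  \<open>A\<^sub>n\<close> with eigenvalue \<open>\<theta> = (\<epsilon> N - 1) f + c(\<mu>) - c(\<lambda>)\<close>, because sums of transpositions act by contents.
  If the eigenvector is nonzero, then \<open>\<nu>\<close> is even by invariance under the hyperoctahedral group,
  the Littlewood--Richardson coefficients are nonzero, and \<open>\<lambda>\<close> lies in \<open>\<Lambda>\<close>, since a traceless tensor that
  is antisymmetric in too many slots vanishes by positivity.

  If \<open>\<theta> = 0\<close>, then positivity makes the eigenvector traceless, so \<open>\<mu>\<close> lies in \<open>\<Lambda>\<close> and both projectors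
  fix it. Otherwise \<open>\<epsilon> \<theta> > 0\<close>, so \<open>\<theta>\<close> is one of the roots in both products, and both projectors kill it.
\<close>


text \<open>Both projectors are built from \<open>A_elt\<close> and central elements of the group
  algebra, so they can be compared on a spanning set of common eigenvectors; the Brauer algebra
  itself need not be semisimple and offers no such vectors. Contents enter because, on a paired
  tensor, contracting one end of a pair with another slot equals a transposition. The sum of all
  contractions thus becomes (\<epsilon> N - 1) f plus all transpositions minus those of the
  traceless slots; the -1 comes from the transposition inside each pair, which fixes the tensor.
  Twisting the place action by the sign for \<epsilon> = -1 makes this uniform in \<epsilon>. The
  facts on shapes come from highest weight vectors among functions of words. The weight and the
  raising relations determine how the sum of transpositions acts, and this value together with
  dominance determines the shape. Inclusion of shapes under restriction and evenness for
  hyperoctahedral invariants both rest on such vectors. A Littlewood--Richardson coefficient enters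
  only through its nonvanishing, for which one nonzero equivariant map is enough.\<close>

section \<open>The group algebra of the finitary symmetric group\<close>

text \<open>
  Permutations are written additively, so that the convolution ring \<open>fperm \<Rightarrow>\<^sub>0 complex\<close> is the group
  algebra.
\<close>

typedef fperm = "{p :: nat \<Rightarrow> nat. permutation p}"
  morphisms ap Fp
  using permutation_id by blast

setup_lifting type_definition_fperm

instantiation fperm :: group_add
begin

lift_definition zero_fperm :: fperm is id
  by (rule permutation_id)

lift_definition plus_fperm :: "fperm \<Rightarrow> fperm \<Rightarrow> fperm" is "\<lambda>p q. p \<circ> q"
  by (rule permutation_compose)

lift_definition uminus_fperm :: "fperm \<Rightarrow> fperm" is "inv_into UNIV"
  by (rule permutation_inverse)

definition minus_fperm :: "fperm \<Rightarrow> fperm \<Rightarrow> fperm" where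
  "minus_fperm p q = p + - q"

instance
proof
  fix a b c :: fperm
  show "a + b + c = a + (b + c)" by transfer (simp add: comp_assoc)
  show "0 + a = a" "a + 0 = a" by (transfer, simp)+
  show "- a + a = 0"
    by transfer (simp add: permutation_bijective bij_is_inj)
  show "a + - b = a - b" by (simp add: minus_fperm_def)
qed

end

lemma permutation_ap [simp]: "permutation (ap p)"
  using ap by simp

lemma bij_ap [simp]: "bij (ap p)"
  by (simp add: permutation_bijective)

lemma inj_ap [simp]: "inj (ap p)"
  by (simp add: bij_is_inj)

lemma ap_eq_iff [simp]: "ap p i = ap p j \<longleftrightarrow> i = j"
  by (simp add: inj_eq)

lemma ap_zero [simp]: "ap 0 = id"
  by (rule zero_fperm.rep_eq)

lemma ap_plus: "ap (p + q) = ap p \<circ> ap q"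
  by (rule plus_fperm.rep_eq)

lemma ap_plus_apply [simp]: "ap (p + q) i = ap p (ap q i)"
  by (simp add: ap_plus)

lemma ap_uminus [simp]: "ap (- p) (ap p i) = i" "ap p (ap (- p) i) = i"
proof -
  have "ap (- p + p) i = i" "ap (p + - p) i = i" by (simp_all del: ap_plus_apply)
  then show "ap (- p) (ap p i) = i" "ap p (ap (- p) i) = i" by (simp_all only: ap_plus_apply)
qed

lemma ap_comp_uminus [simp]: "ap (- p) \<circ> ap p = id" "ap p \<circ> ap (- p) = id"
  by (auto simp: fun_eq_iff)

lemma fperm_eqI: "(\<And>i. ap p i = ap q i) \<Longrightarrow> p = q"
  by transfer auto

lemma ap_Fp: "permutation p \<Longrightarrow> ap (Fp p) = p"
  by (simp add: Fp_inverse)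

section \<open>Transpositions, permutations supported in a set, and signs\<close>

definition tr :: "nat \<Rightarrow> nat \<Rightarrow> fperm" where
  "tr i j = Fp (transpose i j)"

lemma ap_tr: "ap (tr i j) = transpose i j"
  by (simp add: tr_def ap_Fp permutation_swap_id)

lemma ap_tr_simps [simp]:
  "ap (tr i j) i = j" "ap (tr i j) j = i" "k \<noteq> i \<Longrightarrow> k \<noteq> j \<Longrightarrow> ap (tr i j) k = k"
  by (simp_all add: ap_tr)

lemma tr_commute: "tr i j = tr j i"
  by (simp add: tr_def transpose_commute)

lemma uminus_tr [simp]: "- tr i j = tr i j"
  by (rule minus_unique, rule fperm_eqI) (simp add: ap_tr)

lemma tr_tr [simp]: "tr i j + tr i j = 0"
  by (rule fperm_eqI) (simp add: ap_tr)

lemma tr_self [simp]: "tr i i = 0"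
  by (rule fperm_eqI) (simp add: ap_tr)

lemma conj_tr: "p + tr i j = tr (ap p i) (ap p j) + p"
  by (rule fperm_eqI) (simp add: ap_tr transpose_def)

text \<open>All symmetric groups live in the single group \<open>fperm\<close>, so the group on k
  places is literally a subset of the group on m \<ge> k places and inclusion maps never
  appear.\<close>

definition SP :: "nat set \<Rightarrow> fperm set" where
  "SP K = {p. ap p permutes K}"

lemma SP_zero [simp]: "0 \<in> SP K"
  by (simp add: SP_def permutes_id)

lemma SP_plus: "p \<in> SP K \<Longrightarrow> q \<in> SP K \<Longrightarrow> p + q \<in> SP K"
  by (simp add: SP_def ap_plus permutes_compose)

lemma ap_uminus_eq: "ap (- p) = inv_into UNIV (ap p)"
  by (rule uminus_fperm.rep_eq)

lemma SP_uminus: "p \<in> SP K \<Longrightarrow> - p \<in> SP K"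
  by (simp add: SP_def ap_uminus_eq permutes_inv)

lemma SP_uminus_iff [simp]: "- p \<in> SP K \<longleftrightarrow> p \<in> SP K"
  using SP_uminus[of p K] SP_uminus[of "- p" K] by auto

lemma SP_tr: "i \<in> K \<Longrightarrow> j \<in> K \<Longrightarrow> tr i j \<in> SP K"
  by (simp add: SP_def ap_tr permutes_swap_id)

lemma SP_mono: "p \<in> SP K \<Longrightarrow> K \<subseteq> L \<Longrightarrow> p \<in> SP L"
  using permutes_subset[of "ap p" K L] by (simp add: SP_def)

lemma SP_in_iff [simp]: "p \<in> SP K \<Longrightarrow> ap p i \<in> K \<longleftrightarrow> i \<in> K"
  by (simp add: SP_def permutes_in_image)

lemma SP_notin [simp]: "p \<in> SP K \<Longrightarrow> i \<notin> K \<Longrightarrow> ap p i = i"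
  by (simp add: SP_def permutes_not_in)

lemma SP_I: "(\<And>i. i \<notin> K \<Longrightarrow> ap p i = i) \<Longrightarrow> p \<in> SP K"
  unfolding SP_def permutes_def mem_Collect_eq bij_iff[symmetric] by simp

lemma SP_image: "finite K \<Longrightarrow> {ap p |p. p \<in> SP K} = {p. p permutes K}"
proof -
  assume "finite K"
  then have "p = ap (Fp p)" if "p permutes K" for p
    using that permutation_permutes by (subst ap_Fp) auto
  then show ?thesis unfolding SP_def by fastforce
qed

lemma Fp_SP: "finite K \<Longrightarrow> p permutes K \<Longrightarrow> Fp p \<in> SP K \<and> ap (Fp p) = p"
  by (metis (no_types, lifting) SP_def ap_Fp mem_Collect_eq permutation_permutes)

lemma inj_ap_fun: "inj_on ap A"
  by (auto intro!: inj_onI fperm_eqI)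

lemma ap_SP: "finite K \<Longrightarrow> ap ` SP K = {p. p permutes K}"
  using SP_image[of K] by (auto simp: image_def)

lemma bij_betw_SP: "finite K \<Longrightarrow> bij_betw ap (SP K) {p. p permutes K}"
  by (simp add: bij_betw_def inj_ap_fun ap_SP)

lemma finite_SP [simp]: "finite K \<Longrightarrow> finite (SP K)"
  using bij_betw_finite[OF bij_betw_SP] finite_permutations by blast

lemma SP_disjoint_commute:
  assumes "p \<in> SP K" "q \<in> SP L" "K \<inter> L = {}" shows "p + q = q + p"
proof (rule fperm_eqI)
  fix i
  consider "i \<in> K" "i \<notin> L" | "i \<in> L" "i \<notin> K" | "i \<notin> K" "i \<notin> L"
    using assms(3) by blast
  then show "ap (p + q) i = ap (q + p) i"
  proof cases
    case 1
    then have "ap p i \<notin> L" using SP_in_iff[OF assms(1), of i] assms(3) by blast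
    with 1 show ?thesis using assms by simp
  next
    case 2
    then have "ap q i \<notin> K" using SP_in_iff[OF assms(2), of i] assms(3) by blast
    with 2 show ?thesis using assms by simp
  qed (use assms in simp)
qed

text \<open>In the action on tensors the integer is the \<epsilon> of the form, since an adjacent
  transposition acts as \<epsilon> times the flip. In symmetrisers the values 1 and -1 distinguish
  rows from columns.\<close>

definition sg :: "int \<Rightarrow> fperm \<Rightarrow> complex" where
  "sg e p = (if e = 1 then 1 else of_int (sign (ap p)))"

lemma sg_zero [simp]: "sg e 0 = 1"
  by (simp add: sg_def)

lemma sg_plus: "sg e (p + q) = sg e p * sg e q"
  by (simp add: sg_def ap_plus sign_compose)

lemma sg_tr: "i \<noteq> j \<Longrightarrow> e = 1 \<or> e = -1 \<Longrightarrow> sg e (tr i j) = of_int e"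
  by (auto simp: sg_def ap_tr sign_swap_id)

lemma sg_sq [simp]: "sg e p * sg e p = 1"
  by (auto simp: sg_def sign_def)

lemma sg_uminus [simp]: "sg e (- p) = sg e p"
proof -
  have "sg e (- p) * sg e p = 1" by (simp flip: sg_plus)
  then have "sg e (- p) * sg e p * sg e p = sg e p" by simp
  then show ?thesis by (simp only: mult.assoc sg_sq mult_1_right)
qed

lemma cnj_sg [simp]: "cnj (sg e p) = sg e p"
  by (auto simp: sg_def)

lemma sg_one [simp]: "sg 1 p = 1"
  by (simp add: sg_def)

lemma sg_nonzero [simp]: "sg e p \<noteq> 0"
  by (auto simp: sg_def sign_def)

section \<open>The group algebra and its subalgebras on a set of places\<close>

type_synonym galg = "fperm \<Rightarrow>\<^sub>0 complex"

abbreviation lk :: "galg \<Rightarrow> fperm \<Rightarrow> complex" where "lk \<equiv> Poly_Mapping.lookup"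
abbreviation ky :: "galg \<Rightarrow> fperm set" where "ky \<equiv> Poly_Mapping.keys"

definition gp :: "fperm \<Rightarrow> galg" where "gp p = Poly_Mapping.single p 1"
definition sc :: "complex \<Rightarrow> galg" where "sc c = Poly_Mapping.single 0 c"

lemma gp_mult: "gp p * gp q = gp (p + q)"
  by (simp add: gp_def mult_single)

lemma gp_zero [simp]: "gp 0 = 1"
  by (simp add: gp_def)

lemma gp_inverse [simp]: "gp p * gp (- p) = 1" "gp (- p) * gp p = 1"
  by (simp_all add: gp_mult)

lemma gp_cancel [simp]: "gp p * (gp (- p) * x) = x" "gp (- p) * (gp p * x) = x"
  by (simp_all flip: mult.assoc)

lemma sc_0 [simp]: "sc 0 = 0" and sc_1 [simp]: "sc 1 = 1"
  by (simp_all add: sc_def)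

lemma sc_add: "sc (a + b) = sc a + sc b"
  by (simp add: sc_def single_add)

lemma sc_minus: "sc (- a) = - sc a"
  by (simp add: sc_def single_uminus)

lemma sc_mult: "sc (a * b) = sc a * sc b"
  by (simp add: sc_def mult_single)

lemma sc_of_nat: "sc (of_nat n) = of_nat n"
  by (induction n) (auto simp: sc_add)

lemma single_sc: "Poly_Mapping.single p c = sc c * gp p"
  by (simp add: sc_def gp_def mult_single)

lemma single_mult: "sc c * gp p * (sc d * gp q) = sc (c * d) * gp (p + q)"
  by (simp only: single_sc[symmetric] mult_single)

lemma galg_expand: "finite S \<Longrightarrow> ky a \<subseteq> S \<Longrightarrow> a = (\<Sum>p\<in>S. sc (lk a p) * gp p)"
proof (rule poly_mapping_eqI)
  fix k assume "finite S" "ky a \<subseteq> S"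
  have "lk (\<Sum>p\<in>S. sc (lk a p) * gp p) k = (\<Sum>p\<in>S. if p = k then lk a p else 0)"
    by (auto simp: lookup_sum lookup_single when_def intro!: sum.cong simp flip: single_sc)
  also have "\<dots> = lk a k"
    using \<open>finite S\<close> \<open>ky a \<subseteq> S\<close> by (auto simp: in_keys_iff)
  finally show "lk a k = lk (\<Sum>p\<in>S. sc (lk a p) * gp p) k" by simp
qed

lemma galg_induct [case_names zero add single]:
  assumes "P 0" "\<And>a b. P a \<Longrightarrow> P b \<Longrightarrow> P (a + b)" "\<And>c p. P (sc c * gp p)"
  shows "P (a :: galg)"
proof -
  have "P (\<Sum>p\<in>S. sc (f p) * gp p)" if "finite S" for S f
    using that by induction (auto intro: assms)
  from this[of "ky a" "lk a"] show ?thesis using galg_expand[of "ky a" a] by simp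
qed

lemma sc_gp: "sc c * gp p = gp p * sc c"
  by (simp add: sc_def gp_def mult_single)

lemma sc_commute: "a * sc c = sc c * a"
proof (induction a rule: galg_induct)
  case (single d p)
  have "sc d * gp p * sc c = sc d * (sc c * gp p)" by (simp only: mult.assoc sc_gp[of c p])
  also have "\<dots> = sc (d * c) * gp p" by (simp only: sc_mult mult.assoc)
  also have "\<dots> = sc c * (sc d * gp p)" by (simp only: mult.commute[of d c] sc_mult mult.assoc)
  finally show ?case .
qed (auto simp: algebra_simps)

lemma sc_left_commute: "a * (sc c * b) = sc c * (a * b)"
  by (metis sc_commute mult.assoc)

lemmas sc_simps = sc_commute sc_left_commute mult.assoc

lemma lk_sc_mult [simp]: "lk (sc c * a) p = c * lk a p"
proof (induction a rule: galg_induct)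
  case (add a b) then show ?case by (simp add: algebra_simps lookup_add)
next
  case (single d q)
  have "sc c * (sc d * gp q) = Poly_Mapping.single q (c * d)"
    by (simp only: single_sc sc_mult mult.assoc)
  moreover have "sc d * gp q = Poly_Mapping.single q d" by (simp only: single_sc)
  ultimately show ?case by (simp add: lookup_single when_def)
qed simp

lemma lk_gp: "lk (gp p) q = (if p = q then 1 else 0)"
  by (simp add: gp_def lookup_single when_def)

lemma lk_gp_mult: "lk (gp p * a) q = lk a (- p + q)"
proof (induction a rule: galg_induct)
  case (add a b) then show ?case by (simp add: algebra_simps lookup_add)
next
  case (single c r)
  have "p + r = q \<longleftrightarrow> r = - p + q" by (metis add.assoc add.left_inverse add.right_inverse add_0)
  then show ?case by (simp add: sc_left_commute gp_mult lk_gp)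
qed simp

lemma lk_mult_gp: "lk (a * gp p) q = lk a (q + - p)"
proof (induction a rule: galg_induct)
  case (add a b) then show ?case by (simp add: algebra_simps lookup_add)
next
  case (single c r)
  have "r + p = q \<longleftrightarrow> r = q + - p" by (metis add.assoc add.right_inverse add.left_inverse add_0_right)
  then show ?case by (simp add: mult.assoc gp_mult lk_gp)
qed simp

lemma sc_mult_eq_0: "sc c * a = 0 \<longleftrightarrow> c = 0 \<or> a = 0"
proof
  assume "sc c * a = 0"
  then have "sc (inverse c) * (sc c * a) = 0" by simp
  then show "c = 0 \<or> a = 0" by (cases "c = 0") (simp_all flip: mult.assoc sc_mult)
qed auto

definition CS :: "nat set \<Rightarrow> galg set" where
  "CS K = {a. ky a \<subseteq> SP K}"

lemma CS_0 [simp]: "0 \<in> CS K" and CS_1 [simp]: "1 \<in> CS K"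
  by (auto simp: CS_def)

lemma CS_gp [simp]: "gp p \<in> CS K \<longleftrightarrow> p \<in> SP K"
  by (auto simp: CS_def gp_def)

lemma CS_sc [simp]: "sc c \<in> CS K"
  by (auto simp: CS_def sc_def)

lemma CS_add: "a \<in> CS K \<Longrightarrow> b \<in> CS K \<Longrightarrow> a + b \<in> CS K"
  using keys_add[of a b] by (auto simp: CS_def)

lemma CS_mult: "a \<in> CS K \<Longrightarrow> b \<in> CS K \<Longrightarrow> a * b \<in> CS K"
  using keys_mult[of a b] by (auto simp: CS_def intro!: SP_plus dest!: subsetD[of "ky (a * b)"])

lemma CS_sum: "(\<And>i. i \<in> A \<Longrightarrow> f i \<in> CS K) \<Longrightarrow> sum f A \<in> CS K"
  by (induction A rule: infinite_finite_induct) (auto intro: CS_add)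

lemma CS_uminus: "a \<in> CS K \<Longrightarrow> - a \<in> CS K"
  using CS_mult[OF CS_sc[of "- 1" K], of a] by (simp only: sc_minus sc_1 mult_minus1)

lemma CS_diff: "a \<in> CS K \<Longrightarrow> b \<in> CS K \<Longrightarrow> a - b \<in> CS K"
  using CS_add[of a K "- b"] by (simp add: CS_uminus)

lemma CS_mono: "a \<in> CS K \<Longrightarrow> K \<subseteq> L \<Longrightarrow> a \<in> CS L"
  using SP_mono[of _ K L] by (auto simp: CS_def)

lemma CS_induct [consumes 2, case_names zero add single]:
  assumes "a \<in> CS K" "finite K"
    "P 0" "\<And>a b. P a \<Longrightarrow> P b \<Longrightarrow> P (a + b)" "\<And>c p. p \<in> SP K \<Longrightarrow> P (sc c * gp p)"
  shows "P a"
proof -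
  have "P (\<Sum>p\<in>S. sc (f p) * gp p)" if "finite S" "S \<subseteq> SP K" for S f
    using that by induction (auto intro: assms)
  from this[of "ky a" "lk a"] show ?thesis using galg_expand[of "ky a" a] assms(1) by (simp add: CS_def)
qed

lemma CS_disjoint_commute:
  assumes "a \<in> CS K" "b \<in> CS L" "K \<inter> L = {}" "finite K" "finite L" shows "a * b = b * a"
  using assms(1,4)
proof (induction rule: CS_induct)
  case (single c p)
  from assms(2,5) show ?case
  proof (induction rule: CS_induct)
    case (single d q)
    have "p + q = q + p" using SP_disjoint_commute \<open>p \<in> SP K\<close> \<open>q \<in> SP L\<close> assms(3) by blast
    then show ?case by (simp only: single_mult mult.commute[of c d])
  qed (auto simp: algebra_simps)
qed (auto simp: algebra_simps)

lemma CS_commute_gens: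
  assumes "a \<in> CS K" "finite K" "\<And>p. p \<in> SP K \<Longrightarrow> gp p * b = b * gp p"
  shows "a * b = b * a"
  using assms(1,2)
proof (induction rule: CS_induct)
  case (single c p)
  then show ?case using assms(3)[of p] by (simp add: sc_left_commute mult.assoc)
qed (auto simp: algebra_simps)

subsection \<open>The involution\<close>

text \<open>Conjugating the coefficients makes \<open>star a * a\<close> positive. This positivity
  is what shows below that certain products of symmetrisers are nonzero.\<close>

definition star :: "galg \<Rightarrow> galg" where
  "star a = (\<Sum>p\<in>ky a. sc (cnj (lk a p)) * gp (- p))"

lemma lk_star: "lk (star a) p = cnj (lk a (- p))"
proof -
  have "lk (star a) p = (\<Sum>q\<in>ky a. if q = - p then cnj (lk a q) else 0)"
    unfolding star_def lookup_sum lk_sc_mult lk_gp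
    by (rule sum.cong) (auto simp: minus_equation_iff[of _ p])
  also have "\<dots> = cnj (lk a (- p))" by (auto simp: in_keys_iff)
  finally show ?thesis .
qed

lemma star_add: "star (a + b) = star a + star b"
  by (rule poly_mapping_eqI) (simp add: lk_star lookup_add)

lemma star_zero [simp]: "star 0 = 0"
  by (rule poly_mapping_eqI) (simp add: lk_star)

lemma star_star [simp]: "star (star a) = a"
  by (rule poly_mapping_eqI) (simp add: lk_star)

lemma star_single: "star (sc c * gp p) = sc (cnj c) * gp (- p)"
  by (rule poly_mapping_eqI) (auto simp: lk_star lk_gp)

lemma star_gp: "star (gp p) = gp (- p)"
  using star_single[of 1 p] by simp

lemma star_mult: "star (a * b) = star b * star a"
proof (induction a rule: galg_induct)
  case (add a b) then show ?case by (simp add: algebra_simps star_add)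
next
  case (single c p)
  show ?case
  proof (induction b rule: galg_induct)
    case (add a b) then show ?case by (simp add: algebra_simps star_add)
  next
    case (single d q)
    show ?case by (simp only: single_mult star_single minus_add complex_cnj_mult mult.commute[of "cnj c"])
  qed simp
qed simp

lemma star_sum: "star (sum f A) = (\<Sum>i\<in>A. star (f i))"
  by (induction A rule: infinite_finite_induct) (auto simp: star_add)

text \<open>The coefficient of the identity in \<open>star a * a\<close> is the sum of the squared
  moduli of the coefficients of \<open>a\<close>.\<close>

lemma star_mult_self: "star a * a = 0 \<longleftrightarrow> a = 0"
proof
  assume "star a * a = 0"
  have "star a * a = (\<Sum>p\<in>ky a. sc (cnj (lk a p)) * (gp (- p) * a))"
    by (simp add: star_def sum_distrib_right mult.assoc)
  then have "lk (star a * a) 0 = (\<Sum>p\<in>ky a. cnj (lk a p) * lk a p)"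
    by (simp add: lookup_sum lk_gp_mult)
  also have "\<dots> = of_real (\<Sum>p\<in>ky a. (cmod (lk a p))\<^sup>2)"
    unfolding of_real_sum complex_norm_square by (simp add: mult.commute)
  finally have "(\<Sum>p\<in>ky a. (cmod (lk a p))\<^sup>2) = 0"
    using \<open>star a * a = 0\<close> by (simp flip: of_real_sum of_real_power)
  then have "\<forall>p\<in>ky a. lk a p = 0" by (subst (asm) sum_nonneg_eq_0_iff) auto
  then show "a = 0" by (auto simp: poly_mapping_eq_iff fun_eq_iff in_keys_iff)
qed simp

subsection \<open>The action on functions of words\<close>

text \<open>The parameter \<open>e\<close> twists the place permutation by the sign character if \<open>e \<noteq> 1\<close>.\<close>

definition act :: "int \<Rightarrow> galg \<Rightarrow> ((nat \<Rightarrow> nat) \<Rightarrow> complex) \<Rightarrow> (nat \<Rightarrow> nat) \<Rightarrow> complex" where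
  "act e a T = (\<lambda>x. \<Sum>p\<in>ky a. lk a p * sg e p * T (x \<circ> ap p))"

lemma act_superset:
  "finite S \<Longrightarrow> ky a \<subseteq> S \<Longrightarrow> act e a T x = (\<Sum>p\<in>S. lk a p * sg e p * T (x \<circ> ap p))"
  unfolding act_def by (rule sum.mono_neutral_left) (auto simp: in_keys_iff)

lemma act_zero [simp]: "act e 0 T = 0"
  by (simp add: act_def fun_eq_iff)

lemma act_add: "act e (a + b) T = act e a T + act e b T"
proof
  fix x
  have "ky (a + b) \<subseteq> ky a \<union> ky b" by (rule keys_add)
  then show "act e (a + b) T x = (act e a T + act e b T) x"
    by (simp add: act_superset[of "ky a \<union> ky b"] lookup_add algebra_simps sum.distrib)
qed

lemma act_sum: "act e (sum f A) T = (\<Sum>i\<in>A. act e (f i) T)"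
  by (induction A rule: infinite_finite_induct) (simp_all add: act_add)

definition scl :: "complex \<Rightarrow> ((nat \<Rightarrow> nat) \<Rightarrow> complex) \<Rightarrow> (nat \<Rightarrow> nat) \<Rightarrow> complex" where
  "scl c T = (\<lambda>x. c * T x)"

lemma scl_simps: "scl c (scl d T) = scl (c * d) T" "scl 1 T = T" "scl c (S + T) = scl c S + scl c T"
  "scl (c + d) T = scl c T + scl d T" "scl 0 T = 0" "scl c 0 = 0" "scl (- 1) T = - T"
  by (auto simp: scl_def fun_eq_iff algebra_simps)

lemma scl_sum: "scl c (sum f A) = (\<Sum>i\<in>A. scl c (f i))"
  using sum_comp_morphism[of "scl c" f A] by (simp add: scl_simps comp_def)

lemma act_single: "act e (sc c * gp p) T = scl (c * sg e p) (\<lambda>x. T (x \<circ> ap p))"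
proof
  fix x
  have "ky (sc c * gp p) \<subseteq> {p}" by (auto simp flip: single_sc)
  then show "act e (sc c * gp p) T x = scl (c * sg e p) (\<lambda>x. T (x \<circ> ap p)) x"
    by (simp add: act_superset[of "{p}"] scl_def lk_gp)
qed

lemma act_gp: "act e (gp p) T = (\<lambda>x. sg e p * T (x \<circ> ap p))"
  using act_single[of e 1 p T] by (simp add: scl_def)

lemma act_one [simp]: "act e 1 T = T"
  using act_gp[of e 0 T] by simp

lemma act_T_add: "act e a (S + T) = act e a S + act e a T"
  by (auto simp: act_def fun_eq_iff algebra_simps sum.distrib)

lemma act_T_scl: "act e a (scl c T) = scl c (act e a T)"
  by (auto simp: act_def scl_def fun_eq_iff algebra_simps sum_distrib_left)

lemma act_T_zero [simp]: "act e a 0 = 0"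
  by (simp add: act_def fun_eq_iff)

lemma act_T_uminus: "act e a (- T) = - act e a T"
  by (metis act_T_scl scl_simps(7))

lemma act_T_diff: "act e a (S - T) = act e a S - act e a T"
  using act_T_add[of e a S "- T"] by (simp add: act_T_uminus)

lemma act_T_sum: "act e a (sum f A) = (\<Sum>i\<in>A. act e a (f i))"
  using sum_comp_morphism[of "act e a" f A] by (simp add: act_T_add comp_def)

lemma act_T_add_fun: "act e a (\<lambda>x. S x + T x) = (\<lambda>x. act e a S x + act e a T x)"
  using act_T_add[of e a S T] by (simp add: plus_fun_def)

text \<open>Words are composed with p on the right first and with q after that, which gives x
  \<circ> p \<circ> q: a right action on words is a left action on functions of words.\<close>

lemma act_mult: "act e (a * b) T = act e a (act e b T)"
proof (induction a rule: galg_induct)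
  case (add a b) then show ?case by (simp add: algebra_simps act_add)
next
  case (single c p)
  show ?case
  proof (induction b rule: galg_induct)
    case (add a b) then show ?case by (simp add: algebra_simps act_add act_T_add_fun fun_eq_iff)
  next
    case (single d q)
    show ?case
      by (auto simp: single_mult act_single scl_def fun_eq_iff sg_plus ap_plus comp_assoc)
  qed (use act_T_zero[of e "sc c * gp p"] in \<open>simp add: zero_fun_def\<close>)
qed simp

lemma act_sc: "act e (sc c) T = scl c T"
  using act_single[of e c 0 T] by simp

lemma act_sc_mult: "act e (sc c * a) T = scl c (act e a T)"
  by (simp add: act_mult act_sc)

lemma act_uminus: "act e (- a) T = - act e a T"
  using act_sc_mult[of e "- 1" a T] by (simp add: sc_minus scl_simps)

lemma act_diff: "act e (a - b) T = act e a T - act e b T"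
  using act_add[of e a "- b" T] by (simp add: act_uminus)


section \<open>Young symmetrisers\<close>

lemma sc_diff: "sc (a - b) = sc a - sc b"
  by (simp add: sc_def single_diff)

section \<open>Signed sums over stabilisers\<close>

definition stab :: "nat \<Rightarrow> (nat \<Rightarrow> nat) \<Rightarrow> fperm set" where
  "stab n f = {p \<in> SP {..<n}. \<forall>k<n. f (ap p k) = f k}"

lemma stab_SP: "p \<in> stab n f \<Longrightarrow> p \<in> SP {..<n}"
  by (simp add: stab_def)

lemma finite_stab [simp]: "finite (stab n f)"
  by (rule finite_subset[of _ "SP {..<n}"]) (auto simp: stab_def)

lemma SP_less [simp]: "p \<in> SP {..<n} \<Longrightarrow> ap p k < n \<longleftrightarrow> k < n"
  using SP_in_iff[of p "{..<n}" k] by simp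

lemma stab_zero [simp]: "0 \<in> stab n f"
  by (simp add: stab_def)

lemma stab_plus: "p \<in> stab n f \<Longrightarrow> q \<in> stab n f \<Longrightarrow> p + q \<in> stab n f"
  by (auto simp: stab_def intro: SP_plus)

lemma stab_uminus: assumes "p \<in> stab n f" shows "- p \<in> stab n f"
proof -
  have p: "p \<in> SP {..<n}" using assms by (rule stab_SP)
  have "f (ap (- p) k) = f k" if "k < n" for k
  proof -
    have "ap (- p) k < n" using p that by simp
    then have "f (ap p (ap (- p) k)) = f (ap (- p) k)" using assms unfolding stab_def by blast
    then show ?thesis by simp
  qed
  with p show ?thesis by (simp add: stab_def)
qed

lemma stab_uminus_iff [simp]: "- p \<in> stab n f \<longleftrightarrow> p \<in> stab n f"
  using stab_uminus[of p n f] stab_uminus[of "- p" n f] by auto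

text \<open>For the row function and 1 this is the row symmetriser of a tableau, for the column
  function and -1 its column antisymmetriser.\<close>

definition stabsum :: "int \<Rightarrow> nat \<Rightarrow> (nat \<Rightarrow> nat) \<Rightarrow> galg" where
  "stabsum e n f = (\<Sum>p\<in>stab n f. sc (sg e p) * gp p)"

lemma stabsum_CS [simp]: "stabsum e n f \<in> CS {..<n}"
  unfolding stabsum_def by (intro CS_sum CS_mult) (auto simp: stab_SP)

lemma lk_stabsum: "lk (stabsum e n f) p = (if p \<in> stab n f then sg e p else 0)"
proof -
  have "lk (stabsum e n f) p = (\<Sum>q\<in>stab n f. if q = p then sg e q else 0)"
    unfolding stabsum_def lookup_sum lk_sc_mult lk_gp by (rule sum.cong) auto
  then show ?thesis by simp
qed

lemma stabsum_left: 
  assumes "q \<in> stab n f" shows "gp q * stabsum e n f = sc (sg e q) * stabsum e n f"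
proof (rule poly_mapping_eqI)
  fix p
  have "- q + p \<in> stab n f \<longleftrightarrow> p \<in> stab n f"
    using stab_plus[of "- q" n f p] stab_plus[of q n f "- q + p"] assms
    by (auto simp flip: add.assoc)
  then show "lk (gp q * stabsum e n f) p = lk (sc (sg e q) * stabsum e n f) p"
    by (simp add: lk_gp_mult lk_stabsum sg_plus)
qed

lemma stabsum_right: 
  assumes "q \<in> stab n f" shows "stabsum e n f * gp q = sc (sg e q) * stabsum e n f"
proof (rule poly_mapping_eqI)
  fix p
  have "p + - q \<in> stab n f \<longleftrightarrow> p \<in> stab n f"
    using stab_plus[of p n f "- q"] stab_plus[of "p + - q" n f q] assms
    by (auto simp: add.assoc simp del: add_uminus_conv_diff)
  then show "lk (stabsum e n f * gp q) p = lk (sc (sg e q) * stabsum e n f) p"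
    by (simp add: lk_mult_gp lk_stabsum sg_plus del: add_uminus_conv_diff)
qed

lemma star_stabsum: "star (stabsum e n f) = stabsum e n f"
  by (rule poly_mapping_eqI) (simp add: lk_star lk_stabsum)

lemma stabsum_sq: "stabsum e n f * stabsum e n f = sc (of_nat (card (stab n f))) * stabsum e n f"
proof -
  have "stabsum e n f * stabsum e n f = (\<Sum>p\<in>stab n f. sc (sg e p) * (gp p * stabsum e n f))"
    by (simp add: stabsum_def[of e n f] sum_distrib_right mult.assoc)
  also have "\<dots> = (\<Sum>p\<in>stab n f. stabsum e n f)"
    by (rule sum.cong) (simp_all add: stabsum_left flip: mult.assoc sc_mult)
  finally show ?thesis by (simp add: sc_of_nat)
qed

lemma tr_stab: "i < n \<Longrightarrow> j < n \<Longrightarrow> f i = f j \<Longrightarrow> tr i j \<in> stab n f"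
  by (auto simp: stab_def SP_tr ap_tr transpose_def)

text \<open>The transposition of k and l is absorbed by the left factor with sign -1. Carried
  through g it lies in the stabiliser of h and is absorbed by the right factor with sign 1. So the
  product equals its own negative.\<close>

lemma stabsum_sandwich_zero:
  assumes g: "g \<in> SP {..<n}" and k: "k < n" "l < n" "k \<noteq> l" "f k = f l"
    and eq: "h (ap (- g) k) = h (ap (- g) l)"
  shows "stabsum (-1) n f * gp g * stabsum 1 n h = 0" (is "?X = 0")
proof -
  let ?t = "tr (ap (- g) k) (ap (- g) l)"
  have t: "?t \<in> stab n h" using g k eq by (intro tr_stab) auto
  have "stabsum (-1) n f * gp g * stabsum 1 n h = stabsum (-1) n f * gp g * (gp ?t * stabsum 1 n h)"
    by (simp add: stabsum_left[OF t])
  also have "gp g * gp ?t = gp (tr k l) * gp g"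
    by (simp add: gp_mult conj_tr)
  then have "gp g * (gp ?t * stabsum 1 n h) = gp (tr k l) * (gp g * stabsum 1 n h)"
    by (simp only: mult.assoc[symmetric])
  then have "stabsum (-1) n f * gp g * (gp ?t * stabsum 1 n h) =
      (stabsum (-1) n f * gp (tr k l)) * gp g * stabsum 1 n h"
    by (simp only: mult.assoc)
  also have "stabsum (-1) n f * gp (tr k l) = - stabsum (-1) n f"
    using stabsum_right[OF tr_stab[OF k(1,2,4)], of "-1"] k(3)
    by (simp add: sg_tr sc_minus)
  finally have "?X = - stabsum (-1) n f * gp g * stabsum 1 n h" .
  then have e: "?X = - ?X" unfolding mult_minus_left .
  have "sc 2 * ?X = ?X + ?X" using sc_add[of 1 1] by (simp add: mult_2)
  also have "\<dots> = 0" by (subst e) simp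
  finally show ?thesis by (simp only: sc_mult_eq_0) simp
qed

section \<open>Tableaux: von Neumann's lemma and the central idempotent of a shape\<close>

locale tab =
  fixes n :: nat and row col mu :: "nat \<Rightarrow> nat"
  assumes bij: "bij_betw (\<lambda>k. (row k, col k)) {..<n} {(i, j). j < mu i}"
    and dec: "i \<le> j \<Longrightarrow> mu j \<le> mu i"
begin

lemma pos_inj: "k < n \<Longrightarrow> l < n \<Longrightarrow> row k = row l \<Longrightarrow> col k = col l \<Longrightarrow> k = l"
  using bij by (auto simp: bij_betw_def inj_on_def)

lemma pos_in: "k < n \<Longrightarrow> col k < mu (row k)"
  using bij by (auto simp: bij_betw_def)

lemma pos_ex: "j < mu i \<Longrightarrow> \<exists>k<n. row k = i \<and> col k = j"
proof -
  assume "j < mu i"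
  then have "(i, j) \<in> (\<lambda>k. (row k, col k)) ` {..<n}" using bij by (simp add: bij_betw_def)
  then show ?thesis by auto
qed

lemma card_row: "card {k. k < n \<and> row k = i} = mu i"
proof -
  have "bij_betw col {k. k < n \<and> row k = i} {..<mu i}"
    unfolding bij_betw_def
  proof
    show "inj_on col {k. k < n \<and> row k = i}" by (rule inj_onI, rule pos_inj) auto
    show "col ` {k. k < n \<and> row k = i} = {..<mu i}"
    proof
      show "{..<mu i} \<subseteq> col ` {k. k < n \<and> row k = i}"
      proof
        fix j assume "j \<in> {..<mu i}"
        then obtain k where "k < n" "row k = i" "col k = j" using pos_ex[of j i] by auto
        then show "j \<in> col ` {k. k < n \<and> row k = i}" by blast
      qed
    qed (auto dest: pos_in)
  qed
  then show ?thesis by (simp add: bij_betw_same_card)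
qed

lemma card_fun_less:
  fixes x :: "nat \<Rightarrow> nat"
  shows "card {k. k < n \<and> x k < j} = (\<Sum>i<j. card {k. k < n \<and> x k = i})"
proof -
  have "{k. k < n \<and> x k < j} = (\<Union>i<j. {k. k < n \<and> x k = i})" by auto
  then show ?thesis by (simp only:) (rule card_UN_disjoint, auto)
qed

lemma card_row_less: "card {k. k < n \<and> row k < j} = (\<Sum>i<j. mu i)"
  by (simp add: card_fun_less card_row)

text \<open>If column c lies entirely in the first j rows, the right side counts the whole column.
  Otherwise the column has a box in each of the first j rows, while its letters below j are distinct
  and hence at most j in number.\<close>

lemma column_count:
  assumes inj: "\<And>k l. k < n \<Longrightarrow> l < n \<Longrightarrow> col k = col l \<Longrightarrow> x k = x l \<Longrightarrow> k = l"
  shows "card {k. k < n \<and> x k < j \<and> col k = c} \<le> card {k. k < n \<and> row k < j \<and> col k = c}"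
    (is "card ?X \<le> card ?R")
proof (cases "\<forall>k<n. col k = c \<longrightarrow> row k < j")
  case True
  then have "?X \<subseteq> ?R" by auto
  then show ?thesis by (intro card_mono) auto
next
  case False
  then obtain k where k: "k < n" "col k = c" "j \<le> row k" by auto
  have "card ?X \<le> card {..<j}"
    by (rule card_inj_on_le[of x]) (rule inj_onI, rule inj, auto)
  also have "{..<j} \<subseteq> row ` ?R"
  proof
    fix i assume "i \<in> {..<j}"
    then have "c < mu i" using pos_in[OF k(1)] k dec[of i "row k"] by auto
    from pos_ex[OF this] show "i \<in> row ` ?R" using \<open>i \<in> {..<j}\<close> by auto
  qed
  then have "card {..<j} \<le> card ?R" by (intro surj_card_le[of _ _ row]) auto
  finally show ?thesis .
qed

lemma card_split_col:
  "card {k. k < n \<and> P k} = (\<Sum>c\<in>col ` {..<n}. card {k. k < n \<and> P k \<and> col k = c})"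
proof -
  have *: "{k. k < n \<and> P k} = (\<Union>c\<in>col ` {..<n}. {k. k < n \<and> P k \<and> col k = c})" by auto
  show ?thesis unfolding * by (rule card_UN_disjoint) auto
qed

text \<open>The column estimates are added up: a word without repeated letters in a column has a
  content dominated by the shape.\<close>

lemma word_dominated:
  assumes inj: "\<And>k l. k < n \<Longrightarrow> l < n \<Longrightarrow> col k = col l \<Longrightarrow> x k = x l \<Longrightarrow> k = l"
  shows "card {k. k < n \<and> x k < j} \<le> (\<Sum>i<j. mu i)"
  unfolding card_row_less[symmetric] card_split_col[of "\<lambda>k. _ k < j"]
  by (rule sum_mono, rule column_count, rule inj; assumption)

text \<open>Equality of the totals forces equality in every column. Each column then carries each of
  its row indices exactly once, so the word arises from the row word by permuting within
  columns.\<close>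

lemma word_column_perm:
  assumes inj: "\<And>k l. k < n \<Longrightarrow> l < n \<Longrightarrow> col k = col l \<Longrightarrow> x k = x l \<Longrightarrow> k = l"
    and eq: "\<And>j. card {k. k < n \<and> x k < j} = (\<Sum>i<j. mu i)"
  shows "\<exists>q\<in>stab n col. \<forall>k<n. x k = row (ap q k)"
proof -
  have cc: "card {k. k < n \<and> x k < j \<and> col k = c} \<le> card {k. k < n \<and> row k < j \<and> col k = c}"
    for j c by (rule column_count, rule inj; assumption)
  have ceq: "card {k. k < n \<and> x k < j \<and> col k = c} = card {k. k < n \<and> row k < j \<and> col k = c}"
    for j c
  proof (cases "c \<in> col ` {..<n}")
    case True
    have "(\<Sum>c\<in>col ` {..<n}. card {k. k < n \<and> x k < j \<and> col k = c}) =
        (\<Sum>c\<in>col ` {..<n}. card {k. k < n \<and> row k < j \<and> col k = c})"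
      using eq[of j] unfolding card_row_less[symmetric] card_split_col[of "\<lambda>k. _ k < j"] .
    then show ?thesis
      by (rule sum_mono_inv) (use True cc in auto)
  next
    case False
    then have e: "{k. k < n \<and> x k < j \<and> col k = c} = {}" "{k. k < n \<and> row k < j \<and> col k = c} = {}"
      by auto
    show ?thesis unfolding e ..
  qed
  have single: "card {k. k < n \<and> y k < Suc v \<and> col k = c} =
      card {k. k < n \<and> y k < v \<and> col k = c} + card {k. k < n \<and> y k = v \<and> col k = c}"
    for y :: "nat \<Rightarrow> nat" and v c
  proof -
    have "{k. k < n \<and> y k < Suc v \<and> col k = c} =
        {k. k < n \<and> y k < v \<and> col k = c} \<union> {k. k < n \<and> y k = v \<and> col k = c}" by auto
    then show ?thesis by (simp add: card_Un_disjoint disjoint_iff)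
  qed
  have veq: "card {k. k < n \<and> x k = v \<and> col k = c} = card {k. k < n \<and> row k = v \<and> col k = c}" for v c
    using single[of x v c] single[of row v c] ceq[of "Suc v" c] ceq[of v c] by linarith
  have "\<exists>l<n. row l = x k \<and> col l = col k" if "k < n" for k
  proof -
    have "k \<in> {l. l < n \<and> x l = x k \<and> col l = col k}" using that by auto
    then have "card {l. l < n \<and> x l = x k \<and> col l = col k} \<noteq> 0" by auto
    then have "{l. l < n \<and> row l = x k \<and> col l = col k} \<noteq> {}"
      unfolding veq by (metis card.empty)
    then show ?thesis by auto
  qed
  then obtain q where q: "\<And>k. k < n \<Longrightarrow> q k < n \<and> row (q k) = x k \<and> col (q k) = col k" by metis
  define q' where "q' k = (if k < n then q k else k)" for k
  have "inj_on q' {..<n}"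
  proof (rule inj_onI)
    fix k l assume kl: "k \<in> {..<n}" "l \<in> {..<n}" "q' k = q' l"
    then have "x k = x l" "col k = col l" using q[of k] q[of l] by (auto simp: q'_def)
    then show "k = l" using inj[of k l] kl by simp
  qed
  moreover from this have "q' ` {..<n} = {..<n}"
    by (intro endo_inj_surj) (use q in \<open>auto simp: q'_def\<close>)
  ultimately have "q' permutes {..<n}"
    by (intro bij_imp_permutes) (simp_all add: bij_betw_def q'_def)
  then have "Fp q' \<in> SP {..<n}" "ap (Fp q') = q'" using Fp_SP[of "{..<n}" q'] by auto
  with q show ?thesis by (intro bexI[of _ "Fp q'"]) (auto simp: stab_def q'_def)
qed

definition A :: galg where "A = stabsum 1 n row"
definition B :: galg where "B = stabsum (-1) n col"
definition c :: galg where "c = A * B"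

lemma AB_CS [simp]: "A \<in> CS {..<n}" "B \<in> CS {..<n}" "c \<in> CS {..<n}"
  by (simp_all add: A_def B_def c_def CS_mult)

text \<open>Von Neumann's dichotomy. Either the inverse of g sends two places of a column to one
  row, and the product vanishes. Or the word \<open>row \<circ> ap (- g)\<close> has no repetition
  in a column; its content is the shape, so it is the row word moved by a column permutation q. Then
  \<open>q + g\<close> preserves rows, and both \<open>- q\<close> and \<open>q + g\<close> are
  absorbed.\<close>

lemma BgA:
  assumes g: "g \<in> SP {..<n}" shows "\<exists>s. B * gp g * A = sc s * (B * A)"
proof (cases "\<exists>k l. k < n \<and> l < n \<and> k \<noteq> l \<and> col k = col l \<and> row (ap (- g) k) = row (ap (- g) l)")
  case True
  then have "B * gp g * A = 0"
    unfolding A_def B_def using stabsum_sandwich_zero[OF g] by blast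
  then show ?thesis by (intro exI[of _ 0]) simp
next
  case False
  have card: "card {k. k < n \<and> row (ap (- g) k) < j} = (\<Sum>i<j. mu i)" for j
  proof -
    have "bij_betw (ap (- g)) {k. k < n \<and> row (ap (- g) k) < j} {k. k < n \<and> row k < j}"
      by (rule bij_betwI[of _ _ _ "ap g"]) (use g in \<open>auto\<close>)
    then show ?thesis by (simp add: bij_betw_same_card card_row_less)
  qed
  have "\<exists>q\<in>stab n col. \<forall>k<n. row (ap (- g) k) = row (ap q k)"
    by (rule word_column_perm) (use False card in blast)+
  then obtain q where q: "q \<in> stab n col" "\<And>k. k < n \<Longrightarrow> row (ap (- g) k) = row (ap q k)"
    by blast
  have p: "q + g \<in> stab n row"
  proof -
    have "row (ap q (ap g k)) = row k" if "k < n" for k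
      using q(2)[of "ap g k"] g that by simp
    then show ?thesis using g stab_SP[OF q(1)] by (simp add: stab_def SP_plus)
  qed
  have "gp g = gp (- q) * gp (q + g)" by (simp add: gp_mult flip: add.assoc)
  then have "B * gp g * A = (B * gp (- q)) * (gp (q + g) * A)" by (simp add: mult.assoc)
  also have "\<dots> = sc (sg (-1) q) * (B * A)"
    using q(1) p by (simp add: A_def B_def stabsum_left stabsum_right mult.assoc)
  finally show ?thesis ..
qed

lemma BxA:
  assumes "x \<in> CS {..<n}" shows "\<exists>s. B * x * A = sc s * (B * A)"
  using assms finite_lessThan
proof (induction rule: CS_induct)
  case zero show ?case by (intro exI[of _ 0]) simp
next
  case (add a b)
  then obtain s t where "B * a * A = sc s * (B * A)" "B * b * A = sc t * (B * A)" by blast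
  then show ?case by (intro exI[of _ "s + t"]) (simp add: sc_add algebra_simps)
next
  case (single d p)
  then obtain s where "B * gp p * A = sc s * (B * A)" using BgA by blast
  then show ?case
    by (intro exI[of _ "d * s"]) (simp only: sc_mult mult.assoc sc_left_commute[of B])
qed

lemma star_A [simp]: "star A = A" and star_B [simp]: "star B = B" and star_c: "star c = B * A"
  by (simp_all add: A_def B_def c_def star_stabsum star_mult)

lemma star_CS: "x \<in> CS {..<n} \<Longrightarrow> star x \<in> CS {..<n}"
proof -
  assume "x \<in> CS {..<n}"
  then have "ky x \<subseteq> SP {..<n}" by (simp add: CS_def)
  then show ?thesis unfolding star_def by (intro CS_sum CS_mult) auto
qed

lemma AxB:
  assumes "x \<in> CS {..<n}" shows "\<exists>s. A * x * B = sc s * (A * B)"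
proof -
  obtain s where "B * star x * A = sc s * (B * A)" using BxA[OF star_CS[OF assms]] by blast
  then have "star (B * star x * A) = star (sc s * (B * A))" by simp
  then have "A * x * B = star (sc s * (B * A))" by (simp add: star_mult mult.assoc)
  also have "\<dots> = sc (cnj s) * (A * B)"
    using star_single[of s 0] by (simp add: star_mult sc_simps)
  finally show ?thesis ..
qed

lemma cxc:
  assumes "x \<in> CS {..<n}" shows "\<exists>s. c * x * c = sc s * c"
  using AxB[of "B * x * A"] assms by (simp add: c_def mult.assoc CS_mult)

text \<open>A permutation preserving both rows and columns is the identity, so only one pair of
  factors contributes.\<close>

lemma lk_c_0: "lk c 0 = 1"
proof -
  have "p = 0" if "p \<in> stab n row" "p \<in> stab n col" for p
  proof (rule fperm_eqI)
    fix k show "ap p k = ap 0 k"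
      by (cases "k < n") (use that pos_inj[of "ap p k" k] in \<open>auto simp: stab_def\<close>)
  qed
  then have *: "(p \<in> stab n row \<and> p \<in> stab n col) = (p = 0)" for p by auto
  have "lk c 0 = (\<Sum>p\<in>stab n row. lk B (- p))"
    by (simp add: c_def A_def stabsum_def sum_distrib_right lookup_sum lk_gp_mult)
  also have "\<dots> = (\<Sum>p\<in>stab n row. if p = 0 then 1 else 0)"
    by (rule sum.cong) (use * in \<open>auto simp: B_def lk_stabsum\<close>)
  finally show ?thesis by simp
qed

lemma c_nonzero: "c \<noteq> 0"
  using lk_c_0 by auto

text \<open>The element y = \<open>c * star c\<close> is nonzero by positivity. Since A and B are
  idempotent up to scalars, \<open>star y * y\<close> is a multiple of \<open>c * c * A\<close>; if
  the square of c were zero, positivity would give y = 0.\<close>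

lemma cc_nonzero: "c * c \<noteq> 0"
proof
  assume cc: "c * c = 0"
  let ?R = "of_nat (card (stab n row)) :: complex" and ?C = "of_nat (card (stab n col)) :: complex"
  have AA: "A * A = sc ?R * A" and BB: "B * B = sc ?C * B"
    by (simp_all add: A_def B_def stabsum_sq)
  have "star (star c) * star c \<noteq> 0"
    using star_mult_self[of "star c"] c_nonzero by (metis star_star star_zero)
  then have y: "c * star c \<noteq> 0" by simp
  have "star (c * star c) * (c * star c) = 0"
  proof -
    have "star (c * star c) * (c * star c) = A * (B * B) * A * A * (B * B) * A"
      by (simp add: star_c star_mult c_def mult.assoc)
    also have "\<dots> = sc ?C * (sc ?C * (A * B * (A * A) * B * A))"
    proof -
      have BB': "B * (B * w) = sc ?C * (B * w)" for w by (simp add: BB flip: mult.assoc)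
      show ?thesis by (simp add: BB' mult.assoc sc_left_commute[of A] sc_left_commute[of B])
    qed
    also have "\<dots> = sc ?C * (sc ?C * (sc ?R * (c * c * A)))"
    proof -
      have AA': "A * (A * w) = sc ?R * (A * w)" for w by (simp add: AA flip: mult.assoc)
      show ?thesis by (simp add: AA' c_def mult.assoc sc_left_commute[of A] sc_left_commute[of B])
    qed
    finally show ?thesis using cc by simp
  qed
  with y show False by (simp only: star_mult_self)
qed

lemma cc_ex: "\<exists>h. h \<noteq> 0 \<and> c * c = sc h * c"
  using cxc[of 1] cc_nonzero by (metis CS_1 mult.right_neutral mult_zero_left sc_0)

text \<open>Summing c over its conjugates makes it central; up to a scalar this is already the
  central idempotent of the shape.\<close>

definition Y :: galg where "Y = (\<Sum>g\<in>SP {..<n}. gp g * c * gp (- g))"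

lemma Y_CS [simp]: "Y \<in> CS {..<n}"
  unfolding Y_def by (intro CS_sum CS_mult) auto

lemma conj_sum_commute:
  assumes "x \<in> CS {..<n}" shows "x * (\<Sum>g\<in>SP {..<n}. gp g * w * gp (- g)) = (\<Sum>g\<in>SP {..<n}. gp g * w * gp (- g)) * x"
    (is "x * ?S = ?S * x")
  using assms finite_lessThan
proof (rule CS_commute_gens)
  fix p assume p: "p \<in> SP {..<n}"
  have "gp p * ?S * gp (- p) = (\<Sum>g\<in>SP {..<n}. gp (p + g) * w * gp (- (p + g)))"
    by (simp add: sum_distrib_left sum_distrib_right minus_add mult.assoc gp_mult[symmetric]
        del: add_uminus_conv_diff)
  also have "\<dots> = ?S"
    by (rule sum.reindex_bij_witness[of _ "\<lambda>g. - p + g" "\<lambda>g. p + g"])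
       (use p in \<open>auto simp: SP_plus simp flip: add.assoc\<close>)
  finally have "gp p * ?S * gp (- p) * gp p = ?S * gp p" by simp
  then show "gp p * ?S = ?S * gp p" by (simp add: mult.assoc)
qed

lemma Y_commute: "x \<in> CS {..<n} \<Longrightarrow> x * Y = Y * x"
  unfolding Y_def by (rule conj_sum_commute)

text \<open>An elementary form of Schur's lemma: \<open>c * u * c\<close> is a multiple of c by
  \<open>cxc\<close>, and \<open>c * c\<close> is a nonzero one.\<close>

lemma central_c:
  assumes "u \<in> CS {..<n}" "u * c = c * u" shows "\<exists>s. u * c = sc s * c"
proof -
  obtain h where h: "h \<noteq> 0" "c * c = sc h * c" using cc_ex by blast
  obtain s where s: "c * u * c = sc s * c" using cxc[OF assms(1)] by blast
  have "sc h * (u * c) = u * (c * c)" by (simp add: h sc_left_commute)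
  also have "\<dots> = c * u * c" by (simp add: assms(2) flip: mult.assoc)
  finally have "sc (inverse h) * (sc h * (u * c)) = sc (inverse h) * (sc s * c)" by (simp add: s)
  then have "u * c = sc (inverse h * s) * c"
    using h(1) by (simp add: sc_mult flip: mult.assoc) (simp flip: sc_mult)
  then show ?thesis ..
qed

lemma central_mult_Y:
  assumes "\<And>g. g \<in> SP {..<n} \<Longrightarrow> gp g * u = u * gp g" "u * c = sc s * c" shows "u * Y = sc s * Y"
proof -
  have "u * Y = (\<Sum>g\<in>SP {..<n}. gp g * (u * c) * gp (- g))"
    unfolding Y_def sum_distrib_left by (rule sum.cong) (simp_all add: assms(1) flip: mult.assoc)
  then show ?thesis by (simp add: assms(2) Y_def sum_distrib_left mult.assoc sc_left_commute)
qed

lemma lk_Y_0: "lk Y 0 = of_nat (card (SP {..<n}))"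
  by (simp add: Y_def lookup_sum lk_mult_gp lk_gp_mult lk_c_0)

lemma Y_nonzero: "Y \<noteq> 0"
proof -
  have "card (SP {..<n}) \<noteq> 0" using SP_zero[of "{..<n}"] by (auto simp del: SP_zero)
  then show ?thesis using lk_Y_0 by auto
qed

text \<open>Centrality provides the scalar. If it were zero, Y would annihilate B A and all its
  conjugates, hence also \<open>star Y\<close>; positivity would give Y = 0, although its identity
  coefficient is the order of the group.\<close>

lemma Yc_ex: "\<exists>s. s \<noteq> 0 \<and> Y * c = sc s * c"
proof -
  obtain s where s: "Y * c = sc s * c" using central_c[of Y] Y_commute[of c] by auto
  have "s \<noteq> 0"
  proof
    assume "s = 0"
    then have Yc: "Y * c = 0" using s by simp
    obtain h where h: "h \<noteq> 0" "c * c = sc h * c" using cc_ex by blast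
    have sc_star: "star (sc t) = sc (cnj t)" for t using star_single[of t 0] by simp
    have "star (c * c) = star (sc h * c)" by (simp add: h)
    then have "(B * A) * (B * A) = (B * A) * sc (cnj h)"
      by (simp only: star_mult star_c sc_star)
    then have "sc (cnj h) * (Y * (B * A)) = Y * ((B * A) * (B * A))"
      by (metis sc_commute sc_left_commute)
    also have "\<dots> = B * (Y * c) * A"
      by (metis (no_types, lifting) AB_CS(2) Y_commute c_def mult.assoc)
    finally have "sc (cnj h) * (Y * (B * A)) = 0" by (simp add: Yc)
    then have YBA: "Y * (B * A) = 0" using h(1) by (simp add: sc_mult_eq_0)
    have "Y * star Y = (\<Sum>g\<in>SP {..<n}. Y * (gp g * (B * A) * gp (- g)))"
      unfolding Y_def[THEN arg_cong[of _ _ star]] 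
      by (simp add: star_sum star_mult star_gp star_c sum_distrib_left mult.assoc)
    also have "\<dots> = (\<Sum>g\<in>SP {..<n}. gp g * (Y * (B * A)) * gp (- g))"
      by (rule sum.cong) (simp_all add: Y_commute flip: mult.assoc)
    finally have "star (star Y) * star Y = 0" by (simp add: YBA)
    then have "star Y = 0" by (simp only: star_mult_self)
    then have "Y = 0" by (metis star_star star_zero)
    then show False using Y_nonzero by simp
  qed
  with s show ?thesis by blast
qed

definition kap :: complex where "kap = (SOME s. s \<noteq> 0 \<and> Y * c = sc s * c)"

lemma kap: "kap \<noteq> 0" "Y * c = sc kap * c"
  using someI_ex[OF Yc_ex] by (simp_all add: kap_def)

definition z :: galg where "z = sc (inverse kap) * Y"

lemma z_CS [simp]: "z \<in> CS {..<n}"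
  by (simp add: z_def CS_mult)

lemma z_commute: "x \<in> CS {..<n} \<Longrightarrow> x * z = z * x"
  by (simp only: z_def sc_left_commute[of x] Y_commute[of x] mult.assoc)

lemma z_c: "z * c = c"
  using kap by (simp add: z_def mult.assoc) (simp flip: mult.assoc sc_mult)

lemma central_mult_z:
  assumes "\<And>g. g \<in> SP {..<n} \<Longrightarrow> gp g * u = u * gp g" "u * c = sc s * c" shows "u * z = sc s * z"
proof -
  have "u * Y = sc s * Y" by (rule central_mult_Y) (simp_all add: assms)
  then have "u * z = sc (inverse kap) * (sc s * Y)" by (simp only: z_def sc_left_commute[of u])
  then show ?thesis by (simp only: z_def sc_left_commute[of "sc s"])
qed

lemma z_idem: "z * z = z"
proof -
  have "z * z = sc 1 * z" by (rule central_mult_z) (simp_all only: z_commute CS_gp z_c sc_1 mult_1_left)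
  then show ?thesis by simp
qed

lemma z_nonzero: "z \<noteq> 0"
  using z_c c_nonzero by auto

text \<open>The summand u acts on c by a scalar that equals its own square. If the scalar is 0, then
  u = u z = 0; if it is 1, then v annihilates c and the same argument gives v = 0.\<close>

lemma z_primitive:
  assumes "u \<in> CS {..<n}" "v \<in> CS {..<n}"
    and "\<And>x. x \<in> CS {..<n} \<Longrightarrow> x * u = u * x" "\<And>x. x \<in> CS {..<n} \<Longrightarrow> x * v = v * x"
    and "u * u = u" "v * v = v" "u * v = 0" "z = u + v"
  shows "u = 0 \<or> v = 0"
proof -
  have zero: "w = 0" if w: "w * z = w" "w * c = 0" "\<And>g. g \<in> SP {..<n} \<Longrightarrow> gp g * w = w * gp g" for w
  proof -
    have "w * z = sc 0 * z" by (rule central_mult_z) (use w in \<open>simp_all\<close>)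
    then show ?thesis using w(1) by simp
  qed
  obtain s where s: "u * c = sc s * c" using central_c[OF assms(1)] assms(3)[of c] by auto
  have "sc s * c = u * (u * c)" using assms(5) s by (metis mult.assoc)
  also have "\<dots> = sc (s * s) * c" by (simp only: s sc_left_commute[of u] sc_mult mult.assoc)
  finally have "sc (s - s * s) * c = 0"
    by (simp only: sc_diff left_diff_distrib) simp
  then have "s - s * s = 0" using c_nonzero by (simp only: sc_mult_eq_0) simp
  then have "s = 0 \<or> s = 1" by (simp add: algebra_simps)
  then show ?thesis
  proof
    assume "s = 0"
    have "u = 0"
    proof (rule zero)
      show "u * z = u" using assms(5,7,8) by (simp add: distrib_left)
      show "u * c = 0" using s \<open>s = 0\<close> by simp
      show "gp g * u = u * gp g" if "g \<in> SP {..<n}" for g by (rule assms(3)) (simp add: that)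
    qed
    then show ?thesis ..
  next
    assume "s = 1"
    then have "u * c = c" using s by simp
    moreover have "u * c + v * c = c" using z_c assms(8) by (simp add: distrib_right)
    ultimately have vc: "v * c = 0" by simp
    have "v * u = 0" using assms(7) assms(4)[OF assms(1)] by simp
    have "v = 0"
    proof (rule zero)
      show "v * z = v" using assms(6,8) \<open>v * u = 0\<close> by (simp add: distrib_left)
      show "gp g * v = v * gp g" if "g \<in> SP {..<n}" for g by (rule assms(4)) (simp add: that)
    qed (rule vc)
    then show ?thesis ..
  qed
qed

text \<open>A central idempotent w fixing c satisfies w z = z, so w splits into the orthogonal
  central idempotents z and w - z, and primitivity of w leaves only w = z.\<close>

lemma z_unique:
  assumes "w \<in> CS {..<n}" "\<And>x. x \<in> CS {..<n} \<Longrightarrow> x * w = w * x" "w * w = w" "w * c = c"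
    and prim: "\<And>u v. u \<in> CS {..<n} \<Longrightarrow> v \<in> CS {..<n} \<Longrightarrow>
      (\<And>x. x \<in> CS {..<n} \<Longrightarrow> x * u = u * x) \<Longrightarrow> (\<And>x. x \<in> CS {..<n} \<Longrightarrow> x * v = v * x) \<Longrightarrow>
      u * u = u \<Longrightarrow> v * v = v \<Longrightarrow> u * v = 0 \<Longrightarrow> w = u + v \<Longrightarrow> u = 0 \<or> v = 0"
  shows "w = z"
proof -
  have "w * z = sc 1 * z" by (rule central_mult_z) (simp_all add: assms(2,4))
  then have wz: "w * z = z" by simp
  have zw: "z * w = z" using wz assms(2)[OF z_CS] by simp
  have "z = 0 \<or> w - z = 0"
  proof (rule prim)
    show "x * (w - z) = (w - z) * x" if "x \<in> CS {..<n}" for x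
      using assms(2)[OF that] z_commute[OF that] by (simp add: algebra_simps)
    show "(w - z) * (w - z) = w - z" by (simp add: algebra_simps assms wz zw z_idem)
    show "z * (w - z) = 0" by (simp add: algebra_simps zw z_idem)
    show "w - z \<in> CS {..<n}" using assms(1) by (simp add: CS_diff)
    show "x * z = z * x" if "x \<in> CS {..<n}" for x using that by (rule z_commute)
  qed (simp_all add: z_idem)
  then show ?thesis using z_nonzero by simp
qed

text \<open>Passes from the averaged element z to the symmetriser c itself, where the row and column
  sums can be manipulated.\<close>

lemma mult_z_nonzero:
  assumes "u * z \<noteq> 0" shows "\<exists>g\<in>SP {..<n}. u * gp g * c \<noteq> 0"
proof (rule ccontr)
  assume "\<not> ?thesis"
  then have "u * Y = 0"
    by (auto simp: Y_def sum_distrib_left mult.assoc[symmetric] intro!: sum.neutral)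
  then show False using assms by (simp add: z_def sc_left_commute[of u])
qed

text \<open>The trailing A allows the remaining factors to be tested on the row word, see
  \<open>act_w0_nonzero\<close>.\<close>

lemma mult_BA_nonzero:
  assumes "u * c \<noteq> 0" shows "u * A * B * A \<noteq> 0"
proof
  assume "u * A * B * A = 0"
  then have "u * (c * c) = 0" by (simp add: c_def flip: mult.assoc)
  moreover obtain h where "h \<noteq> 0" "c * c = sc h * c" using cc_ex by blast
  ultimately show False using assms by (simp add: sc_left_commute[of u] sc_mult_eq_0)
qed

end

section \<open>Orthogonality of the idempotents of different shapes\<close>

lemma tab_cross:
  assumes "tab n row col la" "tab n row' col' mu" "x \<in> CS {..<n}"
    and nz: "stabsum (-1) n col * x * stabsum 1 n row' \<noteq> 0"
  shows "(\<Sum>i<j. mu i) \<le> (\<Sum>i<j. la i)"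
proof -
  interpret L: tab n row col la by fact
  interpret M: tab n row' col' mu by fact
  have "\<exists>g\<in>SP {..<n}. stabsum (-1) n col * gp g * stabsum 1 n row' \<noteq> 0"
  proof (rule ccontr)
    assume *: "\<not> ?thesis"
    have "stabsum (-1) n col * x * stabsum 1 n row' = 0"
      using assms(3) finite_lessThan
    proof (induction rule: CS_induct)
      case (single d p)
      have "stabsum (-1) n col * (sc d * gp p) * stabsum 1 n row' =
          sc d * (stabsum (-1) n col * gp p * stabsum 1 n row')"
        by (simp only: sc_left_commute[of "stabsum (-1) n col"] mult.assoc)
      then show ?case using * single by simp
    qed (auto simp: algebra_simps)
    with nz show False by simp
  qed
  then obtain g where g: "g \<in> SP {..<n}" "stabsum (-1) n col * gp g * stabsum 1 n row' \<noteq> 0" by blast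
  have inj: "k = l"
    if "k < n" "l < n" "col k = col l" "row' (ap (- g) k) = row' (ap (- g) l)" for k l
    using stabsum_sandwich_zero[OF g(1) that(1,2) _ that(3,4)] g(2) by blast
  have "bij_betw (ap (- g)) {k. k < n \<and> row' (ap (- g) k) < j} {k. k < n \<and> row' k < j}"
    by (rule bij_betwI[of _ _ _ "ap g"]) (use g in \<open>auto\<close>)
  then have "card {k. k < n \<and> row' (ap (- g) k) < j} = (\<Sum>i<j. mu i)"
    by (simp add: bij_betw_same_card M.card_row_less)
  moreover have "card {k. k < n \<and> row' (ap (- g) k) < j} \<le> (\<Sum>i<j. la i)"
    by (rule L.word_dominated, rule inj; assumption)
  ultimately show ?thesis by simp
qed

text \<open>From a nonzero product of the idempotents one extracts nonzero products of a column sum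
  of either tableau with a row sum of the other. This is dominance in both directions.\<close>

lemma tab_orthogonal:
  assumes T: "tab n row col la" "tab n row' col' mu" and nz: "tab.z n row col * tab.z n row' col' \<noteq> 0"
  shows "la = mu"
proof -
  interpret L: tab n row col la by fact
  interpret M: tab n row' col' mu by fact
  obtain g where g: "g \<in> SP {..<n}" "L.z * gp g * M.c \<noteq> 0" using M.mult_z_nonzero[OF nz] by blast
  have "(gp g * M.c) * L.z \<noteq> 0"
    using L.z_commute[of "gp g * M.c"] g by (simp add: mult.assoc CS_mult)
  from L.mult_z_nonzero[OF this] obtain h where h: "h \<in> SP {..<n}" "gp g * M.c * gp h * L.c \<noteq> 0" by blast
  have "M.B * gp h * L.A \<noteq> 0"
  proof
    assume "M.B * gp h * L.A = 0"
    then have "gp g * M.A * (M.B * gp h * L.A) * L.B = 0" by simp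
    then show False using h by (simp add: M.c_def L.c_def mult.assoc)
  qed
  then have 1: "(\<Sum>i<j. la i) \<le> (\<Sum>i<j. mu i)" for j
    using tab_cross[OF T(2,1), of "gp h" j] h by (simp add: M.B_def L.A_def)
  have "M.A * (M.B * gp h * L.A) * L.B \<noteq> 0"
    using h by (auto simp: M.c_def L.c_def mult.assoc)
  then have "star (M.A * (M.B * gp h * L.A) * L.B) \<noteq> 0" by (metis star_star star_zero)
  then have "L.B * (L.A * gp (- h) * M.B) * M.A \<noteq> 0"
    by (simp add: star_mult star_gp mult.assoc)
  then have 2: "(\<Sum>i<j. mu i) \<le> (\<Sum>i<j. la i)" for j
    using tab_cross[OF T, of "L.A * gp (- h) * M.B" j] h by (simp add: L.B_def M.A_def CS_mult)
  have "(\<Sum>i<j. mu i) = (\<Sum>i<j. la i)" for j using 1[of j] 2[of j] by (rule antisym[rotated])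
  from this[of "Suc _"] this show ?thesis by (simp add: fun_eq_iff)
qed


section \<open>Partitions\<close>

text \<open>Row lengths continued by zeros, so that partitions with different numbers of rows are
  compared pointwise and serve as weights.\<close>

definition rl :: "nat list \<Rightarrow> nat \<Rightarrow> nat" where
  "rl \<mu> i = (if i < length \<mu> then \<mu> ! i else 0)"

lemma young_rl: "young \<mu> = {(i, j). j < rl \<mu> i}"
  by (auto simp: young_def rl_def split: if_splits)

lemma part_rl: "part \<mu> (Suc i) = rl \<mu> i"
  by (simp add: part_def rl_def)

lemma sum_list_partitions: "\<mu> \<in> partitions n \<Longrightarrow> sum_list \<mu> = n"
  by (simp add: partitions_def)

lemma finite_partitions [simp]: "finite (partitions n)"
proof (rule finite_subset)
  show "partitions n \<subseteq> {xs. set xs \<subseteq> {..n} \<and> length xs \<le> n}"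
  proof
    fix \<mu> assume "\<mu> \<in> partitions n"
    then have *: "0 \<notin> set \<mu>" "sum_list \<mu> = n" by (simp_all add: partitions_def)
    have "length \<mu> \<le> sum_list \<mu>" using *(1)
      by (induction \<mu>) auto
    with * show "\<mu> \<in> {xs. set xs \<subseteq> {..n} \<and> length xs \<le> n}"
      using member_le_sum_list[of _ \<mu>] by auto
  qed
qed (simp add: finite_lists_length_le)

lemma rl_dec:
  assumes "\<mu> \<in> partitions n" "i \<le> j" shows "rl \<mu> j \<le> rl \<mu> i"
proof -
  have "sorted_wrt (\<ge>) \<mu>" using assms(1) by (simp add: partitions_def)
  then show ?thesis using assms(2)
    by (cases "i = j") (auto simp: rl_def sorted_wrt_iff_nth_less)
qed

lemma rl_inj:
  assumes "\<mu> \<in> partitions n" "\<nu> \<in> partitions m" "rl \<mu> = rl \<nu>" shows "\<mu> = \<nu>"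
proof -
  have pos: "(rl \<mu> i > 0) = (i < length \<mu>)" if "\<mu> \<in> partitions n" for \<mu> n i
  proof (cases "i < length \<mu>")
    case True
    then have "\<mu> ! i \<in> set \<mu>" by simp
    moreover have "0 \<notin> set \<mu>" using that by (simp add: partitions_def)
    ultimately have "\<mu> ! i \<noteq> 0" by metis
    then show ?thesis using True by (simp add: rl_def)
  qed (simp add: rl_def)
  have "i < length \<mu> \<longleftrightarrow> i < length \<nu>" for i
    using pos[OF assms(1)] pos[OF assms(2)] assms(3) by simp
  then have len: "length \<mu> = length \<nu>" by (metis nat_neq_iff)
  show ?thesis
  proof (rule nth_equalityI[OF len])
    fix i assume "i < length \<mu>"
    then show "\<mu> ! i = \<nu> ! i" using fun_cong[OF assms(3), of i] len by (simp add: rl_def)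
  qed
qed

lemma sum_list_take_Suc: "sum_list (take (Suc i) \<mu>) = sum_list (take i \<mu>) + rl \<mu> i"
  by (cases "i < length \<mu>") (auto simp: take_Suc_conv_app_nth rl_def)

lemma sum_list_take_mono: "i \<le> j \<Longrightarrow> sum_list (take i \<mu>) \<le> sum_list (take j (\<mu> :: nat list))"
  by (induction j rule: dec_induct) (auto simp: sum_list_take_Suc)

lemma sum_list_take_le: "sum_list (take i (\<mu> :: nat list)) \<le> sum_list \<mu>"
  using sum_list_take_mono[of i "max i (length \<mu>)" \<mu>] by simp

lemma tab_row_bounds:
  assumes "k < sum_list \<mu>"
  shows "sum_list (take (tab_row \<mu> k) \<mu>) \<le> k" "k < sum_list (take (Suc (tab_row \<mu> k)) \<mu>)"
proof -
  have ex: "k < sum_list (take (Suc (length \<mu>)) \<mu>)" using assms by simp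
  show "k < sum_list (take (Suc (tab_row \<mu> k)) \<mu>)"
    unfolding tab_row_def using ex by (rule LeastI)
  show "sum_list (take (tab_row \<mu> k) \<mu>) \<le> k"
  proof (cases "tab_row \<mu> k")
    case (Suc i)
    then have "\<not> k < sum_list (take (Suc i) \<mu>)"
      unfolding tab_row_def by (intro not_less_Least) simp
    then show ?thesis using Suc by simp
  qed simp
qed

lemma tab_row_eq:
  assumes "sum_list (take i \<mu>) \<le> k" "k < sum_list (take (Suc i) \<mu>)" shows "tab_row \<mu> k = i"
  unfolding tab_row_def
proof (rule Least_equality)
  fix y assume "k < sum_list (take (Suc y) \<mu>)"
  then show "i \<le> y"
    using assms(1) sum_list_take_mono[of "Suc y" i \<mu>] by (cases "i \<le> y") auto
qed fact

lemma tab_partition: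
  assumes "\<mu> \<in> partitions n" shows "tab n (tab_row \<mu>) (tab_col \<mu>) (rl \<mu>)"
proof
  have n: "sum_list \<mu> = n" using assms by (rule sum_list_partitions)
  show "rl \<mu> j \<le> rl \<mu> i" if "i \<le> j" for i j using assms that by (rule rl_dec)
  show "bij_betw (\<lambda>k. (tab_row \<mu> k, tab_col \<mu> k)) {..<n} {(i, j). j < rl \<mu> i}"
  proof (rule bij_betwI[of _ _ _ "\<lambda>(i, j). sum_list (take i \<mu>) + j"])
    show "(\<lambda>k. (tab_row \<mu> k, tab_col \<mu> k)) \<in> {..<n} \<rightarrow> {(i, j). j < rl \<mu> i}"
    proof
      fix k assume "k \<in> {..<n}"
      then show "(tab_row \<mu> k, tab_col \<mu> k) \<in> {(i, j). j < rl \<mu> i}"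
        using tab_row_bounds[of k \<mu>] n by (auto simp: tab_col_def sum_list_take_Suc)
    qed
    show "(\<lambda>(i, j). sum_list (take i \<mu>) + j) \<in> {(i, j). j < rl \<mu> i} \<rightarrow> {..<n}"
    proof
      fix x assume "x \<in> {(i, j). j < rl \<mu> i}"
      then show "(case x of (i, j) \<Rightarrow> sum_list (take i \<mu>) + j) \<in> {..<n}"
        using sum_list_take_le[of "Suc (fst x)" \<mu>] n by (auto simp: sum_list_take_Suc)
    qed
    show "(case (tab_row \<mu> k, tab_col \<mu> k) of (i, j) \<Rightarrow> sum_list (take i \<mu>) + j) = k"
      if "k \<in> {..<n}" for k
      using tab_row_bounds[of k \<mu>] n that by (simp add: tab_col_def)
    show "(tab_row \<mu> (case y of (i, j) \<Rightarrow> sum_list (take i \<mu>) + j),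
        tab_col \<mu> (case y of (i, j) \<Rightarrow> sum_list (take i \<mu>) + j)) = y"
      if y: "y \<in> {(i, j). j < rl \<mu> i}" for y
    proof -
      obtain i j where y: "y = (i, j)" "j < rl \<mu> i" using y by blast
      then have "tab_row \<mu> (sum_list (take i \<mu>) + j) = i"
        by (intro tab_row_eq) (auto simp: sum_list_take_Suc)
      then show ?thesis using y by (simp add: tab_col_def)
    qed
  qed
qed

text \<open>The tableau in reading order is the one behind \<open>young_symmetriser\<close>, so that
  \<open>iota\<close> maps this element to \<open>central_young_symmetriser\<close>.\<close>

definition zz :: "nat list \<Rightarrow> galg" where
  "zz \<mu> = tab.z (sum_list \<mu>) (tab_row \<mu>) (tab_col \<mu>)"

context
  fixes \<mu> n assumes mu: "\<mu> \<in> partitions n"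
begin

interpretation tab n "tab_row \<mu>" "tab_col \<mu>" "rl \<mu>" by (rule tab_partition[OF mu])

lemma zz_z: "zz \<mu> = z"
  using sum_list_partitions[OF mu] by (simp add: zz_def)

lemma zz_CS [simp]: "zz \<mu> \<in> CS {..<n}"
  by (simp add: zz_z)

lemma zz_commute: "x \<in> CS {..<n} \<Longrightarrow> x * zz \<mu> = zz \<mu> * x"
  by (simp only: zz_z z_commute)

lemma zz_idem: "zz \<mu> * zz \<mu> = zz \<mu>"
  by (simp only: zz_z z_idem)

lemma zz_nonzero: "zz \<mu> \<noteq> 0"
  by (simp only: zz_z z_nonzero not_False_eq_True)

lemma zz_orthogonal: "\<nu> \<in> partitions n \<Longrightarrow> zz \<mu> * zz \<nu> \<noteq> 0 \<Longrightarrow> \<mu> = \<nu>"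
  using tab_orthogonal[OF tab_partition[OF mu] tab_partition[of \<nu> n]] rl_inj[OF mu]
    sum_list_partitions[of \<nu> n] sum_list_partitions[OF mu] by (auto simp: zz_def)

end

subsection \<open>Completeness of the central idempotents\<close>

text \<open>The permutation whose cycles are consecutive intervals of the given lengths.\<close>

fun nx :: "nat list \<Rightarrow> nat \<Rightarrow> nat" where
  "nx [] i = i"
| "nx (m # ms) i = (if i < m then Suc i mod m else m + nx ms (i - m))"

text \<open>Writing the cycles of a permutation one after the other conjugates it to the standard
  permutation with the same cycle lengths.\<close>

lemma nx_concat:
  assumes "\<And>cs i. cs \<in> set css \<Longrightarrow> i < length cs \<Longrightarrow> f (cs ! i) = cs ! (Suc i mod length cs)"
    and "i < length (concat css)"
  shows "nx (map length css) i < length (concat css) \<and> f (concat css ! i) = concat css ! nx (map length css) i"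
  using assms
proof (induction css arbitrary: i)
  case (Cons cs css)
  show ?case
  proof (cases "i < length cs")
    case True
    then have "Suc i mod length cs < length cs" by (intro mod_less_divisor) auto
    with True show ?thesis using Cons.prems(1)[of cs i] by (simp add: nth_append)
  next
    case False
    have "nx (map length css) (i - length cs) < length (concat css) \<and>
        f (concat css ! (i - length cs)) = concat css ! nx (map length css) (i - length cs)"
      by (rule Cons.IH) (use Cons.prems False in \<open>auto\<close>)
    with False show ?thesis by (simp add: nth_append)
  qed
qed simp

lemma cycle_type_ex:
  assumes "p permutes S" "finite S"
  shows "\<exists>css. [] \<notin> set css \<and> distinct (concat css) \<and> set (concat css) = S \<and>
    (\<forall>cs\<in>set css. \<forall>i<length cs. p (cs ! i) = cs ! (Suc i mod length cs))"
  using cycle_decomposition[OF assms]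
proof (induction rule: cycle_decomp.induct)
  case empty
  show ?case by (intro exI[of _ "[]"]) simp
next
  case (comp I p cs)
  then obtain css where css: "[] \<notin> set css" "distinct (concat css)" "set (concat css) = I"
    "\<forall>cs\<in>set css. \<forall>i<length cs. p (cs ! i) = cs ! (Suc i mod length cs)" by blast
  have fixp: "p x = x" if "x \<notin> I" for x
    using comp.hyps(1) that by (induction rule: cycle_decomp.induct) (auto simp: id_outside_supp)
  show ?case
  proof (cases "cs = []")
    case True
    then show ?thesis using css by (intro exI[of _ css]) simp
  next
    case False
    have rot: "cycle_of_list cs (cs ! i) = cs ! (Suc i mod length cs)" if "i < length cs" for i
    proof -
      have "map (cycle_of_list cs) cs ! i = rotate 1 cs ! i"
        using cyclic_rotation[OF comp.hyps(2), of 1] by simp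
      then show ?thesis using that by (simp add: nth_rotate del: One_nat_def) simp
    qed
    have "\<forall>ds\<in>set (cs # css). \<forall>i<length ds. (cycle_of_list cs \<circ> p) (ds ! i) = ds ! (Suc i mod length ds)"
    proof (intro ballI allI impI)
      fix ds i assume ds: "ds \<in> set (cs # css)" "i < length ds"
      show "(cycle_of_list cs \<circ> p) (ds ! i) = ds ! (Suc i mod length ds)"
      proof (cases "ds \<in> set css")
        case True
        have "Suc i mod length ds < length ds" using ds(2) by (intro mod_less_divisor) auto
        then have "ds ! (Suc i mod length ds) \<in> I" using True css(3) by (auto intro!: bexI[of _ ds])
        then have "ds ! (Suc i mod length ds) \<notin> set cs" using comp.hyps(3) by blast
        then show ?thesis using css(4) True ds(2) by (simp add: id_outside_supp)
      next
        case False
        then have "ds = cs" using ds(1) by simp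
        moreover have "cs ! i \<notin> I" using comp.hyps(3) ds(2) \<open>ds = cs\<close> nth_mem[of i cs] by blast
        ultimately show ?thesis using rot[of i] ds(2) fixp by simp
      qed
    qed
    then show ?thesis using css comp.hyps False
      by (intro exI[of _ "cs # css"]) (auto simp: disjoint_iff)
  qed
qed

lemma cycle_type_partition:
  assumes "p permutes {..<n}"
  shows "\<exists>css. map length css \<in> partitions n \<and> distinct (concat css) \<and> set (concat css) = {..<n} \<and>
    (\<forall>cs\<in>set css. \<forall>i<length cs. p (cs ! i) = cs ! (Suc i mod length cs))"
proof -
  obtain css where css: "[] \<notin> set css" "distinct (concat css)" "set (concat css) = {..<n}"
    "\<forall>cs\<in>set css. \<forall>i<length cs. p (cs ! i) = cs ! (Suc i mod length cs)"
    using cycle_type_ex[OF assms] by auto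
  \<comment> \<open>Decreasing order of the lengths, as \<open>partitions\<close> demands.\<close>
  define dss where "dss = rev (sort_key length css)"
  have set: "set dss = set css" by (simp add: dss_def)
  have "mset dss = mset css" by (simp add: dss_def)
  then have "sum_list (map length dss) = sum_list (map length css)"
    by (metis mset_map sum_mset_sum_list)
  then have len: "length (concat dss) = length (concat css)" by (simp add: length_concat)
  have sc: "set (concat dss) = {..<n}" using set css(3) by simp
  have n: "length (concat css) = n" using distinct_card[OF css(2)] css(3) by simp
  have "distinct (concat dss)" by (rule card_distinct) (simp only: sc len n card_lessThan)
  moreover have "map length dss \<in> partitions n"
  proof -
    have "sorted (map length (sort_key length css))" by simp
    then have "sorted_wrt (\<ge>) (map length dss)"
      by (simp add: dss_def sorted_wrt_map sorted_wrt_rev)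
    moreover have "0 \<notin> set (map length dss)" using css(1) by (auto simp: dss_def)
    moreover have "sum_list (map length dss) = n" using len n by (simp add: length_concat)
    ultimately show ?thesis by (simp add: partitions_def)
  qed
  ultimately show ?thesis using sc css(4) set by blast
qed

text \<open>Consequently a central element is determined by its coefficients at one permutation per
  partition of n.\<close>

lemma conj_nx:
  assumes p: "p \<in> SP {..<n}"
  shows "\<exists>\<mu>\<in>partitions n. \<exists>s\<in>SP {..<n}. \<exists>t\<in>SP {..<n}. p = s + t + - s \<and> (\<forall>i<n. ap t i = nx \<mu> i)"
proof -
  have "ap p permutes {..<n}" using p by (simp add: SP_def)
  from cycle_type_partition[OF this] obtain css where css: "map length css \<in> partitions n"
    "distinct (concat css)" "set (concat css) = {..<n}"
    "\<And>cs i. cs \<in> set css \<Longrightarrow> i < length cs \<Longrightarrow> ap p (cs ! i) = cs ! (Suc i mod length cs)" by metis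
  have n: "length (concat css) = n" using distinct_card[OF css(2)] css(3) by simp
  define s where "s i = (if i < n then concat css ! i else i)" for i
  have "bij_betw s {..<n} {..<n}"
    using bij_betw_nth[OF css(2), of "{..<n}" "{..<n}"] n css(3)
    by (subst bij_betw_cong[of _ _ "(!) (concat css)"]) (simp_all add: s_def)
  then have "s permutes {..<n}" by (rule bij_imp_permutes) (simp add: s_def)
  then have s: "Fp s \<in> SP {..<n}" "ap (Fp s) = s" using Fp_SP[of "{..<n}" s] by auto
  let ?t = "- Fp s + p + Fp s"
  have t: "?t \<in> SP {..<n}" using s p by (simp add: SP_plus)
  have "ap ?t i = nx (map length css) i" if "i < n" for i
  proof -
    have *: "nx (map length css) i < n" "ap p (concat css ! i) = concat css ! nx (map length css) i"
      using nx_concat[of css "ap p" i, OF css(4)] that n by auto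
    then have "ap p (ap (Fp s) i) = ap (Fp s) (nx (map length css) i)"
      using that by (simp add: s s_def)
    then show ?thesis by simp
  qed
  moreover have "p = Fp s + ?t + - Fp s" by (rule fperm_eqI) (simp del: add_uminus_conv_diff)
  ultimately show ?thesis using css(1) s t by blast
qed

text \<open>Gaussian elimination: an equation with a nonzero coefficient is solved for the unknown
  k, and \<open>M'\<close> is the system left after substitution.\<close>

lemma linear_system:
  fixes M :: "'i \<Rightarrow> 'j \<Rightarrow> complex"
  assumes "finite I" "finite J" "card I < card J"
  shows "\<exists>\<alpha>. (\<exists>j\<in>J. \<alpha> j \<noteq> 0) \<and> (\<forall>i\<in>I. (\<Sum>j\<in>J. \<alpha> j * M i j) = 0)"
  using assms
proof (induction I arbitrary: J M rule: finite_induct)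
  case empty
  then have "J \<noteq> {}" by auto
  then show ?case by (intro exI[of _ "\<lambda>_. 1"]) auto
next
  case (insert i I)
  show ?case
  proof (cases "\<forall>j\<in>J. M i j = 0")
    case True
    have "card I < card J" using insert by simp
    with insert.IH[OF insert.prems(1) this, of M] True show ?thesis by auto
  next
    case False
    then obtain k where k: "k \<in> J" "M i k \<noteq> 0" by blast
    define M' where "M' l j = M l j - M l k * M i j / M i k" for l j
    have "card I < card (J - {k})" using insert k by simp
    from insert.IH[OF _ this, of M'] insert.prems(1)
    obtain \<alpha> where \<alpha>: "\<exists>j\<in>J - {k}. \<alpha> j \<noteq> 0" "\<And>l. l \<in> I \<Longrightarrow> (\<Sum>j\<in>J - {k}. \<alpha> j * M' l j) = 0"
      by auto
    define \<beta> where "\<beta> = \<alpha>(k := - (\<Sum>j\<in>J - {k}. \<alpha> j * M i j) / M i k)"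
    have split: "(\<Sum>j\<in>J. \<beta> j * M l j) = \<beta> k * M l k + (\<Sum>j\<in>J - {k}. \<alpha> j * M l j)" for l
    proof -
      have "(\<Sum>j\<in>J. \<beta> j * M l j) = \<beta> k * M l k + (\<Sum>j\<in>J - {k}. \<beta> j * M l j)"
        using insert.prems(1) k(1) by (rule sum.remove)
      also have "(\<Sum>j\<in>J - {k}. \<beta> j * M l j) = (\<Sum>j\<in>J - {k}. \<alpha> j * M l j)"
        by (rule sum.cong) (auto simp: \<beta>_def)
      finally show ?thesis .
    qed
    have "(\<Sum>j\<in>J. \<beta> j * M i j) = 0" using split[of i] k(2) by (simp add: \<beta>_def)
    moreover have "(\<Sum>j\<in>J. \<beta> j * M l j) = 0" if "l \<in> I" for l
    proof -
      have "(\<Sum>j\<in>J - {k}. \<alpha> j * M' l j) =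
          (\<Sum>j\<in>J - {k}. \<alpha> j * M l j) - M l k / M i k * (\<Sum>j\<in>J - {k}. \<alpha> j * M i j)"
        by (simp add: M'_def algebra_simps sum_subtractf sum_distrib_left)
      then show ?thesis using \<alpha>(2)[OF that] split[of l] by (simp add: \<beta>_def mult.commute)
    qed
    moreover have "\<exists>j\<in>J. \<beta> j \<noteq> 0" using \<alpha>(1) by (auto simp: \<beta>_def)
    ultimately show ?thesis by (intro exI[of _ \<beta>]) auto
  qed
qed

text \<open>If the complement u of the sum were nonzero, u and the idempotents would be linearly
  independent central elements, one more in number than the partitions of n. But central elements
  are determined by as many coefficients as there are partitions, so some nontrivial combination of
  them is zero.\<close>

lemma sum_zz: "(\<Sum>\<mu>\<in>partitions n. zz \<mu>) = 1"
proof (rule ccontr)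
  let ?P = "partitions n"
  define u where "u = 1 - (\<Sum>\<mu>\<in>?P. zz \<mu>)"
  assume "\<not> ?thesis"
  then have u0: "u \<noteq> 0" by (auto simp: u_def)
  have zs: "zz \<nu> * (\<Sum>\<mu>\<in>?P. zz \<mu>) = zz \<nu>" if \<nu>: "\<nu> \<in> ?P" for \<nu>
  proof -
    have "zz \<nu> * (\<Sum>\<mu>\<in>?P. zz \<mu>) = (\<Sum>\<mu>\<in>?P. if \<mu> = \<nu> then zz \<nu> else 0)"
      unfolding sum_distrib_left
      by (rule sum.cong) (use \<nu> zz_orthogonal[OF \<nu>] zz_idem[OF \<nu>] in auto)
    then show ?thesis using \<nu> by simp
  qed
  then have zu: "zz \<nu> * u = 0" if "\<nu> \<in> ?P" for \<nu>
    using that by (simp add: u_def right_diff_distrib)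
  have "u * u = u - (\<Sum>\<mu>\<in>?P. zz \<mu> * u)"
    by (simp add: u_def left_diff_distrib sum_distrib_right)
  then have uu: "u * u = u" using zu by simp
  have u_CS: "u \<in> CS {..<n}" unfolding u_def by (intro CS_diff CS_sum) auto
  define V where "V j = (case j of None \<Rightarrow> u | Some \<mu> \<Rightarrow> zz \<mu>)" for j
  let ?J = "insert None (Some ` ?P)"
  \<comment> \<open>The representative of the conjugacy class with cycle lengths \<mu>.\<close>
  define T where "T \<mu> = (SOME t. t \<in> SP {..<n} \<and> (\<forall>i<n. ap t i = nx \<mu> i))" for \<mu>
  have T: "t = T \<mu>" if "t \<in> SP {..<n}" "\<forall>i<n. ap t i = nx \<mu> i" for t \<mu>
  proof (rule fperm_eqI)
    have "T \<mu> \<in> SP {..<n} \<and> (\<forall>i<n. ap (T \<mu>) i = nx \<mu> i)"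
      unfolding T_def by (rule someI[of _ t]) (use that in blast)
    then show "ap t i = ap (T \<mu>) i" for i using that by (cases "i < n") auto
  qed
  have "card ?P < card ?J" by (simp add: card_image)
  from linear_system[OF finite_partitions _ this, of "\<lambda>\<mu> j. lk (V j) (T \<mu>)"]
  obtain \<alpha> where \<alpha>: "\<exists>j\<in>?J. \<alpha> j \<noteq> 0" "\<And>\<mu>. \<mu> \<in> ?P \<Longrightarrow> (\<Sum>j\<in>?J. \<alpha> j * lk (V j) (T \<mu>)) = 0"
    by auto
  define w where "w = (\<Sum>j\<in>?J. sc (\<alpha> j) * V j)"
  have w_eq: "w = sc (\<alpha> None) * u + (\<Sum>\<mu>\<in>?P. sc (\<alpha> (Some \<mu>)) * zz \<mu>)"
    by (simp add: w_def V_def sum.reindex)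
  have w_CS: "w \<in> CS {..<n}"
    unfolding w_eq by (intro CS_add CS_sum CS_mult u_CS CS_sc) auto
  have comm: "x * w = w * x" if x: "x \<in> CS {..<n}" for x
  proof -
    have xs: "x * (\<Sum>\<mu>\<in>?P. zz \<mu>) = (\<Sum>\<mu>\<in>?P. zz \<mu>) * x"
      unfolding sum_distrib_left sum_distrib_right
      by (rule sum.cong) (use zz_commute x in auto)
    have "x * u = u * x" by (simp add: u_def algebra_simps xs)
    moreover have "x * (\<Sum>\<mu>\<in>?P. sc (\<alpha> (Some \<mu>)) * zz \<mu>) = (\<Sum>\<mu>\<in>?P. sc (\<alpha> (Some \<mu>)) * zz \<mu>) * x"
      unfolding sum_distrib_left sum_distrib_right
      by (rule sum.cong) (simp_all only: sc_left_commute[of x] mult.assoc zz_commute[OF _ x])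
    ultimately show ?thesis
      unfolding w_eq distrib_left distrib_right by (simp only: sc_left_commute[of x] mult.assoc)
  qed
  have "lk w p = 0" for p
  proof (cases "p \<in> SP {..<n}")
    case True
    then obtain \<mu> s t where *: "\<mu> \<in> ?P" "s \<in> SP {..<n}" "t \<in> SP {..<n}" "p = s + t + - s"
      "\<forall>i<n. ap t i = nx \<mu> i" using conj_nx by blast
    have "lk w p = lk (w * gp s) (s + t)" by (simp add: lk_mult_gp *(4))
    also have "\<dots> = lk (gp s * w) (s + t)" using comm[of "gp s"] *(2) by simp
    also have "\<dots> = lk w t" by (simp add: lk_gp_mult flip: add.assoc)
    also have "\<dots> = lk w (T \<mu>)" using T[OF *(3,5)] by simp
    also have "\<dots> = 0" using \<alpha>(2)[OF *(1)] by (simp only: w_def lookup_sum lk_sc_mult)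
    finally show ?thesis .
  next
    case False
    then show ?thesis using w_CS by (auto simp: CS_def in_keys_iff)
  qed
  then have w0: "w = 0" by (simp add: poly_mapping_eqI)
  have "\<alpha> (Some \<nu>) = 0" if \<nu>: "\<nu> \<in> ?P" for \<nu>
  proof -
    have "zz \<nu> * w = sc (\<alpha> None) * (zz \<nu> * u) + (\<Sum>\<mu>\<in>?P. sc (\<alpha> (Some \<mu>)) * (zz \<nu> * zz \<mu>))"
      unfolding w_eq distrib_left sum_distrib_left by (simp only: sc_left_commute[of "zz \<nu>"])
    also have "(\<Sum>\<mu>\<in>?P. sc (\<alpha> (Some \<mu>)) * (zz \<nu> * zz \<mu>)) =
        (\<Sum>\<mu>\<in>?P. if \<mu> = \<nu> then sc (\<alpha> (Some \<nu>)) * zz \<nu> else 0)"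
    proof (rule sum.cong)
      fix \<mu> assume "\<mu> \<in> ?P"
      then have "\<mu> \<noteq> \<nu> \<Longrightarrow> zz \<nu> * zz \<mu> = 0" using zz_orthogonal[OF \<nu>, of \<mu>] by blast
      then show "sc (\<alpha> (Some \<mu>)) * (zz \<nu> * zz \<mu>) = (if \<mu> = \<nu> then sc (\<alpha> (Some \<nu>)) * zz \<nu> else 0)"
        using zz_idem[OF \<nu>] by simp
    qed simp
    finally have "sc (\<alpha> (Some \<nu>)) * zz \<nu> = 0" using w0 zu[OF \<nu>] \<nu> by simp
    then show ?thesis using zz_nonzero[OF \<nu>] by (simp only: sc_mult_eq_0) simp
  qed
  moreover from this have "sc (\<alpha> None) * u = 0" using w_eq w0 by simp
  then have "\<alpha> None = 0" using u0 by (simp only: sc_mult_eq_0) simp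
  ultimately show False using \<alpha>(1) by auto
qed


section \<open>Highest weight vectors\<close>

lemma sum_fun_apply: "sum f A x = (\<Sum>i\<in>A. f i x)"
  by (induction A rule: infinite_finite_induct) simp_all

definition wt :: "nat \<Rightarrow> (nat \<Rightarrow> nat) \<Rightarrow> nat \<Rightarrow> nat" where
  "wt n x a = card {k. k < n \<and> x k = a}"

text \<open>The matrix unit E_ab of gl in coordinates: reading T as the sum of \<open>T x\<close>
  times the basis tensor of the word x, it turns one letter b into a in all possible ways.\<close>

definition raising :: "nat \<Rightarrow> nat \<Rightarrow> nat \<Rightarrow> ((nat \<Rightarrow> nat) \<Rightarrow> complex) \<Rightarrow> (nat \<Rightarrow> nat) \<Rightarrow> complex" where
  "raising n a b T = (\<lambda>x. \<Sum>k\<in>{k. k < n \<and> x k = a}. T (x(k := b)))"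

text \<open>Words are total functions, which makes letter updates and place permutations
  unconditional; a tensor of degree n is then a function that sees only the first n letters.\<close>

definition loc :: "nat \<Rightarrow> ((nat \<Rightarrow> nat) \<Rightarrow> complex) \<Rightarrow> bool" where
  "loc n T \<longleftrightarrow> (\<forall>x y. (\<forall>i<n. x i = y i) \<longrightarrow> T x = T y)"

definition has_wt :: "nat \<Rightarrow> (nat \<Rightarrow> nat) \<Rightarrow> ((nat \<Rightarrow> nat) \<Rightarrow> complex) \<Rightarrow> bool" where
  "has_wt n mu T \<longleftrightarrow> (\<forall>x. T x \<noteq> 0 \<longrightarrow> wt n x = mu)"

definition HW :: "nat \<Rightarrow> (nat \<Rightarrow> nat) \<Rightarrow> ((nat \<Rightarrow> nat) \<Rightarrow> complex) \<Rightarrow> bool" where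
  "HW n mu T \<longleftrightarrow> loc n T \<and> has_wt n mu T \<and> (\<forall>a b. a < b \<longrightarrow> raising n a b T = 0)"

lemma locD: "loc n T \<Longrightarrow> (\<And>i. i < n \<Longrightarrow> x i = y i) \<Longrightarrow> T x = T y"
  by (auto simp: loc_def)

lemma fun_upd_comp_ap: "x(ap p k := b) \<circ> ap p = (x \<circ> ap p)(k := b)"
  by (auto simp: fun_eq_iff)

lemma wt_comp: "p \<in> SP {..<n} \<Longrightarrow> wt n (x \<circ> ap p) = wt n x"
proof
  fix a assume p: "p \<in> SP {..<n}"
  have "bij_betw (ap p) {k. k < n \<and> (x \<circ> ap p) k = a} {k. k < n \<and> x k = a}"
    by (rule bij_betwI[of _ _ _ "ap (- p)"]) (use p in \<open>auto\<close>)
  then show "wt n (x \<circ> ap p) a = wt n x a" by (simp add: wt_def bij_betw_same_card)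
qed

lemma loc_act: assumes "loc n T" "u \<in> CS {..<n}" shows "loc n (act e u T)"
  unfolding loc_def
proof (intro allI impI)
  fix x y :: "nat \<Rightarrow> nat" assume xy: "\<forall>i<n. x i = y i"
  show "act e u T x = act e u T y"
    unfolding act_def
  proof (rule sum.cong)
    fix p assume "p \<in> ky u"
    then have "p \<in> SP {..<n}" using assms(2) by (auto simp: CS_def)
    then show "lk u p * sg e p * T (x \<circ> ap p) = lk u p * sg e p * T (y \<circ> ap p)"
      using xy locD[OF assms(1), of "x \<circ> ap p" "y \<circ> ap p"] by simp
  qed simp
qed

lemma has_wt_act: assumes "has_wt n mu T" "u \<in> CS {..<n}" shows "has_wt n mu (act e u T)"
  unfolding has_wt_def
proof (intro allI impI)
  fix x assume "act e u T x \<noteq> 0"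
  then obtain p where p: "p \<in> ky u" "T (x \<circ> ap p) \<noteq> 0"
    unfolding act_def by (metis (no_types, lifting) mult_zero_right sum.neutral)
  then have "p \<in> SP {..<n}" using assms(2) by (auto simp: CS_def)
  then show "wt n x = mu" using assms(1) p(2) wt_comp[of p n x] by (auto simp: has_wt_def)
qed

lemma raising_gp:
  assumes "p \<in> SP {..<n}"
  shows "raising n a b (\<lambda>x. T (x \<circ> ap p)) = (\<lambda>x. raising n a b T (x \<circ> ap p))"
proof
  fix x
  show "raising n a b (\<lambda>x. T (x \<circ> ap p)) x = raising n a b T (x \<circ> ap p)"
    unfolding raising_def
    by (rule sum.reindex_bij_witness[of _ "ap p" "ap (- p)"])
       (use assms fun_upd_comp_ap[of x p "ap (- p) _" b] in auto)
qed

lemma raising_act: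
  assumes "u \<in> CS {..<n}" shows "raising n a b (act e u T) = act e u (raising n a b T)"
proof
  fix x
  have "raising n a b (act e u T) x =
      (\<Sum>p\<in>ky u. lk u p * sg e p * raising n a b (\<lambda>x. T (x \<circ> ap p)) x)"
    unfolding raising_def act_def by (subst sum.swap) (simp add: sum_distrib_left)
  also have "\<dots> = (\<Sum>p\<in>ky u. lk u p * sg e p * raising n a b T (x \<circ> ap p))"
    by (rule sum.cong) (use assms in \<open>auto simp: CS_def raising_gp subset_iff\<close>)
  finally show "raising n a b (act e u T) x = act e u (raising n a b T) x" by (simp add: act_def)
qed

lemma HW_act: "HW n mu T \<Longrightarrow> u \<in> CS {..<n} \<Longrightarrow> HW n mu (act e u T)"
  by (simp add: HW_def loc_act has_wt_act raising_act)

text \<open>The antisymmetriser absorbs the transposition with sign -1, while T absorbs it with sign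
  1.\<close>

lemma act_altsum_zero:
  assumes "k < n" "l < n" "k \<noteq> l" "col k = col l" "act 1 (gp (tr k l)) T = T"
  shows "act 1 (stabsum (-1) n col) T = 0"
proof -
  have "stabsum (-1) n col * gp (tr k l) = - stabsum (-1) n col"
    using stabsum_right[OF tr_stab[OF assms(1,2,4)], of "-1"] assms(3) by (simp add: sg_tr sc_minus)
  then have "act 1 (stabsum (-1) n col) T = - act 1 (stabsum (-1) n col) T"
    by (metis act_mult act_uminus assms(5))
  then show ?thesis by (simp add: fun_eq_iff)
qed

context tab
begin

definition w0 :: "(nat \<Rightarrow> nat) \<Rightarrow> complex" where
  "w0 x = (if \<forall>i<n. x i = row i then 1 else 0)"

lemma wt_row: "wt n row = mu"
  by (simp add: wt_def card_row fun_eq_iff)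

text \<open>Raising replaces a letter b of the row word by a smaller letter a. The column of the
  affected place also contains a box in row a, so the new word repeats a letter within a column and
  B kills it.\<close>

lemma HW_Bw0: "HW n mu (act 1 B w0)"
  unfolding HW_def
proof (intro conjI allI impI)
  have loc: "loc n w0" by (auto simp: loc_def w0_def)
  then show "loc n (act 1 B w0)" by (rule loc_act) simp
  have "has_wt n mu w0"
    unfolding has_wt_def
  proof (intro allI impI)
    fix x assume "w0 x \<noteq> 0"
    then have "\<forall>i<n. x i = row i" by (auto simp: w0_def split: if_splits)
    then have *: "{k. k < n \<and> x k = a} = {k. k < n \<and> row k = a}" for a by auto
    have "wt n x = wt n row" by (rule ext) (simp add: wt_def *)
    then show "wt n x = mu" using wt_row by simp
  qed
  then show "has_wt n mu (act 1 B w0)" by (rule has_wt_act) simp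
  fix a b :: nat assume "a < b"
  define \<delta> where "\<delta> k x = (if \<forall>i<n. x i = (row(k := a)) i then 1 else 0 :: complex)" for k x
  have r: "raising n a b w0 = (\<Sum>k\<in>{k. k < n \<and> row k = b}. \<delta> k)"
  proof
    fix x
    have "raising n a b w0 x = (\<Sum>k<n. if x k = a \<and> (\<forall>i<n. (x(k := b)) i = row i) then 1 else 0)"
      unfolding raising_def w0_def by (rule sum.mono_neutral_cong_left) auto
    also have "\<dots> = (\<Sum>k<n. if row k = b \<and> (\<forall>i<n. x i = (row(k := a)) i) then 1 else 0)"
      by (rule sum.cong) (auto split: if_splits)
    also have "\<dots> = (\<Sum>k\<in>{k. k < n \<and> row k = b}. \<delta> k x)"
      unfolding \<delta>_def by (rule sum.mono_neutral_cong_right) auto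
    finally show "raising n a b w0 x = (\<Sum>k\<in>{k. k < n \<and> row k = b}. \<delta> k) x"
      by (simp add: sum_fun_apply)
  qed
  have "act 1 B (\<delta> k) = 0" if k: "k < n" "row k = b" for k
  proof -
    have "col k < mu a" using pos_in[OF k(1)] dec[of a b] k(2) \<open>a < b\<close> by simp
    then obtain l where l: "l < n" "row l = a" "col l = col k" using pos_ex by blast
    have kl: "k \<noteq> l" using l k \<open>a < b\<close> by auto
    have "act 1 (gp (tr k l)) (\<delta> k) = \<delta> k"
    proof
      fix x :: "nat \<Rightarrow> nat"
      have "(\<forall>i<n. x (ap (tr k l) i) = (row(k := a)) i) \<longleftrightarrow> (\<forall>i<n. x i = (row(k := a)) i)"
        (is "?L \<longleftrightarrow> ?R")
      proof
        assume L: ?L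
        show ?R
        proof (intro allI impI)
          fix i assume "i < n"
          then show "x i = (row(k := a)) i"
            using spec[OF L, of "ap (tr k l) i"] k l kl by (auto simp: ap_tr transpose_def split: if_splits)
        qed
      next
        assume R: ?R
        show ?L using R k l kl by (auto simp: ap_tr transpose_def)
      qed
      then show "act 1 (gp (tr k l)) (\<delta> k) x = \<delta> k x" by (simp add: act_gp \<delta>_def)
    qed
    then show ?thesis
      unfolding B_def using k(1) l(1) kl l(3) by (intro act_altsum_zero[of k n l]) auto
  qed
  then have "act 1 B (raising n a b w0) = 0" unfolding r act_T_sum by (intro sum.neutral) auto
  then show "raising n a b (act 1 B w0) = 0" by (simp add: raising_act)
qed

text \<open>The value of \<open>act 1 v w0\<close> at the word \<open>row \<circ> ap (- g)\<close>
  is the coefficient of g in \<open>v * A\<close>: both are the sum of the coefficients of v over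
  the coset of g modulo the row group.\<close>

lemma act_w0_nonzero:
  assumes v: "v \<in> CS {..<n}" "v * A \<noteq> 0" shows "act 1 v w0 \<noteq> 0"
proof -
  obtain g where g: "lk (v * A) g \<noteq> 0" using v(2) by (metis lookup_zero poly_mapping_eqI)
  have "g \<in> SP {..<n}"
  proof (rule ccontr)
    assume "g \<notin> SP {..<n}"
    then have "g \<notin> ky (v * A)" using CS_mult[OF v(1) AB_CS(1)] by (auto simp: CS_def)
    with g show False by (simp add: in_keys_iff)
  qed
  have "lk (v * A) g = (\<Sum>r\<in>stab n row. lk v (g + - r))"
    by (simp add: A_def stabsum_def sum_distrib_left lookup_sum lk_mult_gp)
  also have "\<dots> = (\<Sum>r\<in>stab n row. lk v (g + r))"
    by (rule sum.reindex_bij_witness[of _ uminus uminus]) auto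
  also have "\<dots> = (\<Sum>p\<in>{p \<in> SP {..<n}. - g + p \<in> stab n row}. lk v p)"
    by (rule sum.reindex_bij_witness[of _ "\<lambda>p. - g + p" "\<lambda>r. g + r"])
       (use \<open>g \<in> SP {..<n}\<close> in \<open>auto simp: SP_plus stab_SP simp flip: add.assoc\<close>)
  also have "\<dots> = (\<Sum>p\<in>SP {..<n}. if - g + p \<in> stab n row then lk v p else 0)"
    by (rule sum.mono_neutral_cong_left) auto
  also have "\<dots> = act 1 v w0 (row \<circ> ap (- g))"
  proof -
    have "ky v \<subseteq> SP {..<n}" using v(1) by (simp add: CS_def)
    then have "act 1 v w0 (row \<circ> ap (- g)) = (\<Sum>p\<in>SP {..<n}. lk v p * w0 (row \<circ> ap (- g) \<circ> ap p))"
      by (simp add: act_superset[of "SP {..<n}"])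
    also have "\<dots> = (\<Sum>p\<in>SP {..<n}. if - g + p \<in> stab n row then lk v p else 0)"
      by (rule sum.cong) (use \<open>g \<in> SP {..<n}\<close> in \<open>auto simp: stab_def w0_def SP_plus\<close>)
    finally show ?thesis ..
  qed
  finally show ?thesis using g by auto
qed

text \<open>The vector is \<open>act 1 (gp g * A)\<close> applied to \<open>act 1 B w0\<close>. That
  u does not kill it is tested on the row word, where the question becomes whether u g A B A is
  zero.\<close>

lemma HW_exists:
  assumes "u \<in> CS {..<n}" "u * z \<noteq> 0" shows "\<exists>T. HW n mu T \<and> act 1 u T \<noteq> 0"
proof -
  obtain g where g: "g \<in> SP {..<n}" "u * gp g * c \<noteq> 0" using mult_z_nonzero[OF assms(2)] by blast
  let ?v = "gp g * A"
  have "u * gp g * A * B * A \<noteq> 0" using g(2) by (rule mult_BA_nonzero)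
  then have "act 1 (u * gp g * A * B) w0 \<noteq> 0" by (intro act_w0_nonzero CS_mult) (use assms g in auto)
  then have "act 1 u (act 1 ?v (act 1 B w0)) \<noteq> 0" by (simp add: mult.assoc flip: act_mult)
  moreover have "HW n mu (act 1 ?v (act 1 B w0))"
    by (rule HW_act[OF HW_Bw0]) (use g in \<open>simp add: CS_mult\<close>)
  ultimately show ?thesis by blast
qed

text \<open>Some conjugate of c acts nontrivially, so an antisymmetrised tensor is nonzero at a word
  x of content \<open>la\<close>. Antisymmetry forbids repeated letters of x within a column, and
  \<open>word_dominated\<close> applies.\<close>

lemma act_z_dominated:
  assumes T: "has_wt n la T" and nz: "act 1 z T \<noteq> 0"
  shows "(\<Sum>i<j. la i) \<le> (\<Sum>i<j. mu i)"
proof -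
  have "act 1 Y T \<noteq> 0" using nz by (auto simp: z_def act_sc_mult scl_simps)
  then obtain g where g: "g \<in> SP {..<n}" "act 1 (gp g * c * gp (- g)) T \<noteq> 0"
    unfolding Y_def act_sum by (meson sum.neutral)
  define T' where "T' = act 1 (gp (- g)) T"
  have "act 1 B T' \<noteq> 0" using g(2) by (auto simp: c_def act_mult T'_def)
  then obtain x where x: "act 1 B T' x \<noteq> 0" by (auto simp: fun_eq_iff)
  have "has_wt n la (act 1 B T')"
    unfolding T'_def using g(1) by (intro has_wt_act T) auto
  then have wt: "wt n x = la" using x by (simp add: has_wt_def)
  have "k = l" if kl: "k < n" "l < n" "col k = col l" "x k = x l" for k l
  proof (rule ccontr)
    assume "k \<noteq> l"
    have "x \<circ> ap (tr k l) = x" using kl by (auto simp: fun_eq_iff ap_tr transpose_def)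
    then have "act 1 (gp (tr k l) * B) T' x = act 1 B T' x" by (simp add: act_mult act_gp)
    moreover have "gp (tr k l) * B = - B"
      unfolding B_def using stabsum_left[OF tr_stab[OF kl(1-3)], of "-1"] \<open>k \<noteq> l\<close>
      by (simp add: sg_tr sc_minus)
    ultimately show False using x by (simp add: act_uminus)
  qed
  then have "card {k. k < n \<and> x k < j} \<le> (\<Sum>i<j. mu i)" by (rule word_dominated)
  moreover have "card {k. k < n \<and> x k < j} = (\<Sum>i<j. la i)"
    unfolding card_fun_less wt[symmetric] by (simp add: wt_def)
  ultimately show ?thesis by simp
qed

end

subsection \<open>The sum of all transpositions\<close>

text \<open>Each transposition occurs twice.\<close>

definition Tr2 :: "nat set \<Rightarrow> galg" where
  "Tr2 K = (\<Sum>i\<in>K. \<Sum>j\<in>K - {i}. gp (tr i j))"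

text \<open>Twice the sum of the contents when mu is a partition with at most M rows, but also
  meaningful for a weight that is not decreasing.\<close>

definition cas :: "nat \<Rightarrow> (nat \<Rightarrow> nat) \<Rightarrow> int" where
  "cas M mu = (\<Sum>b<M. int (mu b) * (int (mu b) - 1 - 2 * int b))"

lemma Tr2_CS: "Tr2 K \<in> CS K"
  unfolding Tr2_def by (intro CS_sum) (auto intro: SP_tr)

lemma Tr2_conj:
  assumes "finite K" "inj_on (ap g) K"
  shows "gp g * Tr2 K = Tr2 (ap g ` K) * gp g"
proof -
  have "Tr2 (ap g ` K) * gp g = (\<Sum>i\<in>K. \<Sum>j\<in>ap g ` K - {ap g i}. gp (tr (ap g i) j) * gp g)"
    unfolding Tr2_def sum_distrib_right by (subst sum.reindex[OF assms(2)]) simp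
  also have "\<dots> = (\<Sum>i\<in>K. \<Sum>j\<in>K - {i}. gp (tr (ap g i) (ap g j)) * gp g)"
  proof (rule sum.cong)
    fix i assume "i \<in> K"
    have "ap g ` K - {ap g i} = ap g ` (K - {i})" by auto
    then show "(\<Sum>j\<in>ap g ` K - {ap g i}. gp (tr (ap g i) j) * gp g) =
        (\<Sum>j\<in>K - {i}. gp (tr (ap g i) (ap g j)) * gp g)"
      by (simp add: sum.reindex inj_on_def)
  qed simp
  also have "\<dots> = gp g * Tr2 K"
    unfolding Tr2_def sum_distrib_left by (simp add: gp_mult conj_tr)
  finally show ?thesis ..
qed

lemma Tr2_commute: "x \<in> CS K \<Longrightarrow> finite K \<Longrightarrow> x * Tr2 K = Tr2 K * x"
proof (rule CS_commute_gens)
  fix p assume "p \<in> SP K" "finite K"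
  then have "ap p ` K = K" by (auto simp: SP_def permutes_image)
  then show "gp p * Tr2 K = Tr2 K * gp p"
    using Tr2_conj[of K p] \<open>finite K\<close> by (simp add: inj_on_def)
qed

lemma sum_wt:
  fixes f :: "nat \<Rightarrow> int"
  assumes "wt n x = mu" "\<And>b. b \<ge> M \<Longrightarrow> mu b = 0"
  shows "(\<Sum>j<n. f (x j)) = (\<Sum>b<M. int (mu b) * f b)"
proof -
  have "x ` {..<n} \<subseteq> {..<M}"
  proof
    fix b assume "b \<in> x ` {..<n}"
    then have "{k. k < n \<and> x k = b} \<noteq> {}" by auto
    then have "wt n x b \<noteq> 0" by (simp add: wt_def)
    then show "b \<in> {..<M}" using assms by (metis lessThan_iff not_le)
  qed
  then have "(\<Sum>j<n. f (x j)) = (\<Sum>b<M. \<Sum>j\<in>{j \<in> {..<n}. x j = b}. f (x j))"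
    by (intro sum.group[symmetric]) auto
  also have "\<dots> = (\<Sum>b<M. int (mu b) * f b)"
    using assms(1) by (intro sum.cong) (auto simp: wt_def)
  finally show ?thesis .
qed

text \<open>Fix a place j. Swapping it with a place of equal letter does nothing. For a letter a < x
  j, the raising relation at the word with a written into place j says that the swaps of j with all
  places carrying a add up to - T x, so the smaller letters contribute - (x j) T x. Exchanging the
  roles of i and j shows that the larger letters give the same total.\<close>

lemma casimir:
  assumes T: "HW n mu T" and M: "\<And>b. b \<ge> M \<Longrightarrow> mu b = 0"
  shows "act 1 (Tr2 {..<n}) T = scl (of_int (cas M mu)) T"
proof
  fix x
  let ?s = "\<lambda>i j. T (x \<circ> ap (tr i j))"
  have expand: "act 1 (Tr2 {..<n}) T x = (\<Sum>i<n. \<Sum>j\<in>{..<n} - {i}. ?s i j)"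
    by (simp add: Tr2_def act_sum act_gp sum_fun_apply)
  show "act 1 (Tr2 {..<n}) T x = scl (of_int (cas M mu)) T x"
  proof (cases "wt n x = mu")
    case False
    have z: "T y = 0" if "wt n y \<noteq> mu" for y using T that by (auto simp: HW_def has_wt_def)
    have "?s i j = 0" if "i < n" "j < n" for i j
      using z[of "x \<circ> ap (tr i j)"] wt_comp[of "tr i j" n x] SP_tr[of i "{..<n}" j] that False by simp
    then show ?thesis unfolding expand using z[OF False] by (simp add: scl_def)
  next
    case wt: True
    have less: "(\<Sum>i\<in>{i. i < n \<and> x i < x j}. ?s i j) = - of_nat (x j) * T x" if j: "j < n" for j
    proof -
      have a: "(\<Sum>i\<in>{i. i < n \<and> x i = a}. ?s i j) = - T x" if "a < x j" for a
      proof -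
        let ?y = "x(j := a)"
        have "raising n a (x j) T ?y = 0" using T that by (simp add: HW_def)
        moreover have "{k. k < n \<and> ?y k = a} = insert j {i. i < n \<and> x i = a}" using j by auto
        ultimately have "T (?y(j := x j)) + (\<Sum>i\<in>{i. i < n \<and> x i = a}. T (?y(i := x j))) = 0"
          using that by (simp add: raising_def)
        moreover have "?y(j := x j) = x" by simp
        moreover have "(\<Sum>i\<in>{i. i < n \<and> x i = a}. T (?y(i := x j))) = (\<Sum>i\<in>{i. i < n \<and> x i = a}. ?s i j)"
        proof (rule sum.cong)
          fix i assume "i \<in> {i. i < n \<and> x i = a}"
          then have "?y(i := x j) = x \<circ> ap (tr i j)" by (auto simp: fun_eq_iff ap_tr transpose_def)
          then show "T (?y(i := x j)) = ?s i j" by simp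
        qed simp
        ultimately show ?thesis by (simp add: add_eq_0_iff)
      qed
      have "{i. i < n \<and> x i < x j} = (\<Union>a<x j. {i. i < n \<and> x i = a})" by auto
      then have "(\<Sum>i\<in>{i. i < n \<and> x i < x j}. ?s i j) = (\<Sum>a<x j. \<Sum>i\<in>{i. i < n \<and> x i = a}. ?s i j)"
        by (simp only:) (rule sum.UNION_disjoint, auto)
      also have "\<dots> = (\<Sum>a<x j. - T x)" by (rule sum.cong) (use a in auto)
      finally show ?thesis by simp
    qed
    have eq: "(\<Sum>i\<in>{i. i < n \<and> x i = x j \<and> i \<noteq> j}. ?s i j) = (of_nat (mu (x j)) - 1) * T x"
      if j: "j < n" for j
    proof -
      have "(\<Sum>i\<in>{i. i < n \<and> x i = x j \<and> i \<noteq> j}. ?s i j) = (\<Sum>i\<in>{i. i < n \<and> x i = x j} - {j}. T x)"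
      proof (rule sum.cong)
        fix i assume "i \<in> {i. i < n \<and> x i = x j} - {j}"
        then have "x \<circ> ap (tr i j) = x" by (auto simp: fun_eq_iff ap_tr transpose_def)
        then show "?s i j = T x" by simp
      qed auto
      also have "\<dots> = of_nat (card ({i. i < n \<and> x i = x j} - {j})) * T x" by simp
      also have "card ({i. i < n \<and> x i = x j} - {j}) = mu (x j) - 1"
        using wt j by (subst card_Diff_singleton) (auto simp: wt_def)
      also have "mu (x j) \<ge> 1"
      proof -
        have "{i. i < n \<and> x i = x j} \<noteq> {}" using j by auto
        then show ?thesis using wt by (auto simp: wt_def card_gt_0_iff Suc_le_eq)
      qed
      ultimately show ?thesis by (simp add: of_nat_diff comp_def)
    qed
    have "(\<Sum>i<n. \<Sum>j\<in>{..<n} - {i}. ?s i j) = (\<Sum>j<n. \<Sum>i\<in>{..<n} - {j}. ?s i j)"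
      by (simp add: tr_commute)
    also have "\<dots> = (\<Sum>j<n. (\<Sum>i\<in>{i. i < n \<and> x i = x j \<and> i \<noteq> j}. ?s i j) +
        (\<Sum>i\<in>{i. i < n \<and> x i < x j}. ?s i j) + (\<Sum>i\<in>{i. i < n \<and> x j < x i}. ?s i j))"
    proof (rule sum.cong)
      fix j
      have e: "{..<n} - {j} = ({i. i < n \<and> x i = x j \<and> i \<noteq> j} \<union> {i. i < n \<and> x i < x j}) \<union> {i. i < n \<and> x j < x i}"
        by auto
      show "(\<Sum>i\<in>{..<n} - {j}. ?s i j) = (\<Sum>i\<in>{i. i < n \<and> x i = x j \<and> i \<noteq> j}. ?s i j) +
        (\<Sum>i\<in>{i. i < n \<and> x i < x j}. ?s i j) + (\<Sum>i\<in>{i. i < n \<and> x j < x i}. ?s i j)"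
        unfolding e by (subst sum.union_disjoint, simp, simp, force, subst sum.union_disjoint) auto
    qed simp
    also have "\<dots> = (\<Sum>j<n. \<Sum>i\<in>{i. i < n \<and> x i = x j \<and> i \<noteq> j}. ?s i j) +
        (\<Sum>j<n. \<Sum>i\<in>{i. i < n \<and> x i < x j}. ?s i j) + (\<Sum>j<n. \<Sum>i\<in>{i. i < n \<and> x j < x i}. ?s i j)"
      by (simp add: sum.distrib)
    also have "(\<Sum>j<n. \<Sum>i\<in>{i. i < n \<and> x j < x i}. ?s i j) = (\<Sum>j<n. \<Sum>i\<in>{i. i < n \<and> x i < x j}. ?s i j)"
    proof -
      have "(\<Sum>j<n. \<Sum>i\<in>{i. i < n \<and> x j < x i}. ?s i j) = (\<Sum>j<n. \<Sum>i<n. if x j < x i then ?s i j else 0)"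
        by (intro sum.cong refl sum.mono_neutral_cong_left) auto
      also have "\<dots> = (\<Sum>i<n. \<Sum>j<n. if x j < x i then ?s i j else 0)" by (rule sum.swap)
      also have "\<dots> = (\<Sum>i<n. \<Sum>j\<in>{j. j < n \<and> x j < x i}. ?s i j)"
        by (intro sum.cong refl sum.mono_neutral_cong_right) auto
      finally show ?thesis by (simp add: tr_commute)
    qed
    also have "(\<Sum>j<n. \<Sum>i\<in>{i. i < n \<and> x i < x j}. ?s i j) = (\<Sum>j<n. - of_nat (x j) * T x)"
      by (rule sum.cong) (use less in auto)
    also have "(\<Sum>j<n. \<Sum>i\<in>{i. i < n \<and> x i = x j \<and> i \<noteq> j}. ?s i j) = (\<Sum>j<n. (of_nat (mu (x j)) - 1) * T x)"
      by (rule sum.cong) (use eq in auto)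
    also have "(\<Sum>j<n. (of_nat (mu (x j)) - 1) * T x) + (\<Sum>j<n. - of_nat (x j) * T x) + (\<Sum>j<n. - of_nat (x j) * T x) =
        of_int (\<Sum>j<n. int (mu (x j)) - 1 - 2 * int (x j)) * T x"
      unfolding sum.distrib[symmetric] of_int_sum sum_distrib_right
      by (rule sum.cong) (simp_all add: algebra_simps)
    also have "(\<Sum>j<n. int (mu (x j)) - 1 - 2 * int (x j)) = cas M mu"
      unfolding cas_def by (rule sum_wt[OF wt M]) 
    finally show ?thesis unfolding expand by (simp add: scl_def comp_def)
  qed
qed

text \<open>Summation by parts turns the difference of the two values into a sum of nonnegative
  partial-sum differences D with coefficients at least 1, so all of them vanish. The weight mu may
  rise by one from row to row, because a partition with a box removed from an arbitrary row is of
  this kind.\<close>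

lemma cas_rigid:
  fixes ka mu :: "nat \<Rightarrow> nat"
  assumes dom: "\<And>j. (\<Sum>i<j. mu i) \<le> (\<Sum>i<j. ka i)" and tot: "(\<Sum>i<M. mu i) = (\<Sum>i<M. ka i)"
    and ka: "\<And>j. ka (Suc j) \<le> ka j" and mu: "\<And>j. mu (Suc j) \<le> Suc (mu j)"
    and zero: "\<And>b. b \<ge> M \<Longrightarrow> ka b = 0" "\<And>b. b \<ge> M \<Longrightarrow> mu b = 0"
    and cas: "cas M ka = cas M mu"
  shows "ka = mu"
proof -
  define D where "D j = int (\<Sum>i<j. ka i) - int (\<Sum>i<j. mu i)" for j
  define l where "l b = int (ka b) + int (mu b) - 1 - 2 * int b" for b
  have D0: "D 0 = 0" and DM: "D M = 0" and Dpos: "D j \<ge> 0" for j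
    using dom[of j] tot by (simp_all add: D_def flip: of_nat_sum)
  have DS: "D (Suc b) - D b = int (ka b) - int (mu b)" for b by (simp add: D_def)
  have abel: "(\<Sum>b<m. (D (Suc b) - D b) * l b) = D m * l m + (\<Sum>b<m. D (Suc b) * (l b - l (Suc b)))" for m
    by (induction m) (simp_all add: D0 algebra_simps)
  have "0 = cas M ka - cas M mu" by (simp add: cas)
  also have "\<dots> = (\<Sum>b<M. (D (Suc b) - D b) * l b)"
    by (simp add: cas_def DS l_def algebra_simps flip: sum_subtractf)
  also have "\<dots> = (\<Sum>b<M. D (Suc b) * (l b - l (Suc b)))" by (simp add: abel DM)
  finally have s: "(\<Sum>b<M. D (Suc b) * (l b - l (Suc b))) = 0" by simp
  have lpos: "l b - l (Suc b) \<ge> 1" for b using ka[of b] mu[of b] by (simp add: l_def)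
  have pos: "0 \<le> D (Suc b) * (l b - l (Suc b))" for b
    using Dpos[of "Suc b"] lpos[of b] by simp
  have "\<forall>b\<in>{..<M}. D (Suc b) * (l b - l (Suc b)) = 0"
    by (rule sum_nonneg_eq_0_iff[THEN iffD1]) (use pos s in simp_all)
  then have "D (Suc b) = 0" if "b < M" for b using that lpos[of b] by fastforce
  then have D: "D b = 0" if "b \<le> M" for b using that D0 by (cases b) auto
  show ?thesis
  proof
    fix b
    show "ka b = mu b" using DS[of b] D[of b] D[of "Suc b"] zero[of b] by (cases "b < M") auto
  qed
qed

section \<open>Shapes as highest weights\<close>

lemma rl_zero: "\<mu> \<in> partitions n \<Longrightarrow> n \<le> b \<Longrightarrow> rl \<mu> b = 0"
proof -
  assume mu: "\<mu> \<in> partitions n" and b: "n \<le> b"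
  then have *: "0 \<notin> set \<mu>" "sum_list \<mu> = n" by (simp_all add: partitions_def)
  have "length \<mu> \<le> sum_list \<mu>" using *(1) by (induction \<mu>) auto
  then show ?thesis using * b by (simp add: rl_def)
qed

lemma sum_rl: "\<mu> \<in> partitions n \<Longrightarrow> n \<le> M \<Longrightarrow> (\<Sum>i<M. rl \<mu> i) = n"
proof -
  assume mu: "\<mu> \<in> partitions n" and "n \<le> M"
  have "length \<mu> \<le> n"
    using rl_zero[OF mu, of "n"] mu
    by (metis (no_types, lifting) linorder_not_le nth_mem partitions_def mem_Collect_eq rl_def order_refl)
  then have "(\<Sum>i<M. rl \<mu> i) = (\<Sum>i<length \<mu>. rl \<mu> i)"
    using \<open>n \<le> M\<close> by (intro sum.mono_neutral_right) (auto simp: rl_def)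
  also have "\<dots> = sum_list \<mu>" by (simp add: rl_def sum_list_sum_nth atLeast0LessThan)
  finally show ?thesis using sum_list_partitions[OF mu] by simp
qed

lemma HW_zz_exists:
  assumes "\<mu> \<in> partitions n" "u \<in> CS {..<n}" "u * zz \<mu> \<noteq> 0"
  shows "\<exists>T. HW n (rl \<mu>) T \<and> act 1 u T \<noteq> 0"
  using tab.HW_exists[OF tab_partition[OF assms(1)] assms(2)] assms(3) by (simp add: zz_z[OF assms(1)])

text \<open>A deviation from the scalar, multiplied by \<open>zz \<mu>\<close>, would act
  nontrivially on some highest weight vector of weight \<mu>, contrary to
  \<open>casimir\<close>.\<close>

lemma Tr2_zz:
  assumes "\<mu> \<in> partitions n" "n \<le> M" shows "Tr2 {..<n} * zz \<mu> = sc (of_int (cas M (rl \<mu>))) * zz \<mu>"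
proof (rule ccontr)
  assume "\<not> ?thesis"
  then have "(Tr2 {..<n} - sc (of_int (cas M (rl \<mu>)))) * zz \<mu> \<noteq> 0" by (simp add: left_diff_distrib)
  from HW_zz_exists[OF assms(1) _ this] obtain T where T: "HW n (rl \<mu>) T"
    "act 1 (Tr2 {..<n} - sc (of_int (cas M (rl \<mu>)))) T \<noteq> 0"
    using CS_diff[OF Tr2_CS CS_sc] by blast
  have "act 1 (Tr2 {..<n}) T = scl (of_int (cas M (rl \<mu>))) T"
    by (rule casimir[OF T(1)]) (use assms rl_zero in auto)
  with T(2) show False by (simp add: act_diff act_sc)
qed

text \<open>The weight is dominated by the shape, and the sum of transpositions acts on the same
  nonzero vector by the values of both; \<open>cas_rigid\<close> leaves only equality.\<close>

lemma zz_HW_weight: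
  assumes ka: "\<kappa> \<in> partitions n" and T: "HW n mu T" and nz: "act 1 (zz \<kappa>) T \<noteq> 0"
    and mu: "\<And>j. mu (Suc j) \<le> Suc (mu j)" and zero: "\<And>b. b \<ge> M \<Longrightarrow> mu b = 0" "n \<le> M"
    and tot: "(\<Sum>i<M. mu i) = n"
  shows "rl \<kappa> = mu"
proof (rule cas_rigid[of _ _ M])
  have "has_wt n mu T" using T by (simp add: HW_def)
  from tab.act_z_dominated[OF tab_partition[OF ka] this] nz
  show "(\<Sum>i<j. mu i) \<le> (\<Sum>i<j. rl \<kappa> i)" for j by (simp add: zz_z[OF ka])
  have "act 1 (zz \<kappa> * Tr2 {..<n}) T = act 1 (Tr2 {..<n} * zz \<kappa>) T"
    using zz_commute[OF ka Tr2_CS] by simp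
  also have "\<dots> = scl (of_int (cas M (rl \<kappa>))) (act 1 (zz \<kappa>) T)"
    by (simp add: Tr2_zz[OF ka zero(2)] act_sc_mult)
  finally have "scl (of_int (cas M mu)) (act 1 (zz \<kappa>) T) = scl (of_int (cas M (rl \<kappa>))) (act 1 (zz \<kappa>) T)"
    by (simp add: act_mult casimir[OF T zero(1)] act_T_scl)
  moreover obtain x where "act 1 (zz \<kappa>) T x \<noteq> 0" using nz by (auto simp: fun_eq_iff)
  ultimately show "cas M (rl \<kappa>) = cas M mu" by (auto simp: scl_def fun_eq_iff)
qed (use assms rl_zero[OF ka] sum_rl[OF ka] rl_dec[OF ka] in auto)


subsection \<open>Restriction to smaller symmetric groups\<close>

text \<open>Permutations of the first m places do not see the letter at m, so the tensor can be
  sliced along that letter.\<close>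

lemma act_last:
  assumes "u \<in> CS {..<m}" shows "act e u T x = act e u (\<lambda>y. T (y(m := x m))) x"
  unfolding act_def
proof (rule sum.cong)
  fix p assume "p \<in> ky u"
  then have "p \<in> SP {..<m}" using assms by (auto simp: CS_def)
  then have "(x \<circ> ap p)(m := x m) = x \<circ> ap p" by (auto simp: fun_eq_iff)
  then show "lk u p * sg e p * T (x \<circ> ap p) = lk u p * sg e p * T ((x \<circ> ap p)(m := x m))" by simp
qed simp

text \<open>
  The coefficient \<open>y \<mapsto> T (y(m := r))\<close> of the last letter \<open>r\<close> is annihilated by the raising operators
  modulo the coefficients of larger letters, so for the largest \<open>r\<close> that \<open>v\<close> does not kill it
  is a highest weight vector again.
\<close>

lemma branching_step:
  assumes mu: "\<mu> \<in> partitions (Suc m)" and T: "HW (Suc m) (rl \<mu>) T"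
    and u: "u \<in> CS {..<m}" "u * u = u" and nz: "act 1 u T \<noteq> 0"
  shows "\<exists>\<kappa>\<in>partitions m. (\<forall>i. rl \<kappa> i \<le> rl \<mu> i) \<and> (\<exists>T'. HW m (rl \<kappa>) T' \<and> act 1 u T' \<noteq> 0)"
proof -
  define C where "C r y = T (y(m := r))" for r y
  obtain x where "act 1 u T x \<noteq> 0" using nz by (auto simp: fun_eq_iff)
  then have "act 1 u (C (x m)) \<noteq> 0"
    using act_last[OF u(1), of 1 T x] by (auto simp: C_def[abs_def])
  \<comment> \<open>Cutting by the idempotents of the smaller group supplies a shape \<kappa> at
    once; that it is \<mu> with one box removed is only shown at the end.\<close>
  moreover have "act 1 u (C (x m)) = (\<Sum>\<kappa>\<in>partitions m. act 1 (zz \<kappa> * u) (C (x m)))"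
    using sum_zz[of m] by (simp flip: act_sum sum_distrib_right)
  ultimately obtain \<kappa> where ka: "\<kappa> \<in> partitions m" and k: "act 1 (zz \<kappa> * u) (C (x m)) \<noteq> 0"
    by (metis (no_types, lifting) sum.neutral)
  define v where "v = zz \<kappa> * u"
  have v: "v \<in> CS {..<m}" using ka u(1) by (simp add: v_def CS_mult)
  have wtC: "rl \<mu> a = wt m y a + (if r = a then 1 else 0)" if "C r y \<noteq> 0" for r y a
  proof -
    have "wt (Suc m) (y(m := r)) = rl \<mu>" using T that by (auto simp: HW_def has_wt_def C_def)
    then have "rl \<mu> a = wt (Suc m) (y(m := r)) a" by simp
    then have "rl \<mu> a = card {k. k < Suc m \<and> (y(m := r)) k = a}" by (simp only: wt_def)
    also have "{k. k < Suc m \<and> (y(m := r)) k = a} = {k. k < m \<and> y k = a} \<union> (if r = a then {m} else {})"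
      by (auto simp: less_Suc_eq)
    also have "card \<dots> = card {k. k < m \<and> y k = a} + card (if r = a then {m} else {})"
      by (rule card_Un_disjoint) auto
    finally show ?thesis by (simp add: wt_def)
  qed
  let ?R = "{r. act 1 v (C r) \<noteq> 0}"
  have "?R \<subseteq> {..<Suc m}"
  proof
    fix r assume "r \<in> ?R"
    then have "C r \<noteq> 0" by auto
    then obtain y where "C r y \<noteq> 0" by (auto simp: fun_eq_iff)
    then have "rl \<mu> r \<noteq> 0" using wtC[of r y r] by simp
    then show "r \<in> {..<Suc m}" using rl_zero[OF mu, of r] by (meson lessThan_iff not_le)
  qed
  then have fin: "finite ?R" by (rule finite_subset) simp
  have ne: "?R \<noteq> {}" using k by (auto simp: v_def)
  define r where "r = Max ?R"
  have r: "act 1 v (C r) \<noteq> 0" using Max_in[OF fin ne] by (simp add: r_def)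
  have above: "act 1 v (C b) = 0" if "r < b" for b
  proof (rule ccontr)
    assume "act 1 v (C b) \<noteq> 0"
    then have "b \<le> Max ?R" by (intro Max_ge fin) simp
    with that show False by (simp add: r_def)
  qed
  define mu' where "mu' = (rl \<mu>)(r := rl \<mu> r - 1)"
  obtain y0 where "C r y0 \<noteq> 0" using r by (metis act_T_zero zero_fun_def ext)
  then have pos: "rl \<mu> r > 0" using wtC[of r y0 r] by simp
  have HW': "HW m mu' (act 1 v (C r))"
    unfolding HW_def
  proof (intro conjI allI impI)
    have "loc m (C r)"
      unfolding loc_def C_def using T by (auto simp: HW_def intro!: locD[of "Suc m" T])
    then show "loc m (act 1 v (C r))" using v by (rule loc_act)
    have "has_wt m mu' (C r)"
      unfolding has_wt_def mu'_def using wtC[of r] by (auto simp: fun_eq_iff)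
    then show "has_wt m mu' (act 1 v (C r))" using v by (rule has_wt_act)
    fix a b :: nat assume "a < b"
    have "raising m a b (C r) = (if a = r then - C b else 0)"
    proof
      fix y
      have "raising (Suc m) a b T (y(m := r)) = 0" using T \<open>a < b\<close> by (simp add: HW_def)
      moreover have "{k. k < Suc m \<and> (y(m := r)) k = a} = {k. k < m \<and> y k = a} \<union> (if a = r then {m} else {})"
        by (auto simp: less_Suc_eq)
      ultimately have "0 = (\<Sum>k\<in>{k. k < m \<and> y k = a} \<union> (if a = r then {m} else {}). T ((y(m := r))(k := b)))"
        by (simp add: raising_def)
      also have "\<dots> = (\<Sum>k\<in>{k. k < m \<and> y k = a}. T ((y(m := r))(k := b))) + (if a = r then T (y(m := b)) else 0)"
        by (subst sum.union_disjoint) auto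
      also have "(\<Sum>k\<in>{k. k < m \<and> y k = a}. T ((y(m := r))(k := b))) = raising m a b (C r) y"
        unfolding raising_def C_def by (rule sum.cong) (auto simp: fun_upd_twist)
      finally show "raising m a b (C r) y = (if a = r then - C b else 0) y"
        by (auto simp: C_def add_eq_0_iff)
    qed
    then have *: "raising m a b (act 1 v (C r)) = act 1 v (if a = r then - C b else 0)"
      using v by (simp add: raising_act)
    show "raising m a b (act 1 v (C r)) = 0"
    proof (cases "a = r")
      case True
      then have "raising m a b (act 1 v (C r)) = - act 1 v (C b)" using * by (simp only: act_T_uminus simp_thms if_True)
      then show ?thesis using above[of b] \<open>a < b\<close> True by simp
    qed (simp only: * if_False act_T_zero)
  qed
  have vz: "zz \<kappa> * v = v" using zz_idem[OF ka] by (simp add: v_def flip: mult.assoc)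
  have uv: "u * v = v"
    using zz_commute[OF ka u(1)] u(2) by (metis mult.assoc v_def)
  have rl: "rl \<kappa> = mu'"
  proof (rule zz_HW_weight[OF ka HW', of "Suc m"])
    show "act 1 (zz \<kappa>) (act 1 v (C r)) \<noteq> 0" using r vz by (simp flip: act_mult)
    \<comment> \<open>Row r need not be a removable one at this stage, but removing a box breaks
      monotonicity by at most one.\<close>
    show "mu' (Suc j) \<le> Suc (mu' j)" for j using rl_dec[OF mu, of j "Suc j"] by (auto simp: mu'_def)
    show "mu' b = 0" if "Suc m \<le> b" for b using rl_zero[OF mu that] by (auto simp: mu'_def)
    have "r < Suc m" using rl_zero[OF mu, of r] pos by (cases "r < Suc m") auto
    have "(\<Sum>i<Suc m. rl \<mu> i) = rl \<mu> r + (\<Sum>i\<in>{..<Suc m} - {r}. rl \<mu> i)"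
      by (rule sum.remove) (use \<open>r < Suc m\<close> in auto)
    moreover have "(\<Sum>i<Suc m. mu' i) = mu' r + (\<Sum>i\<in>{..<Suc m} - {r}. mu' i)"
      by (rule sum.remove) (use \<open>r < Suc m\<close> in auto)
    moreover have "(\<Sum>i\<in>{..<Suc m} - {r}. mu' i) = (\<Sum>i\<in>{..<Suc m} - {r}. rl \<mu> i)"
      by (rule sum.cong) (auto simp: mu'_def)
    ultimately show "(\<Sum>i<Suc m. mu' i) = m" using sum_rl[OF mu, of "Suc m"] pos by (simp add: mu'_def)
  qed simp
  show ?thesis
  proof (intro bexI[OF _ ka] conjI exI)
    show "\<forall>i. rl \<kappa> i \<le> rl \<mu> i" by (simp add: rl mu'_def)
    show "HW m (rl \<kappa>) (act 1 v (C r))" using HW' rl by simp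
    show "act 1 u (act 1 v (C r)) \<noteq> 0" using r uv by (simp flip: act_mult)
  qed
qed

text \<open>Places are dropped one at a time; when k places remain, \<open>zz_HW_weight\<close>
  identifies \<nu> with the shape that has been reached.\<close>

lemma HW_restrict:
  assumes "k \<le> m" "\<nu> \<in> partitions k" "\<mu> \<in> partitions m" "HW m (rl \<mu>) T" "act 1 (zz \<nu>) T \<noteq> 0"
  shows "rl \<nu> i \<le> rl \<mu> i"
  using assms
proof (induction m arbitrary: \<mu> T i rule: dec_induct)
  case base
  have "rl \<nu> = rl \<mu>"
    by (rule zz_HW_weight[OF base(1,3,4), of k])
       (use rl_dec[OF base(2)] rl_zero[OF base(2)] sum_rl[OF base(2)] in \<open>auto intro: le_SucI\<close>)
  then show ?case by simp
next
  case (step m)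
  have "zz \<nu> \<in> CS {..<m}" using CS_mono[OF zz_CS[OF step.prems(1)], of "{..<m}"] step.hyps(1) by simp
  from branching_step[OF step.prems(2,3) this zz_idem[OF step.prems(1)] step.prems(4)]
  obtain \<kappa> T' where "\<kappa> \<in> partitions m" "\<forall>i. rl \<kappa> i \<le> rl \<mu> i" "HW m (rl \<kappa>) T'" "act 1 (zz \<nu>) T' \<noteq> 0"
    by blast
  then show ?case using step.IH[OF step.prems(1), of \<kappa> T' i] by (meson order_trans)
qed

lemma zz_mult_subset:
  assumes "k \<le> m" "\<nu> \<in> partitions k" "\<mu> \<in> partitions m" "zz \<nu> * zz \<mu> \<noteq> 0"
  shows "young \<nu> \<subseteq> young \<mu>"
proof -
  have "zz \<nu> \<in> CS {..<m}" using CS_mono[OF zz_CS[OF assms(2)], of "{..<m}"] assms(1) by simp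
  from HW_zz_exists[OF assms(3) this assms(4)] obtain T where "HW m (rl \<mu>) T" "act 1 (zz \<nu>) T \<noteq> 0" by blast
  from HW_restrict[OF assms(1-3) this] show ?thesis by (auto simp: young_rl intro: less_le_trans)
qed

lemma zz_conj_subset:
  assumes "k \<le> m" "\<nu> \<in> partitions k" "\<mu> \<in> partitions m" "g \<in> SP {..<m}"
    and "gp g * zz \<nu> * gp (- g) * zz \<mu> \<noteq> 0"
  shows "young \<nu> \<subseteq> young \<mu>"
proof (rule zz_mult_subset[OF assms(1-3)])
  have "gp g * zz \<nu> * gp (- g) * zz \<mu> = gp g * (zz \<nu> * zz \<mu>) * gp (- g)"
    using zz_commute[OF assms(3), of "gp (- g)"] assms(4) by (simp add: mult.assoc)
  then show "zz \<nu> * zz \<mu> \<noteq> 0" using assms(5) by auto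
qed

subsection \<open>Invariants of the hyperoctahedral group\<close>

text \<open>The partner in the perfect matching of the places 2 i and 2 i + 1.\<close>

definition pt :: "nat \<Rightarrow> nat" where
  "pt k = (if even k then Suc k else k - 1)"

lemma pt_pt [simp]: "pt (pt k) = k"
  by (auto simp: pt_def elim: oddE)

lemma pt_neq [simp]: "pt k \<noteq> k" "k \<noteq> pt k"
  by (auto simp: pt_def elim: oddE)

lemma pt_less [simp]: "pt k < 2 * f \<longleftrightarrow> k < 2 * f"
proof
  show "k < 2 * f \<Longrightarrow> pt k < 2 * f" for k
    by (auto simp: pt_def elim!: evenE)
  from this[of "pt k"] show "pt k < 2 * f \<Longrightarrow> k < 2 * f" by simp
qed

lemma pt_eq_iff [simp]: "pt k = pt l \<longleftrightarrow> k = l"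
  by (metis pt_pt)

text \<open>
  Induction on the number of lines \<open>{k, pt k}\<close> with different letters. A line with letters
  \<open>a < b\<close> arises by raising one letter of a line with two letters \<open>a\<close>; the other terms of this
  raising relation either have fewer such lines or equal the same value by invariance.
\<close>

lemma HW_invariant_even:
  assumes T: "HW (2 * f) mu T"
    and inv1: "\<And>x k. k < 2 * f \<Longrightarrow> T (x \<circ> ap (tr k (pt k))) = T x"
    and inv2: "\<And>x k l. k < 2 * f \<Longrightarrow> l < 2 * f \<Longrightarrow> l \<noteq> k \<Longrightarrow> l \<noteq> pt k \<Longrightarrow>
      T (x \<circ> ap (tr k l + tr (pt k) (pt l))) = T x"
    and odd: "odd (mu c)"
  shows "T x = 0"
proof (induction "card {k. k < 2 * f \<and> x k \<noteq> x (pt k)}" arbitrary: x rule: less_induct)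
  case less
  show ?case
  proof (cases "\<exists>k<2 * f. x k \<noteq> x (pt k)")
    case False
    \<comment> \<open>In such a word every letter occurs an even number of times, which the odd
      entry of the weight excludes.\<close>
    then have loop: "x (pt k) = x k" if "k < 2 * f" for k using that by metis
    show ?thesis
    proof (rule ccontr)
      assume "T x \<noteq> 0"
      then have "wt (2 * f) x = mu" using T by (auto simp: HW_def has_wt_def)
      then have m: "mu c = card {k. k < 2 * f \<and> x k = c}" by (auto simp: wt_def)
      have "{k. k < 2 * f \<and> x k = c} = {k. k < 2 * f \<and> even k \<and> x k = c} \<union> pt ` {k. k < 2 * f \<and> even k \<and> x k = c}"
      proof (intro equalityI subsetI)
        fix k assume k: "k \<in> {k. k < 2 * f \<and> x k = c}"
        show "k \<in> {k. k < 2 * f \<and> even k \<and> x k = c} \<union> pt ` {k. k < 2 * f \<and> even k \<and> x k = c}"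
        proof (cases "even k")
          case odd: False
          then have "even (pt k)" by (simp add: pt_def)
          moreover have "pt k < 2 * f" "x (pt k) = c" using k loop[of k] by simp_all
          ultimately have "pt k \<in> {k. k < 2 * f \<and> even k \<and> x k = c}" by simp
          then have "pt (pt k) \<in> pt ` {k. k < 2 * f \<and> even k \<and> x k = c}" by (rule imageI)
          then show ?thesis by simp
        qed (use k in auto)
      next
        fix k assume "k \<in> {k. k < 2 * f \<and> even k \<and> x k = c} \<union> pt ` {k. k < 2 * f \<and> even k \<and> x k = c}"
        then show "k \<in> {k. k < 2 * f \<and> x k = c}" using loop by auto
      qed
      moreover have "card ({k. k < 2 * f \<and> even k \<and> x k = c} \<union> pt ` {k. k < 2 * f \<and> even k \<and> x k = c}) =
          card {k. k < 2 * f \<and> even k \<and> x k = c} + card (pt ` {k. k < 2 * f \<and> even k \<and> x k = c})"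
        by (rule card_Un_disjoint) (auto simp: pt_def)
      moreover have "card (pt ` {k. k < 2 * f \<and> even k \<and> x k = c}) = card {k. k < 2 * f \<and> even k \<and> x k = c}"
        by (rule card_image) (auto simp: inj_on_def)
      ultimately show False using odd m by simp
    qed
  next
    case True
    then obtain k1 where "k1 < 2 * f" "x k1 \<noteq> x (pt k1)" by blast
    then have "x k1 < x (pt k1) \<or> x (pt k1) < x (pt (pt k1))" "pt k1 < 2 * f" by auto
    with \<open>k1 < 2 * f\<close> have "\<exists>k<2 * f. x k < x (pt k)" by blast
    then obtain k where k: "k < 2 * f" "x k < x (pt k)" by blast
    let ?a = "x k" and ?b = "x (pt k)"
    let ?y = "x(pt k := ?a)"
    let ?S = "{j. j < 2 * f \<and> ?y j = ?a}"
    have rel: "(\<Sum>j\<in>?S. T (?y(j := ?b))) = 0"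
    proof -
      have "raising (2 * f) ?a ?b T ?y = 0" using T k(2) by (simp add: HW_def)
      then show ?thesis by (simp add: raising_def)
    qed
    have terms: "T (?y(j := ?b)) = T x \<or> T (?y(j := ?b)) = 0 \<and> j \<noteq> pt k" if j: "j \<in> ?S" for j
    proof -
      consider "j = pt k" | "j = k" | "j \<noteq> k" "j \<noteq> pt k" "x (pt j) = ?a" | "j \<noteq> k" "j \<noteq> pt k" "x (pt j) \<noteq> ?a"
        by blast
      then show ?thesis
      proof cases
        case 1 then show ?thesis by simp
      next
        case 2
        then have "?y(j := ?b) = x \<circ> ap (tr k (pt k))" by (auto simp: fun_eq_iff ap_tr transpose_def)
        then show ?thesis using inv1[OF k(1), of x] by simp
      next
        case 3
        have "pt j \<noteq> k" "pt j \<noteq> pt k" "j \<noteq> pt j" using 3(1,2) by auto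
        then have "?y(j := ?b) = x \<circ> ap (tr j (pt k) + tr (pt j) (pt (pt k)))"
          using 3 j by (auto simp: fun_eq_iff ap_tr transpose_def)
        moreover have "j < 2 * f" "pt k < 2 * f" using j k by auto
        ultimately show ?thesis using inv2[of j "pt k" x] 3 by (metis pt_pt)
      next
        case 4
        let ?z = "?y(j := ?b)"
        have jk: "pt j \<noteq> k" "pt j \<noteq> pt k" using 4(1,2) by auto
        have "{i. i < 2 * f \<and> ?z i \<noteq> ?z (pt i)} \<subset> {i. i < 2 * f \<and> x i \<noteq> x (pt i)}"
        proof (rule psubsetI)
          show "{i. i < 2 * f \<and> ?z i \<noteq> ?z (pt i)} \<subseteq> {i. i < 2 * f \<and> x i \<noteq> x (pt i)}"
          proof
            fix i assume i: "i \<in> {i. i < 2 * f \<and> ?z i \<noteq> ?z (pt i)}"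
            have "i \<noteq> k" "i \<noteq> pt k" using i 4 jk by (auto split: if_splits)
            moreover from this have "pt i \<noteq> k" "pt i \<noteq> pt k" by auto
            moreover have "x i \<noteq> x (pt i)" if "i = j \<or> i = pt j"
              using that 4 j by auto
            moreover have "pt i = j \<Longrightarrow> i = pt j" by auto
            ultimately show "i \<in> {i. i < 2 * f \<and> x i \<noteq> x (pt i)}"
              using i by (cases "i = j \<or> i = pt j") (auto split: if_splits)
          qed
          have "k \<in> {i. i < 2 * f \<and> x i \<noteq> x (pt i)}" using k by auto
          moreover have "k \<notin> {i. i < 2 * f \<and> ?z i \<noteq> ?z (pt i)}" using 4 by auto
          ultimately show "{i. i < 2 * f \<and> ?z i \<noteq> ?z (pt i)} \<noteq> {i. i < 2 * f \<and> x i \<noteq> x (pt i)}" by blast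
        qed
        then have "card {i. i < 2 * f \<and> ?z i \<noteq> ?z (pt i)} < card {i. i < 2 * f \<and> x i \<noteq> x (pt i)}"
          by (intro psubset_card_mono) auto
        then have "T ?z = 0" by (rule less)
        then show ?thesis using 4 by simp
      qed
    qed
    \<comment> \<open>The place \<open>pt k\<close> belongs to Q, so the raising relation becomes a
      positive multiple of T x.\<close>
    define Q where "Q = {j \<in> ?S. T (?y(j := ?b)) = T x}"
    have "(\<Sum>j\<in>?S. T (?y(j := ?b))) = (\<Sum>j\<in>?S. if T (?y(j := ?b)) = T x then T x else 0)"
      by (rule sum.cong) (use terms in auto)
    also have "\<dots> = of_nat (card Q) * T x"
      unfolding Q_def by (simp add: sum.If_cases Int_def)
    finally have "of_nat (card Q) * T x = 0" using rel by simp
    moreover have "finite Q" "pt k \<in> Q" unfolding Q_def using k by simp_all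
    then have "card Q \<noteq> 0" by auto
    ultimately show ?thesis by simp
  qed
qed

lemma even_partition_rl: "even_partition \<mu> \<longleftrightarrow> (\<forall>i. even (rl \<mu> i))"
  unfolding even_partition_def rl_def by (auto simp: all_set_conv_all_nth)

text \<open>Averaging a highest weight vector over H makes it invariant. H is any group containing
  the generators of the hyperoctahedral group, because the application takes all permutations that
  fix every paired tensor.\<close>

lemma invariant_zz_even:
  assumes nu: "\<nu> \<in> partitions (2 * f)" and H: "H \<subseteq> SP {..<2 * f}"
    and H1: "\<And>k. k < 2 * f \<Longrightarrow> tr k (pt k) \<in> H"
    and H2: "\<And>k l. k < 2 * f \<Longrightarrow> l < 2 * f \<Longrightarrow> l \<noteq> k \<Longrightarrow> l \<noteq> pt k \<Longrightarrow> tr k l + tr (pt k) (pt l) \<in> H"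
    and Hplus: "\<And>p q. p \<in> H \<Longrightarrow> q \<in> H \<Longrightarrow> p + q \<in> H" and Hminus: "\<And>p. p \<in> H \<Longrightarrow> - p \<in> H"
    and nz: "(\<Sum>h\<in>H. gp h) * zz \<nu> \<noteq> 0"
  shows "even_partition \<nu>"
proof (rule ccontr)
  assume "\<not> even_partition \<nu>"
  then obtain c where c: "odd (rl \<nu> c)" by (auto simp: even_partition_rl)
  have eH: "(\<Sum>h\<in>H. gp h) \<in> CS {..<2 * f}" using H by (intro CS_sum) auto
  from HW_zz_exists[OF nu this nz] obtain T where T: "HW (2 * f) (rl \<nu>) T" "act 1 (\<Sum>h\<in>H. gp h) T \<noteq> 0"
    by blast
  let ?T = "act 1 (\<Sum>h\<in>H. gp h) T"
  have inv: "?T (x \<circ> ap p) = ?T x" if p: "p \<in> H" for p x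
  proof -
    have "gp p * (\<Sum>h\<in>H. gp h) = (\<Sum>h\<in>H. gp (p + h))" by (simp add: sum_distrib_left gp_mult)
    also have "\<dots> = (\<Sum>h\<in>H. gp h)"
      by (rule sum.reindex_bij_witness[of _ "\<lambda>h. - p + h" "\<lambda>h. p + h"])
         (use p in \<open>auto simp: Hplus Hminus simp flip: add.assoc\<close>)
    finally have "act 1 (gp p) ?T = ?T" by (simp flip: act_mult)
    then show ?thesis by (metis act_gp mult_1 sg_one)
  qed
  have "?T x = 0" for x
  proof (rule HW_invariant_even[OF HW_act[OF T(1) eH] _ _ c])
    show "?T (x \<circ> ap (tr k (pt k))) = ?T x" if "k < 2 * f" for x k
      by (rule inv, rule H1, rule that)
    show "?T (x \<circ> ap (tr k l + tr (pt k) (pt l))) = ?T x"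
      if "k < 2 * f" "l < 2 * f" "l \<noteq> k" "l \<noteq> pt k" for x k l
      by (rule inv, rule H2) (fact that)+
  qed
  then show False using T(2) by (auto simp: fun_eq_iff)
qed

lemma content_cas:
  assumes "\<mu> \<in> partitions n" "n \<le> M" shows "2 * content \<mu> = cas M (rl \<mu>)"
proof -
  have inner: "2 * (\<Sum>j<m. int j - int i) = int m * (int m - 1 - 2 * int i)" for m i
    by (induction m) (auto simp: algebra_simps)
  have "young \<mu> = Sigma {..<M} (\<lambda>i. {..<rl \<mu> i})"
  proof -
    have "i < M" if "j < rl \<mu> i" for i j
      using rl_zero[OF assms(1), of i] assms(2) that by (cases "i < M") auto
    then show ?thesis by (auto simp: young_rl)
  qed
  then have "2 * content \<mu> = 2 * (\<Sum>i<M. \<Sum>j<rl \<mu> i. int j - int i)"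
    by (simp add: content_def sum.Sigma)
  also have "\<dots> = cas M (rl \<mu>)" unfolding sum_distrib_left[of 2 _ "{..<M}"] cas_def by (simp only: inner)
  finally show ?thesis .
qed

lemma Tr2_zz_content:
  assumes "\<mu> \<in> partitions n" shows "Tr2 {..<n} * zz \<mu> = sc (of_int (2 * content \<mu>)) * zz \<mu>"
  using Tr2_zz[OF assms order_refl] content_cas[OF assms order_refl] by simp


section \<open>Products of diagrams\<close>

lemma finite_diagrams [simp]: "finite (diagrams n)"
proof (rule finite_subset)
  show "diagrams n \<subseteq> Pow (Pow ({0, 1} \<times> {..<n}))"
  proof
    fix b assume "b \<in> diagrams n"
    then have "{0, 1} \<times> {..<n} = \<Union> b" unfolding diagrams_def using partition_onD1 by blast
    then show "b \<in> Pow (Pow ({0, 1} \<times> {..<n}))" by (metis PowI Sup_upper subsetI)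
  qed
qed simp

definition line_of :: "diagram \<Rightarrow> node \<Rightarrow> node set" where
  "line_of b x = (THE l. l \<in> b \<and> x \<in> l)"

lemma diagram_line:
  assumes "b \<in> diagrams n" "x \<in> {0, 1} \<times> {..<n}"
  shows "line_of b x \<in> b" "x \<in> line_of b x" "l \<in> b \<Longrightarrow> x \<in> l \<Longrightarrow> line_of b x = l"
proof -
  have p: "partition_on ({0, 1} \<times> {..<n}) b" using assms(1) by (simp add: diagrams_def)
  obtain l0 where l0: "l0 \<in> b" "x \<in> l0" using assms(2) partition_onD1[OF p] by auto
  have uniq: "l = l0" if "l \<in> b" "x \<in> l" for l
    using partition_onD2[OF p] that l0 by (auto simp: disjoint_def)
  have "line_of b x = l0" unfolding line_of_def using l0 uniq by (intro the_equality) blast+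
  then show "line_of b x \<in> b" "x \<in> line_of b x" "l \<in> b \<Longrightarrow> x \<in> l \<Longrightarrow> line_of b x = l"
    using l0 uniq[of l] by simp_all
qed

lemma diagram_nodes: "b \<in> diagrams n \<Longrightarrow> l \<in> b \<Longrightarrow> x \<in> l \<Longrightarrow> x \<in> {0, 1} \<times> {..<n}"
  using partition_onD1[of "{0, 1} \<times> {..<n}" b] unfolding diagrams_def by blast

lemma diagram_partner:
  assumes "b \<in> diagrams n" "x \<in> {0, 1} \<times> {..<n}"
  obtains y where "y \<noteq> x" "y \<in> {0, 1} \<times> {..<n}" "line_of b x = {x, y}"
proof -
  note l = diagram_line[OF assms]
  have "card (line_of b x) = 2" using assms(1) l(1) by (simp add: diagrams_def)
  then obtain u v where uv: "line_of b x = {u, v}" "u \<noteq> v" by (auto simp: card_2_iff)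
  have "\<exists>y. y \<noteq> x \<and> line_of b x = {x, y}"
  proof (cases "u = x")
    case True with uv show ?thesis by (intro exI[of _ v]) auto
  next
    case False with uv l(2) show ?thesis by (intro exI[of _ u]) auto
  qed
  then show ?thesis using that diagram_nodes[OF assms(1) l(1)] by blast
qed

lemma line_of_eq_iff:
  assumes "b \<in> diagrams n" "x \<in> {0, 1} \<times> {..<n}" "y \<in> {0, 1} \<times> {..<n}"
  shows "line_of b x = line_of b y \<longleftrightarrow> y \<in> line_of b x"
  using diagram_line[OF assms(1,2)] diagram_line[OF assms(1,3)] by metis

text \<open>Diagrams are recognised through labellings of the nodes in which every label occurs
  exactly twice.\<close>

lemma pairs_partition:
  assumes ex1: "\<And>x. x \<in> N \<Longrightarrow> \<exists>!y. y \<in> N \<and> y \<noteq> x \<and> L x = L y"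
  shows "partition_on N {{x, y} |x y. x \<in> N \<and> y \<in> N \<and> x \<noteq> y \<and> L x = L y}" (is "partition_on N ?b")
proof (rule partition_onI)
  show "\<Union> ?b = N"
  proof
    show "N \<subseteq> \<Union> ?b"
    proof
      fix x assume x: "x \<in> N"
      then obtain y where "y \<in> N" "y \<noteq> x" "L x = L y" using ex1[OF x] by blast
      then have "{x, y} \<in> ?b" using x by blast
      then show "x \<in> \<Union> ?b" by blast
    qed
  qed blast
next
  fix p q assume pq: "p \<in> ?b" "q \<in> ?b" "p \<noteq> q"
  have mem: "l = {u, v}" if l: "l \<in> ?b" "u \<in> l" and v: "v \<in> N" "v \<noteq> u" "L u = L v" for l u v
  proof -
    obtain x y where xy: "l = {x, y}" "x \<in> N" "y \<in> N" "x \<noteq> y" "L x = L y" using l(1) by blast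
    then consider "u = x" | "u = y" using l(2) by blast
    then show ?thesis
    proof cases
      case 1
      then have "v = y" using ex1[OF xy(2)] xy v by blast
      then show ?thesis using 1 xy by simp
    next
      case 2
      then have "v = x" using ex1[OF xy(3)] xy v by metis
      then show ?thesis using 2 xy by auto
    qed
  qed
  show "disjnt p q"
  proof (rule ccontr)
    assume "\<not> disjnt p q"
    then obtain u where u: "u \<in> p" "u \<in> q" by (auto simp: disjnt_def)
    then have "u \<in> N" using pq(1) by blast
    then obtain v where v: "v \<in> N" "v \<noteq> u" "L u = L v" using ex1[of u] by blast
    have "p = {u, v}" "q = {u, v}" using mem[OF pq(1) u(1) v] mem[OF pq(2) u(2) v] .
    with pq(3) show False by simp
  qed
qed blast

lemma diagramI:
  assumes "\<And>x. x \<in> {0, 1} \<times> {..<n} \<Longrightarrow> \<exists>!y. y \<in> {0, 1} \<times> {..<n} \<and> y \<noteq> x \<and> L x = L y"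
  shows "{{x, y} |x y. x \<in> {0, 1} \<times> {..<n} \<and> y \<in> {0, 1} \<times> {..<n} \<and> x \<noteq> y \<and> L x = L y} \<in> diagrams n"
  unfolding diagrams_def using pairs_partition[of "{0, 1} \<times> {..<n}" L, OF assms] by (auto simp: card_2_iff)

lemma connected_same_label:
  assumes lab: "\<And>l x y. l \<in> stack b1 b2 \<Longrightarrow> x \<in> l \<Longrightarrow> y \<in> l \<Longrightarrow> lab x = lab y"
    and "(x, y) \<in> connected_nodes b1 b2"
  shows "lab x = lab y"
  using assms(2) unfolding connected_nodes_def
proof (induction rule: rtrancl_induct)
  case (step y z)
  then obtain l where l: "l \<in> stack b1 b2" "y \<in> l" "z \<in> l" by blast
  then show ?case using step.IH lab[OF l] by simp
qed simp

lemma connected_line: "l \<in> stack b1 b2 \<Longrightarrow> x \<in> l \<Longrightarrow> y \<in> l \<Longrightarrow> (x, y) \<in> connected_nodes b1 b2"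
  unfolding connected_nodes_def by (rule r_into_rtrancl) blast

lemma connected_refl: "(x, x) \<in> connected_nodes b1 b2"
  unfolding connected_nodes_def by simp

lemma connected_trans: "(x, y) \<in> connected_nodes b1 b2 \<Longrightarrow> (y, z) \<in> connected_nodes b1 b2 \<Longrightarrow>
    (x, z) \<in> connected_nodes b1 b2"
  unfolding connected_nodes_def by (rule rtrancl_trans)

lemma connected_sym: "(x, y) \<in> connected_nodes b1 b2 \<Longrightarrow> (y, x) \<in> connected_nodes b1 b2"
proof -
  have "sym (connected_nodes b1 b2)"
    unfolding connected_nodes_def by (rule sym_rtrancl) (auto simp: sym_def)
  then show "(x, y) \<in> connected_nodes b1 b2 \<Longrightarrow> (y, x) \<in> connected_nodes b1 b2"
    by (rule symD)
qed

definition dbl :: "node \<Rightarrow> node" where "dbl x = (2 * fst x, snd x)"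

text \<open>Instead of tracing paths through the stack, one exhibits a labelling that is constant on
  lines and separates the components meeting the outer rows.\<close>

lemma compose_label:
  assumes lab: "\<And>l x y. l \<in> stack b1 b2 \<Longrightarrow> x \<in> l \<Longrightarrow> y \<in> l \<Longrightarrow> lab x = lab y"
    and conn: "\<And>x y. x \<in> {0, 1} \<times> {..<n} \<Longrightarrow> y \<in> {0, 1} \<times> {..<n} \<Longrightarrow> lab (dbl x) = lab (dbl y) \<Longrightarrow>
      (dbl x, dbl y) \<in> connected_nodes b1 b2"
  shows "compose_diagrams n b1 b2 = {{x, y} |x y. x \<in> {0, 1} \<times> {..<n} \<and> y \<in> {0, 1} \<times> {..<n} \<and> x \<noteq> y \<and>
    lab (dbl x) = lab (dbl y)}"
proof -
  have same: "lab x = lab y" if "(x, y) \<in> connected_nodes b1 b2" for x y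
    using _ that by (rule connected_same_label) (rule lab)
  show ?thesis
  proof (intro equalityI subsetI)
    fix l assume "l \<in> compose_diagrams n b1 b2"
    then obtain r i r' j where "l = {(r, i), (r', j)}" "(r, i) \<in> {0, 1} \<times> {..<n}" "(r', j) \<in> {0, 1} \<times> {..<n}"
      "(r, i) \<noteq> (r', j)" "((2 * r, i), (2 * r', j)) \<in> connected_nodes b1 b2"
      unfolding compose_diagrams_def by blast
    then show "l \<in> {{x, y} |x y. x \<in> {0, 1} \<times> {..<n} \<and> y \<in> {0, 1} \<times> {..<n} \<and> x \<noteq> y \<and> lab (dbl x) = lab (dbl y)}"
      using same[of "(2 * r, i)" "(2 * r', j)"]
      by (intro CollectI exI[of _ "(r, i)"] exI[of _ "(r', j)"] conjI) (simp_all add: dbl_def)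
  next
    fix l assume "l \<in> {{x, y} |x y. x \<in> {0, 1} \<times> {..<n} \<and> y \<in> {0, 1} \<times> {..<n} \<and> x \<noteq> y \<and> lab (dbl x) = lab (dbl y)}"
    then obtain x y where xy: "l = {x, y}" "x \<in> {0, 1} \<times> {..<n}" "y \<in> {0, 1} \<times> {..<n}" "x \<noteq> y"
      "lab (dbl x) = lab (dbl y)" by blast
    from conn[OF xy(2,3,5)] xy show "l \<in> compose_diagrams n b1 b2"
      unfolding compose_diagrams_def
      by (intro CollectI exI[of _ "fst x"] exI[of _ "snd x"] exI[of _ "fst y"] exI[of _ "snd y"] conjI)
         (simp_all add: dbl_def)
  qed
qed

lemma line_pairs:
  assumes "b \<in> diagrams n"
  shows "{{x, y} |x y. x \<in> {0, 1} \<times> {..<n} \<and> y \<in> {0, 1} \<times> {..<n} \<and> x \<noteq> y \<and> line_of b x = line_of b y} = b"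
proof (intro equalityI subsetI)
  fix l assume "l \<in> {{x, y} |x y. x \<in> {0, 1} \<times> {..<n} \<and> y \<in> {0, 1} \<times> {..<n} \<and> x \<noteq> y \<and> line_of b x = line_of b y}"
  then obtain x y where xy: "l = {x, y}" "x \<in> {0, 1} \<times> {..<n}" "y \<in> {0, 1} \<times> {..<n}" "x \<noteq> y"
    "line_of b x = line_of b y" by blast
  obtain z where "line_of b x = {x, z}" using diagram_partner[OF assms xy(2)] by metis
  moreover have "y \<in> line_of b x" using xy line_of_eq_iff[OF assms xy(2,3)] by simp
  ultimately have "line_of b x = l" using xy by auto
  then show "l \<in> b" using diagram_line(1)[OF assms xy(2)] by simp
next
  fix l assume l: "l \<in> b"
  then have "card l = 2" using assms by (simp add: diagrams_def)
  then obtain x y where xy: "l = {x, y}" "x \<noteq> y" by (auto simp: card_2_iff)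
  have n: "x \<in> {0, 1} \<times> {..<n}" "y \<in> {0, 1} \<times> {..<n}" using diagram_nodes[OF assms l] xy by auto
  have "line_of b x = l" "line_of b y = l" using diagram_line(3)[OF assms _ l] n xy by auto
  then show "l \<in> {{x, y} |x y. x \<in> {0, 1} \<times> {..<n} \<and> y \<in> {0, 1} \<times> {..<n} \<and> x \<noteq> y \<and> line_of b x = line_of b y}"
    using xy n by blast
qed

section \<open>Composition with permutation diagrams as relabelling of a row\<close>

definition relabel :: "(nat \<Rightarrow> nat) \<Rightarrow> (nat \<Rightarrow> nat) \<Rightarrow> node \<Rightarrow> node" where
  "relabel p q x = (fst x, if fst x = 0 then p (snd x) else q (snd x))"

lemma relabel_bij:
  assumes "p permutes {..<n}" "q permutes {..<n}"
  shows "relabel p q x \<in> {0, 1} \<times> {..<n} \<longleftrightarrow> x \<in> {0, 1} \<times> {..<n}"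
    "relabel p q (relabel (inv_into UNIV p) (inv_into UNIV q) x) = x"
    "relabel (inv_into UNIV p) (inv_into UNIV q) (relabel p q x) = x"
  using permutes_in_image[OF assms(1), of "snd x"] permutes_in_image[OF assms(2), of "snd x"]
    permutes_inverses[OF assms(1)] permutes_inverses[OF assms(2)]
  by (cases x; auto simp: relabel_def)+

lemma relabel_lines:
  assumes b: "b \<in> diagrams n" and p: "p permutes {..<n}" and q: "q permutes {..<n}"
  shows "{{x, y} |x y. x \<in> {0, 1} \<times> {..<n} \<and> y \<in> {0, 1} \<times> {..<n} \<and> x \<noteq> y \<and>
      line_of b (relabel (inv_into UNIV p) (inv_into UNIV q) x) = line_of b (relabel (inv_into UNIV p) (inv_into UNIV q) y)} =
    (\<lambda>l. relabel p q ` l) ` b" (is "?L = ?R")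
proof -
  let ?h = "relabel p q" and ?h' = "relabel (inv_into UNIV p) (inv_into UNIV q)"
  note h = relabel_bij[OF p q]
  have h': "?h' x \<in> {0, 1} \<times> {..<n} \<longleftrightarrow> x \<in> {0, 1} \<times> {..<n}" for x
    using h(1)[of "?h' x"] h(2)[of x] by simp
  have "?L = {?h ` {x, y} |x y. x \<in> {0, 1} \<times> {..<n} \<and> y \<in> {0, 1} \<times> {..<n} \<and> x \<noteq> y \<and> line_of b x = line_of b y}"
  proof (intro equalityI subsetI)
    fix l assume "l \<in> ?L"
    then obtain x y where xy: "l = {x, y}" "x \<in> {0, 1} \<times> {..<n}" "y \<in> {0, 1} \<times> {..<n}" "x \<noteq> y"
      "line_of b (?h' x) = line_of b (?h' y)" by blast
    then have "l = ?h ` {?h' x, ?h' y}" using h by simp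
    moreover have "?h' x \<noteq> ?h' y" using xy(4) h(2) by metis
    ultimately show "l \<in> {?h ` {x, y} |x y. x \<in> {0, 1} \<times> {..<n} \<and> y \<in> {0, 1} \<times> {..<n} \<and> x \<noteq> y \<and> line_of b x = line_of b y}"
      using xy(2,3,5) h' by (intro CollectI exI[of _ "?h' x"] exI[of _ "?h' y"] conjI) simp_all
  next
    fix l assume "l \<in> {?h ` {x, y} |x y. x \<in> {0, 1} \<times> {..<n} \<and> y \<in> {0, 1} \<times> {..<n} \<and> x \<noteq> y \<and> line_of b x = line_of b y}"
    then obtain x y where xy: "l = ?h ` {x, y}" "x \<in> {0, 1} \<times> {..<n}" "y \<in> {0, 1} \<times> {..<n}" "x \<noteq> y"
      "line_of b x = line_of b y" by blast
    have "l = {?h x, ?h y}" "?h x \<noteq> ?h y" "line_of b (?h' (?h x)) = line_of b (?h' (?h y))"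
    proof -
      show "?h x \<noteq> ?h y" using xy(4) h(3) by metis
    qed (use xy(1,5) h(3) in simp_all)
    then show "l \<in> ?L"
      using xy(2,3) h(1) by (intro CollectI exI[of _ "?h x"] exI[of _ "?h y"] conjI) simp_all
  qed
  also have "\<dots> = (\<lambda>l. ?h ` l) ` {{x, y} |x y. x \<in> {0, 1} \<times> {..<n} \<and> y \<in> {0, 1} \<times> {..<n} \<and> x \<noteq> y \<and> line_of b x = line_of b y}"
    by blast
  finally show ?thesis unfolding line_pairs[OF b] .
qed

lemma relabel_diagram:
  assumes b: "b \<in> diagrams n" and p: "p permutes {..<n}" and q: "q permutes {..<n}"
  shows "(\<lambda>l. relabel p q ` l) ` b \<in> diagrams n"
  unfolding relabel_lines[OF assms, symmetric]
proof (rule diagramI)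
  let ?h = "relabel p q" and ?h' = "relabel (inv_into UNIV p) (inv_into UNIV q)"
  note h = relabel_bij[OF p q]
  have h': "?h' x \<in> {0, 1} \<times> {..<n} \<longleftrightarrow> x \<in> {0, 1} \<times> {..<n}" for x
    using h(1)[of "?h' x"] h(2)[of x] by simp
  fix x :: node assume x: "x \<in> {0, 1} \<times> {..<n}"
  obtain y where y: "y \<noteq> ?h' x" "y \<in> {0, 1} \<times> {..<n}" "line_of b (?h' x) = {?h' x, y}"
    using diagram_partner[OF b] x h' by metis
  show "\<exists>!y. y \<in> {0, 1} \<times> {..<n} \<and> y \<noteq> x \<and> line_of b (?h' x) = line_of b (?h' y)"
  proof (rule ex1I[of _ "?h y"])
    have "y \<in> line_of b (?h' x)" using y(3) by simp
    then have "line_of b (?h' x) = line_of b y" using line_of_eq_iff[OF b, of "?h' x" y] x y(2) h' by blast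
    moreover have "?h y \<noteq> x" using y(1) h(3) by metis
    ultimately show "?h y \<in> {0, 1} \<times> {..<n} \<and> ?h y \<noteq> x \<and> line_of b (?h' x) = line_of b (?h' (?h y))"
      using y(2) by (simp only: h simp_thms)
    fix v assume v: "v \<in> {0, 1} \<times> {..<n} \<and> v \<noteq> x \<and> line_of b (?h' x) = line_of b (?h' v)"
    then have "?h' v \<in> line_of b (?h' x)" using line_of_eq_iff[OF b, of "?h' x" "?h' v"] h' x by blast
    moreover have "?h' v \<noteq> ?h' x" using v h(2) by metis
    ultimately have "?h' v = y" using y(3) by blast
    then show "v = ?h y" using h(2) by metis
  qed
qed

lemma compose_perm_left:
  assumes b: "b \<in> diagrams n" and p: "p permutes {..<n}"
  shows "compose_diagrams n (perm_diagram n p) b = (\<lambda>l. relabel p id ` l) ` b"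
    and "closed_loops n (perm_diagram n p) b = 0"
proof -
  let ?b1 = "perm_diagram n p" and ?p' = "inv_into UNIV p"
  \<comment> \<open>The label is the line of b in the component of the node: the lower outer row
    reaches b through the permutation, the other two rows belong to b after a shift by one.\<close>
  define lab where "lab x = line_of b (if fst x = 0 then (0, ?p' (snd x)) else (fst x - 1, snd x))" for x :: node
  note p' = permutes_inverses[OF p]
  have pin: "?p' i < n \<longleftrightarrow> i < n" for i using permutes_in_image[OF permutes_inv[OF p], of i] by simp
  note hin = relabel_bij(1)[OF permutes_inv[OF p] permutes_inv[OF permutes_id]]
  have vert: "((0, i), (1, ?p' i)) \<in> connected_nodes ?b1 b" if "i < n" for i
  proof (rule connected_line)
    have "{(1, ?p' i), (0, p (?p' i))} \<in> perm_diagram n p" unfolding perm_diagram_def using pin[of i] that by blast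
    then show "{(1, ?p' i), (0, i)} \<in> stack ?b1 b" using p' by (simp add: stack_def)
  qed auto
  have lab: "lab x = lab y" if "l \<in> stack ?b1 b" "x \<in> l" "y \<in> l" for l x y
  proof -
    from that(1) consider "l \<in> ?b1" | l' where "l' \<in> b" "l = (\<lambda>(r, i). (Suc r, i)) ` l'"
      unfolding stack_def by blast
    then show ?thesis
    proof cases
      case 1
      then obtain k where k: "k < n" "l = {(1, k), (0, p k)}" unfolding perm_diagram_def by blast
      then show ?thesis using that p' by (auto simp: lab_def)
    next
      case 2
      have "lab u = l'" if u: "u \<in> l" for u
      proof -
        obtain v where v: "v \<in> l'" "u = (Suc (fst v), snd v)"
          using u unfolding 2(2) by (auto simp: case_prod_unfold)
        then have "lab u = line_of b v" by (simp add: lab_def)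
        then show ?thesis using diagram_line(3)[OF b _ 2(1) v(1)] diagram_nodes[OF b 2(1) v(1)] by simp
      qed
      then show ?thesis using that by simp
    qed
  qed
  have lab_dbl: "lab (dbl x) = line_of b (relabel ?p' (inv_into UNIV id) x)" if "x \<in> {0, 1} \<times> {..<n}" for x
    using that by (auto simp: lab_def dbl_def relabel_def)
  have toline: "(dbl x, (Suc (fst z), snd z)) \<in> connected_nodes ?b1 b"
    if x: "x \<in> {0, 1} \<times> {..<n}" and z: "z \<in> lab (dbl x)" for x z
  proof -
    let ?w = "relabel ?p' (inv_into UNIV id) x"
    have w: "?w \<in> {0, 1} \<times> {..<n}" using x hin by blast
    have "(dbl x, (Suc (fst ?w), snd ?w)) \<in> connected_nodes ?b1 b"
      using x vert[of "snd x"] by (auto simp: relabel_def dbl_def connected_refl numeral_2_eq_2)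
    moreover have "((Suc (fst ?w), snd ?w), (Suc (fst z), snd z)) \<in> connected_nodes ?b1 b"
    proof (rule connected_line)
      show "(\<lambda>(r, i). (Suc r, i)) ` line_of b ?w \<in> stack ?b1 b"
        using diagram_line(1)[OF b w] by (simp add: stack_def)
      show "(Suc (fst ?w), snd ?w) \<in> (\<lambda>(r, i). (Suc r, i)) ` line_of b ?w"
        using diagram_line(2)[OF b w] by (intro image_eqI[of _ _ ?w]) (auto simp: case_prod_unfold)
      show "(Suc (fst z), snd z) \<in> (\<lambda>(r, i). (Suc r, i)) ` line_of b ?w"
        using z lab_dbl[OF x] by (intro image_eqI[of _ _ z]) (auto simp: case_prod_unfold)
    qed
    ultimately show ?thesis by (rule connected_trans)
  qed
  have conn: "(dbl x, dbl y) \<in> connected_nodes ?b1 b"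
    if xy: "x \<in> {0, 1} \<times> {..<n}" "y \<in> {0, 1} \<times> {..<n}" "lab (dbl x) = lab (dbl y)" for x y
  proof -
    have "relabel ?p' (inv_into UNIV id) x \<in> {0, 1} \<times> {..<n}" using xy(1) hin by blast
    then obtain z where "z \<in> lab (dbl x)" using diagram_line(2)[OF b] lab_dbl[OF xy(1)] by metis
    then show ?thesis using toline[OF xy(1), of z] toline[OF xy(2), of z] xy(3)
      by (metis connected_sym connected_trans)
  qed
  have "compose_diagrams n ?b1 b = {{x, y} |x y. x \<in> {0, 1} \<times> {..<n} \<and> y \<in> {0, 1} \<times> {..<n} \<and> x \<noteq> y \<and>
      lab (dbl x) = lab (dbl y)}"
    using lab conn by (rule compose_label)
  also have "\<dots> = {{x, y} |x y. x \<in> {0, 1} \<times> {..<n} \<and> y \<in> {0, 1} \<times> {..<n} \<and> x \<noteq> y \<and>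
      line_of b (relabel ?p' (inv_into UNIV id) x) = line_of b (relabel ?p' (inv_into UNIV id) y)}"
    by (intro Collect_cong ex_cong1 conj_cong refl) (simp_all only: lab_dbl)
  finally show "compose_diagrams n ?b1 b = (\<lambda>l. relabel p id ` l) ` b"
    by (simp only: relabel_lines[OF b p permutes_id])
  \<comment> \<open>Every middle node is joined to the lower outer row, so no component is a closed
    loop.\<close>
  have "False" if C: "C \<in> ({1} \<times> {..<n}) // connected_nodes ?b1 b" "C \<subseteq> {1} \<times> {..<n}" for C
  proof -
    obtain k where k: "k < n" "C = connected_nodes ?b1 b `` {(1, k)}" using C(1) by (auto simp: quotient_def)
    have "p k < n" using k(1) permutes_in_image[OF p, of k] by simp
    from connected_sym[OF vert[OF this]] have "(0, p k) \<in> C" using k(2) p' by auto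
    with C(2) show False by auto
  qed
  then have "{C \<in> ({1} \<times> {..<n}) // connected_nodes ?b1 b. C \<subseteq> {1} \<times> {..<n}} = {}" by blast
  then show "closed_loops n ?b1 b = 0" by (simp add: closed_loops_def)
qed

lemma compose_perm_right:
  assumes b: "b \<in> diagrams n" and p: "p permutes {..<n}"
  shows "compose_diagrams n b (perm_diagram n p) = (\<lambda>l. relabel id (inv_into UNIV p) ` l) ` b"
    and "closed_loops n b (perm_diagram n p) = 0"
proof -
  let ?b2 = "perm_diagram n p" and ?p' = "inv_into UNIV p"
  \<comment> \<open>Here b occupies rows 0 and 1 unshifted, and row 2 reaches it through the
    permutation.\<close>
  define lab where "lab x = line_of b (if fst x = 2 then (1, p (snd x)) else x)" for x :: node
  note p' = permutes_inverses[OF p]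
  have pp: "inv_into UNIV ?p' = p" using permutes_inv_inv[OF p] .
  have pin: "p i < n \<longleftrightarrow> i < n" for i using permutes_in_image[OF p, of i] by simp
  note hin = relabel_bij(1)[OF permutes_inv[OF permutes_id] permutes_inv[OF permutes_inv[OF p]]]
  have vert: "((2, i), (1, p i)) \<in> connected_nodes b ?b2" if "i < n" for i
  proof (rule connected_line)
    have "{(1, i), (0, p i)} \<in> perm_diagram n p" unfolding perm_diagram_def using that by blast
    then have "(\<lambda>(r, i). (Suc r, i)) ` {(1, i), (0, p i)} \<in> stack b ?b2" unfolding stack_def by blast
    then show "{(2, i), (1, p i)} \<in> stack b ?b2" by (simp add: numeral_2_eq_2)
  qed auto
  have lab: "lab x = lab y" if "l \<in> stack b ?b2" "x \<in> l" "y \<in> l" for l x y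
  proof -
    from that(1) consider "l \<in> b" | l' where "l' \<in> ?b2" "l = (\<lambda>(r, i). (Suc r, i)) ` l'"
      unfolding stack_def by blast
    then show ?thesis
    proof cases
      case 1
      have "lab u = l" if "u \<in> l" for u
        using diagram_nodes[OF b 1 that] diagram_line(3)[OF b _ 1 that] by (auto simp: lab_def)
      then show ?thesis using that by simp
    next
      case 2
      then obtain k where k: "k < n" "l' = {(1, k), (0, p k)}" unfolding perm_diagram_def by blast
      then have "l = {(2, k), (1, p k)}" using 2 by (simp add: numeral_2_eq_2)
      then show ?thesis using that by (auto simp: lab_def)
    qed
  qed
  have lab_dbl: "lab (dbl x) = line_of b (relabel (inv_into UNIV id) (inv_into UNIV ?p') x)" if "x \<in> {0, 1} \<times> {..<n}" for x
    using that by (auto simp: lab_def dbl_def relabel_def pp)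
  have toline: "(dbl x, z) \<in> connected_nodes b ?b2"
    if x: "x \<in> {0, 1} \<times> {..<n}" and z: "z \<in> lab (dbl x)" for x z
  proof -
    let ?w = "relabel (inv_into UNIV id) (inv_into UNIV ?p') x"
    have w: "?w \<in> {0, 1} \<times> {..<n}" using x hin by blast
    have "(dbl x, ?w) \<in> connected_nodes b ?b2"
      using x vert[of "snd x"] by (auto simp: relabel_def dbl_def connected_refl pp)
    moreover have "(?w, z) \<in> connected_nodes b ?b2"
      by (rule connected_line[of "line_of b ?w"])
         (use diagram_line(1,2)[OF b w] z lab_dbl[OF x] in \<open>auto simp: stack_def\<close>)
    ultimately show ?thesis by (rule connected_trans)
  qed
  have conn: "(dbl x, dbl y) \<in> connected_nodes b ?b2"
    if xy: "x \<in> {0, 1} \<times> {..<n}" "y \<in> {0, 1} \<times> {..<n}" "lab (dbl x) = lab (dbl y)" for x y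
  proof -
    have "relabel (inv_into UNIV id) (inv_into UNIV ?p') x \<in> {0, 1} \<times> {..<n}" using xy(1) hin by blast
    then obtain z where "z \<in> lab (dbl x)" using diagram_line(2)[OF b] lab_dbl[OF xy(1)] by metis
    then show ?thesis using toline[OF xy(1), of z] toline[OF xy(2), of z] xy(3)
      by (metis connected_sym connected_trans)
  qed
  have "compose_diagrams n b ?b2 = {{x, y} |x y. x \<in> {0, 1} \<times> {..<n} \<and> y \<in> {0, 1} \<times> {..<n} \<and> x \<noteq> y \<and>
      lab (dbl x) = lab (dbl y)}"
    using lab conn by (rule compose_label)
  also have "\<dots> = {{x, y} |x y. x \<in> {0, 1} \<times> {..<n} \<and> y \<in> {0, 1} \<times> {..<n} \<and> x \<noteq> y \<and>
      line_of b (relabel (inv_into UNIV id) (inv_into UNIV ?p') x) = line_of b (relabel (inv_into UNIV id) (inv_into UNIV ?p') y)}"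
    by (intro Collect_cong ex_cong1 conj_cong refl) (simp_all only: lab_dbl)
  finally show "compose_diagrams n b ?b2 = (\<lambda>l. relabel id ?p' ` l) ` b"
    by (simp only: relabel_lines[OF b permutes_id permutes_inv[OF p]])
  have "False" if C: "C \<in> ({1} \<times> {..<n}) // connected_nodes b ?b2" "C \<subseteq> {1} \<times> {..<n}" for C
  proof -
    obtain k where k: "k < n" "C = connected_nodes b ?b2 `` {(1, k)}" using C(1) by (auto simp: quotient_def)
    have "?p' k < n" using k(1) pin[of "?p' k"] p' by simp
    from connected_sym[OF vert[OF this]] have "(2, ?p' k) \<in> C" using k(2) p' by auto
    with C(2) show False by auto
  qed
  then have "{C \<in> ({1} \<times> {..<n}) // connected_nodes b ?b2. C \<subseteq> {1} \<times> {..<n}} = {}" by blast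
  then show "closed_loops n b ?b2 = 0" by (simp add: closed_loops_def)
qed


section \<open>Permutation and arc diagrams\<close>

lemma perm_diagram_in [simp]:
  assumes p: "p permutes {..<n}" shows "perm_diagram n p \<in> diagrams n"
proof -
  define L where "L x = (if fst x = 0 then snd x else p (snd x))" for x :: node
  note pin = permutes_in_image[OF p]
  have "perm_diagram n p = {{x, y} |x y. x \<in> {0, 1} \<times> {..<n} \<and> y \<in> {0, 1} \<times> {..<n} \<and> x \<noteq> y \<and> L x = L y}"
  proof (intro equalityI subsetI)
    fix l assume "l \<in> perm_diagram n p"
    then obtain k where "k < n" "l = {(1, k), (0, p k)}" unfolding perm_diagram_def by blast
    then show "l \<in> {{x, y} |x y. x \<in> {0, 1} \<times> {..<n} \<and> y \<in> {0, 1} \<times> {..<n} \<and> x \<noteq> y \<and> L x = L y}"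
      using pin[of k] by (intro CollectI exI[of _ "(1, k)"] exI[of _ "(0, p k)"]) (simp add: L_def)
  next
    fix l assume "l \<in> {{x, y} |x y. x \<in> {0, 1} \<times> {..<n} \<and> y \<in> {0, 1} \<times> {..<n} \<and> x \<noteq> y \<and> L x = L y}"
    then obtain x y where xy: "l = {x, y}" "x \<in> {0, 1} \<times> {..<n}" "y \<in> {0, 1} \<times> {..<n}" "x \<noteq> y" "L x = L y" by blast
    obtain r k s m where x: "x = (r, k)" and y: "y = (s, m)" by (cases x, cases y)
    have inj: "p k = p m \<longleftrightarrow> k = m" by (metis permutes_inj[OF p] inj_eq)
    consider "r = 0" "s = 1" | "r = 1" "s = 0" | "r = s" using xy(2,3) x y by auto
    then show "l \<in> perm_diagram n p"
    proof cases
      case 1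
      then have "l = {(1, m), (0, p m)}" "m < n" using xy x y by (auto simp: L_def)
      then show ?thesis unfolding perm_diagram_def by blast
    next
      case 2
      then have "l = {(1, k), (0, p k)}" "k < n" using xy x y by (auto simp: L_def)
      then show ?thesis unfolding perm_diagram_def by blast
    next
      case 3
      then show ?thesis using xy x y inj by (auto simp: L_def split: if_splits)
    qed
  qed
  also have "\<dots> \<in> diagrams n"
  proof (rule diagramI)
    fix x :: node assume x: "x \<in> {0, 1} \<times> {..<n}"
    let ?y = "if fst x = 0 then (1, inv_into UNIV p (snd x)) else (0, p (snd x))"
    have pinv: "inv_into UNIV p k < n \<longleftrightarrow> k < n" "p k < n \<longleftrightarrow> k < n" for k
      using permutes_in_image[OF permutes_inv[OF p], of k] pin[of k] by auto
    have pp: "p (inv_into UNIV p k) = k" "inv_into UNIV p (p k) = k" "(p k = p m) = (k = m)" for k m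
      using permutes_inverses[OF p] permutes_inj[OF p] by (auto simp: inj_eq)
    show "\<exists>!y. y \<in> {0, 1} \<times> {..<n} \<and> y \<noteq> x \<and> L x = L y"
      by (rule ex1I[of _ ?y]) (use x pinv pp in \<open>auto simp: L_def split: if_splits\<close>)
  qed
  finally show ?thesis .
qed

lemma arc_diagram_in [simp]:
  assumes "i < n" "j < n" "i \<noteq> j" shows "arc_diagram n i j \<in> diagrams n"
proof -
  define L :: "node \<Rightarrow> nat + nat" where
    "L x = (if snd x = i \<or> snd x = j then Inl (fst x) else Inr (snd x))" for x
  have "arc_diagram n i j = {{x, y} |x y. x \<in> {0, 1} \<times> {..<n} \<and> y \<in> {0, 1} \<times> {..<n} \<and> x \<noteq> y \<and> L x = L y}"
  proof (intro equalityI subsetI)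
    fix l assume "l \<in> arc_diagram n i j"
    then consider "l = {(1, i), (1, j)}" | "l = {(0, i), (0, j)}" |
      k where "k < n" "k \<noteq> i" "k \<noteq> j" "l = {(0, k), (1, k)}" unfolding arc_diagram_def by blast
    then show "l \<in> {{x, y} |x y. x \<in> {0, 1} \<times> {..<n} \<and> y \<in> {0, 1} \<times> {..<n} \<and> x \<noteq> y \<and> L x = L y}"
    proof cases
      case 1 then show ?thesis using assms by (intro CollectI exI[of _ "(1, i)"] exI[of _ "(1, j)"]) (simp add: L_def)
    next
      case 2 then show ?thesis using assms by (intro CollectI exI[of _ "(0, i)"] exI[of _ "(0, j)"]) (simp add: L_def)
    next
      case 3 then show ?thesis by (intro CollectI exI[of _ "(0, k)"] exI[of _ "(1, k)"]) (simp add: L_def)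
    qed
  next
    fix l assume "l \<in> {{x, y} |x y. x \<in> {0, 1} \<times> {..<n} \<and> y \<in> {0, 1} \<times> {..<n} \<and> x \<noteq> y \<and> L x = L y}"
    then obtain x y where xy: "l = {x, y}" "x \<in> {0, 1} \<times> {..<n}" "y \<in> {0, 1} \<times> {..<n}" "x \<noteq> y" "L x = L y" by blast
    obtain r k s m where x: "x = (r, k)" and y: "y = (s, m)" by (cases x, cases y)
    show "l \<in> arc_diagram n i j"
    proof (cases "k = i \<or> k = j")
      case True
      then have "l = {(r, i), (r, j)}" "r = 0 \<or> r = 1"
        using xy x y by (auto simp: L_def split: if_splits)
      then show ?thesis unfolding arc_diagram_def by auto
    next
      case False
      then have "l = {(0, k), (1, k)}" "k < n"
        using xy x y by (auto simp: L_def split: if_splits)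
      then show ?thesis using False unfolding arc_diagram_def by blast
    qed
  qed
  also have "\<dots> \<in> diagrams n"
  proof (rule diagramI)
    fix x :: node assume x: "x \<in> {0, 1} \<times> {..<n}"
    let ?y = "if snd x = i then (fst x, j) else if snd x = j then (fst x, i) else (1 - fst x, snd x)"
    show "\<exists>!y. y \<in> {0, 1} \<times> {..<n} \<and> y \<noteq> x \<and> L x = L y"
      by (rule ex1I[of _ ?y]) (use x assms in \<open>auto simp: L_def split: if_splits\<close>)
  qed
  finally show ?thesis .
qed

lemma compose_perm_perm:
  assumes "p permutes {..<n}" "q permutes {..<n}"
  shows "compose_diagrams n (perm_diagram n p) (perm_diagram n q) = perm_diagram n (p \<circ> q)"
proof -
  have "compose_diagrams n (perm_diagram n p) (perm_diagram n q) = (\<lambda>l. relabel p id ` l) ` perm_diagram n q"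
    using assms by (intro compose_perm_left perm_diagram_in)
  also have "\<dots> = perm_diagram n (p \<circ> q)"
    unfolding perm_diagram_def setcompr_eq_image by (simp add: image_image relabel_def)
  finally show ?thesis .
qed

text \<open>Makes every d_ij available from the adjacent ones, for which alone the representation is
  prescribed.\<close>

lemma conj_arc_diagram:
  assumes p: "p permutes {..<n}" and ij: "i < n" "j < n" "i \<noteq> j"
  shows "compose_diagrams n (compose_diagrams n (perm_diagram n p) (arc_diagram n i j)) (perm_diagram n (inv_into UNIV p)) =
    arc_diagram n (p i) (p j)"
proof -
  have 1: "compose_diagrams n (perm_diagram n p) (arc_diagram n i j) = (\<lambda>l. relabel p id ` l) ` arc_diagram n i j"
    using assms by (intro compose_perm_left arc_diagram_in)
  have "compose_diagrams n ((\<lambda>l. relabel p id ` l) ` arc_diagram n i j) (perm_diagram n (inv_into UNIV p)) =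
      (\<lambda>l. relabel id (inv_into UNIV (inv_into UNIV p)) ` l) ` (\<lambda>l. relabel p id ` l) ` arc_diagram n i j"
    using assms by (intro compose_perm_right relabel_diagram arc_diagram_in permutes_inv permutes_id)
  also have "\<dots> = (\<lambda>l. relabel p p ` l) ` arc_diagram n i j"
    unfolding image_image permutes_inv_inv[OF p]
    by (intro image_cong refl) (auto simp: relabel_def)
  also have "\<dots> = arc_diagram n (p i) (p j)"
  proof -
    have "(\<lambda>l. relabel p p ` l) ` {{(0, k), (1, k)} |k. k < n \<and> k \<noteq> i \<and> k \<noteq> j} =
        {{(0, k), (1, k)} |k. k < n \<and> k \<noteq> p i \<and> k \<noteq> p j}" (is "?L = ?R")
    proof (intro equalityI subsetI)
      fix l assume "l \<in> ?L"
      then obtain k where "l = {(0, p k), (1, p k)}" "k < n" "k \<noteq> i" "k \<noteq> j" by (auto simp: relabel_def)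
      moreover have "p k < n" using permutes_in_image[OF p, of k] \<open>k < n\<close> by simp
      moreover have "p k \<noteq> p i" "p k \<noteq> p j" using calculation permutes_inj[OF p] by (auto simp: inj_eq)
      ultimately show "l \<in> ?R" by blast
    next
      fix l assume "l \<in> ?R"
      then obtain k where k: "l = {(0, k), (1, k)}" "k < n" "k \<noteq> p i" "k \<noteq> p j" by blast
      let ?m = "inv_into UNIV p k"
      have pm: "p ?m = k" using permutes_inverses(1)[OF p] .
      have "?m < n" using permutes_in_image[OF permutes_inv[OF p], of k] k by simp
      moreover have "?m \<noteq> i" "?m \<noteq> j" using pm k by auto
      moreover have "l = relabel p p ` {(0, ?m), (1, ?m)}" using pm k by (simp add: relabel_def)
      ultimately show "l \<in> ?L" by blast
    qed
    then show ?thesis unfolding arc_diagram_def by (simp add: image_Un relabel_def)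
  qed
  finally show ?thesis unfolding 1 .
qed

text \<open>Yields closure of the algebra under left multiplication by \<open>A_elt\<close>. The
  upper arc glues the lines of b through its lower nodes i and j; \<open>f\<close> gives both the
  same label. The lower arc is a component of its own, labelled \<open>None\<close>.\<close>

lemma compose_arc_in:
  assumes b: "b \<in> diagrams n" and ij: "i < n" "j < n" "i \<noteq> j"
  shows "compose_diagrams n (arc_diagram n i j) b \<in> diagrams n"
proof -
  let ?N = "{0, 1} \<times> {..<n} :: node set" and ?b1 = "arc_diagram n i j"
  let ?a = "(0, i) :: node" and ?c = "(0, j) :: node"
  let ?li = "line_of b ?a" and ?lj = "line_of b ?c"
  have ac: "?a \<in> ?N" "?c \<in> ?N" "?a \<noteq> ?c" using ij by auto
  define f where "f l = (if l = ?lj then ?li else l)" for l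
  define lab where "lab x = (if x = ?a \<or> x = ?c then None
     else Some (f (line_of b (if fst x = 0 then x else (fst x - 1, snd x)))))" for x :: node
  have lab_dbl: "lab (dbl x) = (if x = ?a \<or> x = ?c then None else Some (f (line_of b x)))" if "x \<in> ?N" for x
    using that by (auto simp: lab_def dbl_def)
  have lab: "lab x = lab y" if l: "l \<in> stack ?b1 b" "x \<in> l" "y \<in> l" for l x y
  proof -
    from l(1) consider "l = {(1, i), (1, j)}" | "l = {(0, i), (0, j)}" |
      k where "k < n" "k \<noteq> i" "k \<noteq> j" "l = {(0, k), (1, k)}" |
      l' where "l' \<in> b" "l = (\<lambda>(r, i). (Suc r, i)) ` l'"
      unfolding stack_def arc_diagram_def by blast
    then show ?thesis
    proof cases
      case 1
      have "lab (1, i) = Some ?li" "lab (1, j) = Some ?li" by (simp_all add: lab_def f_def)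
      then show ?thesis using 1 l(2,3) by (metis empty_iff insert_iff)
    next
      case 2
      have "lab (0, i) = None" "lab (0, j) = None" by (simp_all add: lab_def)
      then show ?thesis using 2 l(2,3) by (metis empty_iff insert_iff)
    next
      case 3
      have "lab (0, k) = lab (1, k)" using 3 by (simp add: lab_def)
      then show ?thesis using 3 l(2,3) by (metis empty_iff insert_iff)
    next
      case 4
      have "lab u = Some (f l')" if u: "u \<in> l" for u
      proof -
        obtain v where v: "v \<in> l'" "u = (Suc (fst v), snd v)"
          using u unfolding 4(2) by (auto simp: case_prod_unfold)
        then have "lab u = Some (f (line_of b v))" by (simp add: lab_def)
        then show ?thesis using diagram_line(3)[OF b _ 4(1) v(1)] diagram_nodes[OF b 4(1) v(1)] by simp
      qed
      then show ?thesis using l(2,3) by metis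
    qed
  qed
  have ij_line: "((1, i), (1, j)) \<in> connected_nodes ?b1 b"
    by (rule connected_line[of "{(1, i), (1, j)}"]) (auto simp: stack_def arc_diagram_def)
  have shift: "((Suc (fst u), snd u), (Suc (fst v), snd v)) \<in> connected_nodes ?b1 b"
    if uv: "u \<in> ?N" "v \<in> ?N" "line_of b u = line_of b v" for u v
  proof (rule connected_line)
    show "(\<lambda>(r, i). (Suc r, i)) ` line_of b u \<in> stack ?b1 b"
      using diagram_line(1)[OF b uv(1)] by (simp add: stack_def)
    show "(Suc (fst u), snd u) \<in> (\<lambda>(r, i). (Suc r, i)) ` line_of b u"
      using diagram_line(2)[OF b uv(1)] by (intro image_eqI[of _ _ u]) (auto simp: case_prod_unfold)
    show "(Suc (fst v), snd v) \<in> (\<lambda>(r, i). (Suc r, i)) ` line_of b u"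
      using diagram_line(2)[OF b uv(2)] uv(3) by (intro image_eqI[of _ _ v]) (auto simp: case_prod_unfold)
  qed
  have up: "(dbl x, (Suc (fst x), snd x)) \<in> connected_nodes ?b1 b"
    if x: "x \<in> ?N" "x \<noteq> ?a" "x \<noteq> ?c" for x
  proof (cases "fst x = 0")
    case True
    then obtain k where k: "x = (0, k)" by (cases x) simp
    then have "k < n" "k \<noteq> i" "k \<noteq> j" using x by auto
    then have "{(0, k), (1, k)} \<in> stack ?b1 b" unfolding stack_def arc_diagram_def by blast
    from connected_line[OF this, of "(0, k)" "(1, k)"] show ?thesis by (simp add: k dbl_def)
  next
    case False
    then have "dbl x = (Suc (fst x), snd x)" using x by (auto simp: dbl_def)
    then show ?thesis by (simp add: connected_refl)
  qed
  have conn: "(dbl x, dbl y) \<in> connected_nodes ?b1 b"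
    if xy: "x \<in> ?N" "y \<in> ?N" "lab (dbl x) = lab (dbl y)" for x y
  proof (cases "x = ?a \<or> x = ?c")
    case True
    then have "y = ?a \<or> y = ?c" using xy lab_dbl by (auto split: if_splits)
    show ?thesis
      by (rule connected_line[of "{(0, i), (0, j)}"])
         (use True \<open>y = ?a \<or> y = ?c\<close> in \<open>auto simp: stack_def arc_diagram_def dbl_def\<close>)
  next
    case False
    then have y: "\<not> (y = ?a \<or> y = ?c)" and ff: "f (line_of b x) = f (line_of b y)"
      using xy lab_dbl by (auto split: if_splits)
    have "((Suc (fst x), snd x), (Suc (fst y), snd y)) \<in> connected_nodes ?b1 b"
    proof -
      consider "line_of b x = line_of b y" | "line_of b x = ?li" "line_of b y = ?lj" | "line_of b x = ?lj" "line_of b y = ?li"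
        using ff by (auto simp: f_def split: if_splits)
      then show ?thesis
      proof cases
        case 1 then show ?thesis using shift xy by blast
      next
        case 2
        then have "((Suc (fst x), snd x), (1, i)) \<in> connected_nodes ?b1 b" "((1, j), (Suc (fst y), snd y)) \<in> connected_nodes ?b1 b"
          using shift[of x ?a] shift[of ?c y] xy ac by auto
        then show ?thesis using ij_line by (blast intro: connected_trans)
      next
        case 3
        then have "((Suc (fst x), snd x), (1, j)) \<in> connected_nodes ?b1 b" "((1, i), (Suc (fst y), snd y)) \<in> connected_nodes ?b1 b"
          using shift[of x ?c] shift[of ?a y] xy ac by auto
        then show ?thesis using ij_line by (blast intro: connected_trans connected_sym)
      qed
    qed
    then show ?thesis using up[of x] up[of y] xy False y by (blast intro: connected_trans connected_sym)
  qed
  have "compose_diagrams n ?b1 b = {{x, y} |x y. x \<in> ?N \<and> y \<in> ?N \<and> x \<noteq> y \<and> lab (dbl x) = lab (dbl y)}"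
    using lab conn by (rule compose_label)
  also have "\<dots> \<in> diagrams n"
  proof (rule diagramI)
    fix x assume x: "x \<in> ?N"
    have eq: "line_of b u = line_of b v \<longleftrightarrow> v \<in> line_of b u" if "u \<in> ?N" "v \<in> ?N" for u v
      using line_of_eq_iff[OF b that] .
    obtain x' where x': "x' \<noteq> x" "x' \<in> ?N" "line_of b x = {x, x'}" using diagram_partner[OF b x] .
    obtain a' where a': "a' \<noteq> ?a" "a' \<in> ?N" "?li = {?a, a'}" using diagram_partner[OF b ac(1)] .
    obtain c' where c': "c' \<noteq> ?c" "c' \<in> ?N" "?lj = {?c, c'}" using diagram_partner[OF b ac(2)] .
    \<comment> \<open>The node is an end of the lower arc, the far end of one of the two glued
      lines, or on a line of b that the arc does not touch.\<close>
    consider "x = ?a" | "x = ?c" | "x \<noteq> ?a" "x \<noteq> ?c" "x' = ?a" | "x \<noteq> ?a" "x \<noteq> ?c" "x' = ?c" |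
      "x \<noteq> ?a" "x \<noteq> ?c" "x' \<noteq> ?a" "x' \<noteq> ?c" by blast
    then show "\<exists>!y. y \<in> ?N \<and> y \<noteq> x \<and> lab (dbl x) = lab (dbl y)"
    proof cases
      case 1
      show ?thesis
        by (rule ex1I[of _ ?c]) (use 1 ac lab_dbl in \<open>auto split: if_splits\<close>)
    next
      case 2
      show ?thesis
        by (rule ex1I[of _ ?a]) (use 2 ac lab_dbl in \<open>auto split: if_splits\<close>)
    next
      case 3
      have "?a \<in> line_of b x" unfolding x'(3) using 3(3) by simp
      then have lx: "line_of b x = ?li" using eq[OF x ac(1)] by simp
      then have "{?a, a'} = {x, ?a}" using a'(3) x'(3) 3(3) by simp
      then have "a' = x" using 3(1) by (auto simp: doubleton_eq_iff)
      have "?c \<notin> ?li" unfolding a'(3) using \<open>a' = x\<close> 3(2) ac(3) by simp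
      then have ne: "?li \<noteq> ?lj" using eq[OF ac(1,2)] by simp
      have "?a \<notin> ?lj" using ne eq[OF ac(2,1)] by simp
      moreover have "x \<notin> ?lj" using ne eq[OF ac(2) x] lx by simp
      ultimately have "c' \<noteq> ?a" "c' \<noteq> x" unfolding c'(3) by auto
      have lc: "line_of b c' = ?lj" using eq[OF ac(2) c'(2)] unfolding c'(3) by auto
      show ?thesis
      proof (rule ex1I[of _ c'])
        show "c' \<in> ?N \<and> c' \<noteq> x \<and> lab (dbl x) = lab (dbl c')"
          using c' \<open>c' \<noteq> ?a\<close> \<open>c' \<noteq> x\<close> lab_dbl[OF x] lab_dbl[OF c'(2)] 3 lc lx ne by (simp add: f_def)
        fix y assume y: "y \<in> ?N \<and> y \<noteq> x \<and> lab (dbl x) = lab (dbl y)"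
        then have yN: "y \<in> ?N" by simp
        have "y \<noteq> ?a" "y \<noteq> ?c" and "f (line_of b y) = ?li"
          using y lab_dbl[OF x] lab_dbl[OF yN] 3 lx ne by (auto simp: f_def split: if_splits)
        then have "line_of b y = ?li \<or> line_of b y = ?lj" by (auto simp: f_def split: if_splits)
        then have "y \<in> ?li \<or> y \<in> ?lj" using diagram_line(2)[OF b yN] by auto
        then show "y = c'" using a'(3) c'(3) \<open>a' = x\<close> y \<open>y \<noteq> ?a\<close> \<open>y \<noteq> ?c\<close> by blast
      qed
    next
      case 4
      have "?c \<in> line_of b x" unfolding x'(3) using 4(3) by simp
      then have lx: "line_of b x = ?lj" using eq[OF x ac(2)] by simp
      then have "{?c, c'} = {x, ?c}" using c'(3) x'(3) 4(3) by simp
      then have "c' = x" using 4(2) by (auto simp: doubleton_eq_iff)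
      have "?a \<notin> ?lj" unfolding c'(3) using \<open>c' = x\<close> 4(1) ac(3) by simp
      then have ne: "?li \<noteq> ?lj" using eq[OF ac(2,1)] by auto
      have "?c \<notin> ?li" using ne eq[OF ac(1,2)] by simp
      moreover have "x \<notin> ?li" using ne eq[OF ac(1) x] lx by auto
      ultimately have "a' \<noteq> ?c" "a' \<noteq> x" unfolding a'(3) by auto
      have la: "line_of b a' = ?li" using eq[OF ac(1) a'(2)] unfolding a'(3) by auto
      show ?thesis
      proof (rule ex1I[of _ a'])
        show "a' \<in> ?N \<and> a' \<noteq> x \<and> lab (dbl x) = lab (dbl a')"
          using a' \<open>a' \<noteq> ?c\<close> \<open>a' \<noteq> x\<close> lab_dbl[OF x] lab_dbl[OF a'(2)] 4 la lx ne by (simp add: f_def)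
        fix y assume y: "y \<in> ?N \<and> y \<noteq> x \<and> lab (dbl x) = lab (dbl y)"
        then have yN: "y \<in> ?N" by simp
        have "y \<noteq> ?a" "y \<noteq> ?c" and "f (line_of b y) = ?li"
          using y lab_dbl[OF x] lab_dbl[OF yN] 4 lx ne by (auto simp: f_def split: if_splits)
        then have "line_of b y = ?li \<or> line_of b y = ?lj" by (auto simp: f_def split: if_splits)
        then have "y \<in> ?li \<or> y \<in> ?lj" using diagram_line(2)[OF b yN] by auto
        then show "y = a'" using a'(3) c'(3) \<open>c' = x\<close> y \<open>y \<noteq> ?a\<close> \<open>y \<noteq> ?c\<close> by blast
      qed
    next
      case 5
      have "?a \<notin> line_of b x" "?c \<notin> line_of b x" unfolding x'(3) using 5 by simp_all
      then have nl: "line_of b x \<noteq> ?li" "line_of b x \<noteq> ?lj" using eq[OF x ac(1)] eq[OF x ac(2)] by simp_all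
      have "x' \<in> line_of b x" unfolding x'(3) by simp
      then have lx': "line_of b x' = line_of b x" using eq[OF x x'(2)] by simp
      show ?thesis
      proof (rule ex1I[of _ x'])
        show "x' \<in> ?N \<and> x' \<noteq> x \<and> lab (dbl x) = lab (dbl x')"
          using x' lab_dbl[OF x] lab_dbl[OF x'(2)] 5 lx' by simp
        fix y assume y: "y \<in> ?N \<and> y \<noteq> x \<and> lab (dbl x) = lab (dbl y)"
        then have yN: "y \<in> ?N" by simp
        have "f (line_of b y) = line_of b x"
          using y lab_dbl[OF x] lab_dbl[OF yN] 5 nl by (auto simp: f_def split: if_splits)
        then have "line_of b y = line_of b x" using nl by (auto simp: f_def split: if_splits)
        then have "y \<in> line_of b x" using diagram_line(2)[OF b yN] by auto
        then show "y = x'" using x'(3) y by blast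
      qed
    qed
  qed
  finally show ?thesis .
qed


section \<open>The Brauer algebra and the group algebra\<close>

abbreviation bm :: "nat \<Rightarrow> complex \<Rightarrow> brauer \<Rightarrow> brauer \<Rightarrow> brauer" where
  "bm n \<delta> x y \<equiv> x \<otimes>\<^bsub>brauer_algebra n \<delta>\<^esub> y"

lemma bm_eq: "bm n \<delta> x y = (\<Sum>b1\<in>diagrams n. \<Sum>b2\<in>diagrams n.
    scale_elt (x b1 * y b2 * \<delta> ^ closed_loops n b1 b2) (basis_elt (compose_diagrams n b1 b2)))"
  by (simp add: brauer_algebra_def)

lemma bm_apply: "bm n \<delta> x y d = (\<Sum>b1\<in>diagrams n. \<Sum>b2\<in>diagrams n.
    x b1 * y b2 * \<delta> ^ closed_loops n b1 b2 * basis_elt (compose_diagrams n b1 b2) d)"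
  by (simp add: bm_eq sum_fun_apply scale_elt_def)

lemma bm_add_left: "bm n \<delta> (x + x') y = bm n \<delta> x y + bm n \<delta> x' y"
  by (rule ext) (simp add: bm_apply distrib_right sum.distrib)

lemma bm_add_right: "bm n \<delta> x (y + y') = bm n \<delta> x y + bm n \<delta> x y'"
  by (rule ext) (simp add: bm_apply distrib_left distrib_right sum.distrib)

lemma bm_scale_left: "bm n \<delta> (scale_elt c x) y = scale_elt c (bm n \<delta> x y)"
  by (rule ext) (simp add: bm_apply scale_elt_def sum_distrib_left mult.assoc)

lemma bm_scale_right: "bm n \<delta> x (scale_elt c y) = scale_elt c (bm n \<delta> x y)"
  by (rule ext) (simp add: bm_apply scale_elt_def sum_distrib_left mult.assoc mult.left_commute[of _ c])

lemma bm_zero_left: "bm n \<delta> 0 y = 0" and bm_zero_right: "bm n \<delta> x 0 = 0"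
  by (rule ext, simp add: bm_apply)+

lemma bm_sum_left: "bm n \<delta> (sum f I) y = (\<Sum>i\<in>I. bm n \<delta> (f i) y)"
  using sum_comp_morphism[of "\<lambda>x. bm n \<delta> x y" f I] by (simp add: bm_add_left bm_zero_left comp_def)

lemma bm_sum_right: "bm n \<delta> x (sum f I) = (\<Sum>i\<in>I. bm n \<delta> x (f i))"
  using sum_comp_morphism[of "bm n \<delta> x" f I] by (simp add: bm_add_right bm_zero_right comp_def)

lemma bm_basis:
  assumes "b1 \<in> diagrams n" "b2 \<in> diagrams n"
  shows "bm n \<delta> (basis_elt b1) (basis_elt b2) =
    scale_elt (\<delta> ^ closed_loops n b1 b2) (basis_elt (compose_diagrams n b1 b2))"
proof -
  have "bm n \<delta> (basis_elt b1) (basis_elt b2) =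
      (\<Sum>c1\<in>diagrams n. \<Sum>c2\<in>diagrams n. if c1 = b1 \<and> c2 = b2 then
        scale_elt (\<delta> ^ closed_loops n b1 b2) (basis_elt (compose_diagrams n b1 b2)) else 0)"
    unfolding bm_eq by (intro sum.cong refl) (auto simp: basis_elt_def scale_elt_def fun_eq_iff)
  also have "\<dots> = (\<Sum>c1\<in>diagrams n. if c1 = b1 then
      (\<Sum>c2\<in>diagrams n. if c2 = b2 then
        scale_elt (\<delta> ^ closed_loops n b1 b2) (basis_elt (compose_diagrams n b1 b2)) else 0) else 0)"
    by (intro sum.cong refl) (auto intro: sum.neutral)
  finally show ?thesis using assms by simp
qed

lemma scale_elt_simps: "scale_elt 1 x = x" "scale_elt 0 x = 0" "scale_elt c 0 = 0"
  "scale_elt c (scale_elt d x) = scale_elt (c * d) x" "scale_elt c (x + y) = scale_elt c x + scale_elt c y"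
  "scale_elt (c + d) x = scale_elt c x + scale_elt d x"
  by (rule ext, simp add: scale_elt_def algebra_simps)+

lemma carrier_brauer: "x \<in> carrier (brauer_algebra n \<delta>) \<longleftrightarrow> (\<forall>d. d \<notin> diagrams n \<longrightarrow> x d = 0)"
  by (simp add: brauer_algebra_def)

lemma basis_in_carrier [simp]: "b \<in> diagrams n \<Longrightarrow> basis_elt b \<in> carrier (brauer_algebra n \<delta>)"
  by (auto simp: carrier_brauer basis_elt_def)

lemma carrier_add: "x \<in> carrier (brauer_algebra n \<delta>) \<Longrightarrow> y \<in> carrier (brauer_algebra n \<delta>) \<Longrightarrow>
    x + y \<in> carrier (brauer_algebra n \<delta>)"
  and carrier_scale: "x \<in> carrier (brauer_algebra n \<delta>) \<Longrightarrow> scale_elt c x \<in> carrier (brauer_algebra n \<delta>)"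
  and carrier_zero: "0 \<in> carrier (brauer_algebra n \<delta>)"
  by (simp_all add: carrier_brauer scale_elt_def)

lemma carrier_sum: "(\<And>i. i \<in> A \<Longrightarrow> f i \<in> carrier (brauer_algebra n \<delta>)) \<Longrightarrow> sum f A \<in> carrier (brauer_algebra n \<delta>)"
  by (induction A rule: infinite_finite_induct) (auto intro: carrier_add simp: carrier_zero)

lemma brauer_expand:
  assumes "x \<in> carrier (brauer_algebra n \<delta>)" shows "x = (\<Sum>d\<in>diagrams n. scale_elt (x d) (basis_elt d))"
proof
  fix b
  have "(\<Sum>d\<in>diagrams n. scale_elt (x d) (basis_elt d)) b = (\<Sum>d\<in>diagrams n. if d = b then x d else 0)"
    unfolding sum_fun_apply by (rule sum.cong) (auto simp: scale_elt_def basis_elt_def)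
  then show "x b = (\<Sum>d\<in>diagrams n. scale_elt (x d) (basis_elt d)) b"
    using assms by (auto simp: carrier_brauer)
qed

lemma perm_elt_mult:
  assumes "p permutes {..<n}" "q permutes {..<n}"
  shows "bm n \<delta> (perm_elt n p) (perm_elt n q) = perm_elt n (p \<circ> q)"
  using assms by (simp add: bm_basis compose_perm_perm compose_perm_left(2) scale_elt_simps)

lemma perm_diagram_inj:
  assumes "perm_diagram n p = perm_diagram n q" "k < n" shows "p k = q k"
proof -
  have "{(1, k), (0, p k)} \<in> perm_diagram n q" using assms unfolding perm_diagram_def by blast
  then obtain l where "{(1 :: nat, k), (0, p k)} = {(1, l), (0, q l)}" unfolding perm_diagram_def by blast
  then show ?thesis by (auto simp: doubleton_eq_iff)
qed

text \<open>On \<open>CS {..<n}\<close> an isomorphism onto the arc-free part with inverse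
  \<open>coef\<close>. It is multiplicative for every loop parameter, since permutation diagrams
  produce no loops.\<close>

definition iota :: "nat \<Rightarrow> galg \<Rightarrow> brauer" where
  "iota n a = (\<Sum>p\<in>SP {..<n}. scale_elt (lk a p) (perm_elt n (ap p)))"

definition coef :: "nat \<Rightarrow> brauer \<Rightarrow> galg" where
  "coef n x = (\<Sum>p\<in>SP {..<n}. sc (x (perm_diagram n (ap p))) * gp p)"

lemma SP_permutes: "p \<in> SP K \<Longrightarrow> ap p permutes K"
  by (simp add: SP_def)

lemma perm_diagram_ap_inj:
  assumes "p \<in> SP {..<n}" "q \<in> SP {..<n}" "perm_diagram n (ap p) = perm_diagram n (ap q)" shows "p = q"
proof (rule fperm_eqI)
  fix i show "ap p i = ap q i"
    using perm_diagram_inj[OF assms(3), of i] assms(1,2) by (cases "i < n") auto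
qed

lemma iota_add: "iota n (a + b) = iota n a + iota n b"
  by (simp add: iota_def lookup_add scale_elt_simps sum.distrib)

lemma iota_sc: "iota n (sc c * a) = scale_elt c (iota n a)"
  by (rule ext) (simp add: iota_def sum_fun_apply scale_elt_def sum_distrib_left mult.assoc)

lemma iota_zero [simp]: "iota n 0 = 0"
  by (simp add: iota_def scale_elt_simps)

lemma iota_sum: "iota n (sum f A) = (\<Sum>i\<in>A. iota n (f i))"
  by (induction A rule: infinite_finite_induct) (auto simp: iota_add)

lemma iota_gp: "p \<in> SP {..<n} \<Longrightarrow> iota n (gp p) = perm_elt n (ap p)"
proof -
  assume "p \<in> SP {..<n}"
  have "iota n (gp p) = (\<Sum>q\<in>SP {..<n}. if q = p then perm_elt n (ap p) else 0)"
    unfolding iota_def by (rule sum.cong) (auto simp: lk_gp scale_elt_simps)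
  then show ?thesis using \<open>p \<in> SP {..<n}\<close> by simp
qed

lemma iota_carrier [simp]: "iota n a \<in> carrier (brauer_algebra n \<delta>)"
  unfolding iota_def by (intro carrier_sum carrier_scale basis_in_carrier perm_diagram_in SP_permutes)

lemma iota_mult:
  assumes "a \<in> CS {..<n}" "b \<in> CS {..<n}" shows "bm n \<delta> (iota n a) (iota n b) = iota n (a * b)"
  using assms(1) finite_lessThan
proof (induction rule: CS_induct)
  case (single c p)
  from assms(2) finite_lessThan show ?case
  proof (induction rule: CS_induct)
    case (single d q)
    have "bm n \<delta> (iota n (gp p)) (iota n (gp q)) = iota n (gp (p + q))"
      using \<open>p \<in> SP {..<n}\<close> single
      by (simp add: iota_gp SP_plus perm_elt_mult SP_permutes ap_plus)
    then show ?case
      by (simp only: single_mult iota_sc bm_scale_left bm_scale_right scale_elt_simps mult.commute[of d c])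
  next
    case zero
    have "bm n \<delta> (iota n (sc c * gp p)) (iota n 0) = iota n (sc c * gp p * 0)" by (simp add: bm_zero_right)
    then show ?case .
  next
    case (add a b)
    then have "bm n \<delta> (iota n (sc c * gp p)) (iota n (a + b)) = iota n (sc c * gp p * (a + b))"
      by (simp only: distrib_left iota_add bm_add_right)
    then show ?case .
  qed
next
  case zero
  have "bm n \<delta> (iota n 0) (iota n b) = iota n (0 * b)" by (simp add: bm_zero_left)
  then show ?case .
next
  case (add a a')
  then have "bm n \<delta> (iota n (a + a')) (iota n b) = iota n ((a + a') * b)"
    by (simp only: distrib_right iota_add bm_add_left)
  then show ?case .
qed

lemma iota_apply:
  assumes "p \<in> SP {..<n}" shows "iota n a (perm_diagram n (ap p)) = lk a p"
proof -
  have "iota n a (perm_diagram n (ap p)) = (\<Sum>q\<in>SP {..<n}. if q = p then lk a p else 0)"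
    unfolding iota_def sum_fun_apply
    by (rule sum.cong) (use assms perm_diagram_ap_inj[of p n] in \<open>auto simp: scale_elt_def basis_elt_def\<close>)
  then show ?thesis using assms by simp
qed

lemma coef_CS [simp]: "coef n x \<in> CS {..<n}"
  unfolding coef_def by (intro CS_sum CS_mult) auto

lemma coef_iota: assumes "a \<in> CS {..<n}" shows "coef n (iota n a) = a"
proof -
  have "a = (\<Sum>p\<in>SP {..<n}. sc (lk a p) * gp p)"
    by (rule galg_expand) (use assms in \<open>auto simp: CS_def\<close>)
  then show ?thesis by (simp add: coef_def iota_apply)
qed

lemma iota_inj: "a \<in> CS {..<n} \<Longrightarrow> b \<in> CS {..<n} \<Longrightarrow> iota n a = iota n b \<Longrightarrow> a = b"
  by (metis coef_iota)

lemma coef_add: "coef n (x + y) = coef n x + coef n y"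
  by (simp add: coef_def sc_add distrib_right sum.distrib)

lemma coef_scale: "coef n (scale_elt c x) = sc c * coef n x"
  by (simp add: coef_def scale_elt_def sc_mult sum_distrib_left mult.assoc)

text \<open>Every upper node is joined to a lower one, and disjointness of the lines makes this
  assignment injective.\<close>

lemma vertical_diagram:
  assumes d: "d \<in> diagrams n" and vert: "\<And>l. l \<in> d \<Longrightarrow> fst ` l = {0, 1}"
  shows "\<exists>p. p permutes {..<n} \<and> d = perm_diagram n p"
proof -
  have "\<exists>m<n. {(1, k), (0, m)} \<in> d" if k: "k < n" for k
  proof -
    have kN: "(1, k) \<in> {0 :: nat, 1} \<times> {..<n}" using k by simp
    obtain y where y: "y \<noteq> (1, k)" "y \<in> {0, 1} \<times> {..<n}" "line_of d (1, k) = {(1, k), y}"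
      using diagram_partner[OF d kN] .
    have "{(1, k), y} \<in> d" using diagram_line(1)[OF d kN] y(3) by simp
    moreover from vert[OF this] have "{1, fst y} = {0, 1}" by simp
    then have "fst y = 0" by (simp add: doubleton_eq_iff)
    then have "y = (0, snd y)" by (cases y) simp
    ultimately show ?thesis using y(2) by (metis lessThan_iff mem_Sigma_iff)
  qed
  then obtain p0 where p0: "\<And>k. k < n \<Longrightarrow> p0 k < n \<and> {(1, k), (0, p0 k)} \<in> d" by metis
  define p where "p k = (if k < n then p0 k else k)" for k
  have "inj_on p {..<n}"
  proof (rule inj_onI)
    fix k l assume kl: "k \<in> {..<n}" "l \<in> {..<n}" "p k = p l"
    have "(0, p0 k) \<in> {0, 1} \<times> {..<n}" using p0[of k] kl by simp
    from diagram_line(3)[OF d this] p0[of k] p0[of l] kl have "{(1 :: nat, k), (0, p0 k)} = {(1, l), (0, p0 l)}"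
      by (auto simp: p_def)
    then show "k = l" by (auto simp: doubleton_eq_iff)
  qed
  moreover from this have "p ` {..<n} = {..<n}"
    by (intro endo_inj_surj) (use p0 in \<open>auto simp: p_def\<close>)
  ultimately have p: "p permutes {..<n}" by (intro bij_imp_permutes) (simp_all add: bij_betw_def p_def)
  have "d = perm_diagram n p"
  proof
    show "perm_diagram n p \<subseteq> d" unfolding perm_diagram_def using p0 by (auto simp: p_def)
    show "d \<subseteq> perm_diagram n p"
    proof
      fix l assume l: "l \<in> d"
      then have "1 \<in> fst ` l" using vert by simp
      then obtain k where k: "(1, k) \<in> l" by force
      have kN: "(1, k) \<in> {0 :: nat, 1} \<times> {..<n}" using diagram_nodes[OF d l k] .
      then have "{(1, k), (0, p0 k)} \<in> d" "k < n" using p0 by auto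
      then have "l = {(1, k), (0, p0 k)}" using diagram_line(3)[OF d kN l k] diagram_line(3)[OF d kN, of "{(1, k), (0, p0 k)}"] by simp
      then show "l \<in> perm_diagram n p" unfolding perm_diagram_def using \<open>k < n\<close> by (auto simp: p_def)
    qed
  qed
  with p show ?thesis by blast
qed

lemma perm_diagram_vertical: "l \<in> perm_diagram n p \<Longrightarrow> fst ` l = {0, 1}"
  unfolding perm_diagram_def by auto

lemma iota_sym [simp]: "iota n a \<in> carrier (sym_algebra n)"
proof -
  have "\<forall>l\<in>d. fst ` l = {0, 1}" if "iota n a d \<noteq> 0" for d
  proof (rule ccontr)
    assume *: "\<not> ?thesis"
    have "d \<noteq> perm_diagram n p" for p using * perm_diagram_vertical[of _ n p] by metis
    then have "iota n a d = 0"
      unfolding iota_def sum_fun_apply by (simp add: scale_elt_def basis_elt_def)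
    with that show False by simp
  qed
  then show ?thesis by (simp add: sym_algebra_def)
qed

lemma iota_coef:
  assumes x: "x \<in> carrier (sym_algebra n)" shows "iota n (coef n x) = x"
proof
  fix d
  show "iota n (coef n x) d = x d"
  proof (cases "\<exists>p\<in>SP {..<n}. d = perm_diagram n (ap p)")
    case True
    then obtain p where p: "p \<in> SP {..<n}" "d = perm_diagram n (ap p)" by blast
    have "lk (coef n x) p = (\<Sum>q\<in>SP {..<n}. if q = p then x (perm_diagram n (ap p)) else 0)"
      unfolding coef_def lookup_sum lk_sc_mult lk_gp by (rule sum.cong) auto
    then show ?thesis using p by (simp add: iota_apply)
  next
    case False
    have "x d = 0"
    proof (rule ccontr)
      assume "x d \<noteq> 0"
      then have dd: "d \<in> diagrams n" "\<forall>l\<in>d. fst ` l = {0, 1}"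
        using x by (auto simp: sym_algebra_def carrier_brauer)
      have "\<exists>p. p permutes {..<n} \<and> d = perm_diagram n p"
        by (rule vertical_diagram[OF dd(1)]) (rule bspec[OF dd(2)])
      then obtain p where "p permutes {..<n}" "d = perm_diagram n p" by blast
      then have "Fp p \<in> SP {..<n}" "d = perm_diagram n (ap (Fp p))" using Fp_SP[of "{..<n}" p] by auto
      with False show False by blast
    qed
    moreover have "iota n (coef n x) d = 0"
      unfolding iota_def sum_fun_apply
      by (rule sum.neutral) (use False in \<open>auto simp: scale_elt_def basis_elt_def\<close>)
    ultimately show ?thesis by simp
  qed
qed

lemma sym_simps: "x \<otimes>\<^bsub>sym_algebra n\<^esub> y = bm n 1 x y" "\<zero>\<^bsub>sym_algebra n\<^esub> = 0" "x \<oplus>\<^bsub>sym_algebra n\<^esub> y = x + y"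
  by (simp_all add: sym_algebra_def brauer_algebra_def)

lemma sym_carrier: "x \<in> carrier (sym_algebra n) \<longleftrightarrow> (\<exists>a\<in>CS {..<n}. x = iota n a)"
  using iota_coef[of x n] coef_CS[of n x] by (metis iota_sym)

lemma iota_eq_0: "a \<in> CS {..<n} \<Longrightarrow> iota n a = 0 \<longleftrightarrow> a = 0"
  using iota_inj[of a n 0] by auto

lemma central_idempotent_iota:
  assumes a: "a \<in> CS {..<n}"
  shows "central_idempotent (sym_algebra n) (iota n a) \<longleftrightarrow> a * a = a \<and> (\<forall>x\<in>CS {..<n}. x * a = a * x)"
proof -
  have eq: "bm n 1 (iota n a) (iota n x) = bm n 1 (iota n x) (iota n a) \<longleftrightarrow> x * a = a * x"
    if x: "x \<in> CS {..<n}" for x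
    unfolding iota_mult[OF a x] iota_mult[OF x a]
    using iota_inj[OF CS_mult[OF a x] CS_mult[OF x a]] by auto
  have idem: "bm n 1 (iota n a) (iota n a) = iota n a \<longleftrightarrow> a * a = a"
    unfolding iota_mult[OF a a] using iota_inj[OF CS_mult[OF a a] a] by auto
  have img: "carrier (sym_algebra n) = iota n ` CS {..<n}" using sym_carrier by blast
  show ?thesis
    unfolding central_idempotent_def sym_simps idem img using a eq by auto
qed

section \<open>Young symmetrisers and Specht modules inside the Brauer algebra\<close>

context
  fixes \<mu> n assumes mu: "\<mu> \<in> partitions n"
begin

interpretation tab n "tab_row \<mu>" "tab_col \<mu>" "rl \<mu>" by (rule tab_partition[OF mu])

lemma sum_stab_reindex:
  "(\<Sum>p\<in>{p. p permutes {..<n} \<and> (\<forall>k<n. f (p k) = f k)}. F p) = (\<Sum>p\<in>stab n f. F (ap p))"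
proof (rule sum.reindex_bij_witness[of _ ap Fp])
  fix p assume p: "p \<in> {p. p permutes {..<n} \<and> (\<forall>k<n. f (p k) = f k)}"
  then have "Fp p \<in> SP {..<n}" "ap (Fp p) = p" using Fp_SP[of "{..<n}" p] by auto
  with p show "ap (Fp p) = p" "Fp p \<in> stab n f" "F (ap (Fp p)) = F p" by (auto simp: stab_def)
next
  fix p assume p: "p \<in> stab n f"
  then show "Fp (ap p) = p" "ap p \<in> {p. p permutes {..<n} \<and> (\<forall>k<n. f (p k) = f k)}"
    by (auto simp: stab_def SP_permutes ap_inverse)
qed

lemma young_symmetriser_iota: "young_symmetriser \<mu> = iota n c"
proof -
  have n: "sum_list \<mu> = n" using sum_list_partitions[OF mu] .
  have "(\<Sum>p\<in>row_group \<mu>. perm_elt n p) = iota n A"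
    unfolding row_group_def n sum_stab_reindex A_def stabsum_def iota_sum
    by (rule sum.cong) (auto simp: stab_SP iota_gp)
  moreover have "(\<Sum>q\<in>col_group \<mu>. scale_elt (of_int (sign q)) (perm_elt n q)) = iota n B"
    unfolding col_group_def n sum_stab_reindex B_def stabsum_def iota_sum iota_sc
    by (rule sum.cong) (auto simp: stab_SP iota_gp sg_def)
  ultimately show ?thesis unfolding young_symmetriser_def n sym_simps by (simp add: iota_mult c_def)
qed

lemma specht_iota: "specht \<mu> = (\<lambda>a. iota n (a * c)) ` CS {..<n}"
proof -
  have "specht \<mu> = {bm n 1 x (iota n c) |x. x \<in> carrier (sym_algebra n)}"
    unfolding specht_def sum_list_partitions[OF mu] young_symmetriser_iota sym_simps ..
  also have "\<dots> = (\<lambda>a. iota n (a * c)) ` CS {..<n}"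
    unfolding sym_carrier by (auto simp: iota_mult image_iff intro!: exI)
  finally show ?thesis .
qed

text \<open>The description by \<open>THE\<close> is met and met only once by
  \<open>z_primitive\<close> and \<open>z_unique\<close>, transported along
  \<open>iota\<close>.\<close>

lemma central_young_symmetriser_iota: "central_young_symmetriser \<mu> = iota n (zz \<mu>)"
  unfolding central_young_symmetriser_def sum_list_partitions[OF mu]
proof (rule the_equality)
  let ?R = "sym_algebra n"
  have prim: "u = 0 \<or> v = 0" if "central_idempotent ?R u" "central_idempotent ?R v" "bm n 1 u v = 0" "iota n z = u + v" for u v
  proof -
    have "u \<in> carrier ?R" "v \<in> carrier ?R" using that(1,2) by (auto simp: central_idempotent_def)
    then obtain a b where ab: "a \<in> CS {..<n}" "b \<in> CS {..<n}" "u = iota n a" "v = iota n b"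
      unfolding sym_carrier by blast
    have "a * b = 0" using that(3) ab by (simp add: iota_mult iota_eq_0 CS_mult)
    moreover have "z = a + b" using that(4) ab by (intro iota_inj[of _ n]) (auto simp: iota_add CS_add)
    moreover have "a * a = a" "\<And>x. x \<in> CS {..<n} \<Longrightarrow> x * a = a * x"
      using that(1) unfolding ab central_idempotent_iota[OF ab(1)] by blast+
    moreover have "b * b = b" "\<And>x. x \<in> CS {..<n} \<Longrightarrow> x * b = b * x"
      using that(2) unfolding ab central_idempotent_iota[OF ab(2)] by blast+
    ultimately have "a = 0 \<or> b = 0" using z_primitive[of a b] ab(1,2) by blast
    then show ?thesis using ab by auto
  qed
  have "central_idempotent ?R (iota n z)"
    unfolding central_idempotent_iota[OF z_CS] using z_idem z_commute by blast
  then have "primitive_central_idempotent ?R (iota n z)"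
    unfolding primitive_central_idempotent_def sym_simps using prim iota_eq_0[OF z_CS] z_nonzero by blast
  moreover have "bm n 1 (iota n z) x = x" if x: "x \<in> specht \<mu>" for x
  proof -
    obtain a where a: "a \<in> CS {..<n}" "x = iota n (a * c)" using x unfolding specht_iota by blast
    have "z * (a * c) = a * (z * c)" using z_commute[OF a(1)] by (simp flip: mult.assoc)
    then show ?thesis using a by (simp add: iota_mult CS_mult z_c)
  qed
  ultimately show "primitive_central_idempotent ?R (iota n (zz \<mu>)) \<and>
      (\<forall>x\<in>specht \<mu>. iota n (zz \<mu>) \<otimes>\<^bsub>?R\<^esub> x = x)"
    unfolding zz_z[OF mu] sym_simps by blast
next
  let ?R = "sym_algebra n"
  fix w' assume w': "primitive_central_idempotent ?R w' \<and> (\<forall>x\<in>specht \<mu>. w' \<otimes>\<^bsub>?R\<^esub> x = x)"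
  then have ci: "central_idempotent ?R w'" by (simp add: primitive_central_idempotent_def)
  then have "w' \<in> carrier ?R" by (simp add: central_idempotent_def)
  then obtain w where w: "w \<in> CS {..<n}" "w' = iota n w" unfolding sym_carrier by blast
  have "w = z"
  proof (rule z_unique)
    show "w * w = w" "\<And>x. x \<in> CS {..<n} \<Longrightarrow> x * w = w * x"
      using ci unfolding w(2) central_idempotent_iota[OF w(1)] by blast+
    have "iota n (1 * c) \<in> specht \<mu>" unfolding specht_iota by (intro imageI) simp
    then have "bm n 1 (iota n w) (iota n (1 * c)) = iota n (1 * c)" using w' w sym_simps by metis
    then have "iota n (w * c) = iota n c" using w by (simp add: iota_mult)
    then show "w * c = c" using w by (intro iota_inj[of _ n]) (auto intro: CS_mult)
    fix u v assume uv: "u \<in> CS {..<n}" "v \<in> CS {..<n}"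
      "\<And>x. x \<in> CS {..<n} \<Longrightarrow> x * u = u * x" "\<And>x. x \<in> CS {..<n} \<Longrightarrow> x * v = v * x"
      "u * u = u" "v * v = v" "u * v = 0" "w = u + v"
    have "central_idempotent ?R (iota n u)" "central_idempotent ?R (iota n v)"
      unfolding central_idempotent_iota[OF uv(1)] central_idempotent_iota[OF uv(2)] using uv(3-6) by blast+
    moreover have "bm n 1 (iota n u) (iota n v) = 0" "w' = iota n u + iota n v"
      using uv(1,2,7,8) w(2) by (simp_all add: iota_mult iota_add)
    ultimately have "iota n u = 0 \<or> iota n v = 0"
      using w' unfolding primitive_central_idempotent_def sym_simps by blast
    then show "u = 0 \<or> v = 0" using uv(1,2) by (simp add: iota_eq_0)
  qed (fact w(1))
  then show "w' = iota n (zz \<mu>)" using w zz_z[OF mu] by simp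
qed

end

section \<open>Littlewood--Richardson coefficients\<close>

text \<open>Induction on the functionals: the kernel of one of them in S is either S or a complement
  of a line.\<close>

lemma (in vector_space) finite_generation:
  assumes "finite \<Phi>" "subspace S"
    and lin: "\<And>\<phi> x y. \<phi> \<in> \<Phi> \<Longrightarrow> \<phi> (x + y) = \<phi> x + \<phi> y" "\<And>\<phi> c x. \<phi> \<in> \<Phi> \<Longrightarrow> \<phi> (scale c x) = c * \<phi> x"
    and sep: "\<And>x. x \<in> S \<Longrightarrow> (\<And>\<phi>. \<phi> \<in> \<Phi> \<Longrightarrow> \<phi> x = 0) \<Longrightarrow> x = 0"
  shows "\<exists>B\<subseteq>S. finite B \<and> S \<subseteq> span B"
  using assms
proof (induction \<Phi> arbitrary: S rule: finite_induct)
  case empty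
  then show ?case by (intro exI[of _ "{}"]) auto
next
  case (insert \<phi> \<Phi>)
  note lin = insert.prems(2,3)
  define S' where "S' = {x \<in> S. \<phi> x = 0}"
  have sub: "subspace S'"
    using insert.prems(1) lin[of \<phi>] lin(2)[of \<phi> 0] by (auto simp: S'_def subspace_def)
  have "\<exists>B\<subseteq>S'. finite B \<and> S' \<subseteq> span B"
  proof (rule insert.IH[OF sub])
    fix x assume "x \<in> S'" "\<And>\<psi>. \<psi> \<in> \<Phi> \<Longrightarrow> \<psi> x = 0"
    then show "x = 0" using insert.prems(4)[of x] by (auto simp: S'_def)
  qed (use lin in auto)
  then obtain B where B: "B \<subseteq> S'" "finite B" "S' \<subseteq> span B" by blast
  show ?case
  proof (cases "S = S'")
    case True with B show ?thesis by blast
  next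
    case False
    then obtain v where v: "v \<in> S" "\<phi> v \<noteq> 0" by (auto simp: S'_def)
    have "x \<in> span (insert v B)" if x: "x \<in> S" for x
    proof -
      let ?y = "x - scale (\<phi> x / \<phi> v) v"
      have "?y \<in> S" using insert.prems(1) x v by (intro subspace_diff subspace_scale)
      moreover have "\<phi> (?y + scale (\<phi> x / \<phi> v) v) = \<phi> ?y + \<phi> x / \<phi> v * \<phi> v"
        using lin[of \<phi>] by (simp only: insertI1)
      then have "\<phi> ?y = 0" using v(2) by simp
      ultimately have "?y \<in> span B" using B(3) by (auto simp: S'_def)
      then show ?thesis unfolding span_insert by blast
    qed
    then show ?thesis using B v by (intro exI[of _ "insert v B"]) (auto simp: S'_def)
  qed
qed

text \<open>\<open>dim\<close> is the \<open>card\<close> of a basis, which would be 0 for an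
  infinite one; hence the finite spanning set among the hypotheses.\<close>

lemma (in vector_space) dim_nonzero:
  assumes "finite T" "S \<subseteq> span T" "v \<in> S" "v \<noteq> 0" shows "dim S \<noteq> 0"
proof
  assume "dim S = 0"
  obtain B where B: "B \<subseteq> S" "independent B" "S \<subseteq> span B" "card B = dim S" using basis_exists .
  have "finite B" using independent_span_bound[OF assms(1) B(2)] B(1) assms(2) by blast
  then have "B = {}" using B(4) \<open>dim S = 0\<close> by simp
  then show False using B(3) assms(3,4) by auto
qed

text \<open>For n = m + l, conjugation with this rotation carries the permutations of the first l
  places to the block starting at m, the second factor of the Young subgroup.\<close>

definition rot :: "nat \<Rightarrow> nat \<Rightarrow> fperm" where
  "rot n m = Fp (\<lambda>i. if i < n then (i + m) mod n else i)"

lemma rot: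
  assumes "m \<le> n"
  shows "rot n m \<in> SP {..<n}" "i + m < n \<Longrightarrow> ap (rot n m) i = i + m" "ap (- rot n m) = ap (rot n (n - m))"
proof -
  define r where "r m i = (if i < n then (i + m) mod n else i)" for m i
  have rr: "r (n - m) (r m i) = i" if "m \<le> n" for m i
  proof (cases "i < n")
    case True
    then have "(i + m) mod n < n" by (intro mod_less_divisor) auto
    moreover have "((i + m) mod n + (n - m)) mod n = (i + m + (n - m)) mod n" by (simp add: mod_add_left_eq)
    ultimately show ?thesis using True that by (simp add: r_def)
  qed (simp add: r_def)
  have perm: "r m permutes {..<n}" if "m \<le> n" for m
  proof (rule bij_imp_permutes)
    show "bij_betw (r m) {..<n} {..<n}"
    proof (rule bij_betwI[of _ _ _ "r (n - m)"])
      show "r m \<in> {..<n} \<rightarrow> {..<n}" "r (n - m) \<in> {..<n} \<rightarrow> {..<n}" by (auto simp: r_def)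
      show "r (n - m) (r m x) = x" "r m (r (n - m) x) = x" for x
        using rr[of m x] rr[of "n - m" x] that by simp_all
    qed
  qed (simp add: r_def)
  have Fr: "ap (rot n m) = r m" if "m \<le> n" for m
    using Fp_SP[OF _ perm[OF that]] by (simp add: rot_def r_def[abs_def])
  show "rot n m \<in> SP {..<n}" using Fp_SP[OF _ perm[OF assms]] by (simp add: rot_def r_def[abs_def])
  show "ap (rot n m) i = i + m" if "i + m < n" using that Fr[OF assms] by (simp add: r_def)
  show "ap (- rot n m) = ap (rot n (n - m))"
  proof
    fix i
    have "ap (rot n m) (ap (rot n (n - m)) i) = i"
      using rr[of "n - m" i] assms Fr[OF assms] Fr[of "n - m"] by simp
    then show "ap (- rot n m) i = ap (rot n (n - m)) i" by (metis ap_uminus(1))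
  qed
qed

lemma rot_uminus: "m \<le> n \<Longrightarrow> - rot n m = rot n (n - m)"
  by (rule fperm_eqI) (simp add: rot(3))

lemma rot_conj:
  assumes q: "q \<in> SP {..<l}"
  shows "k < l \<Longrightarrow> ap (rot (m + l) m + q + - rot (m + l) m) (m + k) = m + ap q k"
    "i < m \<or> m + l \<le> i \<Longrightarrow> ap (rot (m + l) m + q + - rot (m + l) m) i = i"
proof -
  let ?r = "rot (m + l) m"
  have r: "ap ?r k = m + k" if "k < l" for k using rot(2)[of m "m + l" k] that by simp
  have r': "ap (- ?r) (m + k) = k" if "k < l" for k using r[OF that] by (metis ap_uminus(1))
  show "ap (?r + q + - ?r) (m + k) = m + ap q k" if "k < l"
    using r[of "ap q k"] r'[OF that] q that by (simp del: add_uminus_conv_diff)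
  assume i: "i < m \<or> m + l \<le> i"
  have "\<not> ap (- ?r) i < l"
  proof
    assume "ap (- ?r) i < l"
    from r[OF this] i this show False by simp
  qed
  then show "ap (?r + q + - ?r) i = i" using q by (simp del: add_uminus_conv_diff)
qed

lemma rot_conj_SP: "q \<in> SP {..<l} \<Longrightarrow> rot (m + l) m + q + - rot (m + l) m \<in> SP {m..<m + l}"
  by (rule SP_I) (use rot_conj(2)[of q l] in auto)

lemma rot_conj_CS:
  assumes "a \<in> CS {..<l}" shows "gp (rot (m + l) m) * a * gp (- rot (m + l) m) \<in> CS {m..<m + l}"
  using assms finite_lessThan
proof (induction rule: CS_induct)
  case (single c q)
  have "gp (rot (m + l) m) * (sc c * gp q) * gp (- rot (m + l) m) = sc c * gp (rot (m + l) m + q + - rot (m + l) m)"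
    by (simp only: sc_left_commute[of "gp _"] mult.assoc gp_mult add.assoc)
  then show ?case using rot_conj_SP[OF single] by (simp add: CS_mult del: add_uminus_conv_diff)
qed (auto simp: algebra_simps intro: CS_add)

lemma juxtapose_ap:
  assumes "p \<in> SP {..<m}" "q \<in> SP {..<l}"
  shows "juxtapose m l (ap p) (ap q) = ap (p + (rot (m + l) m + q + - rot (m + l) m))"
proof
  fix i
  let ?s = "rot (m + l) m + q + - rot (m + l) m"
  consider "i < m" | k where "i = m + k" "k < l" | "m + l \<le> i" by (metis le_add_diff_inverse nat_add_left_cancel_less not_le)
  then show "juxtapose m l (ap p) (ap q) i = ap (p + ?s) i"
  proof cases
    case 1
    then have "ap ?s i = i" using rot_conj(2)[OF assms(2)] by blast
    with 1 show ?thesis by (simp add: juxtapose_def ap_plus del: add_uminus_conv_diff ap_plus_apply)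
  next
    case 2
    then have "ap ?s i = m + ap q k" using rot_conj(1)[OF assms(2)] by blast
    moreover have "ap p (m + ap q k) = m + ap q k" using assms(1) by simp
    ultimately show ?thesis using 2 by (simp add: juxtapose_def ap_plus del: add_uminus_conv_diff ap_plus_apply)
  next
    case 3
    then have "ap ?s i = i" using rot_conj(2)[OF assms(2)] by blast
    moreover have "ap p i = i" using assms(1) 3 by simp
    ultimately show ?thesis using 3 by (simp add: juxtapose_def ap_plus del: add_uminus_conv_diff ap_plus_apply)
  qed
qed

text \<open>The map sending X and Y to X sh(Y) w c is equivariant for each w, because elements of
  the two blocks commute. The nonzero product of idempotents provides a w for which it does not
  vanish at the pair of Young symmetrisers.\<close>

lemma lr_coeff_nonzero:
  assumes nu: "\<nu> \<in> partitions m" and ka: "\<kappa> \<in> partitions l" and mu: "\<mu> \<in> partitions (m + l)"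
    and nz: "zz \<nu> * (gp (rot (m + l) m) * zz \<kappa> * gp (- rot (m + l) m)) * zz \<mu> \<noteq> 0"
  shows "lr_coeff \<mu> \<nu> \<kappa> \<noteq> 0"
proof -
  let ?n = "m + l" and ?r = "rot (m + l) m"
  interpret N: tab m "tab_row \<nu>" "tab_col \<nu>" "rl \<nu>" by (rule tab_partition[OF nu])
  interpret K: tab l "tab_row \<kappa>" "tab_col \<kappa>" "rl \<kappa>" by (rule tab_partition[OF ka])
  interpret M: tab ?n "tab_row \<mu>" "tab_col \<mu>" "rl \<mu>" by (rule tab_partition[OF mu])
  have nsum: "sum_list \<nu> = m" "sum_list \<kappa> = l" "sum_list \<mu> = ?n"
    using sum_list_partitions nu ka mu by auto
  define sh where "sh a = gp ?r * a * gp (- ?r)" for a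
  have r: "?r \<in> SP {..<?n}" by (rule rot(1)) simp
  have up1: "a \<in> CS {..<?n}" if "a \<in> CS {..<m}" for a using CS_mono[OF that, of "{..<?n}"] by simp
  have up2: "sh a \<in> CS {..<?n}" if "a \<in> CS {..<l}" for a
    using CS_mono[OF that, of "{..<?n}"] r by (simp add: sh_def CS_mult)
  have sh_mult: "sh (a * b) = sh a * sh b" for a b by (simp add: sh_def mult.assoc)
  have sh_add: "sh (a + b) = sh a + sh b" for a b by (simp add: sh_def algebra_simps)
  have sh_sc: "sh (sc c * a) = sc c * sh a" for c a
    by (simp only: sh_def sc_left_commute[of "gp _"] mult.assoc)
  have comm: "a * sh b = sh b * a" if "a \<in> CS {..<m}" "b \<in> CS {..<l}" for a b
  proof -
    have "{..<m} \<inter> {m..<m + l} = {}" by auto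
    from CS_disjoint_commute[OF that(1) rot_conj_CS[OF that(2), of m] this] show ?thesis by (simp add: sh_def)
  qed
  have "zz \<nu> * sh (zz \<kappa>) * M.z \<noteq> 0" using nz by (simp add: sh_def zz_z[OF mu])
  then obtain g where g: "g \<in> SP {..<?n}" "N.z * sh K.z * gp g * M.c \<noteq> 0"
    using M.mult_z_nonzero[of "zz \<nu> * sh (zz \<kappa>)"] by (auto simp: zz_z[OF nu] zz_z[OF ka])
  \<comment> \<open>Otherwise all products of conjugates of the two symmetrisers would vanish on the
    right part, and with them the product of the idempotents.\<close>
  have "\<exists>w\<in>CS {..<?n}. N.c * (sh K.c * (w * M.c)) \<noteq> 0"
  proof (rule ccontr)
    assume *: "\<not> ?thesis"
    have shY: "sh K.Y = (\<Sum>k\<in>SP {..<l}. sh (gp k) * sh K.c * sh (gp (- k)))"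
      by (simp add: K.Y_def sh_def sum_distrib_left sum_distrib_right mult.assoc)
    have trm: "gp h * N.c * gp (- h) * (sh (gp k) * sh K.c * sh (gp (- k))) * gp g * M.c = 0"
      if h: "h \<in> SP {..<m}" and k: "k \<in> SP {..<l}" for h k
    proof -
      have c1: "gp (- h) * sh (gp k) = sh (gp k) * gp (- h)" using h k by (intro comm) auto
      have c2: "gp (- h) * sh K.c = sh K.c * gp (- h)" using h by (intro comm) auto
      have c3: "N.c * sh (gp k) = sh (gp k) * N.c" using k by (intro comm) auto
      have "gp h * N.c * gp (- h) * (sh (gp k) * sh K.c * sh (gp (- k))) * gp g * M.c =
          gp h * N.c * (gp (- h) * sh (gp k)) * sh K.c * sh (gp (- k)) * gp g * M.c" by (simp only: mult.assoc)
      also have "\<dots> = gp h * (N.c * sh (gp k)) * (gp (- h) * sh K.c) * sh (gp (- k)) * gp g * M.c"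
        by (simp only: c1 mult.assoc)
      also have "\<dots> = gp h * sh (gp k) * (N.c * (sh K.c * ((gp (- h) * sh (gp (- k)) * gp g) * M.c)))"
        by (simp only: c2 c3 mult.assoc)
      also have "gp (- h) * sh (gp (- k)) * gp g \<in> CS {..<?n}"
        using h k g(1) up1[of "gp (- h)"] up2[of "gp (- k)"] by (simp add: CS_mult)
      then have "N.c * (sh K.c * ((gp (- h) * sh (gp (- k)) * gp g) * M.c)) = 0" using * by blast
      finally show ?thesis by simp
    qed
    have "N.Y * sh K.Y * gp g * M.c = (\<Sum>h\<in>SP {..<m}. \<Sum>k\<in>SP {..<l}.
        gp h * N.c * gp (- h) * (sh (gp k) * sh K.c * sh (gp (- k))) * gp g * M.c)"
      unfolding shY N.Y_def sum_distrib_left sum_distrib_right by (rule sum.swap)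
    also have "\<dots> = 0" using trm by (intro sum.neutral ballI) blast
    finally have "N.Y * sh K.Y * gp g * M.c = 0" .
    then have "N.z * sh K.z * gp g * M.c = 0"
      by (simp add: N.z_def K.z_def sh_sc sc_left_commute[of N.Y] mult.assoc)
    with g(2) show False by simp
  qed
  then obtain w where w: "w \<in> CS {..<?n}" "N.c * (sh K.c * (w * M.c)) \<noteq> 0" by blast
  define \<beta> where "\<beta> X Y = (if X \<in> specht \<nu> \<and> Y \<in> specht \<kappa>
     then iota ?n (coef m X * (sh (coef l Y) * (w * M.c))) else 0)" for X Y
  note sp = specht_iota[OF nu] specht_iota[OF ka] specht_iota[OF mu]
  have sp_add: "X + X' \<in> specht \<rho>" if h: "\<rho> \<in> partitions k" "X \<in> specht \<rho>" "X' \<in> specht \<rho>" for X X' \<rho> k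
  proof -
    obtain a b where "a \<in> CS {..<k}" "b \<in> CS {..<k}" "X = iota k (a * tab.c k (tab_row \<rho>) (tab_col \<rho>))"
      "X' = iota k (b * tab.c k (tab_row \<rho>) (tab_col \<rho>))" using h(2,3) unfolding specht_iota[OF h(1)] by blast
    then have "X + X' = iota k ((a + b) * tab.c k (tab_row \<rho>) (tab_col \<rho>))" "a + b \<in> CS {..<k}"
      by (simp_all add: distrib_right iota_add CS_add)
    then show ?thesis unfolding specht_iota[OF h(1)] by blast
  qed
  have sp_scale: "scale_elt t X \<in> specht \<rho>" if h: "\<rho> \<in> partitions k" "X \<in> specht \<rho>" for X \<rho> k t
  proof -
    obtain a where "a \<in> CS {..<k}" "X = iota k (a * tab.c k (tab_row \<rho>) (tab_col \<rho>))"
      using h(2) unfolding specht_iota[OF h(1)] by blast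
    then have "scale_elt t X = iota k ((sc t * a) * tab.c k (tab_row \<rho>) (tab_col \<rho>))" "sc t * a \<in> CS {..<k}"
      by (simp_all add: iota_sc mult.assoc CS_mult)
    then show ?thesis unfolding specht_iota[OF h(1)] by blast
  qed
  have sp_act: "bm k 1 (perm_elt k p) X \<in> specht \<rho> \<and> coef k (bm k 1 (perm_elt k p) X) = gp (Fp p) * coef k X"
    if h: "\<rho> \<in> partitions k" "X \<in> specht \<rho>" "p permutes {..<k}" for X \<rho> k p
  proof -
    interpret T: tab k "tab_row \<rho>" "tab_col \<rho>" "rl \<rho>" by (rule tab_partition[OF h(1)])
    obtain a where a: "a \<in> CS {..<k}" "X = iota k (a * T.c)"
      using h(2) unfolding specht_iota[OF h(1)] by blast
    have p: "Fp p \<in> SP {..<k}" "ap (Fp p) = p" using Fp_SP[OF _ h(3)] by auto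
    have "bm k 1 (perm_elt k p) X = bm k 1 (iota k (gp (Fp p))) (iota k (a * T.c))"
      using p a by (simp add: iota_gp)
    also have "\<dots> = iota k (gp (Fp p) * (a * T.c))" using p a by (intro iota_mult CS_mult) auto
    finally have *: "bm k 1 (perm_elt k p) X = iota k ((gp (Fp p) * a) * T.c)" by (simp add: mult.assoc)
    moreover have "gp (Fp p) * a \<in> CS {..<k}" using p a by (simp add: CS_mult)
    ultimately have "bm k 1 (perm_elt k p) X \<in> specht \<rho>" unfolding specht_iota[OF h(1)] by blast
    moreover have "coef k (bm k 1 (perm_elt k p) X) = gp (Fp p) * coef k X"
    proof -
      have "coef k (bm k 1 (perm_elt k p) X) = gp (Fp p) * a * T.c"
        unfolding * using p a(1) by (intro coef_iota CS_mult) simp_all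
      moreover have "coef k X = a * T.c" unfolding a(2) using a(1) by (intro coef_iota CS_mult) simp_all
      ultimately show ?thesis by (simp only: mult.assoc)
    qed
    ultimately show ?thesis ..
  qed
  have \<beta>: "\<beta> \<in> lr_homs \<mu> \<nu> \<kappa>"
    unfolding lr_homs_def nsum sym_simps
  proof (intro CollectI conjI allI ballI impI)
    show "\<beta> x y = 0" if "x \<notin> specht \<nu> \<or> y \<notin> specht \<kappa>" for x y using that by (auto simp: \<beta>_def)
    show "\<beta> x y \<in> specht \<mu>" if "x \<in> specht \<nu>" "y \<in> specht \<kappa>" for x y
    proof -
      have "\<beta> x y = iota ?n ((coef m x * sh (coef l y) * w) * M.c)" using that by (simp add: \<beta>_def mult.assoc)
      moreover have "coef m x * sh (coef l y) * w \<in> CS {..<?n}" using up1[of "coef m x"] up2[of "coef l y"] w(1) by (simp add: CS_mult)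
      ultimately show ?thesis unfolding sp by blast
    qed
    show "\<beta> (x + x') y = \<beta> x y + \<beta> x' y" if "x \<in> specht \<nu>" "x' \<in> specht \<nu>" "y \<in> specht \<kappa>" for x x' y
      using that sp_add[OF nu that(1,2)] by (simp only: \<beta>_def simp_thms if_True coef_add distrib_right iota_add)
    show "\<beta> x (y + y') = \<beta> x y + \<beta> x y'" if "x \<in> specht \<nu>" "y \<in> specht \<kappa>" "y' \<in> specht \<kappa>" for x y y'
      using that sp_add[OF ka that(2,3)]
      by (simp only: \<beta>_def simp_thms if_True coef_add sh_add distrib_left distrib_right iota_add)
    show "\<beta> (scale_elt t x) y = scale_elt t (\<beta> x y)" if "x \<in> specht \<nu>" "y \<in> specht \<kappa>" for t x y
      using that sp_scale[OF nu that(1), of t] by (simp only: \<beta>_def simp_thms if_True coef_scale mult.assoc iota_sc)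
    show "\<beta> x (scale_elt t y) = scale_elt t (\<beta> x y)" if "x \<in> specht \<nu>" "y \<in> specht \<kappa>" for t x y
      using that sp_scale[OF ka that(2), of t]
      by (simp only: \<beta>_def simp_thms if_True coef_scale sh_sc sc_left_commute[of "coef m x"] mult.assoc iota_sc)
    show "\<beta> (bm m 1 (perm_elt m p) x) (bm l 1 (perm_elt l q) y) =
        bm ?n 1 (perm_elt ?n (juxtapose m l p q)) (\<beta> x y)"
      if pq: "p permutes {..<m} \<and> q permutes {..<l}" and x: "x \<in> specht \<nu>" and y: "y \<in> specht \<kappa>" for p q x y
    proof -
      have p: "Fp p \<in> SP {..<m}" "ap (Fp p) = p" and q: "Fp q \<in> SP {..<l}" "ap (Fp q) = q"
        using pq Fp_SP[of "{..<m}" p] Fp_SP[of "{..<l}" q] by auto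
      let ?s = "Fp p + (?r + Fp q + - ?r)"
      have s: "?s \<in> SP {..<?n}"
        using SP_mono[OF p(1), of "{..<?n}"] SP_mono[OF q(1), of "{..<?n}"] r
        by (simp add: SP_plus del: add_uminus_conv_diff)
      have gs: "gp ?s = gp (Fp p) * sh (gp (Fp q))" by (simp only: sh_def gp_mult add.assoc)
      have "perm_elt ?n (juxtapose m l p q) = iota ?n (gp ?s)"
        using juxtapose_ap[OF p(1) q(1)] p(2) q(2) iota_gp[OF s] by simp
      then have "bm ?n 1 (perm_elt ?n (juxtapose m l p q)) (\<beta> x y) =
          bm ?n 1 (iota ?n (gp ?s)) (iota ?n (coef m x * (sh (coef l y) * (w * M.c))))"
        using x y by (simp add: \<beta>_def)
      also have "\<dots> = iota ?n (gp ?s * (coef m x * (sh (coef l y) * (w * M.c))))"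
        using s up1[of "coef m x"] up2[of "coef l y"] w(1) by (intro iota_mult) (simp_all add: CS_mult)
      also have "gp ?s * (coef m x * (sh (coef l y) * (w * M.c))) =
          gp (Fp p) * coef m x * (sh (gp (Fp q) * coef l y) * (w * M.c))"
        using comm[of "coef m x" "gp (Fp q)"] q(1) unfolding gs sh_mult
        by (simp add: mult.assoc) (simp flip: mult.assoc)
      finally show ?thesis
        using sp_act[OF nu x, of p] sp_act[OF ka y, of q] pq x y by (simp add: \<beta>_def)
    qed
  qed
  have cN: "iota m N.c \<in> specht \<nu>" "iota l K.c \<in> specht \<kappa>"
    unfolding sp by (auto intro!: image_eqI[of _ _ 1])
  have "\<beta> (iota m N.c) (iota l K.c) = iota ?n (N.c * (sh K.c * (w * M.c)))"
    using cN by (simp add: \<beta>_def coef_iota)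
  then have nz': "\<beta> (iota m N.c) (iota l K.c) \<noteq> 0"
    using w iota_eq_0[of "N.c * (sh K.c * (w * M.c))" ?n] by (simp add: CS_mult up1 up2)
  let ?sc = "\<lambda>c (\<beta> :: brauer \<Rightarrow> brauer \<Rightarrow> brauer) x y. scale_elt c (\<beta> x y)"
  interpret V: vector_space ?sc
    by unfold_locales (auto simp: fun_eq_iff scale_elt_def algebra_simps)
  \<comment> \<open>Coefficients of the values at translates of the symmetrisers. The translates
    span the Specht modules, so these finitely many functionals separate the equivariant
    maps.\<close>
  let ?ev = "\<lambda>(p, q, d) (\<beta> :: brauer \<Rightarrow> brauer \<Rightarrow> brauer). \<beta> (iota m (gp p * N.c)) (iota l (gp q * K.c)) d"
  let ?\<Phi> = "?ev ` (SP {..<m} \<times> SP {..<l} \<times> diagrams ?n)"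
  have "\<exists>B\<subseteq>lr_homs \<mu> \<nu> \<kappa>. finite B \<and> lr_homs \<mu> \<nu> \<kappa> \<subseteq> V.span B"
  proof (rule V.finite_generation[of ?\<Phi>])
    show "finite ?\<Phi>" by simp
    show "V.subspace (lr_homs \<mu> \<nu> \<kappa>)"
    proof (rule V.subspaceI)
      have "iota ?n (0 * M.c) \<in> specht \<mu>" unfolding sp by (intro imageI) simp
      then have z: "0 \<in> specht \<mu>" by simp
      show "0 \<in> lr_homs \<mu> \<nu> \<kappa>"
        unfolding lr_homs_def nsum sym_simps by (simp add: z scale_elt_simps bm_zero_right)
      fix \<gamma> assume \<gamma>: "\<gamma> \<in> lr_homs \<mu> \<nu> \<kappa>"
      show "?sc t \<gamma> \<in> lr_homs \<mu> \<nu> \<kappa>" for t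
        using \<gamma> sp_scale[OF mu, of _ t] unfolding lr_homs_def nsum sym_simps
        by (simp add: scale_elt_simps bm_scale_right mult.commute[of t])
      fix \<gamma>' assume "\<gamma>' \<in> lr_homs \<mu> \<nu> \<kappa>"
      with \<gamma> show "\<gamma> + \<gamma>' \<in> lr_homs \<mu> \<nu> \<kappa>"
        using sp_add[OF mu] unfolding lr_homs_def nsum sym_simps
        by (simp add: scale_elt_simps bm_add_right add_ac)
    qed
    show "\<phi> (x + y) = \<phi> x + \<phi> y" if "\<phi> \<in> ?\<Phi>" for \<phi> x y using that by auto
    show "\<phi> (\<lambda>xa y. scale_elt c (x xa y)) = c * \<phi> x" if "\<phi> \<in> ?\<Phi>" for \<phi> x c
      using that by (auto simp: scale_elt_def)
    fix \<gamma> assume \<gamma>: "\<gamma> \<in> lr_homs \<mu> \<nu> \<kappa>" and zero: "\<And>\<phi>. \<phi> \<in> ?\<Phi> \<Longrightarrow> \<phi> \<gamma> = 0"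
    have \<gamma>D: "\<And>x y. x \<notin> specht \<nu> \<or> y \<notin> specht \<kappa> \<Longrightarrow> \<gamma> x y = 0"
      "\<And>x y. x \<in> specht \<nu> \<Longrightarrow> y \<in> specht \<kappa> \<Longrightarrow> \<gamma> x y \<in> specht \<mu>"
      "\<And>x x' y. x \<in> specht \<nu> \<Longrightarrow> x' \<in> specht \<nu> \<Longrightarrow> y \<in> specht \<kappa> \<Longrightarrow> \<gamma> (x + x') y = \<gamma> x y + \<gamma> x' y"
      "\<And>x y y'. x \<in> specht \<nu> \<Longrightarrow> y \<in> specht \<kappa> \<Longrightarrow> y' \<in> specht \<kappa> \<Longrightarrow> \<gamma> x (y + y') = \<gamma> x y + \<gamma> x y'"
      "\<And>t x y. x \<in> specht \<nu> \<Longrightarrow> y \<in> specht \<kappa> \<Longrightarrow> \<gamma> (scale_elt t x) y = scale_elt t (\<gamma> x y)"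
      "\<And>t x y. x \<in> specht \<nu> \<Longrightarrow> y \<in> specht \<kappa> \<Longrightarrow> \<gamma> x (scale_elt t y) = scale_elt t (\<gamma> x y)"
      using \<gamma> unfolding lr_homs_def by blast+
    have spI: "a \<in> CS {..<m} \<Longrightarrow> iota m (a * N.c) \<in> specht \<nu>" "b \<in> CS {..<l} \<Longrightarrow> iota l (b * K.c) \<in> specht \<kappa>" for a b
      unfolding sp by (rule imageI, assumption)+
    have base: "\<gamma> (iota m (gp p * N.c)) (iota l (gp q * K.c)) = 0" if pq: "p \<in> SP {..<m}" "q \<in> SP {..<l}" for p q
    proof
      fix d
      have "\<gamma> (iota m (gp p * N.c)) (iota l (gp q * K.c)) \<in> specht \<mu>" using pq by (intro \<gamma>D(2) spI) simp_all
      then have "\<gamma> (iota m (gp p * N.c)) (iota l (gp q * K.c)) \<in> carrier (brauer_algebra ?n 1)"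
        unfolding sp by auto
      then show "\<gamma> (iota m (gp p * N.c)) (iota l (gp q * K.c)) d = 0 d"
      proof (cases "d \<in> diagrams ?n")
        case True
        have "?ev (p, q, d) \<gamma> = 0" by (rule zero, rule imageI) (use pq True in simp)
        then show ?thesis by simp
      qed (simp add: carrier_brauer)
    qed
    have z0: "iota m (0 * N.c) = scale_elt 0 (iota m (1 * N.c))" "iota l (0 * K.c) = scale_elt 0 (iota l (1 * K.c))"
      by (simp_all add: scale_elt_simps)
    have right: "\<gamma> (iota m (gp p * N.c)) (iota l (b * K.c)) = 0" if p: "p \<in> SP {..<m}" and b: "b \<in> CS {..<l}" for p b
    proof -
      define Q where "Q b \<longleftrightarrow> b \<in> CS {..<l} \<and> \<gamma> (iota m (gp p * N.c)) (iota l (b * K.c)) = 0" for b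
      have pC: "iota m (gp p * N.c) \<in> specht \<nu>" using p by (intro spI) simp
      have "Q b"
      proof (rule CS_induct[of b "{..<l}" Q])
        have "\<gamma> (iota m (gp p * N.c)) (iota l (0 * K.c)) = scale_elt 0 (\<gamma> (iota m (gp p * N.c)) (iota l (1 * K.c)))"
          unfolding z0 by (rule \<gamma>D(6)[OF pC spI(2)]) simp
        then show "Q 0" by (simp add: Q_def scale_elt_simps)
        show "Q (a + b)" if "Q a" "Q b" for a b
          using that unfolding Q_def distrib_right iota_add
          by (simp add: \<gamma>D(4)[OF pC spI(2) spI(2)] CS_add)
        show "Q (sc c * gp q)" if q: "q \<in> SP {..<l}" for c q
        proof -
          have "\<gamma> (iota m (gp p * N.c)) (scale_elt c (iota l (gp q * K.c))) = 0"
            using q by (simp add: \<gamma>D(6)[OF pC spI(2)] base[OF p q] scale_elt_simps)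
          then show ?thesis unfolding Q_def mult.assoc iota_sc using q by (simp add: CS_mult)
        qed
      qed (use b in simp_all)
      then show ?thesis by (simp add: Q_def)
    qed
    have all: "\<gamma> (iota m (a * N.c)) (iota l (b * K.c)) = 0" if a: "a \<in> CS {..<m}" and b: "b \<in> CS {..<l}" for a b
    proof -
      define Q where "Q a \<longleftrightarrow> a \<in> CS {..<m} \<and> \<gamma> (iota m (a * N.c)) (iota l (b * K.c)) = 0" for a
      have bC: "iota l (b * K.c) \<in> specht \<kappa>" using b by (rule spI)
      have "Q a"
      proof (rule CS_induct[of a "{..<m}" Q])
        have "\<gamma> (iota m (0 * N.c)) (iota l (b * K.c)) = scale_elt 0 (\<gamma> (iota m (1 * N.c)) (iota l (b * K.c)))"
          unfolding z0 by (rule \<gamma>D(5)[OF spI(1) bC]) simp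
        then show "Q 0" by (simp add: Q_def scale_elt_simps)
        show "Q (a + a')" if "Q a" "Q a'" for a a'
          using that unfolding Q_def distrib_right iota_add
          by (simp add: \<gamma>D(3)[OF spI(1) spI(1) bC] CS_add)
        show "Q (sc c * gp p)" if p: "p \<in> SP {..<m}" for c p
        proof -
          have "\<gamma> (scale_elt c (iota m (gp p * N.c))) (iota l (b * K.c)) = 0"
            using p by (simp add: \<gamma>D(5)[OF spI(1) bC] right[OF p b] scale_elt_simps)
          then show ?thesis unfolding Q_def mult.assoc iota_sc using p by (simp add: CS_mult)
        qed
      qed (use a in simp_all)
      then show ?thesis by (simp add: Q_def)
    qed
    have "\<gamma> x y = 0" for x y
    proof (cases "x \<in> specht \<nu> \<and> y \<in> specht \<kappa>")
      case True
      then obtain a b where "a \<in> CS {..<m}" "b \<in> CS {..<l}" "x = iota m (a * N.c)" "y = iota l (b * K.c)"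
        unfolding sp by blast
      then show ?thesis using all by simp
    next
      case False
      then show ?thesis using \<gamma>D(1) by blast
    qed
    then show "\<gamma> = 0" by (intro ext) simp
  qed
  then obtain B where B: "finite B" "lr_homs \<mu> \<nu> \<kappa> \<subseteq> V.span B" by blast
  have "\<beta> \<noteq> 0" using nz' by auto
  then have "V.dim (lr_homs \<mu> \<nu> \<kappa>) \<noteq> 0" using V.dim_nonzero[OF B \<beta>] by blast
  then show ?thesis unfolding lr_coeff_def nsum by simp
qed


section \<open>Tensors in coordinates\<close>

text \<open>
  Coordinates are taken in a basis whose Gram matrix \<open>g\<close> is real orthogonal. The inverse Gram
  matrix is then \<open>e g\<close>, which makes \<open>e D i j\<close> a nonnegative Hermitian operator.
\<close>

locale tens =
  fixes N :: nat and e :: int and g :: "nat \<Rightarrow> nat \<Rightarrow> complex"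
  assumes N_pos: "1 \<le> N" and e: "e = 1 \<or> e = -1"
    and g_sym: "g b a = of_int e * g a b"
    and g_real: "cnj (g a b) = g a b"
    and g_orth: "a < N \<Longrightarrow> b < N \<Longrightarrow> (\<Sum>c<N. g c a * g c b) = (if a = b then 1 else 0)"
    and g_out: "N \<le> a \<or> N \<le> b \<Longrightarrow> g a b = 0"
begin

lemma ee [simp]: "of_int e * of_int e = (1 :: complex)"
  using e by auto

lemma ee' [simp]: "of_int e * (of_int e * c) = (c :: complex)"
  by (simp flip: mult.assoc)

lemma g_orth': "a < N \<Longrightarrow> b < N \<Longrightarrow> (\<Sum>c<N. g a c * g b c) = (if a = b then 1 else 0)"
proof -
  assume "a < N" "b < N"
  have "(\<Sum>c<N. g a c * g b c) = (\<Sum>c<N. g c a * g c b)"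
    by (rule sum.cong) (simp_all add: g_sym[of _ a] g_sym[of _ b] ac_simps)
  then show ?thesis using g_orth \<open>a < N\<close> \<open>b < N\<close> by simp
qed

text \<open>The operator of d_ij: the double sum is the contraction, and \<open>of_int e * g\<close>
  is the coordinate matrix of the invariant tensor E.\<close>

definition D :: "nat \<Rightarrow> nat \<Rightarrow> ((nat \<Rightarrow> nat) \<Rightarrow> complex) \<Rightarrow> (nat \<Rightarrow> nat) \<Rightarrow> complex" where
  "D i j T = (\<lambda>x. of_int e * g (x i) (x j) * (\<Sum>a<N. \<Sum>b<N. g a b * T (x(i := a, j := b))))"

lemma D_add: "D i j (S + T) = D i j S + D i j T"
  by (rule ext) (simp add: D_def distrib_left sum.distrib)

lemma D_scl: "D i j (scl c T) = scl c (D i j T)"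
  by (rule ext) (simp add: D_def scl_def sum_distrib_left mult.left_commute[of c] mult.assoc)

lemma D_zero [simp]: "D i j 0 = 0"
  by (rule ext) (simp add: D_def)

lemma D_sum: "D i j (sum f A) = (\<Sum>k\<in>A. D i j (f k))"
  using sum_comp_morphism[of "D i j" f A] by (simp add: D_add comp_def)

lemma D_commute: "i \<noteq> j \<Longrightarrow> D i j T = D j i T"
proof
  fix x assume "i \<noteq> j"
  have "(\<Sum>a<N. \<Sum>b<N. g a b * T (x(j := a, i := b))) = (\<Sum>a<N. \<Sum>b<N. g b a * T (x(j := b, i := a)))"
    by (rule sum.swap)
  also have "\<dots> = (\<Sum>a<N. \<Sum>b<N. of_int e * (g a b * T (x(i := a, j := b))))"
    using \<open>i \<noteq> j\<close> by (intro sum.cong refl) (simp add: g_sym[of _ _, symmetric] fun_upd_twist flip: mult.assoc)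
  finally have "(\<Sum>a<N. \<Sum>b<N. g a b * T (x(j := a, i := b))) =
      of_int e * (\<Sum>a<N. \<Sum>b<N. g a b * T (x(i := a, j := b)))"
    by (simp add: sum_distrib_left)
  then show "D i j T x = D j i T x"
    by (simp add: D_def g_sym[of "x j" "x i"] ac_simps)
qed

lemma act_D: "act e (gp p) (D i j T) = D (ap p i) (ap p j) (act e (gp p) T)"
proof
  fix x
  show "act e (gp p) (D i j T) x = D (ap p i) (ap p j) (act e (gp p) T) x"
    by (simp add: act_gp D_def fun_upd_comp_ap sum_distrib_left ac_simps)
qed

lemma D_act: "D i j (act e (gp p) T) = act e (gp p) (D (ap (- p) i) (ap (- p) j) T)"
  by (simp add: act_D)

lemma D_idem: "i \<noteq> j \<Longrightarrow> D i j (D i j T) = scl (of_int e * of_nat N) (D i j T)"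
proof
  fix x assume "i \<noteq> j"
  define s where "s = (\<Sum>c<N. \<Sum>d<N. g c d * T (x(i := c, j := d)))"
  have "D i j T (x(i := a, j := b)) = of_int e * g a b * s" for a b
    using \<open>i \<noteq> j\<close> by (simp add: D_def s_def fun_upd_twist)
  then have "D i j (D i j T) x = of_int e * g (x i) (x j) * (\<Sum>a<N. \<Sum>b<N. g a b * g a b * (of_int e * s))"
    by (simp add: D_def[of i j "D i j T"] ac_simps)
  also have "(\<Sum>a<N. \<Sum>b<N. g a b * g a b * (of_int e * s)) = (\<Sum>a<N. \<Sum>b<N. g a b * g a b) * (of_int e * s)"
    by (simp add: sum_distrib_right)
  also have "(\<Sum>a<N. \<Sum>b<N. g a b * g a b) = (\<Sum>a<N. 1)"
    by (rule sum.cong) (use g_orth' in auto)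
  finally show "D i j (D i j T) x = scl (of_int e * of_nat N) (D i j T) x"
    by (simp add: scl_def D_def s_def ac_simps)
qed

text \<open>The Brauer relation d_ij d_ik = s_kj d_ik. Orthogonality of g collapses the sum over the
  common slot; the vanishing of T covers letters outside the range where g is orthogonal.\<close>

lemma D_D_shared:
  assumes "i \<noteq> j" "i \<noteq> k" "j \<noteq> k" "\<And>x. N \<le> x k \<Longrightarrow> T x = 0" "\<And>x. N \<le> x j \<Longrightarrow> T x = 0"
  shows "D i j (D i k T) = act e (gp (tr k j)) (D i k T)"
proof
  fix x
  define s where "s = (\<Sum>c<N. \<Sum>d<N. g c d * T (x(i := c, j := x k, k := d)))"
  have 1: "D i k T (x(i := a, j := b)) = of_int e * g a (x k) * (\<Sum>c<N. \<Sum>d<N. g c d * T (x(i := c, j := b, k := d)))" for a b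
    using assms(1-3) by (simp add: D_def fun_upd_twist)
  have sgt: "sg e (tr k j) = of_int e" using assms(3) e by (intro sg_tr) auto
  have R: "act e (gp (tr k j)) (D i k T) x = of_int e * (of_int e * g (x i) (x j) * s)"
  proof -
    have "(x \<circ> ap (tr k j))(i := c, k := d) = x(i := c, j := x k, k := d)" for c d
      using assms(1-3) by (auto simp: fun_eq_iff ap_tr transpose_def)
    then show ?thesis using assms(1-3) sgt by (simp add: act_gp D_def s_def ap_tr)
  qed
  define G where "G b = (\<Sum>c<N. \<Sum>d<N. g c d * T (x(i := c, j := b, k := d)))" for b
  have "D i j (D i k T) x = of_int e * g (x i) (x j) * (\<Sum>a<N. \<Sum>b<N. g a b * (of_int e * g a (x k) * G b))"
    by (simp add: D_def[of i j "D i k T"] 1 G_def)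
  also have "(\<Sum>a<N. \<Sum>b<N. g a b * (of_int e * g a (x k) * G b)) =
      (\<Sum>b<N. (\<Sum>a<N. g a b * g a (x k)) * (of_int e * G b))"
    by (rule trans[OF sum.swap], rule sum.cong[OF refl]) (simp add: sum_distrib_left ac_simps)
  also have "\<dots> = of_int e * s"
  proof (cases "x k < N")
    case True
    then have "(\<Sum>b<N. (\<Sum>a<N. g a b * g a (x k)) * (of_int e * G b)) =
        (\<Sum>b<N. if b = x k then of_int e * s else 0)"
      by (intro sum.cong refl) (auto simp: g_orth s_def G_def)
    then show ?thesis using True by simp
  next
    case False
    have "T (x(i := c, j := x k, k := d)) = 0" for c d using assms(1-3,5) False by simp
    then show ?thesis using False by (simp add: s_def g_out)
  qed
  finally show "D i j (D i k T) x = act e (gp (tr k j)) (D i k T) x" unfolding R by (simp add: ac_simps)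
qed

lemma act_tr_D: assumes "i \<noteq> j" shows "act e (gp (tr i j)) (D i j T) = D i j T"
proof -
  have *: "D i j T (x \<circ> ap (tr i j)) = of_int e * D i j T x" for x
  proof -
    have "(x \<circ> ap (tr i j))(i := a, j := b) = x(i := a, j := b)" for a b
      by (auto simp: fun_eq_iff ap_tr transpose_def)
    then show ?thesis by (simp add: D_def ap_tr g_sym[of "x j" "x i"])
  qed
  have "sg e (tr i j) = of_int e" using assms e by (intro sg_tr) auto
  then show ?thesis by (simp add: act_gp * fun_eq_iff)
qed

lemma D_D_disjoint:
  assumes "{i, j} \<inter> {k, l} = {}" shows "D i j (D k l T) = D k l (D i j T)"
proof
  fix x :: "nat \<Rightarrow> nat"
  have upd: "x(i := a, j := b, k := c, l := d) = x(k := c, l := d, i := a, j := b)" for a b c d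
    using assms by (auto simp: fun_eq_iff)
  have 1: "D k l T (x(i := a, j := b)) = of_int e * g (x k) (x l) * (\<Sum>c<N. \<Sum>d<N. g c d * T (x(k := c, l := d, i := a, j := b)))" for a b
    using assms by (simp add: D_def upd[symmetric])
  have 2: "D i j T (x(k := c, l := d)) = of_int e * g (x i) (x j) * (\<Sum>a<N. \<Sum>b<N. g a b * T (x(k := c, l := d, i := a, j := b)))" for c d
    using assms by (simp add: D_def)
  let ?F = "\<lambda>a b c d. g a b * g c d * T (x(k := c, l := d, i := a, j := b))"
  have "D i j (D k l T) x = g (x i) (x j) * g (x k) (x l) * (\<Sum>a<N. \<Sum>b<N. \<Sum>c<N. \<Sum>d<N. ?F a b c d)"
    by (simp add: D_def[of i j "D k l T"] 1 sum_distrib_left ac_simps)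
  also have "(\<Sum>a<N. \<Sum>b<N. \<Sum>c<N. \<Sum>d<N. ?F a b c d) = (\<Sum>a<N. \<Sum>c<N. \<Sum>b<N. \<Sum>d<N. ?F a b c d)"
    by (rule sum.cong[OF refl], rule sum.swap)
  also have "\<dots> = (\<Sum>c<N. \<Sum>a<N. \<Sum>b<N. \<Sum>d<N. ?F a b c d)"
    by (rule sum.swap)
  also have "\<dots> = (\<Sum>c<N. \<Sum>a<N. \<Sum>d<N. \<Sum>b<N. ?F a b c d)"
    by (rule sum.cong[OF refl], rule sum.cong[OF refl], rule sum.swap)
  also have "\<dots> = (\<Sum>c<N. \<Sum>d<N. \<Sum>a<N. \<Sum>b<N. ?F a b c d)"
    by (rule sum.cong[OF refl], rule sum.swap)
  also have "g (x i) (x j) * g (x k) (x l) * \<dots> = D k l (D i j T) x"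
    by (simp add: D_def[of k l "D i j T"] 2 sum_distrib_left ac_simps)
  finally show "D i j (D k l T) x = D k l (D i j T) x" .
qed

subsection \<open>The inner product\<close>

text \<open>Letters beyond the dimension are legal and carry the value 0, so letter updates and
  permutations need no side conditions.\<close>

definition W :: "nat \<Rightarrow> ((nat \<Rightarrow> nat) \<Rightarrow> complex) set" where
  "W n = {T. loc n T \<and> (\<forall>x i. i < n \<longrightarrow> N \<le> x i \<longrightarrow> T x = 0)}"

lemma W_loc: "T \<in> W n \<Longrightarrow> loc n T"
  by (simp add: W_def)

lemma W_out: "T \<in> W n \<Longrightarrow> i < n \<Longrightarrow> N \<le> x i \<Longrightarrow> T x = 0"
  by (auto simp: W_def)

lemma W_zero [simp]: "0 \<in> W n"
  by (simp add: W_def loc_def)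

lemma W_add: "S \<in> W n \<Longrightarrow> T \<in> W n \<Longrightarrow> S + T \<in> W n"
  by (auto simp: W_def loc_def intro!: arg_cong2[of _ _ _ _ "(+)"])

lemma W_scl: "T \<in> W n \<Longrightarrow> scl c T \<in> W n"
  by (auto simp: W_def loc_def scl_def)

lemma W_sum: "(\<And>i. i \<in> A \<Longrightarrow> f i \<in> W n) \<Longrightarrow> sum f A \<in> W n"
  by (induction A rule: infinite_finite_induct) (auto intro: W_add)

lemma W_uminus: "T \<in> W n \<Longrightarrow> - T \<in> W n"
  using W_scl[of T n "- 1"] by (simp add: scl_simps)

lemma W_diff: "S \<in> W n \<Longrightarrow> T \<in> W n \<Longrightarrow> S - T \<in> W n"
  using W_add[of S n "- T"] by (simp add: W_uminus)

lemma W_act: assumes "T \<in> W n" "u \<in> CS {..<n}" shows "act e' u T \<in> W n"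
  unfolding W_def
proof (intro CollectI conjI allI impI)
  show "loc n (act e' u T)" using assms by (intro loc_act) (simp_all add: W_def)
  fix x i assume x: "i < n" "N \<le> x i"
  show "act e' u T x = 0"
    unfolding act_def
  proof (rule sum.neutral, rule ballI)
    fix p assume "p \<in> ky u"
    then have p: "p \<in> SP {..<n}" using assms(2) by (auto simp: CS_def)
    have "T (x \<circ> ap p) = 0" by (rule W_out[OF assms(1), of "ap (- p) i"]) (use p x in auto)
    then show "lk u p * sg e' p * T (x \<circ> ap p) = 0" by simp
  qed
qed

lemma W_D: assumes "T \<in> W n" "i < n" "j < n" shows "D i j T \<in> W n"
  unfolding W_def
proof (intro CollectI conjI allI impI)
  show "loc n (D i j T)"
    unfolding loc_def
  proof (intro allI impI)
    fix x y :: "nat \<Rightarrow> nat" assume xy: "\<forall>k<n. x k = y k"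
    have "T (x(i := a, j := b)) = T (y(i := a, j := b))" for a b
      by (rule locD[OF W_loc[OF assms(1)]]) (use xy in simp)
    then show "D i j T x = D i j T y" using xy assms by (simp add: D_def)
  qed
  fix x k assume k: "k < n" "N \<le> x k"
  show "D i j T x = 0"
  proof (cases "k = i \<or> k = j")
    case True
    then show ?thesis using k(2) by (auto simp: D_def g_out)
  next
    case False
    have "T (x(i := a, j := b)) = 0" for a b by (rule W_out[OF assms(1) k(1)]) (use False k in auto)
    then show ?thesis by (simp add: D_def)
  qed
qed

text \<open>One extensional representative of each word with letters below N, as a finite index set
  for the inner product.\<close>

definition words :: "nat \<Rightarrow> (nat \<Rightarrow> nat) set" where
  "words n = PiE {..<n} (\<lambda>_. {..<N})"

lemma finite_words [simp]: "finite (words n)"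
  by (simp add: words_def finite_PiE)

definition inn :: "nat \<Rightarrow> ((nat \<Rightarrow> nat) \<Rightarrow> complex) \<Rightarrow> ((nat \<Rightarrow> nat) \<Rightarrow> complex) \<Rightarrow> complex" where
  "inn n S T = (\<Sum>x\<in>words n. cnj (S x) * T x)"

lemma inn_add_left: "inn n (S + S') T = inn n S T + inn n S' T"
  and inn_add_right: "inn n S (T + T') = inn n S T + inn n S T'"
  and inn_scl_left: "inn n (scl c S) T = cnj c * inn n S T"
  and inn_scl_right: "inn n S (scl c T) = c * inn n S T"
  and inn_zero: "inn n 0 T = 0" "inn n S 0 = 0"
  by (simp_all add: inn_def scl_def algebra_simps sum.distrib sum_distrib_left)

lemma inn_diff_right: "inn n S (T - T') = inn n S T - inn n S T'"
  by (simp add: inn_def algebra_simps sum_subtractf)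

lemma inn_sum_left: "inn n (sum f A) T = (\<Sum>i\<in>A. inn n (f i) T)"
  using sum_comp_morphism[of "\<lambda>S. inn n S T" f A] by (simp add: inn_zero inn_add_left comp_def)

lemma inn_cnj: "cnj (inn n S T) = inn n T S"
  by (simp add: inn_def mult.commute)

lemma inn_self: "inn n T T = of_real (\<Sum>x\<in>words n. (cmod (T x))\<^sup>2)"
  unfolding inn_def of_real_sum complex_norm_square by (simp add: mult.commute)

lemma inn_definite: assumes "T \<in> W n" "inn n T T = 0" shows "T = 0"
proof
  fix x
  have "(\<Sum>x\<in>words n. (cmod (T x))\<^sup>2) = 0" using assms(2) unfolding inn_self of_real_eq_0_iff .
  then have z: "T y = 0" if "y \<in> words n" for y
    using that by (subst (asm) sum_nonneg_eq_0_iff) auto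
  show "T x = 0 x"
  proof (cases "\<forall>i<n. x i < N")
    case True
    have "T x = T (restrict x {..<n})" by (rule locD[OF W_loc[OF assms(1)]]) simp
    moreover have "restrict x {..<n} \<in> words n" using True by (auto simp: words_def)
    ultimately show ?thesis using z by simp
  next
    case False
    then obtain i where "i < n" "N \<le> x i" by (auto simp: not_less)
    then show ?thesis using W_out[OF assms(1)] by simp
  qed
qed

lemma words_upd: "x \<in> words n \<Longrightarrow> i < n \<Longrightarrow> a < N \<Longrightarrow> x(i := a) \<in> words n"
  by (auto simp: words_def PiE_def extensional_def Pi_def)

lemma words_less: "x \<in> words n \<Longrightarrow> i < n \<Longrightarrow> x i < N"
  by (auto simp: words_def)

text \<open>Exchanging the letters at i and j with the summation letters a and b turns one side into
  the other; reality of g disposes of the conjugation.\<close>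

lemma inn_D: assumes "i < n" "j < n" "i \<noteq> j" shows "inn n S (D i j T) = inn n (D i j S) T"
proof -
  have "inn n S (D i j T) = (\<Sum>x\<in>words n. \<Sum>a<N. \<Sum>b<N. cnj (S x) * of_int e * g (x i) (x j) * g a b * T (x(i := a, j := b)))"
    by (simp add: inn_def D_def sum_distrib_left ac_simps)
  also have "\<dots> = (\<Sum>(x, a, b)\<in>words n \<times> {..<N} \<times> {..<N}. cnj (S x) * of_int e * g (x i) (x j) * g a b * T (x(i := a, j := b)))"
    by (simp add: sum.cartesian_product)
  also have "\<dots> = (\<Sum>(x, a, b)\<in>words n \<times> {..<N} \<times> {..<N}. cnj (S (x(i := a, j := b))) * of_int e * g (x i) (x j) * g a b * T x)"
    by (rule sum.reindex_bij_witness[of _ "\<lambda>(x, a, b). (x(i := a, j := b), x i, x j)" "\<lambda>(x, a, b). (x(i := a, j := b), x i, x j)"])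
       (use assms in \<open>auto simp: words_upd words_less fun_upd_twist ac_simps\<close>)
  also have "\<dots> = (\<Sum>x\<in>words n. \<Sum>a<N. \<Sum>b<N. cnj (S (x(i := a, j := b))) * of_int e * g (x i) (x j) * g a b * T x)"
    by (simp add: sum.cartesian_product)
  also have "\<dots> = inn n (D i j S) T"
    by (simp add: inn_def D_def sum_distrib_left sum_distrib_right g_real ac_simps)
  finally show ?thesis .
qed

lemma inn_act:
  assumes p: "p \<in> SP {..<n}" shows "inn n (act e (gp p) S) T = inn n S (act e (gp (- p)) T)"
proof -
  have w: "x \<circ> ap q \<in> words n" if q: "q \<in> SP {..<n}" and x: "x \<in> words n" for q x
    using q x by (auto simp: words_def PiE_def extensional_def Pi_def)
  show ?thesis
    unfolding inn_def act_gp
    by (rule sum.reindex_bij_witness[of _ "\<lambda>x. x \<circ> ap (- p)" "\<lambda>x. x \<circ> ap p"])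
       (use p w in \<open>auto simp: comp_assoc\<close>)
qed

text \<open>D is Hermitian with D D = \<epsilon> N D, so N \<epsilon> D is the square of a Hermitian
  operator. This is the source of all positivity arguments below.\<close>

lemma inn_D_self:
  assumes "i < n" "j < n" "i \<noteq> j"
  shows "of_nat N * (of_int e * inn n T (D i j T)) = inn n (D i j T) (D i j T)"
proof -
  have "inn n (D i j T) (D i j T) = inn n T (D i j (D i j T))" using inn_D[OF assms, of T "D i j T"] by simp
  also have "\<dots> = of_int e * of_nat N * inn n T (D i j T)" using assms by (simp add: D_idem inn_scl_right)
  finally show ?thesis by (simp add: ac_simps)
qed

end


interpretation scl: vector_space scl
  by unfold_locales (simp_all add: scl_simps mult.commute)

lemma scl_cancel: "c \<noteq> 0 \<Longrightarrow> scl c S = scl c T \<Longrightarrow> S = T"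
  by (simp add: scl_def fun_eq_iff)

lemma act_expand: "act e u T = (\<Sum>p\<in>ky u. scl (lk u p) (act e (gp p) T))"
  by (rule ext) (simp add: act_def[of e u] act_gp scl_def sum_fun_apply mult.assoc)

context tens
begin

lemma W_subspace: "scl.subspace (W n)"
  by (rule scl.subspaceI) (auto intro: W_add W_scl)

subsection \<open>Paired and traceless tensors\<close>

abbreviation c0 :: complex where "c0 \<equiv> of_int e * of_nat N"

lemma c0_nonzero: "c0 \<noteq> 0"
  using N_pos e by auto

text \<open>Since D D = c0 D, the eigenvalue equation says that the tensor lies in the image of D,
  which means that it carries the invariant tensor on the slots k and \<open>pt k\<close>.\<close>

definition paired :: "nat \<Rightarrow> ((nat \<Rightarrow> nat) \<Rightarrow> complex) \<Rightarrow> bool" where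
  "paired f x \<longleftrightarrow> (\<forall>k<2 * f. D k (pt k) x = scl c0 x)"

text \<open>Stated through D in place of the bare contraction: g is not the zero matrix, so both
  vanish together.\<close>

definition traceless :: "nat set \<Rightarrow> ((nat \<Rightarrow> nat) \<Rightarrow> complex) \<Rightarrow> bool" where
  "traceless K x \<longleftrightarrow> (\<forall>i\<in>K. \<forall>j\<in>K. i \<noteq> j \<longrightarrow> D i j x = 0)"

text \<open>\<open>D_D_shared\<close> divided by c0: contracting a slot i of the pair with j hands
  the role of its partner over to j.\<close>

lemma pair_move:
  assumes x: "x \<in> W n" and ij: "i < n" "i' < n" "j < n" "i \<noteq> i'" "i \<noteq> j" "i' \<noteq> j"
    and p: "D i i' x = scl c0 x"
  shows "D i j x = act e (gp (tr i' j)) x"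
proof (rule scl_cancel[OF c0_nonzero])
  have "scl c0 (D i j x) = D i j (D i i' x)" by (simp add: p D_scl)
  also have "\<dots> = act e (gp (tr i' j)) (D i i' x)"
    by (rule D_D_shared) (use ij W_out[OF x] in auto)
  finally show "scl c0 (D i j x) = scl c0 (act e (gp (tr i' j)) x)" by (simp add: p act_T_scl)
qed

lemma pair_sym: "i \<noteq> j \<Longrightarrow> D i j x = scl c0 x \<Longrightarrow> act e (gp (tr i j)) x = x"
  by (rule scl_cancel[OF c0_nonzero]) (metis act_T_scl act_tr_D)

text \<open>Seen from the first pair, the contraction of i with j' is the transposition of i' and
  j'; seen from the second, it is that of i and j. Both agree on x, so their product fixes
  it.\<close>

lemma pair_swap:
  assumes x: "x \<in> W n" and ij: "i < n" "i' < n" "j < n" "j' < n" "i \<noteq> i'" "j \<noteq> j'" "{i, i'} \<inter> {j, j'} = {}"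
    and p: "D i i' x = scl c0 x" "D j j' x = scl c0 x"
  shows "act e (gp (tr i j + tr i' j')) x = x"
proof -
  have p': "D j' j x = scl c0 x" using p(2) ij D_commute[of j' j x] by simp
  have "act e (gp (tr i' j')) x = D i j' x" by (rule pair_move[symmetric, OF x _ _ _ _ _ _ p(1)]) (use ij in auto)
  also have "\<dots> = D j' i x" using ij by (intro D_commute) auto
  also have "\<dots> = act e (gp (tr j i)) x" by (rule pair_move[OF x _ _ _ _ _ _ p']) (use ij in auto)
  finally have "act e (gp (tr i j)) (act e (gp (tr i' j')) x) = act e (gp (tr i j) * gp (tr j i)) x"
    by (simp add: act_mult)
  then show ?thesis by (simp add: tr_commute[of j i] gp_mult flip: act_mult)
qed

lemma pairedD:
  assumes "paired f x" "k < 2 * f" shows "D k (pt k) x = scl c0 x"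
  using assms by (simp add: paired_def)

lemma paired_zero: "paired f 0"
  and paired_add: "paired f x \<Longrightarrow> paired f y \<Longrightarrow> paired f (x + y)"
  and paired_scl: "paired f x \<Longrightarrow> paired f (scl c x)"
  by (simp_all add: paired_def D_add D_scl scl_simps mult.commute)

lemma D_act_fix:
  assumes "\<And>p. p \<in> ky u \<Longrightarrow> ap p i = i \<and> ap p j = j"
  shows "D i j (act e u x) = act e u (D i j x)"
  unfolding act_expand[of e u] D_sum D_scl
proof (rule sum.cong[OF refl])
  fix p assume "p \<in> ky u"
  then have "ap (- p) i = i" "ap (- p) j = j" using assms by (metis ap_uminus(1))+
  then show "scl (lk u p) (D i j (act e (gp p) x)) = scl (lk u p) (act e (gp p) (D i j x))" by (simp add: D_act)
qed

lemma paired_act: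
  assumes x: "paired f x" and u: "u \<in> CS K" "K \<inter> {..<2 * f} = {}"
  shows "paired f (act e u x)"
  unfolding paired_def
proof (intro allI impI)
  fix k assume k: "k < 2 * f"
  have "D k (pt k) (act e u x) = act e u (D k (pt k) x)"
  proof (rule D_act_fix)
    fix p assume "p \<in> ky u"
    then have p: "p \<in> SP K" using u(1) by (auto simp: CS_def)
    have "k \<notin> K" "pt k \<notin> K" using k u(2) by auto
    then show "ap p k = k \<and> ap p (pt k) = pt k" using p by simp
  qed
  then show "D k (pt k) (act e u x) = scl c0 (act e u x)" using pairedD[OF x k] by (simp add: act_T_scl)
qed

lemma traceless_act:
  assumes x: "traceless K x" and u: "u \<in> CS K"
  shows "traceless K (act e u x)"
  unfolding traceless_def
proof (intro ballI impI)
  fix i j assume ij: "i \<in> K" "j \<in> K" "i \<noteq> j"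
  show "D i j (act e u x) = 0"
    unfolding act_expand[of e u] D_sum D_scl
  proof (rule sum.neutral, rule ballI)
    fix p assume "p \<in> ky u"
    then have p: "- p \<in> SP K" using u by (auto simp: CS_def)
    have "D (ap (- p) i) (ap (- p) j) x = 0" using x ij p SP_in_iff[OF p] by (simp add: traceless_def)
    then show "scl (lk u p) (D i j (act e (gp p) x)) = 0" by (simp add: D_act scl_simps)
  qed
qed

subsection \<open>The sum of all contractions\<close>

text \<open>The operator of \<open>2 A\<^sub>n\<close>.\<close>

definition A2 :: "nat \<Rightarrow> ((nat \<Rightarrow> nat) \<Rightarrow> complex) \<Rightarrow> (nat \<Rightarrow> nat) \<Rightarrow> complex" where
  "A2 n x = (\<Sum>i<n. \<Sum>j\<in>{..<n} - {i}. D i j x)"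

lemma A2_add: "A2 n (x + y) = A2 n x + A2 n y"
  by (simp add: A2_def D_add sum.distrib)

lemma A2_scl: "A2 n (scl c x) = scl c (A2 n x)"
  by (simp add: A2_def D_scl scl_sum)

lemma A2_zero: "A2 n 0 = 0"
  by (simp add: A2_def)

lemma A2_sum: "A2 n (sum f A) = (\<Sum>i\<in>A. A2 n (f i))"
  using sum_comp_morphism[of "A2 n" f A] by (simp add: A2_add A2_zero comp_def)

lemma A2_act:
  assumes u: "u \<in> CS {..<n}" shows "A2 n (act e u x) = act e u (A2 n x)"
  unfolding act_expand[of e u] A2_sum A2_scl
proof (rule sum.cong[OF refl])
  fix p assume "p \<in> ky u"
  then have p: "p \<in> SP {..<n}" using u by (auto simp: CS_def)
  have "A2 n (act e (gp p) x) = (\<Sum>i<n. \<Sum>j\<in>{..<n} - {i}. act e (gp p) (D (ap (- p) i) (ap (- p) j) x))"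
    by (simp add: A2_def D_act)
  also have "\<dots> = (\<Sum>i<n. \<Sum>j\<in>{..<n} - {i}. act e (gp p) (D i j x))"
  proof (rule sum.reindex_bij_witness[of _ "ap p" "ap (- p)"])
    fix i assume "i \<in> {..<n}"
    show "(\<Sum>j\<in>{..<n} - {ap (- p) i}. act e (gp p) (D (ap (- p) i) j x)) =
        (\<Sum>j\<in>{..<n} - {i}. act e (gp p) (D (ap (- p) i) (ap (- p) j) x))"
      by (rule sum.reindex_bij_witness[of _ "ap (- p)" "ap p"]) (use p in auto)
  qed (use p in auto)
  also have "\<dots> = act e (gp p) (A2 n x)" by (simp add: A2_def act_T_sum)
  finally show "scl (lk u p) (A2 n (act e (gp p) x)) = scl (lk u p) (act e (gp p) (A2 n x))" by simp
qed

text \<open>By \<open>pair_move\<close> every contraction is a transposition, except that partners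
  give c0 and two traceless slots give 0. After reindexing by \<open>pt\<close> these are all
  transpositions meeting a paired slot, save those inside the pairs; the latter fix x, whence c0 -
  1.\<close>

lemma A2_paired:
  assumes x: "x \<in> W n" and f: "2 * f \<le> n" and p: "paired f x" and t: "traceless {2 * f..<n} x"
  shows "A2 n x = scl (2 * of_nat f * (c0 - 1)) x + act e (Tr2 {..<n}) x - act e (Tr2 {2 * f..<n}) x"
proof -
  let ?L = "{..<2 * f}" and ?H = "{2 * f..<n}"
  let ?t = "\<lambda>i j. act e (gp (tr i j)) x"
  have LH: "{..<n} = ?L \<union> ?H" using f by auto
  have low: "(\<Sum>j\<in>{..<n} - {i}. D i j x) = scl c0 x + (\<Sum>j\<in>{..<n} - {i, pt i}. ?t (pt i) j)" if i: "i < 2 * f" for i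
  proof -
    have pi: "pt i < n" "i < n" using i f by (simp_all add: less_le_trans[of _ "2 * f"])
    have "(\<Sum>j\<in>{..<n} - {i}. D i j x) = D i (pt i) x + (\<Sum>j\<in>{..<n} - {i} - {pt i}. D i j x)"
      by (rule sum.remove) (use pi in auto)
    also have "(\<Sum>j\<in>{..<n} - {i} - {pt i}. D i j x) = (\<Sum>j\<in>{..<n} - {i, pt i}. ?t (pt i) j)"
    proof (rule sum.cong)
      fix j assume "j \<in> {..<n} - {i, pt i}"
      then show "D i j x = ?t (pt i) j"
        using pi by (intro pair_move[OF x _ _ _ _ _ _ pairedD[OF p i]]) auto
    qed auto
    finally show ?thesis unfolding pairedD[OF p i] .
  qed
  have high: "(\<Sum>j\<in>{..<n} - {i}. D i j x) = (\<Sum>j\<in>?L. ?t i j)" if i: "i \<in> ?H" for i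
  proof -
    have "(\<Sum>j\<in>{..<n} - {i}. D i j x) = (\<Sum>j\<in>?L. D i j x)"
      by (rule sum.mono_neutral_right) (use i f t in \<open>auto simp: traceless_def\<close>)
    also have "\<dots> = (\<Sum>j\<in>?L. ?t (pt j) i)"
    proof (rule sum.cong[OF refl])
      fix j assume j: "j \<in> ?L"
      then have "pt j < 2 * f" by simp
      moreover have "2 * f \<le> i" "i < n" using i by auto
      ultimately have pj: "pt j < n" "i \<noteq> pt j" by linarith+
      have "D i j x = D j i x" using i j by (intro D_commute) auto
      also have "\<dots> = ?t (pt j) i"
        using i j pj f by (intro pair_move[OF x _ _ _ _ _ _ pairedD[OF p]]) auto
      finally show "D i j x = ?t (pt j) i" .
    qed
    also have "\<dots> = (\<Sum>j\<in>?L. ?t j i)"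
      by (rule sum.reindex_bij_witness[of _ pt pt]) auto
    finally show ?thesis by (simp add: tr_commute)
  qed
  have "A2 n x = (\<Sum>i\<in>?L. \<Sum>j\<in>{..<n} - {i}. D i j x) + (\<Sum>i\<in>?H. \<Sum>j\<in>{..<n} - {i}. D i j x)"
    unfolding A2_def LH by (rule sum.union_disjoint) auto
  also have "(\<Sum>i\<in>?H. \<Sum>j\<in>{..<n} - {i}. D i j x) = (\<Sum>i\<in>?H. \<Sum>j\<in>?L. ?t i j)"
    by (rule sum.cong[OF refl]) (rule high)
  also have "(\<Sum>i\<in>?L. \<Sum>j\<in>{..<n} - {i}. D i j x) =
      (\<Sum>i\<in>?L. scl c0 x) + (\<Sum>i\<in>?L. \<Sum>j\<in>{..<n} - {i, pt i}. ?t (pt i) j)"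
    unfolding sum.distrib[symmetric] by (rule sum.cong[OF refl]) (use low in simp)
  also have "(\<Sum>i\<in>?L. \<Sum>j\<in>{..<n} - {i, pt i}. ?t (pt i) j) = (\<Sum>i\<in>?L. \<Sum>j\<in>{..<n} - {i, pt i}. ?t i j)"
    by (rule sum.reindex_bij_witness[of _ pt pt]) (auto simp: insert_commute)
  also have "(\<Sum>i\<in>?L. \<Sum>j\<in>{..<n} - {i, pt i}. ?t i j) = (\<Sum>i\<in>?L. (\<Sum>j\<in>{..<n} - {i}. ?t i j) - x)"
  proof (rule sum.cong[OF refl])
    fix i assume i: "i \<in> ?L"
    then have "pt i \<in> {..<n} - {i}" using f by (simp add: less_le_trans[of _ "2 * f"])
    then have "(\<Sum>j\<in>{..<n} - {i}. ?t i j) = ?t i (pt i) + (\<Sum>j\<in>{..<n} - {i} - {pt i}. ?t i j)"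
      by (intro sum.remove) auto
    moreover have "?t i (pt i) = x" using i by (intro pair_sym pairedD[OF p]) auto
    moreover have "{..<n} - {i} - {pt i} = {..<n} - {i, pt i}" by auto
    ultimately show "(\<Sum>j\<in>{..<n} - {i, pt i}. ?t i j) = (\<Sum>j\<in>{..<n} - {i}. ?t i j) - x" by simp
  qed
  finally have 1: "A2 n x = (\<Sum>i\<in>?L. scl c0 x) + (\<Sum>i\<in>?L. (\<Sum>j\<in>{..<n} - {i}. ?t i j) - x) + (\<Sum>i\<in>?H. \<Sum>j\<in>?L. ?t i j)" .
  have 2: "act e (Tr2 {..<n}) x = (\<Sum>i\<in>?L. \<Sum>j\<in>{..<n} - {i}. ?t i j) + (\<Sum>i\<in>?H. \<Sum>j\<in>{..<n} - {i}. ?t i j)"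
    unfolding Tr2_def act_sum LH by (rule sum.union_disjoint) auto
  have 3: "(\<Sum>i\<in>?H. \<Sum>j\<in>{..<n} - {i}. ?t i j) = (\<Sum>i\<in>?H. \<Sum>j\<in>?L. ?t i j) + (\<Sum>i\<in>?H. \<Sum>j\<in>?H - {i}. ?t i j)"
    unfolding sum.distrib[symmetric]
  proof (rule sum.cong[OF refl])
    fix i assume "i \<in> ?H"
    then have eq: "{..<n} - {i} = ?L \<union> (?H - {i})" using f by auto
    show "(\<Sum>j\<in>{..<n} - {i}. ?t i j) = (\<Sum>j\<in>?L. ?t i j) + (\<Sum>j\<in>?H - {i}. ?t i j)"
      unfolding eq by (rule sum.union_disjoint) auto
  qed
  have 4: "act e (Tr2 ?H) x = (\<Sum>i\<in>?H. \<Sum>j\<in>?H - {i}. ?t i j)" by (simp add: Tr2_def act_sum)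
  have c: "(\<Sum>i\<in>?L. scl c0 x) - (\<Sum>i\<in>?L. x) = scl (2 * of_nat f * (c0 - 1)) x"
    by (rule ext) (simp add: sum_fun_apply scl_def algebra_simps)
  show ?thesis
    unfolding 1 2 3 4 c[symmetric] sum_subtractf by (simp add: algebra_simps)
qed

subsection \<open>Spanning by permuted paired tensors\<close>

lemma inn_span: "(\<And>u. u \<in> B \<Longrightarrow> inn n u X = 0) \<Longrightarrow> v \<in> scl.span B \<Longrightarrow> inn n v X = 0"
  by (rule scl.span_induct[of v B "\<lambda>v. inn n v X = 0"])
     (auto intro!: scl.subspaceI simp: inn_zero inn_add_left inn_scl_left)

text \<open>Gram--Schmidt: q is the projection of the new vector v to the span of the others, and v
  - q the additional direction.\<close>

lemma projection:
  assumes "finite B" "B \<subseteq> W n" "T \<in> W n"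
  shows "\<exists>p\<in>scl.span B. \<forall>u\<in>B. inn n u (T - p) = 0"
  using assms
proof (induction B arbitrary: T rule: finite_induct)
  case empty
  show ?case by (intro bexI[of _ 0] scl.span_zero) auto
next
  case (insert v B)
  have vB: "v \<in> W n" "B \<subseteq> W n" using insert.prems(1) by auto
  obtain q where q: "q \<in> scl.span B" "\<And>u. u \<in> B \<Longrightarrow> inn n u (v - q) = 0" using insert.IH[OF vB(2,1)] by blast
  obtain p where p: "p \<in> scl.span B" "\<And>u. u \<in> B \<Longrightarrow> inn n u (T - p) = 0"
    using insert.IH[OF vB(2) insert.prems(2)] by blast
  have "scl.span B \<subseteq> W n" by (rule scl.span_minimal[OF vB(2) W_subspace])
  then have vq: "v - q \<in> W n" using q(1) vB(1) by (auto intro: W_diff)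
  have mono: "scl.span B \<subseteq> scl.span (insert v B)" by (rule scl.span_mono) auto
  have qv: "inn n v X = inn n (v - q) X + inn n q X" for X
    by (simp flip: inn_add_left)
  show ?case
  proof (cases "inn n (v - q) (v - q) = 0")
    case True
    then have "v = q" using inn_definite[OF vq] by simp
    then have "inn n v (T - p) = 0" using inn_span[OF p(2) q(1)] by simp
    then show ?thesis using p mono by blast
  next
    case False
    let ?c = "inn n (v - q) (T - p) / inn n (v - q) (v - q)"
    let ?p = "p + scl ?c (v - q)"
    have Tp: "inn n X (T - ?p) = inn n X (T - p) - ?c * inn n X (v - q)" for X
      by (simp add: inn_diff_right inn_add_right inn_scl_right)
    have "v \<in> scl.span (insert v B)" by (rule scl.span_base) simp
    then have "?p \<in> scl.span (insert v B)"
      using p(1) q(1) mono by (intro scl.span_add scl.span_scale scl.span_diff) auto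
    moreover have B0: "inn n u (T - ?p) = 0" if "u \<in> B" for u unfolding Tp using p(2) q(2) that by simp
    moreover have "inn n v (T - ?p) = 0"
      unfolding qv[of "T - ?p"] using inn_span[OF B0 q(1)] Tp[of "v - q"] False by simp
    ultimately show ?thesis by blast
  qed
qed

lemma W_finite_span:
  assumes "scl.subspace U" "U \<subseteq> W n" shows "\<exists>B\<subseteq>U. finite B \<and> U \<subseteq> scl.span B"
proof (rule scl.finite_generation[of "(\<lambda>w T. T w) ` words n"])
  fix x assume x: "x \<in> U" "\<And>\<phi>. \<phi> \<in> (\<lambda>w T. T w) ` words n \<Longrightarrow> \<phi> x = 0"
  have "inn n x x = 0" unfolding inn_def by (rule sum.neutral) (use x(2) in auto)
  then show "x = 0" using inn_definite x(1) assms(2) by blast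
qed (use assms(1) in \<open>auto simp: scl_def\<close>)

lemma move_pair:
  assumes "i \<in> K" "j \<in> K" "i \<noteq> j" "a \<in> K" "b \<in> K" "a \<noteq> b"
  shows "\<exists>s\<in>SP K. ap s a = i \<and> ap s b = j"
proof -
  let ?j = "ap (tr a i) j"
  have j: "?j \<in> K" "?j \<noteq> a" using assms by (auto simp: ap_tr transpose_def)
  have "ap (tr a i + tr b ?j) b = j" by (simp add: ap_tr)
  moreover have "ap (tr a i + tr b ?j) a = i" using j assms by (simp add: ap_tr)
  moreover have "tr a i + tr b ?j \<in> SP K" using assms j by (intro SP_plus SP_tr)
  ultimately show ?thesis by blast
qed

text \<open>
  A paired tensor splits orthogonally into a traceless part and a sum of contracted parts
  \<open>D i j w\<close>; a permutation turns the latter into tensors with one more pair.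
\<close>

lemma paired_induct:
  assumes zero: "P 0" and add: "\<And>S T. P S \<Longrightarrow> P T \<Longrightarrow> P (S + T)" and scale: "\<And>c S. P S \<Longrightarrow> P (scl c S)"
    and base: "\<And>f h x. 2 * f \<le> n \<Longrightarrow> h \<in> SP {..<n} \<Longrightarrow> x \<in> W n \<Longrightarrow> paired f x \<Longrightarrow>
      traceless {2 * f..<n} x \<Longrightarrow> P (act e (gp h) x)"
    and "2 * f \<le> n" "x \<in> W n" "paired f x" "h \<in> SP {..<n}"
  shows "P (act e (gp h) x)"
  using assms(5-)
proof (induction "n - f" arbitrary: f x h rule: less_induct)
  case less
  let ?K = "{2 * f..<n}"
  define Y where "Y = {w \<in> W n. paired f w}"
  define G where "G = {D i j w |i j w. i \<in> ?K \<and> j \<in> ?K \<and> i \<noteq> j \<and> w \<in> Y}"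
  have Y: "scl.subspace Y"
    by (rule scl.subspaceI) (auto simp: Y_def W_add W_scl paired_zero paired_add paired_scl)
  have DY: "D i j w \<in> Y" if ij: "i \<in> ?K" "j \<in> ?K" and w: "w \<in> Y" for i j w
  proof -
    have "D k (pt k) (D i j w) = scl c0 (D i j w)" if k: "k < 2 * f" for k
    proof -
      have "pt k < 2 * f" using k by simp
      moreover have "2 * f \<le> i" "2 * f \<le> j" using ij by auto
      ultimately have "k \<noteq> i" "k \<noteq> j" "pt k \<noteq> i" "pt k \<noteq> j" using k by linarith+
      then have "{k, pt k} \<inter> {i, j} = {}" by blast
      then have "D k (pt k) (D i j w) = D i j (D k (pt k) w)" by (rule D_D_disjoint)
      then show ?thesis using w k by (simp add: Y_def paired_def D_scl)
    qed
    then show ?thesis using ij w by (simp add: Y_def paired_def W_D)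
  qed
  have GY: "G \<subseteq> Y" using DY by (auto simp: G_def)
  have U: "scl.span G \<subseteq> Y" using GY Y by (rule scl.span_minimal)
  have UW: "scl.span G \<subseteq> W n" using U by (auto simp: Y_def)
  obtain B where B: "B \<subseteq> scl.span G" "finite B" "scl.span G \<subseteq> scl.span B"
    using W_finite_span[OF scl.subspace_span UW] by blast
  have "B \<subseteq> W n" using B(1) UW by blast
  from projection[OF B(2) this less.prems(2)] obtain p where p: "p \<in> scl.span B" "\<And>u. u \<in> B \<Longrightarrow> inn n u (x - p) = 0"
    by blast
  have pG: "p \<in> scl.span G" using p(1) scl.span_minimal[OF B(1) scl.subspace_span] by blast
  define r where "r = x - p"
  have rY: "r \<in> Y"
    unfolding r_def using less.prems pG U by (intro scl.subspace_diff[OF Y]) (auto simp: Y_def)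
  \<comment> \<open>The remainder r is orthogonal to \<open>D i j (D i j r)\<close>, which lies in
    G; as D is Hermitian, \<open>D i j r\<close> has norm zero.\<close>
  have "D i j r = 0" if ij: "i \<in> ?K" "j \<in> ?K" "i \<noteq> j" for i j
  proof (rule inn_definite)
    show "D i j r \<in> W n" using DY[OF ij(1,2) rY] by (simp add: Y_def)
    have "D i j (D i j r) \<in> G" unfolding G_def using ij DY[OF ij(1,2) rY] by blast
    then have "D i j (D i j r) \<in> scl.span B" using B(3) scl.span_base by blast
    then have "inn n (D i j (D i j r)) r = 0" unfolding r_def[symmetric] using p(2) inn_span[of B n r] by (simp add: r_def)
    then show "inn n (D i j r) (D i j r) = 0" using inn_D[of i n j "D i j r" r] ij by simp
  qed
  then have "traceless ?K r" by (simp add: traceless_def)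
  then have 1: "P (act e (gp h) r)" using rY less.prems by (intro base[of f]) (auto simp: Y_def)
  have "P (act e (gp h) v)" if v: "v \<in> scl.span G" for v
  proof (rule scl.span_induct[OF v])
    show "scl.subspace {v. P (act e (gp h) v)}"
      by (rule scl.subspaceI) (simp_all add: zero add scale act_T_add act_T_scl)
    fix v assume "v \<in> G"
    then obtain i j w where ijw: "i \<in> ?K" "j \<in> ?K" "i \<noteq> j" "w \<in> Y" "v = D i j w" unfolding G_def by blast
    then have lt: "2 * f \<in> ?K" "Suc (2 * f) \<in> ?K" by auto
    \<comment> \<open>The permutation brings the contracted slots to the places 2 f and 2 f + 1,
      where they become the next pair, and leaves the old pairs alone.\<close>
    obtain s where s: "s \<in> SP ?K" "ap s (2 * f) = i" "ap s (Suc (2 * f)) = j"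
      using move_pair[OF ijw(1-3) lt] by auto
    have s': "ap (- s) i = 2 * f" "ap (- s) j = Suc (2 * f)" using s by auto
    have sn: "s \<in> SP {..<n}" using SP_mono[OF s(1), of "{..<n}"] by (simp add: subset_iff)
    let ?v = "act e (gp (- s)) v"
    have vs: "?v = D (2 * f) (Suc (2 * f)) (act e (gp (- s)) w)"
      unfolding ijw(5) act_D s' ..
    have "P (act e (gp (h + s)) ?v)"
    proof (rule less.hyps[of "Suc f"])
      show "n - Suc f < n - f" "2 * Suc f \<le> n" using lt by auto
      show "?v \<in> W n" using DY[OF ijw(1,2,4)] sn by (intro W_act) (auto simp: Y_def ijw(5))
      show "h + s \<in> SP {..<n}" using less.prems(4) sn by (rule SP_plus)
      have pf: "paired f ?v"
        using DY[OF ijw(1,2,4)] s(1) unfolding ijw(5) by (intro paired_act[of f _ _ ?K]) (auto simp: Y_def)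
      have "D (2 * f) (Suc (2 * f)) ?v = scl c0 ?v" unfolding vs by (rule D_idem) simp
      moreover from this have "D (Suc (2 * f)) (2 * f) ?v = scl c0 ?v" using D_commute[of "Suc (2 * f)" "2 * f" ?v] by simp
      ultimately show "paired (Suc f) ?v"
        unfolding paired_def using pf by (auto simp: paired_def less_Suc_eq pt_def)
    qed
    then show "P (act e (gp h) v)" by (simp add: gp_mult add.assoc flip: act_mult)
  qed
  from this[OF pG] 1 have "P (act e (gp h) r + act e (gp h) p)" by (rule add[rotated])
  then show ?case by (simp add: r_def flip: act_T_add)
qed

lemma paired_even:
  assumes x: "x \<in> W n" and f: "2 * f \<le> n" and p: "paired f x" and nu: "\<nu> \<in> partitions (2 * f)"
    and nz: "act e (zz \<nu>) x \<noteq> 0"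
  shows "even_partition \<nu>"
proof -
  \<comment> \<open>Defined by what it fixes, H is visibly a group; \<open>pair_sym\<close> and
    \<open>pair_swap\<close> put the generators of the hyperoctahedral group into it.\<close>
  define H where "H = {p \<in> SP {..<2 * f}. \<forall>y\<in>W n. paired f y \<longrightarrow> act e (gp p) y = y}"
  have fin: "finite H" by (rule finite_subset[of _ "SP {..<2 * f}"]) (auto simp: H_def)
  show ?thesis
  proof (rule invariant_zz_even[OF nu, of H])
    show "H \<subseteq> SP {..<2 * f}" by (auto simp: H_def)
    show "tr k (pt k) \<in> H" if k: "k < 2 * f" for k
    proof -
      have "act e (gp (tr k (pt k))) y = y" if "paired f y" for y
        by (rule pair_sym[OF pt_neq(2) pairedD[OF that k]])
      then show ?thesis using k by (simp add: H_def SP_tr)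
    qed
    show "tr k l + tr (pt k) (pt l) \<in> H" if kl: "k < 2 * f" "l < 2 * f" "l \<noteq> k" "l \<noteq> pt k" for k l
    proof -
      have lt: "pt k < 2 * f" "pt l < 2 * f" using kl by simp_all
      have "act e (gp (tr k l + tr (pt k) (pt l))) y = y" if y: "y \<in> W n" "paired f y" for y
      proof (rule pair_swap[OF y(1)])
        show "{k, pt k} \<inter> {l, pt l} = {}" using kl by auto
      qed (use kl lt f y pairedD[OF y(2)] in \<open>auto simp: less_le_trans[of _ "2 * f"]\<close>)
      then show ?thesis using kl lt by (simp add: H_def SP_tr SP_plus)
    qed
    show "p + q \<in> H" if "p \<in> H" "q \<in> H" for p q
      using that by (simp add: H_def SP_plus act_mult flip: gp_mult)
    show "- p \<in> H" if "p \<in> H" for p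
    proof -
      have "act e (gp (- p)) y = y" if y: "y \<in> W n" "paired f y" for y
      proof -
        have "act e (gp p) y = y" using \<open>p \<in> H\<close> y by (simp add: H_def)
        then have "act e (gp (- p)) y = act e (gp (- p)) (act e (gp p) y)" by simp
        then show ?thesis by (simp flip: act_mult)
      qed
      then show ?thesis using that by (simp add: H_def)
    qed
    \<comment> \<open>The sum over H multiplies x by the nonzero number \<open>card H\<close>, so it
      may be inserted next to \<open>zz \<nu>\<close>.\<close>
    show "(\<Sum>h\<in>H. gp h) * zz \<nu> \<noteq> 0"
    proof
      assume "(\<Sum>h\<in>H. gp h) * zz \<nu> = 0"
      moreover have "(\<Sum>h\<in>H. gp h) \<in> CS {..<2 * f}" by (rule CS_sum) (auto simp: H_def)
      ultimately have "zz \<nu> * (\<Sum>h\<in>H. gp h) = 0" using zz_commute[OF nu] by simp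
      then have "act e (zz \<nu>) (act e (\<Sum>h\<in>H. gp h) x) = 0" by (simp flip: act_mult)
      moreover have "act e (\<Sum>h\<in>H. gp h) x = (\<Sum>h\<in>H. x)"
        unfolding act_sum by (rule sum.cong) (use x p in \<open>auto simp: H_def\<close>)
      moreover have "(\<Sum>h\<in>H. x) = scl (of_nat (card H)) x"
        by (rule ext) (simp add: sum_fun_apply scl_def)
      ultimately have "scl (of_nat (card H)) (act e (zz \<nu>) x) = 0" by (simp add: act_T_scl)
      moreover have "0 \<in> H" by (simp add: H_def)
      then have "card H \<noteq> 0" using fin by auto
      ultimately show False using nz scl_cancel[of "of_nat (card H)" "act e (zz \<nu>) x" 0] by (simp add: scl_simps)
    qed
  qed
qed

end


declare scl.scale_minus_left [simp del]

context tens
begin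

subsection \<open>Vanishing of antisymmetric traceless tensors\<close>

text \<open>
  Invariance up to the sign \<open>- e\<close> under the signed action of transpositions is antisymmetry in the
  usual sense.
\<close>

definition alt :: "nat set \<Rightarrow> ((nat \<Rightarrow> nat) \<Rightarrow> complex) \<Rightarrow> bool" where
  "alt C x \<longleftrightarrow> (\<forall>p\<in>C. \<forall>q\<in>C. p \<noteq> q \<longrightarrow> act e (gp (tr p q)) x = scl (- of_int e) x)"

lemma altD: "alt C x \<Longrightarrow> p \<in> C \<Longrightarrow> q \<in> C \<Longrightarrow> p \<noteq> q \<Longrightarrow> act e (gp (tr p q)) x = scl (- of_int e) x"
  by (simp add: alt_def)

text \<open>Antisymmetrises over \<open>insert o' C\<close> a tensor which is already antisymmetric over \<open>C\<close>.\<close>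

definition coset :: "nat \<Rightarrow> nat set \<Rightarrow> ((nat \<Rightarrow> nat) \<Rightarrow> complex) \<Rightarrow> (nat \<Rightarrow> nat) \<Rightarrow> complex" where
  "coset o' C x = x + (\<Sum>p\<in>C. scl (- of_int e) (act e (gp (tr o' p)) x))"

lemma tr_tr_shared: "distinct [a, b, c] \<Longrightarrow> tr a b + tr a c = tr a c + tr b c"
  by (rule fperm_eqI) (auto simp: ap_tr transpose_def)

lemma scl_e_e [simp]: "scl (- of_int e) (scl (- of_int e) x) = x"
  by (simp add: scl_simps)

text \<open>The identity and the transpositions of the new slot with those of C represent the cosets
  of the smaller symmetric group in the larger one, so a transposition permutes the terms up to the
  common sign.\<close>

lemma alt_coset:
  assumes x: "alt C x" and C: "finite C" "o' \<notin> C" shows "alt (insert o' C) (coset o' C x)"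
proof -
  let ?s = "- of_int e :: complex"
  let ?t = "\<lambda>p. act e (gp (tr o' p)) x"
  have new: "act e (gp (tr o' p)) (coset o' C x) = scl ?s (coset o' C x)" if p: "p \<in> C" for p
  proof -
    have q: "act e (gp (tr o' p)) (?t q) = scl ?s (?t q)" if q: "q \<in> C - {p}" for q
    proof -
      have d: "distinct [o', p, q]" using C p q by auto
      have "act e (gp (tr o' p)) (?t q) = act e (gp (tr o' q + tr p q)) x"
        unfolding tr_tr_shared[OF d, symmetric] by (simp add: gp_mult flip: act_mult)
      also have "\<dots> = act e (gp (tr o' q)) (act e (gp (tr p q)) x)" by (simp add: gp_mult flip: act_mult)
      also have "\<dots> = scl ?s (?t q)" using q by (subst altD[OF x p]) (auto simp: act_T_scl simp del: scl.scale_minus_left)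
      finally show ?thesis .
    qed
    have pp: "act e (gp (tr o' p)) (?t p) = x" by (simp add: gp_mult flip: act_mult)
    have split: "(\<Sum>q\<in>C. f q) = f p + (\<Sum>q\<in>C - {p}. f q)" for f :: "nat \<Rightarrow> (nat \<Rightarrow> nat) \<Rightarrow> complex"
      using C p by (simp add: sum.remove)
    have "act e (gp (tr o' p)) (coset o' C x) =
        ?t p + (scl ?s x + (\<Sum>q\<in>C - {p}. scl ?s (scl ?s (?t q))))"
      unfolding coset_def act_T_add act_T_sum act_T_scl split pp using q by simp
    also have "\<dots> = scl ?s (coset o' C x)"
      unfolding coset_def scl_simps(3) scl_sum split scl_e_e by simp
    finally show ?thesis .
  qed
  have old: "act e (gp (tr p q)) (coset o' C x) = scl ?s (coset o' C x)" if pq: "p \<in> C" "q \<in> C" "p \<noteq> q" for p q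
  proof -
    have "act e (gp (tr p q)) (?t r) = scl ?s (?t (transpose p q r))" if r: "r \<in> C" for r
    proof -
      have "tr p q + tr o' r = tr o' (transpose p q r) + tr p q"
        using C pq by (subst conj_tr) (auto simp: ap_tr transpose_def)
      then have "act e (gp (tr p q)) (?t r) = act e (gp (tr o' (transpose p q r))) (act e (gp (tr p q)) x)"
        by (simp add: gp_mult flip: act_mult)
      then show ?thesis using altD[OF x pq] by (simp add: act_T_scl)
    qed
    then have 1: "act e (gp (tr p q)) (coset o' C x) =
        scl ?s x + (\<Sum>r\<in>C. scl ?s (scl ?s (?t (transpose p q r))))"
      unfolding coset_def act_T_add act_T_sum act_T_scl altD[OF x pq] by simp
    have 2: "(\<Sum>r\<in>C. scl ?s (scl ?s (?t (transpose p q r)))) = (\<Sum>r\<in>C. scl ?s (scl ?s (?t r)))"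
      by (rule sum.reindex_bij_witness[of _ "transpose p q" "transpose p q"]) (use pq in \<open>auto simp: transpose_def\<close>)
    show ?thesis unfolding 1 2 by (simp add: coset_def scl_simps(3) scl_sum)
  qed
  show ?thesis
    unfolding alt_def using new old tr_commute by (metis insert_iff)
qed

text \<open>Each transposition is moved to the other argument, which absorbs it with the same
  sign.\<close>

lemma inn_coset:
  assumes "\<And>p. p \<in> C \<Longrightarrow> act e (gp (tr o' p)) U = scl (- of_int e) U" "o' < m" "C \<subseteq> {..<m}"
  shows "inn m (coset o' C x) U = (1 + of_nat (card C)) * inn m x U"
proof -
  have "inn m (scl (- of_int e) (act e (gp (tr o' p)) x)) U = inn m x U" if p: "p \<in> C" for p
  proof -
    have "tr o' p \<in> SP {..<m}" using assms(2,3) p by (intro SP_tr) auto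
    then show ?thesis unfolding inn_scl_left by (simp only: inn_act uminus_tr assms(1)[OF p] inn_scl_right) simp
  qed
  then show ?thesis by (simp add: coset_def inn_add_left inn_sum_left distrib_right del: scl.scale_minus_left)
qed

text \<open>Positivity of e D at y, where D y = k t, gives N e k \<open>inn m y t\<close> = k k
  \<open>inn m t t\<close>. By the hypothesis on \<open>inn m y y\<close> the left side is a
  nonpositive multiple of the squared norm of y, so both sides are zero.\<close>

lemma contraction_vanish:
  assumes t: "t \<in> W m" and y: "y \<in> W m" and ij: "i < m" "j < m" "i \<noteq> j"
    and D: "D i j y = scl (of_int k) t" and yy: "inn m y y = of_nat (Suc c) * inn m t y" and k: "e * k < 0"
  shows "t = 0"
proof -
  define T where "T = (\<Sum>x\<in>words m. (cmod (t x))\<^sup>2)"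
  define Y where "Y = (\<Sum>x\<in>words m. (cmod (y x))\<^sup>2)"
  have T: "inn m t t = of_real T" and Y: "inn m y y = of_real Y" by (simp_all add: inn_self T_def Y_def)
  have "inn m t y = of_real (Y / Suc c)"
    using yy unfolding Y by (simp add: nonzero_eq_divide_eq mult.commute del: of_nat_Suc)
  then have ty: "inn m y t = of_real (Y / Suc c)" by (metis inn_cnj complex_cnj_complex_of_real)
  have "of_nat N * (of_int e * (of_int k * inn m y t)) = of_int k * of_int k * inn m t t"
    using inn_D_self[OF ij, of y] unfolding D by (simp add: inn_scl_left inn_scl_right)
  then have "of_real (real N * (of_int (e * k) * (Y / Suc c))) = (of_real (of_int (k * k) * T) :: complex)"
    unfolding ty T by (simp add: ac_simps)
  then have "real N * (of_int (e * k) * (Y / Suc c)) = of_int (k * k) * T" by (rule of_real_eq_iff[THEN iffD1])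
  moreover have "0 \<le> Y" "0 \<le> T" by (simp_all add: T_def Y_def sum_nonneg)
  moreover have "real_of_int (e * k) < 0" using k by (metis of_int_less_0_iff)
  then have "real N * (of_int (e * k) * (Y / Suc c)) \<le> 0"
    using \<open>0 \<le> Y\<close> by (intro mult_nonneg_nonpos mult_nonpos_nonneg) simp_all
  moreover have "k * k > 0" using k by (cases "k = 0") (auto simp: zero_less_mult_iff linorder_neq_iff)
  ultimately have "T = 0" by (metis antisym mult_eq_0_iff mult_nonneg_nonneg of_int_0_eq_iff of_int_0_le_iff order_less_imp_le order_less_irrefl)
  then show ?thesis using inn_definite[OF t] T by simp
qed

text \<open>
  Adjoins two slots carrying the invariant tensor. Antisymmetrising the result together with the
  new slots and contracting these gives a multiple \<open>k\<close> of it. If the antisymmetric slots are too many,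
  then \<open>e * k < 0\<close>, which contradicts the positivity of \<open>e D\<close> unless the tensor vanishes.
\<close>

definition ext :: "nat \<Rightarrow> ((nat \<Rightarrow> nat) \<Rightarrow> complex) \<Rightarrow> (nat \<Rightarrow> nat) \<Rightarrow> complex" where
  "ext n x = (\<lambda>w. g (w n) (w (Suc n)) * x w)"

lemma ext_upd: "x \<in> W n \<Longrightarrow> x (w(n := a, Suc n := b)) = x w"
  by (rule locD[OF W_loc]) auto

lemma ext_W: "x \<in> W n \<Longrightarrow> ext n x \<in> W (Suc (Suc n))"
proof -
  assume x: "x \<in> W n"
  have "loc (Suc (Suc n)) (ext n x)"
    unfolding loc_def ext_def using locD[OF W_loc[OF x]] by (metis less_Suc_eq)
  moreover have "ext n x w = 0" if "i < Suc (Suc n)" "N \<le> w i" for w i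
    using that W_out[OF x, of i w] by (auto simp: ext_def less_Suc_eq g_out)
  ultimately show ?thesis by (simp add: W_def)
qed

lemma ext_D: "x \<in> W n \<Longrightarrow> D n (Suc n) (ext n x) = scl c0 (ext n x)"
proof
  fix w assume x: "x \<in> W n"
  have "ext n x (w(n := a, Suc n := b)) = g a b * x w" for a b
    using ext_upd[OF x, of w a b] by (simp add: ext_def)
  then have "(\<Sum>a<N. \<Sum>b<N. g a b * ext n x (w(n := a, Suc n := b))) = (\<Sum>a<N. \<Sum>b<N. g a b * g a b) * x w"
    by (simp add: sum_distrib_right mult.assoc)
  moreover have "(\<Sum>a<N. \<Sum>b<N. g a b * g a b) = (\<Sum>a<N. 1)"
    by (rule sum.cong) (use g_orth' in auto)
  ultimately have S: "(\<Sum>a<N. \<Sum>b<N. g a b * ext n x (w(n := a, Suc n := b))) = of_nat N * x w"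
    by (simp only: sum_constant card_lessThan mult_1_right)
  show "D n (Suc n) (ext n x) w = scl c0 (ext n x) w"
    unfolding D_def S by (simp add: scl_def ext_def)
qed

lemma ext_D_old:
  assumes "p < n" "q < n" "D p q x = 0" shows "D p q (ext n x) = 0"
proof
  fix w
  have "D p q (ext n x) w = g (w n) (w (Suc n)) * D p q x w"
    using assms(1,2) by (simp add: D_def ext_def sum_distrib_left ac_simps)
  then show "D p q (ext n x) w = 0 w" using assms(3) by simp
qed

lemma ext_alt:
  assumes "alt C x" "C \<subseteq> {..<n}" shows "alt C (ext n x)"
  unfolding alt_def
proof (intro ballI impI)
  fix p q assume pq: "p \<in> C" "q \<in> C" "p \<noteq> q"
  have "p < n" "q < n" using pq assms by auto
  then have "act e (gp (tr p q)) (ext n x) = ext n (act e (gp (tr p q)) x)"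
    by (auto simp: act_gp ext_def ap_tr transpose_def fun_eq_iff)
  then show "act e (gp (tr p q)) (ext n x) = scl (- of_int e) (ext n x)"
    using altD[OF assms(1) pq] by (simp add: ext_def scl_def fun_eq_iff)
qed

lemma ext_eq_0:
  assumes x: "x \<in> W n" and 0: "ext n x = 0" shows "x = 0"
proof
  fix w
  have "\<exists>a<N. g a 0 \<noteq> 0"
  proof (rule ccontr)
    assume "\<not> ?thesis"
    then have "(\<Sum>c<N. g c 0 * g c 0) = 0" by simp
    then show False using g_orth[of 0 0] N_pos by simp
  qed
  then obtain a where a: "g a 0 \<noteq> 0" by blast
  have "ext n x (w(n := a, Suc n := 0)) = 0" using 0 by simp
  then show "x w = 0 w" using a ext_upd[OF x] by (simp add: ext_def)
qed

text \<open>The contractions of the adjoined pair needed below. After one transposition with an old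
  slot the pair gives t back; after two, it contracts the old slots p and q of x.\<close>

lemma ext_D_tr:
  assumes x: "x \<in> W n" and p: "p < n" and q: "q < n"
  defines "t \<equiv> ext n x"
  shows "D n (Suc n) (act e (gp (tr n p)) t) = t" "D n (Suc n) (act e (gp (tr (Suc n) q)) t) = t"
    and "p \<noteq> q \<Longrightarrow> D p q x = 0 \<Longrightarrow> D n (Suc n) (act e (gp (tr (Suc n) q)) (act e (gp (tr n p)) t)) = 0"
    and "act e (gp (tr n (Suc n))) t = t"
proof -
  have t: "t \<in> W (Suc (Suc n))" "D n (Suc n) t = scl c0 t" unfolding t_def using x by (rule ext_W, intro ext_D)
  have t': "D (Suc n) n t = scl c0 t" using t(2) D_commute[of "Suc n" n t] by simp
  show "act e (gp (tr n (Suc n))) t = t" by (rule pair_sym[OF _ t(2)]) simp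
  have "D n (Suc n) (act e (gp (tr n p)) t) = act e (gp (tr n p)) (D p (Suc n) t)"
    using p by (simp add: D_act)
  also have "D p (Suc n) t = D (Suc n) p t" using p by (intro D_commute) simp
  also have "\<dots> = act e (gp (tr n p)) t" by (rule pair_move[OF t(1) _ _ _ _ _ _ t']) (use p in auto)
  finally show "D n (Suc n) (act e (gp (tr n p)) t) = t" by (simp add: gp_mult flip: act_mult)
  have "D n (Suc n) (act e (gp (tr (Suc n) q)) t) = act e (gp (tr (Suc n) q)) (D n q t)"
    using q by (simp add: D_act)
  also have "D n q t = act e (gp (tr (Suc n) q)) t" by (rule pair_move[OF t(1) _ _ _ _ _ _ t(2)]) (use q in auto)
  finally show "D n (Suc n) (act e (gp (tr (Suc n) q)) t) = t" by (simp add: gp_mult flip: act_mult)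
  assume pq: "p \<noteq> q" "D p q x = 0"
  have "D n (Suc n) (act e (gp (tr (Suc n) q)) (act e (gp (tr n p)) t)) =
      act e (gp (tr (Suc n) q)) (act e (gp (tr n p)) (D p q t))"
    using p q pq by (simp add: D_act)
  then show "D n (Suc n) (act e (gp (tr (Suc n) q)) (act e (gp (tr n p)) t)) = 0"
    using ext_D_old[OF p q pq(2)] by (simp add: t_def)
qed

lemma coset_W:
  assumes "x \<in> W m" "o' < m" "C \<subseteq> {..<m}" shows "coset o' C x \<in> W m"
  unfolding coset_def by (intro W_add W_sum W_scl W_act assms) (use assms in \<open>auto intro: SP_tr\<close>)

lemma D_coset:
  "D i j (coset o' C x) = D i j x + (\<Sum>p\<in>C. scl (- of_int e) (D i j (act e (gp (tr o' p)) x)))"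
  by (simp only: coset_def D_add D_sum D_scl)

lemma act_coset:
  "act e u (coset o' C x) = act e u x + (\<Sum>p\<in>C. scl (- of_int e) (act e u (act e (gp (tr o' p)) x)))"
  by (simp only: coset_def act_T_add act_T_sum act_T_scl)

lemma sum_scl_const: "(\<Sum>p\<in>C. scl c x) = scl (of_nat (card C) * c) x"
  by (rule ext) (simp add: sum_fun_apply scl_def)

text \<open>Each adjoined slot joins one column. Contracting the adjoined slots again gives N from
  the pair itself and -1 from every transposition with a column slot, hence k = N -
  \<open>card C1\<close> - \<open>card C2\<close>. Terms with two transpositions contract a slot of
  C1 with one of C2 and vanish.\<close>

lemma two_columns_vanish:
  assumes e1: "e = 1" and x: "x \<in> W n" and C: "C1 \<subseteq> {..<n}" "C2 \<subseteq> {..<n}" "C1 \<inter> C2 = {}"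
    and alt: "alt C1 x" "alt C2 x" and tl: "\<And>p q. p \<in> C1 \<Longrightarrow> q \<in> C2 \<Longrightarrow> D p q x = 0"
    and gt: "N < card C1 + card C2"
  shows "x = 0"
proof (rule ext_eq_0[OF x])
  let ?t = "ext n x" and ?m = "Suc (Suc n)"
  let ?U1 = "coset n C1 ?t"
  let ?U = "coset (Suc n) C2 ?U1"
  have fin: "finite C1" "finite C2" by (rule finite_subset[OF C(1)], simp, rule finite_subset[OF C(2)], simp)
  have sub: "C1 \<subseteq> {..<?m}" "C2 \<subseteq> {..<?m}" using C by auto
  have out: "n \<notin> C1" "Suc n \<notin> C1" "n \<notin> C2" "Suc n \<notin> C2" using C by auto
  have t: "?t \<in> W ?m" by (rule ext_W[OF x])
  have U1: "?U1 \<in> W ?m" by (rule coset_W[OF t]) (use sub in auto)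
  have U: "?U \<in> W ?m" by (rule coset_W[OF U1]) (use sub in auto)
  have commute: "act e (gp (tr p q)) (act e (gp (tr r s)) y) = act e (gp (tr r s)) (act e (gp (tr p q)) y)"
    if "{p, q} \<inter> {r, s} = {}" for p q r s y
  proof -
    have "tr p q + tr r s = tr r s + tr p q"
      by (rule SP_disjoint_commute[of _ "{p, q}" _ "{r, s}"]) (use that in \<open>auto intro: SP_tr\<close>)
    then show ?thesis by (simp add: gp_mult flip: act_mult)
  qed
  have alt1: "alt (insert n C1) ?U1"
    by (rule alt_coset[OF ext_alt[OF alt(1) C(1)] fin(1) out(1)])
  have alt21: "alt C2 ?U1"
    unfolding alt_def
  proof (intro ballI impI)
    fix p q assume pq: "p \<in> C2" "q \<in> C2" "p \<noteq> q"
    have t: "act e (gp (tr p q)) ?t = scl (- of_int e) ?t" by (rule altD[OF ext_alt[OF alt(2) C(2)] pq])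
    have "act e (gp (tr p q)) (act e (gp (tr n r)) ?t) = scl (- of_int e) (act e (gp (tr n r)) ?t)" if "r \<in> C1" for r
      using commute[of p q n r ?t] pq that out C(3) unfolding t act_T_scl by auto
    then show "act e (gp (tr p q)) ?U1 = scl (- of_int e) ?U1"
      unfolding act_coset t by (simp add: coset_def scl_simps(3) scl_sum)
  qed
  have alt2: "alt (insert (Suc n) C2) ?U" by (rule alt_coset[OF alt21 fin(2) out(4)])
  have alt12: "act e (gp (tr n p)) ?U = scl (- of_int e) ?U" if p: "p \<in> C1" for p
  proof -
    have u: "act e (gp (tr n p)) ?U1 = scl (- of_int e) ?U1" by (rule altD[OF alt1]) (use p out in auto)
    have "act e (gp (tr n p)) (act e (gp (tr (Suc n) r)) ?U1) = scl (- of_int e) (act e (gp (tr (Suc n) r)) ?U1)" if "r \<in> C2" for r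
      using commute[of n p "Suc n" r ?U1] p that out C(3) unfolding u act_T_scl by auto
    then show ?thesis unfolding act_coset[of _ "Suc n"] u by (simp add: coset_def[of "Suc n"] scl_simps(3) scl_sum)
  qed
  have "inn ?m ?U ?U = (1 + of_nat (card C2)) * inn ?m ?U1 ?U"
    by (rule inn_coset) (use altD[OF alt2] out sub in auto)
  also have "inn ?m ?U1 ?U = (1 + of_nat (card C1)) * inn ?m ?t ?U"
    by (rule inn_coset) (use alt12 out sub in auto)
  finally have inn: "inn ?m ?U ?U = of_nat (Suc (card C2 + card C1 + card C2 * card C1)) * inn ?m ?t ?U"
    by (simp add: algebra_simps)
  have "D n (Suc n) (act e (gp (tr (Suc n) q)) ?U1) = ?t" if q: "q \<in> C2" for q
  proof -
    have "D n (Suc n) (act e (gp (tr (Suc n) q)) (act e (gp (tr n p)) ?t)) = 0" if p: "p \<in> C1" for p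
      using ext_D_tr(3)[OF x, of p q] p q C tl by blast
    then show ?thesis unfolding act_coset D_add D_sum D_scl using ext_D_tr(2)[OF x, of q q] q C by (auto simp: scl_simps)
  qed
  moreover have "D n (Suc n) ?U1 = scl c0 ?t + (\<Sum>p\<in>C1. scl (- of_int e) ?t)"
    unfolding D_coset ext_D[OF x] by (intro arg_cong2[of _ _ _ _ "(+)"] refl sum.cong) (use ext_D_tr(1)[OF x] C in auto)
  ultimately have "D n (Suc n) ?U = scl c0 ?t + (\<Sum>p\<in>C1. scl (- of_int e) ?t) + (\<Sum>q\<in>C2. scl (- of_int e) ?t)"
    unfolding D_coset[of _ _ "Suc n"] by simp
  also have "\<dots> = scl (of_int (int N - int (card C1) - int (card C2))) ?t"
    unfolding sum_scl_const e1 by (simp flip: scl_simps(4))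
  finally have D: "D n (Suc n) ?U = \<dots>" .
  show "?t = 0"
    by (rule contraction_vanish[OF t U _ _ _ D inn]) (use gt e1 in auto)
qed

text \<open>Both adjoined slots join the same column. The first antisymmetrisation contributes
  \<open>card C\<close> - N, the transposition of the two new slots contributes the same again, and
  each q in C contributes 2; so k = 4 \<open>card C\<close> - 2 N.\<close>

lemma long_column_vanish:
  assumes e1: "e = -1" and x: "x \<in> W n" and C: "C \<subseteq> {..<n}"
    and alt: "alt C x" and tl: "traceless C x" and gt: "N < 2 * card C"
  shows "x = 0"
proof (rule ext_eq_0[OF x])
  let ?t = "ext n x" and ?m = "Suc (Suc n)"
  let ?U1 = "coset n C ?t"
  let ?U = "coset (Suc n) (insert n C) ?U1"
  let ?k = "of_nat (card C) :: complex"
  have fin: "finite C" using C by (rule finite_subset) simp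
  have sub: "C \<subseteq> {..<?m}" using C by auto
  have out: "n \<notin> C" "Suc n \<notin> C" using C by auto
  have ss: "scl (- of_int e) y = y" for y by (simp add: e1 scl_simps)
  have t: "?t \<in> W ?m" by (rule ext_W[OF x])
  have U1: "?U1 \<in> W ?m" by (rule coset_W[OF t]) (use sub in auto)
  have U: "?U \<in> W ?m" by (rule coset_W[OF U1]) (use sub in auto)
  have alt1: "alt (insert n C) ?U1"
    by (rule alt_coset[OF ext_alt[OF alt C] fin out(1)])
  have alt2: "alt (insert (Suc n) (insert n C)) ?U"
    by (rule alt_coset[OF alt1]) (use fin out in auto)
  have "inn ?m ?U ?U = (1 + of_nat (card (insert n C))) * inn ?m ?U1 ?U"
    by (rule inn_coset) (use altD[OF alt2] out sub in auto)
  also have "inn ?m ?U1 ?U = (1 + of_nat (card C)) * inn ?m ?t ?U"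
    by (rule inn_coset) (use altD[OF alt2, of n] out sub in auto)
  also have "card (insert n C) = Suc (card C)" using fin out by simp
  finally have inn: "inn ?m ?U ?U = of_nat (Suc (Suc (card C + card C + card C + card C * card C))) * inn ?m ?t ?U"
    by (simp add: algebra_simps)
  have old: "D n (Suc n) (act e (gp (tr (Suc n) q)) ?U1) = scl 2 ?t" if q: "q \<in> C" for q
  proof -
    have "D n (Suc n) (act e (gp (tr (Suc n) q)) (act e (gp (tr n p)) ?t)) = (if p = q then ?t else 0)" if p: "p \<in> C" for p
    proof (cases "p = q")
      case True
      have d: "distinct [p, Suc n, n]" using p out by auto
      have "act e (gp (tr (Suc n) p)) (act e (gp (tr n p)) ?t) = act e (gp (tr p (Suc n) + tr p n)) ?t"
        by (simp add: gp_mult tr_commute[of p] flip: act_mult)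
      also have "\<dots> = act e (gp (tr n p)) (act e (gp (tr n (Suc n))) ?t)"
        unfolding tr_tr_shared[OF d] by (simp add: gp_mult tr_commute[of p] tr_commute[of "Suc n"] flip: act_mult)
      also have "\<dots> = act e (gp (tr n p)) ?t" using ext_D_tr(4)[OF x, of p p] p C by auto
      finally show ?thesis using ext_D_tr(1)[OF x, of p p] p C True by auto
    next
      case False
      then have "D p q x = 0" using tl p q by (simp add: traceless_def)
      then show ?thesis using ext_D_tr(3)[OF x, of p q] p q C False by auto
    qed
    then have "D n (Suc n) (act e (gp (tr (Suc n) q)) ?U1) = ?t + (\<Sum>p\<in>C. if p = q then ?t else 0)"
      unfolding act_coset D_add D_sum D_scl ss using ext_D_tr(2)[OF x, of q q] q C by auto
    also have "\<dots> = scl 2 ?t" using q fin scl_simps(4)[of 1 1 ?t] by (simp add: scl_simps(2))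
    finally show ?thesis .
  qed
  have U1D: "D n (Suc n) ?U1 = scl (c0 + ?k) ?t"
  proof -
    have "D n (Suc n) ?U1 = scl c0 ?t + (\<Sum>p\<in>C. scl 1 ?t)"
      unfolding D_coset ext_D[OF x] ss by (intro arg_cong2[of _ _ _ _ "(+)"] refl sum.cong) (use ext_D_tr(1)[OF x] C in \<open>auto simp: scl_simps\<close>)
    then show ?thesis unfolding sum_scl_const by (simp add: scl_simps(4))
  qed
  have new: "D n (Suc n) (act e (gp (tr (Suc n) n)) ?U1) = scl (c0 + ?k) ?t"
  proof -
    have "D n (Suc n) (act e (gp (tr (Suc n) n)) ?U1) = act e (gp (tr n (Suc n))) (D n (Suc n) ?U1)"
      unfolding D_act by (simp add: D_commute[of "Suc n" n] tr_commute[of "Suc n"])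
    also have "\<dots> = scl (c0 + ?k) (act e (gp (tr n (Suc n))) ?t)" unfolding U1D act_T_scl ..
    also have "act e (gp (tr n (Suc n))) ?t = ?t"
      by (rule pair_sym[OF _ ext_D[OF x]]) simp
    finally show ?thesis .
  qed
  have "D n (Suc n) ?U = scl (c0 + ?k) ?t + (scl (c0 + ?k) ?t + (\<Sum>q\<in>C. scl 2 ?t))"
    unfolding D_coset[of _ _ "Suc n"] ss U1D using fin out new old by simp
  also have "\<dots> = scl (of_int (- 2 * int N + 4 * int (card C))) ?t"
    unfolding sum_scl_const e1 by (simp flip: scl_simps(4) add: algebra_simps)
  finally have D: "D n (Suc n) ?U = \<dots>" .
  show "?t = 0"
    by (rule contraction_vanish[OF t U _ _ _ D inn]) (use gt e1 in auto)
qed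

subsection \<open>Restrictions on the shapes\<close>

text \<open>The lines of the diagram along which tensors become antisymmetric in the usual sense:
  for \<epsilon> = -1 the sign twist of the action exchanges the roles of rows and columns.\<close>

definition lin :: "nat list \<Rightarrow> nat \<Rightarrow> nat" where
  "lin \<mu> = (if e = 1 then tab_col \<mu> else tab_row \<mu>)"

text \<open>Some conjugate of c = A B is nonzero on x. For \<epsilon> = 1 its part beginning with B
  is used; for \<epsilon> = -1 the whole of c, whose outer factor A antisymmetrises under the
  twisted action.\<close>

lemma zz_alt:
  assumes mu: "\<mu> \<in> partitions n" and nz: "act e (zz \<mu>) x \<noteq> 0"
  shows "\<exists>u\<in>CS {..<n}. act e u x \<noteq> 0 \<and> (\<forall>j. alt {k. k < n \<and> lin \<mu> k = j} (act e u x))"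
proof -
  interpret t: tab n "tab_row \<mu>" "tab_col \<mu>" "rl \<mu>" by (rule tab_partition[OF mu])
  have "act e t.Y x \<noteq> 0"
    using nz unfolding zz_z[OF mu] t.z_def by (auto simp: act_sc_mult scl_simps)
  then obtain h where h: "h \<in> SP {..<n}" "act e (gp h * t.c * gp (- h)) x \<noteq> 0"
    unfolding t.Y_def act_sum by (meson sum.neutral)
  have nz: "act e (t.c * gp (- h)) x \<noteq> 0" "act e (t.B * gp (- h)) x \<noteq> 0"
    using h(2) by (auto simp: act_mult t.c_def mult.assoc)
  have alt: "alt {k. k < n \<and> f k = j} (act e (stabsum s n f * u) x)" if s: "s = - e" for f s u j
    unfolding alt_def
  proof (intro ballI impI)
    fix p q assume "p \<in> {k. k < n \<and> f k = j}" "q \<in> {k. k < n \<and> f k = j}" "p \<noteq> q"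
    then have st: "tr p q \<in> stab n f" and pq: "p \<noteq> q" by (auto intro: tr_stab)
    have "sg s (tr p q) = - of_int e" using pq e s by (subst sg_tr) auto
    then have "gp (tr p q) * (stabsum s n f * u) = sc (- of_int e) * (stabsum s n f * u)"
      using stabsum_left[OF st, of s] by (simp flip: mult.assoc)
    then show "act e (gp (tr p q)) (act e (stabsum s n f * u) x) = scl (- of_int e) (act e (stabsum s n f * u) x)"
      by (simp flip: act_mult act_sc_mult)
  qed
  show ?thesis
  proof (cases "e = 1")
    case True
    have "t.B * gp (- h) \<in> CS {..<n}" using h(1) by (intro CS_mult) auto
    moreover have "alt {k. k < n \<and> lin \<mu> k = j} (act e (t.B * gp (- h)) x)" for j
      unfolding t.B_def lin_def using alt True by simp
    ultimately show ?thesis using nz(2) by blast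
  next
    case False
    have "t.c * gp (- h) \<in> CS {..<n}" using h(1) by (intro CS_mult) auto
    moreover have "alt {k. k < n \<and> lin \<mu> k = j} (act e (t.c * gp (- h)) x)" for j
      unfolding t.c_def t.A_def lin_def mult.assoc using alt[of 1] False e by auto
    ultimately show ?thesis using nz(1) by blast
  qed
qed

text \<open>A word with more slots in C than letters repeats a letter there, and antisymmetry makes
  the value zero.\<close>

lemma alt_card:
  assumes x: "x \<in> W n" "x \<noteq> 0" and C: "C \<subseteq> {..<n}" "alt C x" shows "card C \<le> N"
proof (rule ccontr)
  assume gt: "\<not> card C \<le> N"
  have "x w = 0" for w
  proof (cases "\<forall>i<n. w i < N")
    case True
    then have "w ` C \<subseteq> {..<N}" using C by auto
    then have "\<not> inj_on w C" using gt card_inj_on_le[of w C "{..<N}"] by auto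
    then obtain p q where pq: "p \<in> C" "q \<in> C" "p \<noteq> q" "w p = w q" unfolding inj_on_def by blast
    have "w \<circ> ap (tr p q) = w" using pq(4) by (auto simp: fun_eq_iff ap_tr transpose_def)
    then have "sg e (tr p q) * x w = - of_int e * x w"
      using fun_cong[OF altD[OF C(2) pq(1-3)], of w] by (simp add: act_gp scl_def)
    then show ?thesis using sg_tr[OF pq(3) e] e by auto
  next
    case False
    then show ?thesis using W_out[OF x(1)] by (auto simp: not_less)
  qed
  then show False using x(2) by (simp add: fun_eq_iff)
qed

lemma card_column:
  assumes "\<mu> \<in> partitions n"
  shows "part (conjugate \<mu>) (Suc j) = card {k. k < n \<and> tab_col \<mu> k = j}"
proof -
  interpret t: tab n "tab_row \<mu>" "tab_col \<mu>" "rl \<mu>" by (rule tab_partition[OF assms])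
  have img: "tab_row \<mu> ` {k. k < n \<and> tab_col \<mu> k = j} = {i. (i, j) \<in> young \<mu>}"
  proof (intro equalityI subsetI)
    fix i assume "i \<in> {i. (i, j) \<in> young \<mu>}"
    then obtain k where "k < n" "tab_row \<mu> k = i" "tab_col \<mu> k = j" using t.pos_ex by (auto simp: young_rl)
    then show "i \<in> tab_row \<mu> ` {k. k < n \<and> tab_col \<mu> k = j}" by blast
  qed (auto simp: young_rl dest: t.pos_in)
  have "inj_on (tab_row \<mu>) {k. k < n \<and> tab_col \<mu> k = j}"
    by (rule inj_onI, rule t.pos_inj) auto
  from card_image[OF this] have card: "card {i. (i, j) \<in> young \<mu>} = card {k. k < n \<and> tab_col \<mu> k = j}"
    unfolding img .
  show ?thesis
  proof (cases "j < part \<mu> 1")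
    case True
    then show ?thesis using card by (simp add: part_def conjugate_def)
  next
    case False
    have len: "length (conjugate \<mu>) = part \<mu> 1" by (simp add: conjugate_def)
    have "(i, j) \<notin> young \<mu>" for i
      using False rl_dec[OF assms, of 0 i] part_rl[of \<mu> 0] by (auto simp: young_rl)
    then have "{i. (i, j) \<in> young \<mu>} = {}" by simp
    moreover have "part (conjugate \<mu>) (Suc j) = 0" using False len by (simp add: part_def[of "conjugate \<mu>"])
    ultimately show ?thesis using card by simp
  qed
qed

lemma card_first_row:
  assumes "\<mu> \<in> partitions n" shows "part \<mu> 1 = card {k. k < n \<and> tab_row \<mu> k = 0}"
proof -
  interpret t: tab n "tab_row \<mu>" "tab_col \<mu>" "rl \<mu>" by (rule tab_partition[OF assms])
  show ?thesis using t.card_row[of 0] part_rl[of \<mu> 0] by simp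
qed

lemma zz_Sigma:
  assumes x: "x \<in> W n" and mu: "\<mu> \<in> partitions n" and nz: "act e (zz \<mu>) x \<noteq> 0"
  shows "\<mu> \<in> Sigma_set e N n"
proof -
  obtain u where u: "u \<in> CS {..<n}" "act e u x \<noteq> 0" "alt {k. k < n \<and> lin \<mu> k = 0} (act e u x)"
    using zz_alt[OF mu nz] by blast
  have "card {k. k < n \<and> lin \<mu> k = 0} \<le> N"
    by (rule alt_card[OF W_act[OF x u(1)] u(2) _ u(3)]) auto
  then show ?thesis
    using mu card_column[OF mu, of 0] card_first_row[OF mu] by (auto simp: Sigma_set_def lin_def)
qed

text \<open>After cutting by the symmetriser the lines of \<kappa> are antisymmetric and still
  traceless, so the two vanishing results bound the first two columns or the first row.\<close>

lemma zz_Lambda: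
  assumes x: "x \<in> W n" and l: "l \<le> n" and t: "traceless {..<l} x" and la: "\<kappa> \<in> partitions l" and nz: "act e (zz \<kappa>) x \<noteq> 0"
  shows "\<kappa> \<in> Lambda_set e N l"
proof -
  obtain u where u: "u \<in> CS {..<l}" "act e u x \<noteq> 0" "\<And>j. alt {k. k < l \<and> lin \<kappa> k = j} (act e u x)"
    using zz_alt[OF la nz] by blast
  have W: "act e u x \<in> W n" using x u(1) l by (intro W_act) (auto elim!: CS_mono)
  have tl: "traceless {..<l} (act e u x)" by (rule traceless_act[OF t u(1)])
  show ?thesis
  proof (cases "e = 1")
    case True
    have "\<not> N < card {k. k < l \<and> lin \<kappa> k = 0} + card {k. k < l \<and> lin \<kappa> k = 1}"
    proof
      assume gt: "N < card {k. k < l \<and> lin \<kappa> k = 0} + card {k. k < l \<and> lin \<kappa> k = 1}"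
      have "act e u x = 0"
      proof (rule two_columns_vanish[OF True W _ _ _ u(3) u(3) _ gt])
        fix p q assume "p \<in> {k. k < l \<and> lin \<kappa> k = 0}" "q \<in> {k. k < l \<and> lin \<kappa> k = 1}"
        then have "p \<in> {..<l}" "q \<in> {..<l}" "p \<noteq> q" by auto
        then show "D p q (act e u x) = 0" using tl unfolding traceless_def by blast
      qed (use l in auto)
      then show False using u(2) by simp
    qed
    moreover have "lin \<kappa> = tab_col \<kappa>" unfolding lin_def using True by simp
    ultimately show ?thesis
      using la True card_column[OF la, of 0] card_column[OF la, of 1]
      by (simp add: Lambda_set_def numeral_2_eq_2)
  next
    case False
    have "\<not> N < 2 * card {k. k < l \<and> lin \<kappa> k = 0}"
    proof
      assume gt: "N < 2 * card {k. k < l \<and> lin \<kappa> k = 0}"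
      have "e = -1" using e False by blast
      moreover have "traceless {k. k < l \<and> lin \<kappa> k = 0} (act e u x)"
        using tl unfolding traceless_def by blast
      moreover have "{k. k < l \<and> lin \<kappa> k = 0} \<subseteq> {..<n}" using l by auto
      ultimately have "act e u x = 0" using long_column_vanish[OF _ W _ u(3) _ gt] by blast
      then show False using u(2) by simp
    qed
    then show ?thesis using la False card_first_row[OF la] by (simp add: Lambda_set_def lin_def)
  qed
qed

subsection \<open>The spectrum of the sum of all contractions\<close>

lemma inn_sum_right: "inn n S (sum f A) = (\<Sum>i\<in>A. inn n S (f i))"
  using sum_comp_morphism[of "inn n S" f A] by (simp add: inn_zero inn_add_right comp_def)

text \<open>By \<open>inn_D_self\<close>, N times the inner product of y with \<epsilon> A2 y is the
  sum of the squared norms of all \<open>D i j y\<close>; if it is zero, each of these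
  vanishes.\<close>

lemma A2_positive:
  assumes y: "y \<in> W n" "y \<noteq> 0" and A: "A2 n y = scl (of_int (2 * \<theta>)) y"
  shows "0 \<le> e * \<theta>" "\<theta> = 0 \<Longrightarrow> traceless {..<n} y"
proof -
  define M where "M T = (\<Sum>x\<in>words n. (cmod (T x))\<^sup>2)" for T :: "(nat \<Rightarrow> nat) \<Rightarrow> complex"
  have M: "inn n T T = of_real (M T)" "0 \<le> M T" for T by (simp_all add: inn_self M_def sum_nonneg)
  have M0: "T = 0" if "T \<in> W n" "M T = 0" for T using inn_definite[OF that(1)] that(2) M(1) by simp
  define S where "S = (\<Sum>i<n. \<Sum>j\<in>{..<n} - {i}. M (D i j y))"
  have "of_nat N * (of_int e * inn n y (A2 n y)) = (\<Sum>i<n. \<Sum>j\<in>{..<n} - {i}. of_nat N * (of_int e * inn n y (D i j y)))"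
    by (simp add: A2_def inn_sum_right sum_distrib_left)
  also have "\<dots> = (\<Sum>i<n. \<Sum>j\<in>{..<n} - {i}. of_real (M (D i j y)))"
  proof (intro sum.cong refl)
    fix i j assume "i \<in> {..<n}" "j \<in> {..<n} - {i}"
    then show "of_nat N * (of_int e * inn n y (D i j y)) = of_real (M (D i j y))"
      using inn_D_self[of i n j y] M(1) by auto
  qed
  finally have "of_nat N * (of_int e * (of_int (2 * \<theta>) * of_real (M y))) = (of_real S :: complex)"
    unfolding A inn_scl_right M(1) by (simp add: S_def)
  then have "of_real (2 * real N * of_int (e * \<theta>) * M y) = (of_real S :: complex)" by (simp add: ac_simps)
  then have eq: "2 * real N * of_int (e * \<theta>) * M y = S" by (rule of_real_eq_iff[THEN iffD1])
  have "0 < M y" using M0[OF y(1)] M(2)[of y] y(2) by (cases "M y = 0") auto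
  moreover have S: "0 \<le> S" unfolding S_def by (intro sum_nonneg M(2))
  ultimately have "0 \<le> real_of_int (e * \<theta>)"
    using N_pos unfolding eq[symmetric] by (simp add: zero_le_mult_iff)
  then show "0 \<le> e * \<theta>" by (rule of_int_0_le_iff[THEN iffD1])
  assume "\<theta> = 0"
  then have "S = 0" using eq by simp
  have "M (D i j y) = 0" if ij: "i < n" "j < n" "i \<noteq> j" for i j
  proof -
    have "(\<Sum>j\<in>{..<n} - {i}. M (D i j y)) = 0"
      using \<open>S = 0\<close> ij unfolding S_def by (subst (asm) sum_nonneg_eq_0_iff) (auto intro: sum_nonneg M(2))
    then show ?thesis using ij by (subst (asm) sum_nonneg_eq_0_iff) (auto intro: M(2))
  qed
  then show "traceless {..<n} y" using M0 W_D[OF y(1)] by (auto simp: traceless_def)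
qed

text \<open>Carries elements on the first n - m places to the last n - m places, where the traceless
  slots are.\<close>

definition shifted :: "nat \<Rightarrow> nat \<Rightarrow> galg \<Rightarrow> galg" where
  "shifted n m a = gp (rot n m) * a * gp (- rot n m)"

lemma shifted_CS: "m \<le> n \<Longrightarrow> a \<in> CS {..<n - m} \<Longrightarrow> shifted n m a \<in> CS {m..<n}"
  using rot_conj_CS[of a "n - m" m] by (simp add: shifted_def)

lemma shifted_Tr2: "m \<le> n \<Longrightarrow> shifted n m (Tr2 {..<n - m}) = Tr2 {m..<n}"
proof -
  assume m: "m \<le> n"
  have "ap (rot n m) ` {..<n - m} = (\<lambda>i. i + m) ` {..<n - m}"
    by (rule image_cong) (use rot(2)[OF m] in auto)
  also have "\<dots> = {m..<n}" using image_add_atLeastLessThan'[of m 0 "n - m"] m by (simp add: lessThan_atLeast0)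
  finally show ?thesis
    unfolding shifted_def using Tr2_conj[of "{..<n - m}" "rot n m"] by (simp add: inj_on_def mult.assoc)
qed

lemma shifted_mult: "shifted n m a * shifted n m b = shifted n m (a * b)"
  by (simp add: shifted_def mult.assoc)

text \<open>In \<open>A2_paired\<close> the transpositions of all places can be moved to
  \<open>zz \<mu>\<close> and those of the traceless slots to the shifted
  \<open>zz \<kappa>\<close>, which turns both into contents. The factor h is the permutation that
  the spanning tensors carry.\<close>

lemma generator:
  assumes x: "x \<in> W n" and f: "2 * f \<le> n" and p: "paired f x" and t: "traceless {2 * f..<n} x" and h: "h \<in> SP {..<n}"
    and mu: "\<mu> \<in> partitions n" and nu: "\<nu> \<in> partitions (2 * f)" and la: "\<kappa> \<in> partitions (n - 2 * f)"
  defines "y \<equiv> act e (zz \<mu> * gp h * zz \<nu> * shifted n (2 * f) (zz \<kappa>)) x"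
  assumes y: "y \<noteq> 0"
  shows "A2 n y = scl (of_int (2 * ((e * int N - 1) * int f + (content \<mu> - content \<kappa>)))) y"
    and "\<kappa> \<in> Lambda_set e N (n - 2 * f)" "\<mu> \<in> Sigma_set e N n" "even_partition \<nu>"
    and "lr_coeff \<mu> \<nu> \<kappa> \<noteq> 0" "lr_coeff \<mu> \<kappa> \<nu> \<noteq> 0" "young \<kappa> \<subseteq> young \<mu>" "young \<nu> \<subseteq> young \<mu>"
proof -
  let ?r = "rot n (2 * f)" and ?l = "n - 2 * f"
  let ?z = "shifted n (2 * f) (zz \<kappa>)"
  let ?u = "zz \<mu> * gp h * zz \<nu> * ?z"
  have n: "2 * f + ?l = n" "?l + 2 * f = n" using f by simp_all
  have zla: "?z \<in> CS {2 * f..<n}" using la f by (intro shifted_CS) simp_all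
  have r: "?r \<in> SP {..<n}" using f by (rule rot)
  have mono: "a \<in> CS {2 * f..<n} \<Longrightarrow> a \<in> CS {..<n}" "a \<in> CS {..<2 * f} \<Longrightarrow> a \<in> CS {..<n}" for a
    by (erule CS_mono, use f in auto)+
  have u: "?u \<in> CS {..<n}" using mu nu h zla by (intro CS_mult) (simp_all add: mono)
  have nz: "zz \<nu> * ?z * zz \<mu> \<noteq> 0"
  proof
    assume 0: "zz \<nu> * ?z * zz \<mu> = 0"
    have "gp h * zz \<nu> * ?z \<in> CS {..<n}" using h nu zla by (intro CS_mult) (simp_all add: mono)
    then have "?u = gp h * (zz \<nu> * ?z * zz \<mu>)" using zz_commute[OF mu, of "gp h * zz \<nu> * ?z"] by (simp add: mult.assoc)
    then show False using y 0 by (simp add: y_def)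
  qed
  have com: "zz \<nu> * ?z = ?z * zz \<nu>"
    by (rule CS_disjoint_commute[OF zz_CS[OF nu] zla]) auto
  have "act e ?z x \<noteq> 0" using y by (auto simp: y_def act_mult)
  then have nzla: "act e (zz \<kappa>) (act e (gp (- ?r)) x) \<noteq> 0" by (auto simp: shifted_def act_mult)
  have Tmu: "?u * Tr2 {..<n} = sc (of_int (2 * content \<mu>)) * ?u"
  proof -
    have "?u * Tr2 {..<n} = Tr2 {..<n} * zz \<mu> * (gp h * zz \<nu> * ?z)"
      using Tr2_commute[OF u] by (simp add: mult.assoc)
    also have "\<dots> = sc (of_int (2 * content \<mu>)) * ?u" unfolding Tr2_zz_content[OF mu] by (simp add: mult.assoc)
    finally show ?thesis .
  qed
  have Tla: "?u * Tr2 {2 * f..<n} = sc (of_int (2 * content \<kappa>)) * ?u"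
  proof -
    have "?z * Tr2 {2 * f..<n} = shifted n (2 * f) (Tr2 {..<?l} * zz \<kappa>)"
      unfolding shifted_Tr2[OF f, symmetric] shifted_mult zz_commute[OF la Tr2_CS] ..
    also have "\<dots> = sc (of_int (2 * content \<kappa>)) * ?z"
      unfolding Tr2_zz_content[OF la] shifted_def by (simp add: sc_left_commute[of "gp ?r"] mult.assoc)
    finally show ?thesis by (simp add: mult.assoc sc_left_commute[of "zz \<mu>"] sc_left_commute[of "gp h"] sc_left_commute[of "zz \<nu>"])
  qed
  have "A2 n y = act e ?u (A2 n x)" unfolding y_def by (rule A2_act[OF u])
  also have "\<dots> = scl (2 * of_nat f * (c0 - 1)) y + act e (?u * Tr2 {..<n}) x - act e (?u * Tr2 {2 * f..<n}) x"
    unfolding A2_paired[OF x f p t] by (simp add: y_def act_T_add act_T_diff act_T_scl act_mult)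
  also have "\<dots> = scl (2 * of_nat f * (c0 - 1)) y + scl (of_int (2 * content \<mu>)) y - scl (of_int (2 * content \<kappa>)) y"
    unfolding Tmu Tla act_sc_mult y_def ..
  also have "\<dots> = scl (of_int (2 * ((e * int N - 1) * int f + (content \<mu> - content \<kappa>)))) y"
    by (rule ext) (simp add: scl_def algebra_simps)
  finally show "A2 n y = scl (of_int (2 * ((e * int N - 1) * int f + (content \<mu> - content \<kappa>)))) y" .
  show "\<kappa> \<in> Lambda_set e N ?l"
  proof (rule zz_Lambda[OF _ _ _ la nzla])
    show "act e (gp (- ?r)) x \<in> W n" using x r by (intro W_act) auto
    show "traceless {..<?l} (act e (gp (- ?r)) x)"
      unfolding traceless_def
    proof (intro ballI impI)
      fix i j assume ij: "i \<in> {..<?l}" "j \<in> {..<?l}" "i \<noteq> j"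
      then have "ap ?r i = i + 2 * f" "ap ?r j = j + 2 * f" by (intro rot(2)[OF f], simp)+
      then show "D i j (act e (gp (- ?r)) x) = 0" using ij t by (simp add: D_act traceless_def)
    qed
  qed simp
  show "\<mu> \<in> Sigma_set e N n"
  proof (rule zz_Sigma[OF _ mu])
    show "act e (gp h * zz \<nu> * ?z) x \<in> W n"
      using x h nu zla by (intro W_act CS_mult) (simp_all add: mono)
    show "act e (zz \<mu>) (act e (gp h * zz \<nu> * ?z) x) \<noteq> 0"
      using y by (simp add: y_def mult.assoc flip: act_mult)
  qed
  show "even_partition \<nu>"
  proof (rule paired_even[OF _ f _ nu])
    show "act e ?z x \<in> W n" using x zla by (intro W_act mono)
    show "paired f (act e ?z x)" by (rule paired_act[OF p zla]) auto
    show "act e (zz \<nu>) (act e ?z x) \<noteq> 0" using y by (auto simp: y_def act_mult)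
  qed
  show "lr_coeff \<mu> \<nu> \<kappa> \<noteq> 0"
    by (rule lr_coeff_nonzero[OF nu la]) (use mu nz n in \<open>simp_all add: shifted_def\<close>)
  show "lr_coeff \<mu> \<kappa> \<nu> \<noteq> 0"
  proof (rule lr_coeff_nonzero[OF la nu])
    \<comment> \<open>The other order of the blocks: conjugation by the rotation exchanges them, and
      the two block idempotents commute.\<close>
    have r': "rot n ?l = - ?r" using rot_uminus[OF f] by simp
    show "zz \<kappa> * (gp (rot (?l + 2 * f) ?l) * zz \<nu> * gp (- rot (?l + 2 * f) ?l)) * zz \<mu> \<noteq> 0"
    proof
      assume "zz \<kappa> * (gp (rot (?l + 2 * f) ?l) * zz \<nu> * gp (- rot (?l + 2 * f) ?l)) * zz \<mu> = 0"
      then have 0: "zz \<kappa> * (gp (- ?r) * zz \<nu> * gp ?r) * zz \<mu> = 0" unfolding n r' by simp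
      have "?z * zz \<nu> * zz \<mu> * gp ?r = gp ?r * (zz \<kappa> * (gp (- ?r) * zz \<nu> * gp ?r) * zz \<mu>)"
        using zz_commute[OF mu, of "gp ?r"] r by (simp add: shifted_def mult.assoc)
      then have "?z * zz \<nu> * zz \<mu> * gp ?r * gp (- ?r) = 0" using 0 by simp
      then have "?z * zz \<nu> * zz \<mu> = 0" by (simp add: mult.assoc)
      then show False using nz com by simp
    qed
  qed (use mu n in simp)
  show "young \<kappa> \<subseteq> young \<mu>"
  proof (rule zz_conj_subset[OF _ la mu r])
    have "zz \<nu> * (?z * zz \<mu>) \<noteq> 0" using nz by (simp add: mult.assoc)
    then show "gp ?r * zz \<kappa> * gp (- ?r) * zz \<mu> \<noteq> 0" by (auto simp: shifted_def)
  qed simp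
  show "young \<nu> \<subseteq> young \<mu>"
  proof (rule zz_conj_subset[OF f nu mu, of 0])
    have "?z * (zz \<nu> * zz \<mu>) \<noteq> 0" using nz com by (simp add: mult.assoc)
    then show "gp 0 * zz \<nu> * gp (- 0) * zz \<mu> \<noteq> 0" by auto
  qed simp
qed

subsection \<open>The two projectors in coordinates\<close>

text \<open>The 2 in the denominator compensates for \<open>A2\<close> being twice the operator of
  \<open>A_elt\<close>.\<close>

definition factors :: "nat \<Rightarrow> int list \<Rightarrow> ((nat \<Rightarrow> nat) \<Rightarrow> complex) \<Rightarrow> (nat \<Rightarrow> nat) \<Rightarrow> complex" where
  "factors n = foldr (\<lambda>\<alpha> x. x - scl (1 / (2 * of_int \<alpha>)) (A2 n x))"

lemma factors_simps [simp]:
  "factors n [] x = x"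
  "factors n (\<alpha> # as) x = factors n as x - scl (1 / (2 * of_int \<alpha>)) (A2 n (factors n as x))"
  by (simp_all add: factors_def)

lemma factors_add: "factors n as (x + y) = factors n as x + factors n as y"
  by (rule list.induct[of "\<lambda>as. factors n as (x + y) = factors n as x + factors n as y"])
     (simp_all only: factors_simps A2_add scl_simps(3) add_diff_add)

lemma factors_scl: "factors n as (scl c x) = scl c (factors n as x)"
  by (rule list.induct[of "\<lambda>as. factors n as (scl c x) = scl c (factors n as x)"])
     (simp_all only: factors_simps A2_scl scl.scale_right_diff_distrib scl.scale_left_commute[of c])

lemma factors_zero [simp]: "factors n as 0 = 0"
  by (rule list.induct[of "\<lambda>as. factors n as 0 = 0"]) (simp_all only: factors_simps A2_zero scl_simps diff_zero)

lemma factors_eigen: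
  assumes "A2 n y = scl (of_int (2 * \<theta>)) y"
  shows "factors n as y = scl (\<Prod>\<alpha>\<leftarrow>as. 1 - of_int \<theta> / of_int \<alpha>) y"
proof (induction as)
  case (Cons \<alpha> as)
  have "factors n (\<alpha> # as) y = scl (\<Prod>\<alpha>\<leftarrow>as. 1 - of_int \<theta> / of_int \<alpha>) y -
      scl (1 / (2 * of_int \<alpha>) * ((\<Prod>\<alpha>\<leftarrow>as. 1 - of_int \<theta> / of_int \<alpha>) * of_int (2 * \<theta>))) y"
    by (simp add: Cons.IH A2_scl assms scl_simps(1) del: of_int_mult)
  also have "\<dots> = scl (\<Prod>\<alpha>\<leftarrow>\<alpha> # as. 1 - of_int \<theta> / of_int \<alpha>) y"
    unfolding scl.scale_left_diff_distrib[symmetric] by (rule arg_cong[of _ _ "\<lambda>c. scl c y"]) (simp add: field_simps)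
  finally show ?case .
qed (simp add: scl_simps)

lemma factors_kernel:
  assumes "A2 n y = scl (of_int (2 * \<theta>)) y" "\<theta> \<in> set as" "\<theta> \<noteq> 0"
  shows "factors n as y = 0"
proof -
  have "0 \<in> set (map (\<lambda>\<alpha>. 1 - of_int \<theta> / of_int \<alpha> :: complex) as)"
    using assms(2,3) by (force simp: image_iff)
  then have "(\<Prod>\<alpha>\<leftarrow>as. 1 - of_int \<theta> / of_int \<alpha> :: complex) = 0" by (simp only: prod_list_zero_iff)
  then show ?thesis by (simp add: factors_eigen[OF assms(1)] scl_simps)
qed

lemma factors_fixed: "A2 n y = 0 \<Longrightarrow> factors n as y = y"
  by (induction as) (simp_all add: scl_simps)

lemma zz_zz_act:
  assumes "\<mu> \<in> partitions n" "\<rho> \<in> partitions n" "y = act e (zz \<mu>) x"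
  shows "act e (zz \<rho>) y = (if \<rho> = \<mu> then y else 0)"
proof (cases "\<rho> = \<mu>")
  case True
  then show ?thesis using assms zz_idem[OF assms(1)] by (simp flip: act_mult)
next
  case False
  then have "zz \<rho> * zz \<mu> = 0" using zz_orthogonal[OF assms(2,1)] by blast
  then show ?thesis using False assms(3) by (simp flip: act_mult)
qed

lemma finite_Lambda_set [simp]: "finite (Lambda_set e' M l)"
  by (rule finite_subset[OF _ finite_partitions[of l]]) (auto simp: Lambda_set_def)

text \<open>Ensures that \<open>sorted_list_of_set\<close> really lists the eigenvalues; on an
  infinite set it would be empty.\<close>

lemma finite_spec: "finite (spec_nz e' M n)" "finite (spec_nz_rho e' M \<rho>)"
proof -
  have "{(e' * int M - 1) * int f + (content \<mu> - content \<kappa>) | f \<kappa> \<mu>.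
      1 \<le> f \<and> f \<le> n div 2 \<and> \<kappa> \<in> Lambda_set e' M (n - 2 * f) \<and> \<mu> \<in> cl_set e' M f \<kappa>} \<subseteq>
    (\<lambda>(f, \<kappa>, \<mu>). (e' * int M - 1) * int f + (content \<mu> - content \<kappa>)) `
      (SIGMA f:{..n}. SIGMA \<kappa>:partitions (n - 2 * f). partitions (n - 2 * f + 2 * f))"
  proof
    fix t assume "t \<in> {(e' * int M - 1) * int f + (content \<mu> - content \<kappa>) | f \<kappa> \<mu>.
      1 \<le> f \<and> f \<le> n div 2 \<and> \<kappa> \<in> Lambda_set e' M (n - 2 * f) \<and> \<mu> \<in> cl_set e' M f \<kappa>}"
    then obtain f \<kappa> \<mu> where *: "f \<le> n" "\<kappa> \<in> partitions (n - 2 * f)" "\<mu> \<in> partitions (sum_list \<kappa> + 2 * f)"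
        "t = (e' * int M - 1) * int f + (content \<mu> - content \<kappa>)"
      unfolding Lambda_set_def cl_set_def Sigma_set_def using div_le_dividend le_trans by blast
    then show "t \<in> (\<lambda>(f, \<kappa>, \<mu>). (e' * int M - 1) * int f + (content \<mu> - content \<kappa>)) `
      (SIGMA f:{..n}. SIGMA \<kappa>:partitions (n - 2 * f). partitions (n - 2 * f + 2 * f))"
      by (intro image_eqI[of _ _ "(f, \<kappa>, \<mu>)"]) (auto simp: sum_list_partitions[of \<kappa>])
  qed
  then have "finite {(e' * int M - 1) * int f + (content \<mu> - content \<kappa>) | f \<kappa> \<mu>.
      1 \<le> f \<and> f \<le> n div 2 \<and> \<kappa> \<in> Lambda_set e' M (n - 2 * f) \<and> \<mu> \<in> cl_set e' M f \<kappa>}"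
    by (rule finite_subset) auto
  then show "finite (spec_nz e' M n)" unfolding spec_nz_def by (rule finite_Int[OF disjI1])
  have "{(e' * int M - 1) * int f + (content \<rho> - content \<sigma>) | f \<sigma>.
      1 \<le> f \<and> f \<le> sum_list \<rho> div 2 \<and> \<sigma> \<in> Lambda_rho e' M \<rho> \<and> sum_list \<rho> = sum_list \<sigma> + 2 * f} \<subseteq>
    (\<lambda>(f, \<sigma>). (e' * int M - 1) * int f + (content \<rho> - content \<sigma>)) `
      ({..sum_list \<rho>} \<times> (\<Union>l\<le>sum_list \<rho>. partitions l))"
  proof
    fix t assume "t \<in> {(e' * int M - 1) * int f + (content \<rho> - content \<sigma>) | f \<sigma>.
      1 \<le> f \<and> f \<le> sum_list \<rho> div 2 \<and> \<sigma> \<in> Lambda_rho e' M \<rho> \<and> sum_list \<rho> = sum_list \<sigma> + 2 * f}"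
    then obtain f f' \<sigma> where *: "f \<le> sum_list \<rho>" "\<sigma> \<in> partitions (sum_list \<rho> - 2 * f')"
        "t = (e' * int M - 1) * int f + (content \<rho> - content \<sigma>)"
      unfolding Lambda_set_def Lambda_rho_def using div_le_dividend le_trans by blast
    then show "t \<in> (\<lambda>(f, \<sigma>). (e' * int M - 1) * int f + (content \<rho> - content \<sigma>)) `
      ({..sum_list \<rho>} \<times> (\<Union>l\<le>sum_list \<rho>. partitions l))"
      by (intro image_eqI[of _ _ "(f, \<sigma>)"]) (auto intro: bexI[of _ "sum_list \<rho> - 2 * f'"])
  qed
  then have "finite {(e' * int M - 1) * int f + (content \<rho> - content \<sigma>) | f \<sigma>.
      1 \<le> f \<and> f \<le> sum_list \<rho> div 2 \<and> \<sigma> \<in> Lambda_rho e' M \<rho> \<and> sum_list \<rho> = sum_list \<sigma> + 2 * f}"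
    by (rule finite_subset) auto
  then show "finite (spec_nz_rho e' M \<rho>)" unfolding spec_nz_rho_def by (rule finite_Int[OF disjI1])
qed

theorem projector_formula:
  assumes T: "T \<in> W n"
  shows "factors n (sorted_list_of_set (spec_nz e N n)) T =
    (\<Sum>\<mu>\<in>Lambda_set e N n. factors n (sorted_list_of_set (spec_nz_rho e N \<mu>)) (act e (zz \<mu>) T))"
    (is "?L T = ?R T")
proof -
  define Q where "Q T \<longleftrightarrow> ?L T = ?R T" for T
  have R_add: "?R (x + y) = ?R x + ?R y" for x y by (simp only: act_T_add factors_add sum.distrib)
  have R_scl: "?R (scl c x) = scl c (?R x)" for c x by (simp add: act_T_scl factors_scl scl_sum)
  have zero: "Q 0" by (simp only: Q_def act_T_zero factors_zero sum.neutral_const)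
  have add: "Q (x + y)" if "Q x" "Q y" for x y
    using that unfolding Q_def factors_add[of n "sorted_list_of_set (spec_nz e N n)"] R_add by simp
  have scale: "Q (scl c x)" if "Q x" for c x
    using that unfolding Q_def R_scl factors_scl[of n "sorted_list_of_set (spec_nz e N n)"] by simp
  have sums: "Q (sum F I)" if "\<And>i. i \<in> I \<Longrightarrow> Q (F i)" for F and I :: "nat list set"
    using that by (induction I rule: infinite_finite_induct) (auto intro: zero add)
  have gen: "Q y"
    if x: "x \<in> W n" "2 * f \<le> n" "paired f x" "traceless {2 * f..<n} x" "h \<in> SP {..<n}"
      and part: "\<mu> \<in> partitions n" "\<nu> \<in> partitions (2 * f)" "\<kappa> \<in> partitions (n - 2 * f)"
      and y_def: "y = act e (zz \<mu> * gp h * zz \<nu> * shifted n (2 * f) (zz \<kappa>)) x"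
    for x y f h \<mu> \<nu> \<kappa>
  proof (cases "y = 0")
    case False
    define \<theta> where "\<theta> = (e * int N - 1) * int f + (content \<mu> - content \<kappa>)"
    note G = generator[OF x part, folded y_def, OF False, folded \<theta>_def]
    have zla: "shifted n (2 * f) (zz \<kappa>) \<in> CS {2 * f..<n}" using part x(2) by (intro shifted_CS) simp_all
    have mono: "a \<in> CS {2 * f..<n} \<Longrightarrow> a \<in> CS {..<n}" "a \<in> CS {..<2 * f} \<Longrightarrow> a \<in> CS {..<n}" for a
      by (erule CS_mono, use x(2) in auto)+
    have u: "zz \<mu> * gp h * zz \<nu> * shifted n (2 * f) (zz \<kappa>) \<in> CS {..<n}"
      using part x(5) zla by (intro CS_mult) (simp_all add: mono)
    have yW: "y \<in> W n" unfolding y_def using x(1) u by (rule W_act)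
    have ymu: "y = act e (zz \<mu>) (act e (gp h * zz \<nu> * shifted n (2 * f) (zz \<kappa>)) x)"
      by (simp add: y_def mult.assoc flip: act_mult)
    have "factors n (sorted_list_of_set (spec_nz_rho e N \<rho>)) (act e (zz \<rho>) y) =
        (if \<rho> = \<mu> then factors n (sorted_list_of_set (spec_nz_rho e N \<mu>)) y else 0)"
      if "\<rho> \<in> Lambda_set e N n" for \<rho>
    proof -
      have "\<rho> \<in> partitions n" using that by (simp add: Lambda_set_def)
      from zz_zz_act[OF part(1) this ymu] show ?thesis by simp
    qed
    then have R: "?R y = (if \<mu> \<in> Lambda_set e N n then factors n (sorted_list_of_set (spec_nz_rho e N \<mu>)) y else 0)"
      by simp
    show ?thesis
    proof (cases "\<theta> = 0")
      case True
      have "traceless {..<n} y" by (rule A2_positive(2)[OF yW False G(1) True])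
      moreover have "act e (zz \<mu>) y \<noteq> 0" using zz_zz_act[OF part(1) part(1) ymu] False by simp
      ultimately have "\<mu> \<in> Lambda_set e N n" using zz_Lambda[OF yW order_refl _ part(1)] by blast
      moreover have "A2 n y = 0" using G(1) True by (simp add: scl_simps)
      ultimately show ?thesis unfolding Q_def R by (simp add: factors_fixed)
    next
      case nonzero: False
      have "0 < e * \<theta>" using A2_positive(1)[OF yW False G(1)] nonzero e by auto
      then have sn: "\<theta> \<in> signed_naturals e"
        using e by (auto simp: signed_naturals_def intro!: exI[of _ "nat (e * \<theta>)"])
      \<comment> \<open>The spectra only range over f \<ge> 1. For f = 0 the tensor x is traceless,
        so the eigenvalue would be zero.\<close>
      have "f \<noteq> 0"
      proof
        assume "f = 0"
        then have t: "traceless {..<n} x" using x(4) by (simp add: atLeast0LessThan)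
        have "A2 n x = 0" unfolding A2_def by (intro sum.neutral ballI) (use t in \<open>auto simp: traceless_def\<close>)
        then have "A2 n y = 0" unfolding y_def A2_act[OF u] by simp
        then have "scl (of_int (2 * \<theta>)) y = 0" using G(1) by simp
        then show False using False nonzero by (simp add: scl.scale_eq_0_iff)
      qed
      then have f: "1 \<le> f" "f \<le> n div 2" using x(2) by auto
      have sl: "sum_list \<kappa> + 2 * f = n" using sum_list_partitions[OF part(3)] x(2) by simp
      have "\<mu> \<in> cl_set e N f \<kappa>"
        unfolding cl_set_def sl using G(3,4,5,7) part(2) by blast
      then have "\<theta> \<in> spec_nz e N n" unfolding spec_nz_def \<theta>_def[symmetric] using f G(2) sn \<theta>_def by blast
      then have L: "factors n (sorted_list_of_set (spec_nz e N n)) y = 0" using factors_kernel[OF G(1) _ nonzero] finite_spec(1) by simp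
      have sm: "sum_list \<mu> = n" by (rule sum_list_partitions[OF part(1)])
      have "\<kappa> \<in> Lambda_rho e N \<mu>" unfolding Lambda_rho_def sm using x(2) G(2,4,6,8) part(2) by blast
      then have "\<theta> \<in> spec_nz_rho e N \<mu>" unfolding spec_nz_rho_def sm using f sl sn \<theta>_def by blast
      then have "factors n (sorted_list_of_set (spec_nz_rho e N \<mu>)) y = 0"
        using factors_kernel[OF G(1) _ nonzero] finite_spec(2) by simp
      then show ?thesis unfolding Q_def L R by simp
    qed
  qed (simp add: zero)
  \<comment> \<open>With no pairs the condition \<open>paired\<close> is vacuous, so the induction
    may start from an arbitrary tensor and the identity permutation.\<close>
  have "Q (act e (gp 0) T)"
  proof (rule paired_induct[of Q, OF zero add scale])
    fix f h x assume f: "2 * f \<le> n" and h: "h \<in> SP {..<n}" and x: "x \<in> W n" "paired f x" "traceless {2 * f..<n} x"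
    have sh: "(\<Sum>\<kappa>\<in>partitions (n - 2 * f). shifted n (2 * f) (zz \<kappa>)) = 1"
      unfolding shifted_def sum_distrib_left[symmetric] sum_distrib_right[symmetric] sum_zz by simp
    \<comment> \<open>Three resolutions of the identity, on all slots, on the paired slots and on
      the traceless slots.\<close>
    have "gp h = (\<Sum>\<mu>\<in>partitions n. zz \<mu>) * gp h * (\<Sum>\<nu>\<in>partitions (2 * f). zz \<nu>) *
        (\<Sum>\<kappa>\<in>partitions (n - 2 * f). shifted n (2 * f) (zz \<kappa>))"
      unfolding sh sum_zz by simp
    also have "\<dots> = (\<Sum>\<kappa>\<in>partitions (n - 2 * f). \<Sum>\<nu>\<in>partitions (2 * f). \<Sum>\<mu>\<in>partitions n.
        zz \<mu> * gp h * zz \<nu> * shifted n (2 * f) (zz \<kappa>))"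
      by (simp only: sum_distrib_left sum_distrib_right)
    finally have gh: "gp h = (\<Sum>\<kappa>\<in>partitions (n - 2 * f). \<Sum>\<nu>\<in>partitions (2 * f). \<Sum>\<mu>\<in>partitions n.
        zz \<mu> * gp h * zz \<nu> * shifted n (2 * f) (zz \<kappa>))" .
    have eq: "act e (gp h) x = (\<Sum>\<kappa>\<in>partitions (n - 2 * f). \<Sum>\<nu>\<in>partitions (2 * f). \<Sum>\<mu>\<in>partitions n.
        act e (zz \<mu> * gp h * zz \<nu> * shifted n (2 * f) (zz \<kappa>)) x)"
      using arg_cong[OF gh, of "\<lambda>u. act e u x"] unfolding act_sum .
    show "Q (act e (gp h) x)"
      unfolding eq by (intro sums gen[OF x(1) f x(2,3) h _ _ _ refl])
  next
    show "2 * 0 \<le> n" "T \<in> W n" "paired 0 T" "0 \<in> SP {..<n}" using T by (simp_all add: paired_def)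
  qed
  then show ?thesis by (simp add: Q_def)
qed

end


section \<open>An adapted basis\<close>

lemma sum_split_add: "(\<Sum>c<k + m. f c) = (\<Sum>c<k. f c) + (\<Sum>c<m. f (k + c))" for f :: "nat \<Rightarrow> complex"
  by (induction m) (simp_all add: add.assoc)

context form_space
begin

lemma form_simps:
  "form (x + y) w = form x w + form y w" "form w (x + y) = form w x + form w y"
  "form (scale c x) w = c * form x w" "form w (scale c x) = c * form w x"
  using form_linear_left[of w] form_linear_right[of w] by (simp_all add: Vector_Spaces.linear_iff)

lemma form_zero [simp]: "form 0 w = 0" "form w 0 = 0"
  using form_simps(3,4)[of 0 0 w] form_simps(4)[of w 0 0] by simp_all

lemma form_sum: "form (sum f A) w = (\<Sum>i\<in>A. form (f i) w)" "form w (sum f A) = (\<Sum>i\<in>A. form w (f i))"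
  by (induction A rule: infinite_finite_induct) (simp_all add: form_simps)

lemma form_diff: "form (x - y) w = form x w - form y w" "form w (x - y) = form w x - form w y"
  using form_simps(1)[of "x - y" y w] form_simps(2)[of w "x - y" y] by simp_all

text \<open>Asking for a real orthogonal Gram matrix treats both symmetry types at once: orthonormal
  vectors for \<epsilon> = 1 and hyperbolic pairs for \<epsilon> = -1 satisfy it.\<close>

definition adapted :: "nat \<Rightarrow> (nat \<Rightarrow> 'v) \<Rightarrow> bool" where
  "adapted k u \<longleftrightarrow> (\<forall>a<k. \<forall>b<k. cnj (form (u a) (u b)) = form (u a) (u b) \<and>
     (\<Sum>c<k. form (u c) (u a) * form (u c) (u b)) = (if a = b then 1 else 0))"

lemma adapted_join:
  assumes u: "adapted k u" and y: "adapted m y" and orth: "\<And>a b. a < k \<Longrightarrow> b < m \<Longrightarrow> form (u a) (y b) = 0"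
  shows "adapted (k + m) (\<lambda>i. if i < k then u i else y (i - k))"
  unfolding adapted_def
proof (intro allI impI)
  have orth': "form (y b) (u a) = 0" if "a < k" "b < m" for a b
    using orth[OF that] form_sym[of "y b" "u a"] by simp
  fix a b assume ab: "a < k + m" "b < k + m"
  let ?v = "\<lambda>i. if i < k then u i else y (i - k)"
  show "cnj (form (?v a) (?v b)) = form (?v a) (?v b) \<and>
      (\<Sum>c<k + m. form (?v c) (?v a) * form (?v c) (?v b)) = (if a = b then 1 else 0)"
    using ab u y orth orth' unfolding adapted_def sum_split_add by auto
qed

text \<open>Transposing the Gram matrix only costs the factor \<epsilon>, so its rows are
  orthonormal as well; pairing the relation with a row recovers a single coefficient.\<close>

lemma adapted_kernel:
  assumes u: "adapted k u" and 0: "\<And>c. c < k \<Longrightarrow> (\<Sum>a<k. \<alpha> a * form (u a) (u c)) = 0" and b: "b < k"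
  shows "\<alpha> b = 0"
proof -
  have s: "(\<Sum>c<k. form (u a) (u c) * form (u b) (u c)) = (if a = b then 1 else 0)" if "a < k" for a
  proof -
    have ee: "of_int \<epsilon> * of_int \<epsilon> = (1 :: complex)" using eps by auto
    have "form (u a) (u c) * form (u b) (u c) = (of_int \<epsilon> * of_int \<epsilon>) * (form (u c) (u a) * form (u c) (u b))" for c
      unfolding form_sym[of "u a" "u c"] form_sym[of "u b" "u c"] by (simp add: ac_simps)
    then show ?thesis using u that b unfolding ee by (simp add: adapted_def)
  qed
  have "0 = (\<Sum>c<k. (\<Sum>a<k. \<alpha> a * form (u a) (u c)) * form (u b) (u c))" using 0 by simp
  also have "\<dots> = (\<Sum>a<k. \<alpha> a * (\<Sum>c<k. form (u a) (u c) * form (u b) (u c)))"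
    by (simp add: sum_distrib_left sum_distrib_right mult.assoc, subst sum.swap, rule refl)
  also have "\<dots> = (\<Sum>a<k. if a = b then \<alpha> a else 0)" by (rule sum.cong) (simp_all add: s)
  also have "\<dots> = \<alpha> b" using b by simp
  finally show ?thesis by simp
qed

lemma zero_from_basis:
  assumes "\<And>i. i < N \<Longrightarrow> form v (e i) = 0" shows "v = 0"
proof (rule form_nondegenerate)
  fix w
  have "w \<in> span (e ` {..<N})" using basis_span by simp
  then show "form v w = 0"
    by (induction rule: span_induct_alt) (use assms in \<open>auto simp: form_simps\<close>)
qed

text \<open>More than N vectors satisfy a nontrivial linear relation, found by testing against the
  basis e, and the invertible Gram matrix forbids it.\<close>

lemma adapted_le:
  assumes u: "adapted k u" shows "k \<le> N"
proof (rule ccontr)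
  assume "\<not> k \<le> N"
  then have "card {..<N} < card {..<k}" by simp
  from linear_system[OF _ _ this, of "\<lambda>i a. form (u a) (e i)"]
  obtain \<alpha> a where \<alpha>: "a < k" "\<alpha> a \<noteq> 0" "\<And>i. i < N \<Longrightarrow> (\<Sum>a<k. \<alpha> a * form (u a) (e i)) = 0" by auto
  have "(\<Sum>a<k. scale (\<alpha> a) (u a)) = 0"
    by (rule zero_from_basis) (simp add: form_sum form_simps \<alpha>(3))
  then have "form (\<Sum>a<k. scale (\<alpha> a) (u a)) (u c) = 0" for c by simp
  then have "(\<Sum>a<k. \<alpha> a * form (u a) (u c)) = 0" for c by (simp add: form_sum form_simps)
  then show False using adapted_kernel[OF u _ \<alpha>(1)] \<alpha>(2) by blast
qed

text \<open>These are fewer linear conditions than coordinates; the inverse Gram matrix shows that a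
  nontrivial combination of the basis is not the zero vector.\<close>

lemma orthogonal_vector:
  assumes "k < N" shows "\<exists>v. v \<noteq> 0 \<and> (\<forall>c<k. form v (u c) = 0)"
proof -
  have "card {..<k} < card {..<N}" using assms by simp
  from linear_system[OF _ _ this, of "\<lambda>c i. form (e i) (u c)"]
  obtain \<alpha> a where \<alpha>: "a < N" "\<alpha> a \<noteq> 0" "\<And>c. c < k \<Longrightarrow> (\<Sum>i<N. \<alpha> i * form (e i) (u c)) = 0" by auto
  let ?v = "\<Sum>i<N. scale (\<alpha> i) (e i)"
  have "?v \<noteq> 0"
  proof
    assume "?v = 0"
    then have 0: "(\<Sum>i<N. \<alpha> i * form (e b) (e i)) = 0" for b
      using form_sum(2)[of "e b" "\<lambda>i. scale (\<alpha> i) (e i)" "{..<N}"] by (simp add: form_simps)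
    have "0 = (\<Sum>b<N. ginv a b * (\<Sum>i<N. \<alpha> i * form (e b) (e i)))" unfolding 0 by simp
    also have "\<dots> = (\<Sum>i<N. \<alpha> i * (\<Sum>b<N. ginv a b * form (e b) (e i)))"
      by (simp add: sum_distrib_left mult.left_commute, subst sum.swap, rule refl)
    also have "\<dots> = (\<Sum>i<N. if i = a then \<alpha> i else 0)" by (rule sum.cong) (use ginv \<alpha>(1) in auto)
    also have "\<dots> = \<alpha> a" using \<alpha>(1) by simp
    finally show False using \<alpha>(2) by simp
  qed
  moreover have "form ?v (u c) = 0" if "c < k" for c using \<alpha>(3)[OF that] by (simp add: form_sum form_simps)
  ultimately show ?thesis by blast
qed

text \<open>The coordinate of v at \<open>u a\<close>, computed with the transposed Gram matrix as
  the inverse.\<close>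

definition dual :: "nat \<Rightarrow> (nat \<Rightarrow> 'v) \<Rightarrow> nat \<Rightarrow> 'v \<Rightarrow> complex" where
  "dual k u a v = (\<Sum>b<k. form (u a) (u b) * form v (u b))"

lemma dual_residual:
  assumes u: "adapted k u" and c: "c < k"
  shows "form (v - (\<Sum>a<k. scale (dual k u a v) (u a))) (u c) = 0"
proof -
  have "(\<Sum>a<k. dual k u a v * form (u a) (u c)) =
      (\<Sum>b<k. (\<Sum>a<k. form (u a) (u b) * form (u a) (u c)) * form v (u b))"
    by (simp add: dual_def sum_distrib_left sum_distrib_right ac_simps, subst sum.swap, rule refl)
  also have "\<dots> = (\<Sum>b<k. if b = c then form v (u b) else 0)"
    by (rule sum.cong) (use u c in \<open>auto simp: adapted_def\<close>)
  also have "\<dots> = form v (u c)" using c by simp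
  finally show ?thesis by (simp add: form_diff form_sum form_simps)
qed

text \<open>Some w' pairs nontrivially with v, and so does its projection w to the orthogonal
  complement of the family. In the symmetric case one of v, w, v + w or another complement vector is
  not isotropic and is normalised by a complex square root; in the skew case v and a rescaled w form
  a hyperbolic pair.\<close>

lemma adapted_extend:
  assumes u: "adapted k u" and v: "v \<noteq> 0" "\<And>c. c < k \<Longrightarrow> form v (u c) = 0"
  shows "\<exists>k'>k. \<exists>u'. adapted k' u'"
proof -
  obtain w' where w': "form v w' \<noteq> 0" using form_nondegenerate v(1) by blast
  define w where "w = w' - (\<Sum>a<k. scale (dual k u a w') (u a))"
  have w: "form w (u c) = 0" if "c < k" for c unfolding w_def by (rule dual_residual[OF u that])
  have vw: "form v w \<noteq> 0" using w' v(2) by (simp add: w_def form_diff form_sum form_simps)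
  have sym: "form (u c) y = 0" if "form y (u c) = 0" for c y using that form_sym[of "u c" y] by simp
  consider "\<epsilon> = 1" | "\<epsilon> = -1" using eps by blast
  then show ?thesis
  proof cases
    case 1
    have "\<exists>x. form x x \<noteq> 0 \<and> (\<forall>c<k. form x (u c) = 0)"
    proof (rule ccontr)
      assume *: "\<not> ?thesis"
      then have iso: "form x x = 0" if "\<forall>c<k. form x (u c) = 0" for x using that by blast
      have "form v v = 0" "form w w = 0" "form (v + w) (v + w) = 0"
        by (rule iso, simp add: v(2) w form_simps)+
      moreover have "form w v = form v w" using form_sym[of v w] 1 by simp
      ultimately show False using vw by (simp add: form_simps)
    qed
    then obtain x where x: "form x x \<noteq> 0" "\<And>c. c < k \<Longrightarrow> form x (u c) = 0" by blast
    let ?s = "1 / csqrt (form x x)"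
    have "?s * (?s * form x x) = form x x / (csqrt (form x x))\<^sup>2" by (simp add: power2_eq_square)
    then have "form (scale ?s x) (scale ?s x) = 1" using x(1) by (simp add: form_simps)
    then have "adapted 1 (\<lambda>_. scale ?s x)" by (simp add: adapted_def)
    then have "adapted (k + 1) (\<lambda>i. if i < k then u i else scale ?s x)"
      by (rule adapted_join[OF u]) (use x sym in \<open>auto simp: form_simps\<close>)
    then show ?thesis using less_add_one by blast
  next
    case 2
    have iso: "form x x = 0" for x using form_sym[of x x] 2 by simp
    let ?z = "scale (1 / form v w) w"
    have z: "form v ?z = 1" using vw by (simp add: form_simps)
    then have z': "form ?z v = -1" using form_sym[of ?z v] 2 by simp
    have "adapted 2 (\<lambda>i. if i = 0 then v else ?z)"
      using z z' iso by (auto simp: adapted_def numeral_2_eq_2 less_Suc_eq)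
    then have "adapted (k + 2) (\<lambda>i. if i < k then u i else if i - k = 0 then v else ?z)"
      by (rule adapted_join[OF u]) (use v w sym in \<open>auto simp: form_simps\<close>)
    moreover have "k < k + 2" by simp
    ultimately show ?thesis by blast
  qed
qed

lemma adapted_basis_exists: "\<exists>u. adapted N u"
proof -
  have "\<exists>u. adapted 0 u" by (simp add: adapted_def)
  moreover have "\<forall>k. (\<exists>u. adapted k u) \<longrightarrow> k \<le> N" using adapted_le by blast
  ultimately obtain k where k: "\<exists>u. adapted k u" "\<And>k'. \<exists>u. adapted k' u \<Longrightarrow> k' \<le> k"
    using GreatestI_nat[of "\<lambda>k. \<exists>u. adapted k u" 0 N] Greatest_le_nat[of "\<lambda>k. \<exists>u. adapted k u" _ N] by blast
  then obtain u where u: "adapted k u" by blast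
  have "\<not> k < N"
  proof
    assume "k < N"
    then obtain v where "v \<noteq> 0" "\<And>c. c < k \<Longrightarrow> form v (u c) = 0" using orthogonal_vector by blast
    from adapted_extend[OF u this] k(2) show False by (meson not_le)
  qed
  then show ?thesis using u adapted_le[OF u] by auto
qed

text \<open>A nonzero remainder would extend the family beyond N vectors.\<close>

lemma dual_expand:
  assumes u: "adapted N u" shows "(\<Sum>a<N. scale (dual N u a v) (u a)) = v"
proof (rule ccontr)
  assume "\<not> ?thesis"
  then have "v - (\<Sum>a<N. scale (dual N u a v) (u a)) \<noteq> 0" by auto
  from adapted_extend[OF u this dual_residual[OF u]] show False using adapted_le by (meson not_le)
qed

end


section \<open>Coordinates of tensors\<close>

interpretation ts: vector_space scale_tensor
  by unfold_locales (simp_all add: scale_tensor_def algebra_simps fun_eq_iff)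

lemma prod_split_pair:
  fixes F :: "nat \<Rightarrow> complex"
  assumes "i < n" "j < n" "i \<noteq> j" shows "(\<Prod>k<n. F k) = F i * (F j * (\<Prod>k\<in>{..<n} - {i} - {j}. F k))"
  using assms by (subst prod.remove[of _ i], simp_all, subst prod.remove[of _ j], simp_all)

locale adapted_space = form_space scale N \<epsilon> form e ginv
  for scale :: "complex \<Rightarrow> 'v::ab_group_add \<Rightarrow> 'v"
    and N :: nat and \<epsilon> :: int and form :: "'v \<Rightarrow> 'v \<Rightarrow> complex"
    and e :: "nat \<Rightarrow> 'v" and ginv :: "nat \<Rightarrow> nat \<Rightarrow> complex" +
  fixes u :: "nat \<Rightarrow> 'v"
  assumes u: "adapted N u"
begin

text \<open>The cut-off to 0 makes letters beyond N carry the value zero, as \<open>g_out\<close>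
  demands.\<close>

definition gram :: "nat \<Rightarrow> nat \<Rightarrow> complex" where
  "gram a b = (if a < N \<and> b < N then form (u a) (u b) else 0)"

sublocale t: tens N \<epsilon> gram
proof
  show "gram b a = of_int \<epsilon> * gram a b" for a b using form_sym[of "u b" "u a"] by (simp add: gram_def)
  show "cnj (gram a b) = gram a b" for a b using u by (simp add: gram_def adapted_def)
  show "(\<Sum>c<N. gram c a * gram c b) = (if a = b then 1 else 0)" if "a < N" "b < N" for a b
    using u that by (simp add: gram_def adapted_def)
qed (use N_pos eps in \<open>auto simp: gram_def\<close>)

definition du :: "nat \<Rightarrow> 'v \<Rightarrow> complex" where
  "du a v = (\<Sum>b<N. gram a b * form v (u b))"

lemma du_expand: "(\<Sum>a<N. scale (du a v) (u a)) = v"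
proof -
  have "du a v = dual N u a v" if "a < N" for a using that by (simp add: du_def dual_def gram_def)
  then show ?thesis using dual_expand[OF u, of v] by simp
qed

lemma du_out: "N \<le> a \<Longrightarrow> du a v = 0"
  by (simp add: du_def gram_def)

lemma linear_functional_iff: "Vector_Spaces.linear scale (*) \<phi> \<longleftrightarrow>
    (\<forall>x y. \<phi> (x + y) = \<phi> x + \<phi> y) \<and> (\<forall>c x. \<phi> (scale c x) = c * \<phi> x)" for \<phi> :: "'v \<Rightarrow> complex"
proof -
  have "vector_space ((*) :: complex \<Rightarrow> _)" by unfold_locales (simp_all add: algebra_simps)
  then show ?thesis unfolding Vector_Spaces.linear_iff using vector_space_axioms by simp
qed

lemma du_linear: "Vector_Spaces.linear scale (*) (du a)"
  unfolding linear_functional_iff by (simp add: du_def form_simps algebra_simps sum.distrib sum_distrib_left)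

lemma functional_expand:
  assumes "Vector_Spaces.linear scale (*) \<phi>" shows "\<phi> v = (\<Sum>a<N. \<phi> (u a) * du a v)"
proof -
  have z: "\<phi> 0 = 0" using assms unfolding linear_functional_iff by (metis mult_zero_left scale_zero_left)
  have "\<phi> (sum f A) = (\<Sum>a\<in>A. \<phi> (f a))" for f and A :: "nat set"
    using assms z by (induction A rule: infinite_finite_induct) (simp_all add: linear_functional_iff)
  then have "\<phi> (\<Sum>a<N. scale (du a v) (u a)) = (\<Sum>a<N. du a v * \<phi> (u a))"
    using assms by (simp add: linear_functional_iff)
  then show ?thesis unfolding du_expand by (simp add: mult.commute)
qed

lemma form_expand: "form v w = (\<Sum>a<N. \<Sum>b<N. gram a b * (du a v * du b w))"
proof -
  have "form v w = (\<Sum>b<N. form v (u b) * du b w)" by (rule functional_expand[OF form_linear_right])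
  also have "\<dots> = (\<Sum>b<N. (\<Sum>a<N. form (u a) (u b) * du a v) * du b w)"
    by (subst functional_expand[OF form_linear_left]) (rule refl)
  also have "\<dots> = (\<Sum>b<N. \<Sum>a<N. gram a b * (du a v * du b w))"
    by (intro sum.cong refl) (simp add: sum_distrib_right gram_def mult.assoc)
  also have "\<dots> = (\<Sum>a<N. \<Sum>b<N. gram a b * (du a v * du b w))" by (rule sum.swap)
  finally show ?thesis .
qed

lemma basis_expand: "w = (\<Sum>a<N. scale (\<Sum>b<N. ginv a b * form (e b) w) (e a))"
proof -
  let ?c = "\<lambda>w a. \<Sum>b<N. ginv a b * form (e b) w"
  have "w \<in> span (e ` {..<N})" using basis_span by simp
  then show ?thesis
  proof (induction rule: span_induct_alt)
    case (step c x y)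
    obtain s where s: "s < N" "x = e s" using step(1) by auto
    have "?c (scale c x + y) a = (if a = s then c else 0) + ?c y a" if "a < N" for a
    proof -
      have "?c (scale c x + y) a = c * (\<Sum>b<N. ginv a b * form (e b) (e s)) + ?c y a"
        by (simp add: form_simps s algebra_simps sum.distrib sum_distrib_left)
      then show ?thesis using ginv[OF that s(1)] by simp
    qed
    then have "(\<Sum>a<N. scale (?c (scale c x + y) a) (e a)) =
        (\<Sum>a<N. scale (if a = s then c else 0) (e a)) + (\<Sum>a<N. scale (?c y a) (e a))"
      by (simp add: scale_left_distrib sum.distrib)
    also have "(\<Sum>a<N. scale (if a = s then c else 0) (e a)) = (\<Sum>a<N. if a = s then scale c (e s) else 0)"
      by (rule sum.cong) auto
    also have "\<dots> = scale c x" using s by simp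
    finally show ?case using step(2) by simp
  qed simp
qed

text \<open>The invariant tensor does not depend on the basis e: paired with x and y through the
  form it gives \<open>form y x\<close>. In the adapted basis this becomes \<epsilon> times the Gram
  matrix.\<close>

lemma E_coordinates: "(\<Sum>a<N. \<Sum>b<N. ginv a b * (du c (e a) * du d (e b))) = of_int \<epsilon> * gram c d"
proof -
  have E: "(\<Sum>a<N. \<Sum>b<N. ginv a b * (form (e a) x * form (e b) y)) = form y x" for x y
  proof -
    have "form y x = form (\<Sum>a<N. scale (\<Sum>b<N. ginv a b * form (e b) y) (e a)) x"
      by (subst basis_expand[symmetric]) (rule refl)
    then show ?thesis by (simp add: form_sum form_simps sum_distrib_left ac_simps)
  qed
  have "(\<Sum>a<N. \<Sum>b<N. ginv a b * (du c (e a) * du d (e b))) =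
      (\<Sum>a<N. \<Sum>b<N. \<Sum>p<N. \<Sum>q<N. gram c p * gram d q * (ginv a b * (form (e a) (u p) * form (e b) (u q))))"
    unfolding du_def unfolding sum_product unfolding sum_distrib_left by (intro sum.cong refl) (simp add: ac_simps)
  also have "\<dots> = (\<Sum>a<N. \<Sum>p<N. \<Sum>b<N. \<Sum>q<N. gram c p * gram d q * (ginv a b * (form (e a) (u p) * form (e b) (u q))))"
    by (rule sum.cong[OF refl], rule sum.swap)
  also have "\<dots> = (\<Sum>p<N. \<Sum>a<N. \<Sum>b<N. \<Sum>q<N. gram c p * gram d q * (ginv a b * (form (e a) (u p) * form (e b) (u q))))"
    by (rule sum.swap)
  also have "\<dots> = (\<Sum>p<N. \<Sum>a<N. \<Sum>q<N. \<Sum>b<N. gram c p * gram d q * (ginv a b * (form (e a) (u p) * form (e b) (u q))))"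
    by (rule sum.cong[OF refl], rule sum.cong[OF refl], rule sum.swap)
  also have "\<dots> = (\<Sum>p<N. \<Sum>q<N. \<Sum>a<N. \<Sum>b<N. gram c p * gram d q * (ginv a b * (form (e a) (u p) * form (e b) (u q))))"
    by (rule sum.cong[OF refl], rule sum.swap)
  also have "\<dots> = (\<Sum>p<N. \<Sum>q<N. gram c p * gram d q * form (u q) (u p))"
    unfolding sum_distrib_left[symmetric] E ..
  also have "\<dots> = (\<Sum>p<N. gram c p * (of_int \<epsilon> * (\<Sum>q<N. gram d q * gram p q)))"
  proof (rule sum.cong[OF refl])
    fix p assume "p \<in> {..<N}"
    then have "form (u q) (u p) = of_int \<epsilon> * gram p q" if "q < N" for q
      using that form_sym[of "u q" "u p"] by (simp add: gram_def)
    then show "(\<Sum>q<N. gram c p * gram d q * form (u q) (u p)) = gram c p * (of_int \<epsilon> * (\<Sum>q<N. gram d q * gram p q))"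
      by (simp add: sum_distrib_left ac_simps)
  qed
  also have "\<dots> = of_int \<epsilon> * gram c d"
  proof (cases "d < N")
    case True
    then have "(\<Sum>p<N. gram c p * (of_int \<epsilon> * (\<Sum>q<N. gram d q * gram p q))) =
        (\<Sum>p<N. if p = d then gram c p * of_int \<epsilon> else 0)"
      by (intro sum.cong refl) (simp add: t.g_orth')
    then show ?thesis using True by simp
  qed (simp add: gram_def)
  finally show ?thesis .
qed

text \<open>Tensors are multilinear functions of functionals, so the coordinates are the values at
  the dual basis.\<close>

definition coords :: "nat \<Rightarrow> 'v tensor \<Rightarrow> (nat \<Rightarrow> nat) \<Rightarrow> complex" where
  "coords n T = (\<lambda>x. T (map (\<lambda>i. du (x i)) [0..<n]))"

lemma coords_add: "coords n (S + T) = coords n S + coords n T"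
  and coords_scale: "coords n (scale_tensor c T) = scl c (coords n T)"
  and coords_zero [simp]: "coords n 0 = 0"
  by (simp_all add: coords_def scale_tensor_def scl_def fun_eq_iff)

lemma coords_sum: "coords n (sum f A) = (\<Sum>i\<in>A. coords n (f i))"
  using sum_comp_morphism[of "coords n" f A] by (simp add: coords_add comp_def)

lemma coords_pure:
  "length vs = n \<Longrightarrow> coords n (pure_tensor scale vs) = (\<lambda>x. \<Prod>i<n. du (x i) (vs ! i))"
  by (auto simp: coords_def pure_tensor_def du_linear fun_eq_iff)

abbreviation tp :: "nat \<Rightarrow> 'v tensor set" where "tp n \<equiv> tensor_power scale n"

lemma tp_closed: "S \<in> tp n \<Longrightarrow> T \<in> tp n \<Longrightarrow> S + T \<in> tp n" "T \<in> tp n \<Longrightarrow> scale_tensor c T \<in> tp n" "0 \<in> tp n"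
  "length vs = n \<Longrightarrow> pure_tensor scale vs \<in> tp n"
  unfolding tensor_power_def by (auto intro: ts.span_add ts.span_scale ts.span_zero ts.span_base)

lemma tp_induct [consumes 1, case_names zero step]:
  assumes "T \<in> tp n" "P 0"
    and "\<And>c vs T. length vs = n \<Longrightarrow> T \<in> tp n \<Longrightarrow> P T \<Longrightarrow> P (scale_tensor c (pure_tensor scale vs) + T)"
  shows "P T"
proof -
  have "T \<in> tp n \<and> P T"
    using assms(1) unfolding tensor_power_def[of scale n]
  proof (induction rule: ts.span_induct_alt)
    case base
    then show ?case using assms(2) ts.span_zero by blast
  next
    case (step c x y)
    then show ?case using assms(3) unfolding tensor_power_def[of scale n]
      by (auto intro: ts.span_add ts.span_scale ts.span_base simp del: plus_fun_apply)
  qed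
  then show ?thesis ..
qed

text \<open>Multilinearity recovers the tensor from its coordinates; on lists of wrong length or
  with nonlinear entries all tensors share the default value 0. Hence \<open>coords\<close> is
  injective.\<close>

lemma reconstruct:
  assumes "T \<in> tp n"
  shows "T \<phi>s = (if length \<phi>s = n \<and> (\<forall>\<phi>\<in>set \<phi>s. Vector_Spaces.linear scale (*) \<phi>)
     then \<Sum>x\<in>t.words n. (\<Prod>i<n. (\<phi>s ! i) (u (x i))) * coords n T x else 0)"
  using assms
proof (induction rule: tp_induct)
  case (step c vs T)
  have "pure_tensor scale vs \<phi>s = (\<Sum>x\<in>t.words n. (\<Prod>i<n. (\<phi>s ! i) (u (x i))) * coords n (pure_tensor scale vs) x)"
    if \<phi>: "length \<phi>s = n" "\<forall>\<phi>\<in>set \<phi>s. Vector_Spaces.linear scale (*) \<phi>"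
  proof -
    have "pure_tensor scale vs \<phi>s = (\<Prod>i<n. \<Sum>a<N. (\<phi>s ! i) (u a) * du a (vs ! i))"
      using \<phi> step(1) functional_expand by (auto simp: pure_tensor_def intro!: prod.cong)
    also have "\<dots> = (\<Sum>x\<in>t.words n. \<Prod>i<n. (\<phi>s ! i) (u (x i)) * du (x i) (vs ! i))"
      unfolding t.words_def by (rule prod_sum_PiE) auto
    finally show ?thesis by (simp add: coords_pure[OF step(1)] prod.distrib)
  qed
  moreover have "pure_tensor scale vs \<phi>s = 0"
    if "\<not> (length \<phi>s = n \<and> (\<forall>\<phi>\<in>set \<phi>s. Vector_Spaces.linear scale (*) \<phi>))"
    using that step(1) by (auto simp: pure_tensor_def)
  ultimately show ?case
    using step(3) unfolding coords_add coords_scale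
    by (auto simp: scale_tensor_def scl_def algebra_simps sum.distrib sum_distrib_left)
qed auto

lemma coords_inj: "S \<in> tp n \<Longrightarrow> T \<in> tp n \<Longrightarrow> coords n S = coords n T \<Longrightarrow> S = T"
  by (rule ext) (simp add: reconstruct)

lemma coords_W: "T \<in> tp n \<Longrightarrow> coords n T \<in> t.W n"
proof (induction rule: tp_induct)
  case (step c vs T)
  have "(\<Prod>i<n. du (x i) (vs ! i)) = 0" if "i < n" "N \<le> x i" for x i
    using that du_out by (intro prod_zero) auto
  then have "coords n (pure_tensor scale vs) \<in> t.W n"
    unfolding coords_pure[OF step(1)] t.W_def loc_def by (auto intro!: prod.cong)
  then show ?case using step(3) unfolding coords_add coords_scale by (intro t.W_add t.W_scl)
qed (simp only: coords_zero t.W_zero)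

lemma coords_swap:
  assumes i: "Suc i < n" and vs: "length vs = n"
  shows "coords n (scale_tensor (of_int \<epsilon>) (pure_tensor scale (vs[i := vs ! Suc i, Suc i := vs ! i]))) =
    act \<epsilon> (gp (tr i (Suc i))) (coords n (pure_tensor scale vs))"
proof
  fix x
  let ?t = "transpose i (Suc i)"
  have "(\<Prod>k<n. du (x k) (vs[i := vs ! Suc i, Suc i := vs ! i] ! k)) = (\<Prod>k<n. du (x (?t k)) (vs ! k))"
    by (rule prod.reindex_bij_witness[of _ ?t ?t])
       (use i vs in \<open>auto simp: transpose_def nth_list_update\<close>)
  then show "coords n (scale_tensor (of_int \<epsilon>) (pure_tensor scale (vs[i := vs ! Suc i, Suc i := vs ! i]))) x =
      act \<epsilon> (gp (tr i (Suc i))) (coords n (pure_tensor scale vs)) x"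
    using vs sg_tr[of i "Suc i" \<epsilon>] eps by (simp add: coords_scale coords_pure scl_def act_gp ap_tr)
qed

lemma coords_arc:
  assumes i: "Suc i < n" and vs: "length vs = n"
  shows "coords n (scale_tensor (form (vs ! i) (vs ! Suc i))
      (\<Sum>a<N. \<Sum>b<N. scale_tensor (ginv a b) (pure_tensor scale (vs[i := e a, Suc i := e b])))) =
    t.D i (Suc i) (coords n (pure_tensor scale vs))"
proof
  fix x
  let ?j = "Suc i"
  \<comment> \<open>The factor of the slots that the arc does not touch.\<close>
  define R where "R = (\<Prod>k\<in>{..<n} - {i} - {?j}. du (x k) (vs ! k))"
  have L: "(\<Prod>k<n. du (x k) (vs[i := e a, ?j := e b] ! k)) = du (x i) (e a) * du (x ?j) (e b) * R" for a b
    unfolding R_def by (subst prod_split_pair[of i n ?j])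
      (use i vs in \<open>auto simp: nth_list_update intro!: prod.cong\<close>)
  have M: "(\<Prod>k<n. du ((x(i := a, ?j := b)) k) (vs ! k)) = du a (vs ! i) * du b (vs ! ?j) * R" for a b
    unfolding R_def by (subst prod_split_pair[of i n ?j])
      (use i in \<open>auto intro!: prod.cong\<close>)
  have S: "(\<Sum>a<N. \<Sum>b<N. gram a b * (\<Prod>k<n. du ((x(i := a, ?j := b)) k) (vs ! k))) = form (vs ! i) (vs ! ?j) * R"
    unfolding M form_expand[of "vs ! i" "vs ! ?j"] sum_distrib_right by (simp only: mult.assoc)
  have "coords n (scale_tensor (form (vs ! i) (vs ! ?j))
      (\<Sum>a<N. \<Sum>b<N. scale_tensor (ginv a b) (pure_tensor scale (vs[i := e a, ?j := e b])))) x =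
    form (vs ! i) (vs ! ?j) * (\<Sum>a<N. \<Sum>b<N. ginv a b * (\<Prod>k<n. du (x k) (vs[i := e a, ?j := e b] ! k)))"
    using vs by (simp only: coords_scale coords_sum coords_pure length_list_update scl_def sum_fun_apply)
  also have "\<dots> = form (vs ! i) (vs ! ?j) * ((of_int \<epsilon> * gram (x i) (x ?j)) * R)"
    unfolding L E_coordinates[symmetric] by (simp add: sum_distrib_right mult.assoc)
  also have "\<dots> = of_int \<epsilon> * gram (x i) (x ?j) *
      (\<Sum>a<N. \<Sum>b<N. gram a b * (\<Prod>k<n. du ((x(i := a, ?j := b)) k) (vs ! k)))"
    unfolding S by (simp only: ac_simps)
  also have "\<dots> = t.D i ?j (coords n (pure_tensor scale vs)) x"
    using vs by (simp add: t.D_def coords_pure)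
  finally show "coords n (scale_tensor (form (vs ! i) (vs ! ?j))
      (\<Sum>a<N. \<Sum>b<N. scale_tensor (ginv a b) (pure_tensor scale (vs[i := e a, ?j := e b])))) x =
    t.D i ?j (coords n (pure_tensor scale vs)) x" .
qed

end


section \<open>The Brauer algebra in coordinates\<close>

lemma bm_A_closed:
  assumes "x \<in> carrier (brauer_algebra n \<delta>)" shows "bm n \<delta> (A_elt n) x \<in> carrier (brauer_algebra n \<delta>)"
proof -
  have arc: "bm n \<delta> (basis_elt (arc_diagram n i j)) x \<in> carrier (brauer_algebra n \<delta>)" if ij: "i < j" "j < n" for i j
    by (subst brauer_expand[OF assms], unfold bm_sum_right bm_scale_right, intro carrier_sum carrier_scale)
       (use ij in \<open>simp add: bm_basis carrier_scale compose_arc_in\<close>)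
  show ?thesis unfolding A_elt_def bm_sum_left by (intro carrier_sum) (use arc in auto)
qed

lemma minus_scale_elt: "x - scale_elt c y = x + scale_elt (- c) y"
  by (rule ext) (simp add: scale_elt_def)

lemma bm_one_left:
  assumes "x \<in> carrier (brauer_algebra n \<delta>)" shows "bm n \<delta> (perm_elt n id) x = x"
proof -
  have "compose_diagrams n (perm_diagram n id) b = b \<and> closed_loops n (perm_diagram n id) b = 0" if "b \<in> diagrams n" for b
  proof -
    have "relabel id id = id" by (rule ext) (simp add: relabel_def)
    then show ?thesis using compose_perm_left[OF that permutes_id] by simp
  qed
  then have "bm n \<delta> (perm_elt n id) (basis_elt b) = basis_elt b" if "b \<in> diagrams n" for b
    using that by (simp add: bm_basis permutes_id scale_elt_simps)
  then show ?thesis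
    by (subst (1 2) brauer_expand[OF assms]) (simp add: bm_sum_right bm_scale_right)
qed

lemma bm_iota_closed:
  assumes "x \<in> carrier (brauer_algebra n \<delta>)" shows "bm n \<delta> x (iota n a) \<in> carrier (brauer_algebra n \<delta>)"
proof -
  have "bm n \<delta> x (perm_elt n (ap p)) \<in> carrier (brauer_algebra n \<delta>)" if p: "p \<in> SP {..<n}" for p
    unfolding bm_sum_left bm_scale_left
  proof (subst brauer_expand[OF assms], unfold bm_sum_left bm_scale_left, intro carrier_sum carrier_scale)
    fix d assume d: "d \<in> diagrams n"
    note q = SP_permutes[OF p]
    have "compose_diagrams n d (perm_diagram n (ap p)) \<in> diagrams n"
      unfolding compose_perm_right(1)[OF d q] by (rule relabel_diagram[OF d permutes_id permutes_inv[OF q]])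
    then show "bm n \<delta> (basis_elt d) (perm_elt n (ap p)) \<in> carrier (brauer_algebra n \<delta>)"
      using d q by (simp add: bm_basis carrier_scale)
  qed
  then show ?thesis unfolding iota_def bm_sum_right bm_scale_right by (intro carrier_sum carrier_scale)
qed

locale rep_space = adapted_space scale N \<epsilon> form e ginv u
  for scale :: "complex \<Rightarrow> 'v::ab_group_add \<Rightarrow> 'v"
    and N :: nat and \<epsilon> :: int and form :: "'v \<Rightarrow> 'v \<Rightarrow> complex"
    and e :: "nat \<Rightarrow> 'v" and ginv :: "nat \<Rightarrow> nat \<Rightarrow> complex" and u :: "nat \<Rightarrow> 'v" +
  fixes n :: nat and \<r> :: "brauer \<Rightarrow> 'v tensor \<Rightarrow> 'v tensor"
  assumes rep: "tensor_rep scale N \<epsilon> form e ginv n \<r>"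
begin

abbreviation "B \<equiv> brauer_algebra n (loop_value \<epsilon> N)"

lemma r_hom: "\<r> \<in> ring_hom B (End_ring (tp n))"
  using rep by (simp add: tensor_rep_def)

lemma r_End: "b \<in> carrier B \<Longrightarrow> \<r> b \<in> carrier (End_ring (tp n))"
  using r_hom by (rule ring_hom_closed)

lemma r_closed: "b \<in> carrier B \<Longrightarrow> T \<in> tp n \<Longrightarrow> \<r> b T \<in> tp n"
  using r_End[of b] by (auto simp: End_ring_def)

lemma r_add_T: "b \<in> carrier B \<Longrightarrow> S \<in> tp n \<Longrightarrow> T \<in> tp n \<Longrightarrow> \<r> b (S + T) = \<r> b S + \<r> b T"
  and r_scale_T: "b \<in> carrier B \<Longrightarrow> T \<in> tp n \<Longrightarrow> \<r> b (scale_tensor c T) = scale_tensor c (\<r> b T)"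
  using r_End[of b] by (auto simp: End_ring_def)

lemma r_mult: "a \<in> carrier B \<Longrightarrow> b \<in> carrier B \<Longrightarrow> T \<in> tp n \<Longrightarrow> \<r> (bm n (loop_value \<epsilon> N) a b) T = \<r> a (\<r> b T)"
  using ring_hom_mult[OF r_hom, of a b] by (simp add: End_ring_def compose_eq)

lemma r_add: "a \<in> carrier B \<Longrightarrow> b \<in> carrier B \<Longrightarrow> T \<in> tp n \<Longrightarrow> \<r> (a + b) T = \<r> a T + \<r> b T"
  using ring_hom_add[OF r_hom, of a b] by (simp add: End_ring_def brauer_algebra_def)

lemma r_scale: "b \<in> carrier B \<Longrightarrow> T \<in> tp n \<Longrightarrow> \<r> (scale_elt c b) T = scale_tensor c (\<r> b T)"
  using rep by (simp add: tensor_rep_def)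

lemma r_one: "T \<in> tp n \<Longrightarrow> \<r> (perm_elt n id) T = T"
  using ring_hom_one[OF r_hom] by (simp add: End_ring_def brauer_algebra_def)

lemma r_eqI:
  assumes "a \<in> carrier B" "b \<in> carrier B" "\<And>T. T \<in> tp n \<Longrightarrow> \<r> a T = \<r> b T" shows "\<r> a = \<r> b"
proof (rule extensionalityI)
  show "\<r> a \<in> extensional (tp n)" "\<r> b \<in> extensional (tp n)"
    using r_End[OF assms(1)] r_End[OF assms(2)] by (auto simp: End_ring_def PiE_def)
qed (rule assms(3))

text \<open>Membership in the carrier is included because the homomorphism laws of the
  representation hold only there.\<close>

definition acts :: "brauer \<Rightarrow> (((nat \<Rightarrow> nat) \<Rightarrow> complex) \<Rightarrow> (nat \<Rightarrow> nat) \<Rightarrow> complex) \<Rightarrow> bool" where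
  "acts b F \<longleftrightarrow> b \<in> carrier B \<and> (\<forall>T\<in>tp n. coords n (\<r> b T) = F (coords n T))"

lemma acts_mult:
  assumes "acts a F" "acts b G" "bm n (loop_value \<epsilon> N) a b \<in> carrier B"
  shows "acts (bm n (loop_value \<epsilon> N) a b) (\<lambda>x. F (G x))"
  using assms by (simp add: acts_def r_mult r_closed del: of_int_mult)

lemma acts_add: "acts a F \<Longrightarrow> acts b G \<Longrightarrow> acts (a + b) (\<lambda>x. F x + G x)"
  by (simp add: acts_def r_add coords_add carrier_add)

lemma acts_scale: "acts a F \<Longrightarrow> acts (scale_elt c a) (\<lambda>x. scl c (F x))"
  by (simp add: acts_def r_scale coords_scale carrier_scale)

lemma acts_one: "acts (perm_elt n id) (\<lambda>x. x)"
  by (simp add: acts_def r_one permutes_id)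

lemma acts_zero: "acts 0 (\<lambda>x. 0)"
  using acts_scale[OF acts_one, of 0] by (simp add: scale_elt_simps scl_simps)

lemma acts_sum: "(\<And>i. i \<in> I \<Longrightarrow> acts (f i) (F i)) \<Longrightarrow> acts (sum f I) (\<lambda>x. \<Sum>i\<in>I. F i x)"
proof (induction I rule: infinite_finite_induct)
  case (insert i I)
  then have "acts (f i + sum f I) (\<lambda>x. F i x + (\<Sum>i\<in>I. F i x))" by (intro acts_add) auto
  then show ?case by (simp only: sum.insert[OF insert.hyps])
qed (simp_all only: sum.infinite sum.empty acts_zero not_False_eq_True)

lemma acts_pureI:
  assumes b: "b \<in> carrier B" and F: "\<And>x y. F (x + y) = F x + F y" "\<And>c x. F (scl c x) = scl c (F x)"
    and pure: "\<And>vs. length vs = n \<Longrightarrow> coords n (\<r> b (pure_tensor scale vs)) = F (coords n (pure_tensor scale vs))"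
  shows "acts b F"
  unfolding acts_def
proof (intro conjI ballI b)
  fix T assume "T \<in> tp n"
  then show "coords n (\<r> b T) = F (coords n T)"
  proof (induction rule: tp_induct)
    case zero
    have "\<r> b 0 = 0" using r_scale_T[OF b tp_closed(3), of 0] by (simp only: ts.scale_zero_left)
    moreover have "F 0 = 0" using F(2)[of 0 0] by (simp only: scl_simps)
    ultimately show ?case by (simp only: coords_zero)
  next
    case (step c vs T)
    have "\<r> b (scale_tensor c (pure_tensor scale vs) + T) = scale_tensor c (\<r> b (pure_tensor scale vs)) + \<r> b T"
      using step(1,2) b by (simp only: r_add_T r_scale_T tp_closed)
    then show ?case using step(3) pure[OF step(1)] by (simp only: coords_add coords_scale F)
  qed
qed

lemma acts_adjacent: "Suc i < n \<Longrightarrow> acts (perm_elt n (transpose i (Suc i))) (act \<epsilon> (gp (tr i (Suc i))))"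
proof (rule acts_pureI)
  assume i: "Suc i < n"
  then show "perm_elt n (transpose i (Suc i)) \<in> carrier B" by (simp add: permutes_swap_id)
  show "coords n (\<r> (perm_elt n (transpose i (Suc i))) (pure_tensor scale vs)) =
      act \<epsilon> (gp (tr i (Suc i))) (coords n (pure_tensor scale vs))" if "length vs = n" for vs
    using rep coords_swap[OF i that] i that by (simp add: tensor_rep_def)
qed (simp_all only: act_T_add act_T_scl)

lemma acts_arc_adjacent: "Suc i < n \<Longrightarrow> acts (basis_elt (arc_diagram n i (Suc i))) (t.D i (Suc i))"
proof (rule acts_pureI)
  assume i: "Suc i < n"
  then show "basis_elt (arc_diagram n i (Suc i)) \<in> carrier B" by simp
  show "coords n (\<r> (basis_elt (arc_diagram n i (Suc i))) (pure_tensor scale vs)) =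
      t.D i (Suc i) (coords n (pure_tensor scale vs))" if "length vs = n" for vs
    using rep coords_arc[OF i that] i that by (simp add: tensor_rep_def)
qed (simp_all only: t.D_add t.D_scl)

lemma acts_perm_mult:
  assumes "p \<in> SP {..<n}" "q \<in> SP {..<n}" "acts (perm_elt n (ap p)) (act \<epsilon> (gp p))" "acts (perm_elt n (ap q)) (act \<epsilon> (gp q))"
  shows "acts (perm_elt n (ap (p + q))) (act \<epsilon> (gp (p + q)))"
proof -
  have eq: "bm n (loop_value \<epsilon> N) (perm_elt n (ap p)) (perm_elt n (ap q)) = perm_elt n (ap (p + q))"
    using assms(1,2) by (simp add: perm_elt_mult SP_permutes ap_plus)
  have "perm_elt n (ap (p + q)) \<in> carrier B" using assms(1,2) by (simp add: SP_permutes SP_plus)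
  then show ?thesis
    using acts_mult[OF assms(3,4)] unfolding eq by (simp add: gp_mult flip: act_mult)
qed

text \<open>Only adjacent transpositions are prescribed; the others arise by conjugation, moving j
  one step at a time.\<close>

lemma acts_tr: "i < j \<Longrightarrow> j < n \<Longrightarrow> acts (perm_elt n (ap (tr i j))) (act \<epsilon> (gp (tr i j)))"
proof (induction j)
  case (Suc j)
  show ?case
  proof (cases "i = j")
    case True
    then show ?thesis using acts_adjacent Suc.prems by (simp add: ap_tr)
  next
    case False
    have a: "acts (perm_elt n (ap (tr j (Suc j)))) (act \<epsilon> (gp (tr j (Suc j))))"
      using acts_adjacent Suc.prems by (simp add: ap_tr)
    have b: "acts (perm_elt n (ap (tr i j))) (act \<epsilon> (gp (tr i j)))" using Suc False by simp
    have S: "tr j (Suc j) \<in> SP {..<n}" "tr i j \<in> SP {..<n}" using Suc.prems by (auto intro: SP_tr)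
    have "tr j (Suc j) + (tr i j + tr j (Suc j)) = tr i (Suc j)"
      using False Suc.prems by (intro fperm_eqI) (auto simp: ap_tr transpose_def)
    then show ?thesis
      using acts_perm_mult[OF S(1) SP_plus[OF S(2,1)] a acts_perm_mult[OF S(2,1) b a]] by simp
  qed
qed simp

lemma acts_perm: assumes "p permutes {..<n}" shows "acts (perm_elt n p) (act \<epsilon> (gp (Fp p)))"
  using assms finite_lessThan
proof (induction rule: permutes_induct)
  case id
  have "Fp id = 0" by (rule fperm_eqI) (simp add: ap_Fp)
  then have "act \<epsilon> (gp (Fp id)) = (\<lambda>x. x)" by (intro ext) (simp only: gp_zero act_one)
  then show ?case using acts_one by (simp only:)
next
  case (swap a b p)
  have p: "Fp p \<in> SP {..<n}" "ap (Fp p) = p" using Fp_SP[OF _ swap(4)] by simp_all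
  have tr: "acts (perm_elt n (ap (tr a b))) (act \<epsilon> (gp (tr a b)))"
    using acts_tr[of a b] acts_tr[of b a] swap(1-3) tr_commute[of a b] by (cases "a < b") auto
  have "ap (tr a b + Fp p) = transpose a b \<circ> p" by (simp add: ap_plus ap_tr p)
  moreover from this have "Fp (transpose a b \<circ> p) = tr a b + Fp p" by (metis ap_inverse)
  ultimately show ?case
    using acts_perm_mult[OF SP_tr p(1) tr] swap p by (simp add: comp_def)
qed

lemma acts_iota: assumes "a \<in> CS {..<n}" shows "acts (iota n a) (act \<epsilon> a)"
  using assms finite_lessThan
proof (induction rule: CS_induct)
  case zero
  then show ?case using acts_zero by (simp add: acts_def zero_fun_def)
next
  case (add a b)
  then show ?case using acts_add by (simp only: iota_add act_add)
next
  case (single c p)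
  then have "acts (perm_elt n (ap p)) (act \<epsilon> (gp p))" using acts_perm[OF SP_permutes] by (simp add: ap_inverse)
  then show ?case using single acts_scale by (simp only: iota_sc act_sc_mult iota_gp)
qed

text \<open>The adjacent arc diagram is conjugated by the transposition of i + 1 and j, both as a
  diagram and as an operator.\<close>

lemma acts_arc:
  assumes ij: "i < j" "j < n" shows "acts (basis_elt (arc_diagram n i j)) (t.D i j)"
proof -
  let ?p = "tr (Suc i) j"
  have p: "?p \<in> SP {..<n}" "inv_into UNIV (ap ?p) = ap ?p"
    using ij by (auto intro: SP_tr simp flip: ap_uminus_eq)
  note p = p SP_permutes[OF p(1)]
  have mv: "ap ?p i = i" "ap ?p (Suc i) = j" using ij by simp_all
  let ?\<delta> = "loop_value \<epsilon> N"
  have arc: "arc_diagram n i (Suc i) \<in> diagrams n" using ij by simp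
  have c1: "bm n ?\<delta> (perm_elt n (ap ?p)) (basis_elt (arc_diagram n i (Suc i))) =
      basis_elt (compose_diagrams n (perm_diagram n (ap ?p)) (arc_diagram n i (Suc i)))"
    using arc p by (simp add: bm_basis compose_perm_left(2) scale_elt_simps)
  have cd: "compose_diagrams n (perm_diagram n (ap ?p)) (arc_diagram n i (Suc i)) \<in> diagrams n"
    unfolding compose_perm_left(1)[OF arc p(3)] by (rule relabel_diagram[OF arc p(3) permutes_id])
  have c2: "bm n ?\<delta> (bm n ?\<delta> (perm_elt n (ap ?p)) (basis_elt (arc_diagram n i (Suc i)))) (perm_elt n (ap ?p)) =
      basis_elt (arc_diagram n i j)"
    unfolding c1 using p(3) conj_arc_diagram[OF p(3), of i "Suc i"] ij mv p(2)
    by (simp add: bm_basis cd compose_perm_right(2)[OF cd] scale_elt_simps)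
  have P: "acts (perm_elt n (ap ?p)) (act \<epsilon> (gp ?p))" using acts_perm[OF p(3)] by (simp add: ap_inverse)
  have "acts (bm n ?\<delta> (bm n ?\<delta> (perm_elt n (ap ?p)) (basis_elt (arc_diagram n i (Suc i)))) (perm_elt n (ap ?p)))
      (\<lambda>x. act \<epsilon> (gp ?p) (t.D i (Suc i) (act \<epsilon> (gp ?p) x)))"
  proof (rule acts_mult[OF acts_mult[OF P acts_arc_adjacent] P])
    show "bm n ?\<delta> (perm_elt n (ap ?p)) (basis_elt (arc_diagram n i (Suc i))) \<in> carrier B"
      unfolding c1 using cd by simp
    show "bm n ?\<delta> (bm n ?\<delta> (perm_elt n (ap ?p)) (basis_elt (arc_diagram n i (Suc i)))) (perm_elt n (ap ?p)) \<in> carrier B"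
      unfolding c2 using ij by simp
  qed (use ij in simp)
  moreover have "act \<epsilon> (gp ?p) (t.D i (Suc i) (act \<epsilon> (gp ?p) x)) = t.D i j x" for x
    using mv by (simp add: t.act_D gp_mult flip: act_mult)
  ultimately show ?thesis unfolding c2 by simp
qed

text \<open>A2 runs over ordered pairs and D is symmetric in its indices, hence the factor
  1/2.\<close>

lemma acts_A: "acts (A_elt n) (\<lambda>x. scl (1 / 2) (t.A2 n x))"
proof -
  let ?S = "{(i, j). i < j \<and> j < n}"
  have fin: "finite ?S" by (rule finite_subset[of _ "{..<n} \<times> {..<n}"]) auto
  have "acts (A_elt n) (\<lambda>x. \<Sum>p\<in>?S. t.D (fst p) (snd p) x)"
    unfolding A_elt_def by (rule acts_sum) (auto intro: acts_arc)
  moreover have "(\<Sum>p\<in>?S. t.D (fst p) (snd p) x) = scl (1 / 2) (t.A2 n x)" for x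
  proof -
    let ?s = "\<Sum>p\<in>?S. t.D (fst p) (snd p) x"
    have "t.A2 n x = (\<Sum>p\<in>(SIGMA i:{..<n}. {..<n} - {i}). t.D (fst p) (snd p) x)"
      unfolding t.A2_def by (simp add: sum.Sigma case_prod_unfold)
    also have "(SIGMA i:{..<n}. {..<n} - {i}) = ?S \<union> prod.swap ` ?S"
      by (auto simp: image_iff)
    also have "(\<Sum>p\<in>?S \<union> prod.swap ` ?S. t.D (fst p) (snd p) x) =
        ?s + (\<Sum>p\<in>prod.swap ` ?S. t.D (fst p) (snd p) x)"
      by (rule sum.union_disjoint) (use fin in auto)
    also have "(\<Sum>p\<in>prod.swap ` ?S. t.D (fst p) (snd p) x) = (\<Sum>p\<in>?S. t.D (snd p) (fst p) x)"
      by (subst sum.reindex) (auto simp: comp_def)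
    also have "\<dots> = ?s" by (rule sum.cong[OF refl]) (auto intro: t.D_commute)
    finally have A2: "t.A2 n x = ?s + ?s" .
    have "scl (1 / 2) (y + y) = y" for y by (rule ext) (simp add: scl_def)
    then show ?thesis unfolding A2 by (simp only:)
  qed
  ultimately show ?thesis by simp
qed

lemma acts_A_product: "acts (A_product n (loop_value \<epsilon> N) S) (t.factors n (sorted_list_of_set S))"
proof -
  let ?\<delta> = "loop_value \<epsilon> N"
  define I where "I = perm_elt n id"
  have one: "\<one>\<^bsub>B\<^esub> = I" by (simp add: brauer_algebra_def I_def)
  have eq: "bm n ?\<delta> (I - scale_elt c (A_elt n)) y = y + scale_elt (- c) (bm n ?\<delta> (A_elt n) y)"
    if "y \<in> carrier B" for c y
    unfolding minus_scale_elt bm_add_left bm_scale_left bm_one_left[OF that, folded I_def] ..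
  have "acts (foldr (\<lambda>\<alpha>. bm n ?\<delta> (I - scale_elt (1 / of_int \<alpha>) (A_elt n))) as I)
      (t.factors n as)" for as
  proof (induction as)
    case Nil
    have "t.factors n [] = (\<lambda>x. x)" by (intro ext) (simp only: t.factors_simps)
    then show ?case using acts_one by (simp only: foldr.simps id_apply I_def[symmetric])
  next
    case (Cons \<alpha> as)
    let ?y = "foldr (\<lambda>\<alpha>. bm n ?\<delta> (I - scale_elt (1 / of_int \<alpha>) (A_elt n))) as I"
    have y: "?y \<in> carrier B" using Cons by (simp only: acts_def)
    have F: "t.factors n (\<alpha> # as) =
        (\<lambda>x. t.factors n as x + scl (- (1 / of_int \<alpha>)) (scl (1 / 2) (t.A2 n (t.factors n as x))))"
      by (intro ext) (simp add: scl_def)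
    show ?case
      unfolding F foldr.simps comp_def eq[OF y]
      by (intro acts_add acts_scale acts_mult[OF acts_A] Cons bm_A_closed y)
  qed
  then show ?thesis unfolding A_product_def one .
qed

lemma acts_P: "acts (P_elt \<epsilon> N n) (t.factors n (sorted_list_of_set (spec_nz \<epsilon> N n)))"
  unfolding P_elt_def by (rule acts_A_product)

lemma acts_P_tilde: "acts (P_tilde_elt \<epsilon> N n)
    (\<lambda>x. \<Sum>\<mu>\<in>Lambda_set \<epsilon> N n. t.factors n (sorted_list_of_set (spec_nz_rho \<epsilon> N \<mu>)) (act \<epsilon> (zz \<mu>) x))"
  unfolding P_tilde_elt_def
proof (rule acts_sum)
  fix \<mu> assume "\<mu> \<in> Lambda_set \<epsilon> N n"
  then have mu: "\<mu> \<in> partitions n" by (simp add: Lambda_set_def)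
  have P: "acts (P_rho_elt \<epsilon> N \<mu>) (t.factors n (sorted_list_of_set (spec_nz_rho \<epsilon> N \<mu>)))"
    unfolding P_rho_elt_def sum_list_partitions[OF mu] by (rule acts_A_product)
  then have "P_rho_elt \<epsilon> N \<mu> \<in> carrier B" by (simp only: acts_def)
  then show "acts (bm n (loop_value \<epsilon> N) (P_rho_elt \<epsilon> N \<mu>) (central_young_symmetriser \<mu>))
      (\<lambda>x. t.factors n (sorted_list_of_set (spec_nz_rho \<epsilon> N \<mu>)) (act \<epsilon> (zz \<mu>) x))"
    unfolding central_young_symmetriser_iota[OF mu]
    by (intro acts_mult[OF P] acts_iota zz_CS mu bm_iota_closed)
qed

lemma projectors_agree: "\<r> (P_elt \<epsilon> N n) = \<r> (P_tilde_elt \<epsilon> N n)"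
proof (rule r_eqI)
  show P: "P_elt \<epsilon> N n \<in> carrier B" and P': "P_tilde_elt \<epsilon> N n \<in> carrier B"
    using acts_P acts_P_tilde by (simp_all only: acts_def)
  fix T assume T: "T \<in> tp n"
  have "coords n (\<r> (P_elt \<epsilon> N n) T) = coords n (\<r> (P_tilde_elt \<epsilon> N n) T)"
    using acts_P acts_P_tilde T t.projector_formula[OF coords_W[OF T]] by (simp only: acts_def)
  then show "\<r> (P_elt \<epsilon> N n) T = \<r> (P_tilde_elt \<epsilon> N n) T"
    by (intro coords_inj[of _ n] r_closed P P' T)
qed

end

theorem corollary4p5:
  fixes scale :: "complex \<Rightarrow> 'v::ab_group_add \<Rightarrow> 'v"
    and form :: "'v \<Rightarrow> 'v \<Rightarrow> complex"
    and e :: "nat \<Rightarrow> 'v"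
    and ginv :: "nat \<Rightarrow> nat \<Rightarrow> complex"
    and \<epsilon> :: int
    and N n :: nat
    and \<r> :: "brauer \<Rightarrow> 'v tensor \<Rightarrow> 'v tensor"
  assumes "form_space scale N \<epsilon> form e ginv"
    and "n \<ge> 2"
    and "tensor_rep scale N \<epsilon> form e ginv n \<r>"
  shows "universal_traceless_projector \<r> \<epsilon> N n = \<r> (P_tilde_elt \<epsilon> N n)"
proof -
  interpret form_space scale N \<epsilon> form e ginv by (rule assms(1))
  obtain u where "adapted N u" using adapted_basis_exists by blast
  then interpret rep_space scale N \<epsilon> form e ginv u n \<r>
    by unfold_locales (use assms(3) in simp_all)
  show ?thesis unfolding universal_traceless_projector_def by (rule projectors_agree)
qed

end
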